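(* The $M$-module $\Sigma_2^0=\bigoplus_k S_{2,k}(\Gamma[\sqrt{-3}])$ is generated by the three modular forms $D_0,D_1,D_2$ of weight $(2,5)$, which generate an $S_4$-representation of type $s[3,1]$: for $k\ge0$ we have $$S_{2,3k+5}(\Gamma[\sqrt{-3}])=M_{3k}(\Gamma[\sqrt{-3}])\otimes\langle D_0,D_1,D_2\rangle ,$$ where the identification is given by multiplication of forms.
   Context: Let $F=\mathbb{Q}(\sqrt{-3})\subset\mathbb{C}$, $\rho=(-1+\sqrt{-3})/2$, $O_F=\mathbb{Z}[\rho]$. Let $h(z,w)=z_1\bar w_2+z_2\bar w_1+z_3\bar w_3$, $\Gamma=\{g\in \mathrm{GL}_3(O_F): h(gz,gw)=h(z,w)\}$, $\Gamma_1=\{g\in\Gamma:\det g=1\}$, $\Gamma[\sqrt{-3}]=\{g\in\Gamma: g\equiv 1 \bmod \sqrt{-3}\}$, $\Gamma_1[\sqrt{-3}]=\Gamma_1\cap\Gamma[\sqrt{-3}]$. Let $B=\{(u,v)\in\mathbb{C}^2: 2\,\mathrm{Re}\,v+|u|^2<0\}$, where $(u,v)$ corresponds to the line $(v:1:u)$. A matrix $g=(g_{ij})$ acts by $(u,v)\mapsto\left(\frac{g_{31}v+g_{32}+g_{33}u}{j_1},\frac{g_{11}v+g_{12}+g_{13}u}{j_1}\right)$ with $j_1=j_1(g,u,v)=g_{21}v+g_{22}+g_{23}u$. With $G_{ij}$ the minor of $g_{ij}$ put $j_2(g,u,v)=\det(g)^{-1}\begin{pmatrix}G_{32}u+G_{33}&G_{32}v+G_{31}\\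 G_{12}u+G_{13}&G_{12}v+G_{11}\end{pmatrix}$. For a vector $x=(a,b)^t$ let $\mathrm{Sym}^j(x)=(a^j,a^{j-1}b,\dots,b^j)^t$, and let $\mathrm{Sym}^j(A)$ be the matrix with $\mathrm{Sym}^j(A)\mathrm{Sym}^j(x)=\mathrm{Sym}^j(Ax)$. For $f:B\to \mathrm{Sym}^j(\mathbb{C}^2)$ put $(f|_{j,k}g)(b)=j_1(g,b)^{-k}\,\mathrm{Sym}^j(j_2(g,b)^{-1})f(g\cdot b)$. $M_{j,k}(\Gamma[\sqrt{-3}],\det^\ell)$ is the space of holomorphic $f:B\to\mathrm{Sym}^j(\mathbb{C}^2)$ with $f|_{j,k}g=\det(g)^\ell f$ for all $g\in\Gamma[\sqrt{-3}]$ (the character is omitted for $\ell=0$; $M_k=M_{0,k}$). Such $f$ has a Fourier-Jacobi expansion $f(u,v)=\sum_{n\ge0}f_n(u)w^n$, $w=e^{2\pi v/\sqrt3}$; $f$ is a cusp form ($f\in S_{j,k}$) if the constant term of $f|_{j,k}\gamma$ vanishes for every $\gamma\in\Gamma$. The four cusps of $\Gamma_1[\sqrt{-3}]$ are represented by $c_1=(1:0:0)$, $c_2=(0:1:0)$ and $c_3,c_4$ (the points $(\rho:1:\pm1)$ in some fixed order). The permutation of the cusps gives an isomorphism $\Gamma_1/\Gamma_1[\sqrt{-3}]\cong S_4$, and $S_4$ acts on $M_{j,k}(\Gamma[\sqrt{-3}],\det^\ell)$ by $\sigma(f)=f|_{j,k}g^{-1}$ for $g\in\Gamma_1$ inducing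 $\sigma$. $s[3,1]$ is the irreducible representation of $S_4$ given by permutations of coordinates on $\sum_{i=1}^4x_i=0$. $M=\bigoplus_k M_{0,k}(\Gamma[\sqrt{-3}])$. It is known that $M=\mathbb{C}[\varphi_0,\varphi_1,\varphi_2]$ is a polynomial ring with $\varphi_i\in M_{0,3}(\Gamma[\sqrt{-3}])$ having constant term $1$ in the Fourier-Jacobi expansion and such that $x_1=\varphi_0+\varphi_1+\varphi_2$, $x_2=-3\varphi_0+\varphi_1+\varphi_2$, $x_3=\varphi_0-3\varphi_1+\varphi_2$, $x_4=\varphi_0+\varphi_1-3\varphi_2$ satisfy $\sigma(x_i)=\mathrm{sgn}(\sigma)x_{\sigma(i)}$. For scalar-valued forms $f$ of weight $k$ and $g$ of weight $l$ put $[f,g]=\frac1l f\nabla g-\frac1k g\nabla f$, with $\nabla f=(\partial f/\partial u,\partial f/\partial v)^t$. Put $\Phi_0=-\frac{[\varphi_1,\varphi_2]}{6\pi\sqrt{-1}}$, $\Phi_1=-\frac{[\varphi_2,\varphi_0]}{6\pi\sqrt{-1}}$, $\Phi_2=-\frac{[\varphi_0,\varphi_1]}{6\pi\sqrt{-1}}$ in $S_{1,7}(\Gamma[\sqrt{-3}])$. For $i=0,1,2$ (indices mod 3) put $D_i=9\sqrt{-3}\,\frac{\mathrm{Sym}^2(\Phi_i)}{\varphi_{i+1}\varphi_{i+2}(\varphi_{i+1}-\varphi_{i+2})}\in S_{2,5}(\Gamma[\sqrt{-3}])$. *)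

theory Defs
  imports
    "HOL-Analysis.Analysis"
    "HOL-Library.Function_Algebras"
    "HOL-Computational_Algebra.Polynomial"
    "HOL-Combinatorics.Permutations"
begin

section \<open>The Picard modular group\<close>

definition sqrt_m3 :: complex where
  "sqrt_m3 = \<i> * complex_of_real (sqrt 3)"

definition \<rho> :: complex where
  "\<rho> = (- 1 + sqrt_m3) / 2"

definition O_F :: "complex set" where
  "O_F = {of_int a + of_int b * \<rho> | a b. True}"

definition herm :: "complex^3 \<Rightarrow> complex^3 \<Rightarrow> complex" where
  "herm z w = z$1 * cnj (w$2) + z$2 * cnj (w$1) + z$3 * cnj (w$3)"

definition GL3_O_F :: "(complex^3^3) set" where
  "GL3_O_F = {g. (\<forall>i j. g$i$j \<in> O_F) \<and>
     (\<exists>g'. (\<forall>i j. g'$i$j \<in> O_F) \<and> g ** g' = mat 1 \<and> g' ** g = mat 1)}"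

definition \<Gamma> :: "(complex^3^3) set" where
  "\<Gamma> = {g \<in> GL3_O_F. \<forall>z w. herm (g *v z) (g *v w) = herm z w}"

definition \<Gamma>1 :: "(complex^3^3) set" where
  "\<Gamma>1 = {g \<in> \<Gamma>. det g = 1}"

definition \<Gamma>_cong :: "(complex^3^3) set" where
  "\<Gamma>_cong = {g \<in> \<Gamma>. \<forall>i j. \<exists>x\<in>O_F. g$i$j - mat 1$i$j = sqrt_m3 * x}"

definition \<Gamma>1_cong :: "(complex^3^3) set" where
  "\<Gamma>1_cong = \<Gamma>1 \<inter> \<Gamma>_cong"

section \<open>The ball and the factors of automorphy\<close>

definition Ball2 :: "(complex \<times> complex) set" where
  "Ball2 = {(u, v). 2 * Re v + (cmod u)\<^sup>2 < 0}"

definition j1 :: "complex^3^3 \<Rightarrow> complex \<times> complex \<Rightarrow> complex" where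
  "j1 g = (\<lambda>(u, v). g$2$1 * v + g$2$2 + g$2$3 * u)"

definition act :: "complex^3^3 \<Rightarrow> complex \<times> complex \<Rightarrow> complex \<times> complex" where
  "act g = (\<lambda>(u, v).
     ((g$3$1 * v + g$3$2 + g$3$3 * u) / j1 g (u, v),
      (g$1$1 * v + g$1$2 + g$1$3 * u) / j1 g (u, v)))"

text \<open>The two indices in \<open>{1, 2, 3}\<close> different from \<open>i\<close>, in increasing order
  (in the type \<open>3\<close> the numeral \<open>3\<close> denotes \<open>0\<close>, but is regarded as the last index).\<close>

definition lo :: "3 \<Rightarrow> 3" where "lo i = (if i = 1 then 2 else 1)"
definition hi :: "3 \<Rightarrow> 3" where "hi i = (if i = 3 then 2 else 3)"

text \<open>Minors carry no sign; with this convention \<open>j2\<close> below is a factor of automorphy.\<close>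

definition minor :: "complex^3^3 \<Rightarrow> 3 \<Rightarrow> 3 \<Rightarrow> complex" where
  "minor g i j = g$lo i$lo j * g$hi i$hi j - g$lo i$hi j * g$hi i$lo j"

definition j2 :: "complex^3^3 \<Rightarrow> complex \<times> complex \<Rightarrow> complex^2^2" where
  "j2 g = (\<lambda>(u, v). \<chi> r s. inverse (det g) *
     (if r = 1
      then (if s = 1 then minor g 3 2 * u + minor g 3 3 else minor g 3 2 * v + minor g 3 1)
      else (if s = 1 then minor g 1 2 * u + minor g 1 3 else minor g 1 2 * v + minor g 1 1)))"

section \<open>Symmetric powers\<close>

text \<open>A vector \<open>y\<close> of the space \<open>Sym\<^sup>j(\<complex>\<^sup>2)\<close> of dimension \<open>j + 1\<close> is
  a function \<open>nat \<Rightarrow> complex\<close> with \<open>y i = 0\<close> for \<open>i > j\<close>.\<close>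

definition sym_vec :: "nat \<Rightarrow> complex^2 \<Rightarrow> nat \<Rightarrow> complex" where
  "sym_vec j x = (\<lambda>i. if i \<le> j then (x$1) ^ (j - i) * (x$2) ^ i else 0)"

text \<open>Row \<open>i\<close> consists of the coefficients of \<open>(A\<^sub>1\<^sub>1 a + A\<^sub>1\<^sub>2 b)\<^sup>j\<^sup>-\<^sup>i (A\<^sub>2\<^sub>1 a + A\<^sub>2\<^sub>2 b)\<^sup>i\<close>
  at the monomials \<open>a\<^sup>j\<^sup>-\<^sup>m b\<^sup>m\<close>; see \<open>sym_mat_sym_vec\<close> and \<open>sym_mat_unique\<close>.\<close>

definition sym_mat :: "nat \<Rightarrow> complex^2^2 \<Rightarrow> nat \<Rightarrow> nat \<Rightarrow> complex" where
  "sym_mat j A i m = (if i \<le> j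
     then coeff ([:A$1$1, A$1$2:] ^ (j - i) * [:A$2$1, A$2$2:] ^ i) m else 0)"

definition sym_app :: "nat \<Rightarrow> (nat \<Rightarrow> nat \<Rightarrow> complex) \<Rightarrow> (nat \<Rightarrow> complex) \<Rightarrow> nat \<Rightarrow> complex" where
  "sym_app j S y = (\<lambda>i. \<Sum>m\<le>j. S i m * y m)"

lemma homog_mult:
  fixes p q :: "complex poly"
  assumes "degree p \<le> d" "degree q \<le> e"
  shows "(\<Sum>m\<le>d+e. coeff (p * q) m * a ^ (d + e - m) * b ^ m) =
    (\<Sum>m\<le>d. coeff p m * a ^ (d - m) * b ^ m) * (\<Sum>m\<le>e. coeff q m * a ^ (e - m) * b ^ m)"
proof (cases "a = 0")
  case False
  have *: "(\<Sum>m\<le>n. coeff r m * a ^ (n - m) * b ^ m) = a ^ n * poly r (b / a)"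
    if "degree r \<le> n" for r :: "complex poly" and n
  proof -
    have "poly r (b / a) = (\<Sum>m\<le>n. coeff r m * (b / a) ^ m)"
      unfolding poly_altdef using that
      by (intro sum.mono_neutral_left) (auto simp: coeff_eq_0)
    then show ?thesis
      unfolding sum_distrib_left using False
      by (auto simp: sum_distrib_left power_diff power_divide intro!: sum.cong)
  qed
  show ?thesis
    using assms by (simp add: * degree_mult_le order_trans[OF degree_mult_le] power_add)
next
  case True
  have *: "(\<Sum>m\<le>n. coeff r m * a ^ (n - m) * b ^ m) = coeff r n * b ^ n"
    for r :: "complex poly" and n
    using True by (subst sum.remove[of _ n]) (auto intro!: sum.neutral)
  have "coeff (p * q) (d + e) = coeff p d * coeff q e"
  proof -
    have "coeff (p * q) (d + e) = (\<Sum>i\<le>d+e. coeff p i * coeff q (d + e - i))"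
      by (simp add: coeff_mult)
    also have "\<dots> = (\<Sum>i\<in>{d}. coeff p i * coeff q (d + e - i))"
    proof (rule sum.mono_neutral_right)
      show "\<forall>i\<in>{..d + e} - {d}. coeff p i * coeff q (d + e - i) = 0"
      proof
        fix i assume "i \<in> {..d + e} - {d}"
        then have "d < i \<or> e < d + e - i" by auto
        then show "coeff p i * coeff q (d + e - i) = 0"
          using assms by (auto simp: coeff_eq_0)
      qed
    qed auto
    finally show ?thesis by simp
  qed
  then show ?thesis by (simp add: * power_add)
qed

lemma homog_power:
  "(\<Sum>m\<le>n. coeff ([:x, y:] ^ n) m * a ^ (n - m) * b ^ m) = (x * a + y * b :: complex) ^ n"
proof (induction n)
  case (Suc n)
  have d: "degree [:x, y:] \<le> 1" "degree ([:x, y:] ^ n) \<le> n"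
    using degree_power_le[of "[:x, y:]" n] by (auto split: if_splits)
  from homog_mult[OF d, of a b] Suc show ?case
    by (simp add: coeff_pCons algebra_simps)
qed simp

lemma sym_mat_sym_vec: "sym_app j (sym_mat j A) (sym_vec j x) = sym_vec j (A *v x)"
proof
  fix i
  show "sym_app j (sym_mat j A) (sym_vec j x) i = sym_vec j (A *v x) i"
  proof (cases "i \<le> j")
    case True
    have d: "degree ([:A$1$1, A$1$2:] ^ (j - i)) \<le> j - i" "degree ([:A$2$1, A$2$2:] ^ i) \<le> i"
      using degree_power_le[of "[:A$1$1, A$1$2:]" "j - i"]
        degree_power_le[of "[:A$2$1, A$2$2:]" i] by (auto split: if_splits)
    from homog_mult[OF d, of "x$1" "x$2"] True show ?thesis
      unfolding homog_power
      by (simp add: sym_app_def sym_mat_def sym_vec_def matrix_vector_mult_def sum_2 mult.assoc)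
  qed (simp add: sym_app_def sym_mat_def sym_vec_def)
qed

lemma sym_mat_unique:
  assumes "\<And>x. sym_app j S (sym_vec j x) = sym_vec j (A *v x)" "i \<le> j" "m \<le> j"
  shows "S i m = sym_mat j A i m"
proof -
  define c where "c n = S i n - sym_mat j A i n" for n
  have "(\<Sum>n\<le>j. c n * z ^ n) = 0" for z
  proof -
    have "sym_app j S (sym_vec j (vector [1, z])) i
        = sym_app j (sym_mat j A) (sym_vec j (vector [1, z])) i"
      by (simp add: assms(1) sym_mat_sym_vec)
    then show ?thesis
      by (simp add: sym_app_def sym_vec_def c_def left_diff_distrib sum_subtractf)
  qed
  then have "c m = 0"
    using assms(3) polyfun_eq_0[of c j] by blast
  then show ?thesis by (simp add: c_def)
qed

section \<open>Modular forms\<close>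

text \<open>Functions on the ball are extended by \<open>0\<close> to all of \<open>\<complex>\<^sup>2\<close>,
  so that equality of functions on the ball is equality in HOL.\<close>

type_synonym scalar_fun = "complex \<times> complex \<Rightarrow> complex"
type_synonym vector_fun = "complex \<times> complex \<Rightarrow> nat \<Rightarrow> complex"

definition fscale :: "complex \<Rightarrow> ('a \<Rightarrow> complex) \<Rightarrow> 'a \<Rightarrow> complex" where
  "fscale c f = (\<lambda>x. c * f x)"

definition vscale :: "complex \<Rightarrow> ('a \<Rightarrow> 'b \<Rightarrow> complex) \<Rightarrow> 'a \<Rightarrow> 'b \<Rightarrow> complex" where
  "vscale c f = (\<lambda>x i. c * f x i)"

global_interpretation fsp: vector_space "fscale :: complex \<Rightarrow> ('a \<Rightarrow> complex) \<Rightarrow> 'a \<Rightarrow> complex"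
  by standard (auto simp: fscale_def fun_eq_iff algebra_simps)

global_interpretation vsp: vector_space
  "vscale :: complex \<Rightarrow> ('a \<Rightarrow> 'b \<Rightarrow> complex) \<Rightarrow> 'a \<Rightarrow> 'b \<Rightarrow> complex"
  by standard (auto simp: vscale_def fun_eq_iff algebra_simps)

definition holomorphic2_on :: "scalar_fun \<Rightarrow> (complex \<times> complex) set \<Rightarrow> bool"
    (infixl "holomorphic2'_on" 50) where
  "f holomorphic2_on S \<longleftrightarrow>
     (\<forall>b\<in>S. \<exists>p q. (f has_derivative (\<lambda>(x, y). p * x + q * y)) (at b within S))"

definition slash :: "nat \<Rightarrow> int \<Rightarrow> vector_fun \<Rightarrow> complex^3^3 \<Rightarrow> vector_fun" where
  "slash j k f g = (\<lambda>b. if b \<in> Ball2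
     then (\<lambda>i. j1 g b powi (- k) * sym_app j (sym_mat j (matrix_inv (j2 g b))) (f (act g b)) i)
     else 0)"

definition holo_forms :: "nat \<Rightarrow> vector_fun set" where
  "holo_forms j = {f. (\<forall>b. b \<notin> Ball2 \<longrightarrow> f b = 0) \<and> (\<forall>b i. i > j \<longrightarrow> f b i = 0) \<and>
     (\<forall>i. (\<lambda>b. f b i) holomorphic2_on Ball2)}"

definition MF :: "nat \<Rightarrow> int \<Rightarrow> int \<Rightarrow> vector_fun set" where
  "MF j k l = {f \<in> holo_forms j. \<forall>g\<in>\<Gamma>_cong. slash j k f g = vscale (det g powi l) f}"

definition has_FJ_expansion :: "vector_fun \<Rightarrow> (nat \<Rightarrow> complex \<Rightarrow> nat \<Rightarrow> complex) \<Rightarrow> bool" where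
  "has_FJ_expansion f c \<longleftrightarrow> (\<forall>u v i. (u, v) \<in> Ball2 \<longrightarrow>
     (\<lambda>n. c n u i * exp (of_real (2 * pi) * v / of_real (sqrt 3)) ^ n) sums f (u, v) i)"

definition CF :: "nat \<Rightarrow> int \<Rightarrow> int \<Rightarrow> vector_fun set" where
  "CF j k l = {f \<in> MF j k l. \<forall>g\<in>\<Gamma>. \<exists>c. has_FJ_expansion (slash j k f g) c \<and> c 0 = 0}"

text \<open>The identification of \<open>\<complex>\<close> with \<open>Sym\<^sup>0(\<complex>\<^sup>2)\<close>.\<close>

definition as_vector :: "scalar_fun \<Rightarrow> vector_fun" where
  "as_vector f = (\<lambda>b i. if i = 0 then f b else 0)"

definition scalar_MF :: "int \<Rightarrow> scalar_fun set" where
  "scalar_MF k = {f. as_vector f \<in> MF 0 k 0}"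

definition fmul :: "scalar_fun \<Rightarrow> vector_fun \<Rightarrow> vector_fun" where
  "fmul a f = (\<lambda>b i. a b * f b i)"

section \<open>The cusps and the action of the symmetric group\<close>

text \<open>The parameter \<open>e = \<plusminus>1\<close> fixes the order of the last two cusps. The symmetric
  group permutes the type \<open>4\<close>, whose elements are \<open>1, 2, 3, 4\<close>.\<close>

definition cusp :: "complex \<Rightarrow> 4 \<Rightarrow> complex^3" where
  "cusp e i = (if i = 1 then vector [1, 0, 0] else if i = 2 then vector [0, 1, 0]
     else if i = 3 then vector [\<rho>, 1, e] else vector [\<rho>, 1, - e])"

definition induces :: "complex \<Rightarrow> complex^3^3 \<Rightarrow> (4 \<Rightarrow> 4) \<Rightarrow> bool" where
  "induces e g \<sigma> \<longleftrightarrow> \<sigma> permutes UNIV \<and>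
     (\<forall>i. \<exists>h\<in>\<Gamma>1_cong. \<exists>t. t \<noteq> 0 \<and> h *v (g *v cusp e i) = t *s cusp e (\<sigma> i))"

text \<open>\<open>S4_acts e j k \<sigma> f f'\<close> says that \<open>\<sigma>(f) = f'\<close>, whichever \<open>g\<close> inducing \<open>\<sigma>\<close> is used
  to compute \<open>\<sigma>(f)\<close>.\<close>

definition S4_acts :: "complex \<Rightarrow> nat \<Rightarrow> int \<Rightarrow> (4 \<Rightarrow> 4) \<Rightarrow> vector_fun \<Rightarrow> vector_fun \<Rightarrow> bool" where
  "S4_acts e j k \<sigma> f f' \<longleftrightarrow>
     (\<forall>g\<in>\<Gamma>1. induces e g \<sigma> \<longrightarrow> slash j k f (matrix_inv g) = f')"

definition s31_space :: "(complex^4) set" where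
  "s31_space = {x. (\<Sum>i\<in>UNIV. x$i) = 0}"

definition permute_coords :: "(4 \<Rightarrow> 4) \<Rightarrow> complex^4 \<Rightarrow> complex^4" where
  "permute_coords \<sigma> x = (\<chi> i. x $ inv \<sigma> i)"

definition S4_rep_of_type_s31 :: "complex \<Rightarrow> nat \<Rightarrow> int \<Rightarrow> vector_fun set \<Rightarrow> bool" where
  "S4_rep_of_type_s31 e j k W \<longleftrightarrow> (\<exists>T. bij_betw T s31_space W \<and>
     (\<forall>x\<in>s31_space. \<forall>y\<in>s31_space. T (x + y) = T x + T y) \<and>
     (\<forall>c. \<forall>x\<in>s31_space. T (c *s x) = vscale c (T x)) \<and>
     (\<forall>\<sigma>. \<sigma> permutes UNIV \<longrightarrow>
        (\<forall>x\<in>s31_space. S4_acts e j k \<sigma> (T x) (T (permute_coords \<sigma> x)))))"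

section \<open>Graded modules\<close>

text \<open>External direct sums over all weights, as families of finite support.\<close>

definition dsum :: "(int \<Rightarrow> 'a set) \<Rightarrow> (int \<Rightarrow> 'a::zero) set" where
  "dsum V = {F. (\<forall>k. F k \<in> V k) \<and> finite {k. F k \<noteq> 0}}"

definition M_ring :: "(int \<Rightarrow> scalar_fun) set" where
  "M_ring = dsum scalar_MF"

definition Sigma20 :: "(int \<Rightarrow> vector_fun) set" where
  "Sigma20 = dsum (\<lambda>k. CF 2 k 0)"

definition homogeneous :: "int \<Rightarrow> 'a \<Rightarrow> int \<Rightarrow> 'a::zero" where
  "homogeneous d f = (\<lambda>k. if k = d then f else 0)"

definition gmul :: "(int \<Rightarrow> scalar_fun) \<Rightarrow> (int \<Rightarrow> vector_fun) \<Rightarrow> int \<Rightarrow> vector_fun" where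
  "gmul a F = (\<lambda>n. \<Sum>k | a k \<noteq> 0. fmul (a k) (F (n - k)))"

definition M_generated :: "(3 \<Rightarrow> int \<Rightarrow> vector_fun) \<Rightarrow> (int \<Rightarrow> vector_fun) set" where
  "M_generated G = {\<Sum>i\<in>UNIV. gmul (a i) (G i) | a. \<forall>i. a i \<in> M_ring}"

text \<open>A polynomial in variables \<open>X\<^sub>0, X\<^sub>1, X\<^sub>2\<close> is a finitely supported family of complex
  coefficients indexed by exponents \<open>3 \<Rightarrow> nat\<close>. Substituting forms \<open>\<phi>\<^sub>i\<close> of weight 3 yields
  an element of the graded ring whose component of weight \<open>n\<close> collects the monomials of
  degree \<open>n / 3\<close>.\<close>

definition polynomials3 :: "((3 \<Rightarrow> nat) \<Rightarrow> complex) set" where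
  "polynomials3 = {p. finite {x. p x \<noteq> 0}}"

definition subst_forms :: "(3 \<Rightarrow> scalar_fun) \<Rightarrow> ((3 \<Rightarrow> nat) \<Rightarrow> complex) \<Rightarrow> int \<Rightarrow> scalar_fun" where
  "subst_forms \<phi> p = (\<lambda>n b. if b \<in> Ball2
     then (\<Sum>x | p x \<noteq> 0 \<and> n = 3 * int (\<Sum>i\<in>UNIV. x i). p x * (\<Prod>i\<in>UNIV. \<phi> i b ^ x i)) else 0)"

section \<open>Tensor products\<close>

text \<open>The tensor product over \<open>\<complex>\<close> of a space of scalar-valued and a space of vector-valued
  functions: the free vector space on \<open>V \<times> W\<close> modulo the subspace spanned by the
  bilinearity relations.\<close>

definition free_space :: "'a set \<Rightarrow> ('a \<Rightarrow> complex) set" where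
  "free_space X = {p. finite {x. p x \<noteq> 0} \<and> {x. p x \<noteq> 0} \<subseteq> X}"

definition delta :: "'a \<Rightarrow> 'a \<Rightarrow> complex" where
  "delta x = (\<lambda>y. if y = x then 1 else 0)"

definition bilinearity_relations ::
    "scalar_fun set \<Rightarrow> vector_fun set \<Rightarrow> (scalar_fun \<times> vector_fun \<Rightarrow> complex) set" where
  "bilinearity_relations V W =
     {delta (v + v', w) - delta (v, w) - delta (v', w) | v v' w. v \<in> V \<and> v' \<in> V \<and> w \<in> W} \<union>
     {delta (v, w + w') - delta (v, w) - delta (v, w') | v w w'. v \<in> V \<and> w \<in> W \<and> w' \<in> W} \<union>
     {delta (fscale c v, w) - fscale c (delta (v, w)) | c v w. v \<in> V \<and> w \<in> W} \<union>
     {delta (v, vscale c w) - fscale c (delta (v, w)) | c v w. v \<in> V \<and> w \<in> W}"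

definition tensor_eq ::
    "scalar_fun set \<Rightarrow> vector_fun set \<Rightarrow> (scalar_fun \<times> vector_fun \<Rightarrow> complex) rel" where
  "tensor_eq V W = {(p, q). p \<in> free_space (V \<times> W) \<and> q \<in> free_space (V \<times> W) \<and>
     p - q \<in> fsp.span (bilinearity_relations V W)}"

definition tensor ::
    "scalar_fun set \<Rightarrow> vector_fun set \<Rightarrow> (scalar_fun \<times> vector_fun \<Rightarrow> complex) set set" where
  "tensor V W = free_space (V \<times> W) // tensor_eq V W"

definition free_mult :: "(scalar_fun \<times> vector_fun \<Rightarrow> complex) \<Rightarrow> vector_fun" where
  "free_mult p = (\<Sum>(a, f) | p (a, f) \<noteq> 0. vscale (p (a, f)) (fmul a f))"

text \<open>The linear map on the tensor product induced by multiplication of forms.\<close>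

definition tensor_mult :: "(scalar_fun \<times> vector_fun \<Rightarrow> complex) set \<Rightarrow> vector_fun" where
  "tensor_mult C = (THE y. \<forall>p\<in>C. free_mult p = y)"

lemma free_mult_superset:
  assumes "finite A" "{x. p x \<noteq> 0} \<subseteq> A"
  shows "free_mult p = (\<Sum>x\<in>A. vscale (p x) (fmul (fst x) (snd x)))"
  unfolding free_mult_def case_prod_beta prod.collapse
  by (rule sum.mono_neutral_left) (use assms in \<open>auto simp: vscale_def zero_fun_def\<close>)

lemma free_mult_combine:
  assumes "finite {x. p x \<noteq> 0}" "finite {x. q x \<noteq> 0}"
  shows "free_mult (p + fscale c q) = free_mult p + vscale c (free_mult q)"
proof -
  define A where "A = {x. p x \<noteq> 0} \<union> {x. q x \<noteq> 0}"
  have A: "finite A" "{x. p x \<noteq> 0} \<subseteq> A" "{x. q x \<noteq> 0} \<subseteq> A"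
    "{x. (p + fscale c q) x \<noteq> 0} \<subseteq> A"
    using assms by (auto simp: A_def fscale_def)
  show ?thesis
    unfolding free_mult_superset[OF A(1,2)] free_mult_superset[OF A(1,3)]
      free_mult_superset[OF A(1,4)]
    by (simp add: vsp.scale_sum_right sum.distrib [symmetric] fscale_def vsp.scale_left_distrib)
qed

lemma free_mult_delta: "free_mult (delta (a, f)) = fmul a f"
  by (subst free_mult_superset[of "{(a, f)}"]) (auto simp: delta_def)

lemma finite_support_delta: "finite {x. delta y x \<noteq> 0}"
  by (rule finite_subset[of _ "{y}"]) (auto simp: delta_def)

lemma finite_support_combine:
  assumes "finite {x. p x \<noteq> 0}" "finite {x. q x \<noteq> 0}"
  shows "finite {x. (p + fscale c q) x \<noteq> 0}"
  by (rule finite_subset[of _ "{x. p x \<noteq> 0} \<union> {x. q x \<noteq> 0}"])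
    (use assms in \<open>auto simp: fscale_def\<close>)

lemma tensor_mult_class:
  assumes "p \<in> free_space (V \<times> W)"
  shows "tensor_mult (tensor_eq V W `` {p}) = free_mult p"
proof -
  have minus: "q - r = q + fscale (- 1) r" for q r :: "scalar_fun \<times> vector_fun \<Rightarrow> complex"
    by (auto simp: fun_eq_iff fscale_def)
  have smult: "fscale c q = 0 + fscale c q" for c and q :: "scalar_fun \<times> vector_fun \<Rightarrow> complex"
    by simp
  have fin: "finite {x. (q - r) x \<noteq> 0}" "finite {x. (fscale c r) x \<noteq> 0}"
    and lin: "free_mult (q - r) = free_mult q - free_mult r"
      "free_mult (fscale c r) = vscale c (free_mult r)"
    if "finite {x. q x \<noteq> 0}" "finite {x. r x \<noteq> 0}" for c q r
  proof -
    have z: "finite {x. (0 :: scalar_fun \<times> vector_fun \<Rightarrow> complex) x \<noteq> 0}" "free_mult 0 = 0"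
      by (simp_all add: free_mult_def)
    show "finite {x. (q - r) x \<noteq> 0}" "finite {x. (fscale c r) x \<noteq> 0}"
      using finite_support_combine[OF that, of "- 1"] finite_support_combine[OF z(1) that(2), of c]
      by (simp_all only: minus smult[symmetric])
    show "free_mult (q - r) = free_mult q - free_mult r"
      "free_mult (fscale c r) = vscale c (free_mult r)"
      using free_mult_combine[OF that, of "- 1"] free_mult_combine[OF z(1) that(2), of c] z(2)
      by (simp_all only: minus smult[symmetric]) simp_all
  qed
  have rel: "finite {x. r x \<noteq> 0} \<and> free_mult r = 0" if "r \<in> bilinearity_relations V W" for r
  proof -
    note fs = finite_support_delta fin(1)[OF finite_support_delta finite_support_delta]
      fin(2)[OF finite_support_delta finite_support_delta]
    from that consider
        v v' w where "r = delta (v + v', w) - delta (v, w) - delta (v', w)"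
      | v w w' where "r = delta (v, w + w') - delta (v, w) - delta (v, w')"
      | c v w where "r = delta (fscale c v, w) - fscale c (delta (v, w))"
      | c v w where "r = delta (v, vscale c w) - fscale c (delta (v, w))"
      unfolding bilinearity_relations_def by blast
    then show ?thesis
    proof cases
      case 1
      show ?thesis unfolding 1
        by (intro conjI fin(1) fs, subst lin(1)[OF fs(2) fs(1)], subst lin(1)[OF fs(1) fs(1)])
          (simp add: free_mult_delta fmul_def fun_eq_iff algebra_simps)
    next
      case 2
      show ?thesis unfolding 2
        by (intro conjI fin(1) fs, subst lin(1)[OF fs(2) fs(1)], subst lin(1)[OF fs(1) fs(1)])
          (simp add: free_mult_delta fmul_def fun_eq_iff algebra_simps)
    next
      case 3
      show ?thesis unfolding 3
        by (intro conjI fin(1) fs, subst lin(1)[OF fs(1) fs(3)], subst lin(2)[OF fs(1) fs(1)])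
          (simp add: free_mult_delta fmul_def fscale_def vscale_def fun_eq_iff)
    next
      case 4
      show ?thesis unfolding 4
        by (intro conjI fin(1) fs, subst lin(1)[OF fs(1) fs(3)], subst lin(2)[OF fs(1) fs(1)])
          (simp add: free_mult_delta fmul_def fscale_def vscale_def fun_eq_iff)
    qed
  qed
  have z: "finite {x. r x \<noteq> 0} \<and> free_mult r = 0"
    if "r \<in> fsp.span (bilinearity_relations V W)" for r
    using that
  proof (induction rule: fsp.span_induct_alt)
    case base
    then show ?case by (simp add: free_mult_def)
  next
    case (step c x y)
    then have fin: "finite {x. y x \<noteq> 0}" "finite {z. x z \<noteq> 0}"
      and zero: "free_mult y = 0" "free_mult x = 0"
      using rel by blast+
    show ?case
      using free_mult_combine[OF fin, of c] finite_support_combine[OF fin, of c]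
      unfolding zero add.commute[of "fscale c x" y] vsp.scale_zero_right
      by (simp only: add_0_right simp_thms)
  qed
  have eq: "free_mult q = free_mult p" if "(p, q) \<in> tensor_eq V W" for q
  proof -
    have "finite {x. q x \<noteq> 0}" "finite {x. p x \<noteq> 0}" "free_mult (p - q) = 0"
      using that z by (auto simp: tensor_eq_def free_space_def)
    then show ?thesis
      using lin(1)[of p q] by simp
  qed
  have "(p, p) \<in> tensor_eq V W"
    using assms by (simp add: tensor_eq_def fsp.span_zero)
  then have refl: "p \<in> tensor_eq V W `` {p}" by (rule ImageI) (rule singletonI)
  show ?thesis
    unfolding tensor_mult_def
  proof (rule the_equality)
    show "\<forall>q\<in>tensor_eq V W `` {p}. free_mult q = free_mult p"
      by (intro ballI eq) (simp only: Image_singleton_iff)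
    show "y = free_mult p" if "\<forall>q\<in>tensor_eq V W `` {p}. free_mult q = y" for y
      using bspec[OF that refl] by (rule sym)
  qed
qed

section \<open>The generators\<close>

definition d_u :: "scalar_fun \<Rightarrow> scalar_fun" where
  "d_u f = (\<lambda>(u, v). deriv (\<lambda>z. f (z, v)) u)"

definition d_v :: "scalar_fun \<Rightarrow> scalar_fun" where
  "d_v f = (\<lambda>(u, v). deriv (\<lambda>z. f (u, z)) v)"

definition nabla :: "scalar_fun \<Rightarrow> complex \<times> complex \<Rightarrow> complex^2" where
  "nabla f = (\<lambda>b. vector [d_u f b, d_v f b])"

text \<open>The bracket of a form \<open>f\<close> of weight \<open>k\<close> and a form \<open>g\<close> of weight \<open>l\<close>.\<close>

definition bracket ::
    "int \<Rightarrow> int \<Rightarrow> scalar_fun \<Rightarrow> scalar_fun \<Rightarrow> complex \<times> complex \<Rightarrow> complex^2" where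
  "bracket k l f g = (\<lambda>b. (1 / of_int l * f b) *s nabla g b - (1 / of_int k * g b) *s nabla f b)"

text \<open>Indices in the type \<open>3\<close> are taken modulo \<open>3\<close>.\<close>

definition \<Phi> :: "(3 \<Rightarrow> scalar_fun) \<Rightarrow> 3 \<Rightarrow> complex \<times> complex \<Rightarrow> complex^2" where
  "\<Phi> \<phi> i = (\<lambda>b. (- 1 / (6 * of_real pi * \<i>)) *s bracket 3 3 (\<phi> (i + 1)) (\<phi> (i + 2)) b)"

definition D_denom :: "(3 \<Rightarrow> scalar_fun) \<Rightarrow> 3 \<Rightarrow> scalar_fun" where
  "D_denom \<phi> i = (\<lambda>b. \<phi> (i + 1) b * \<phi> (i + 2) b * (\<phi> (i + 1) b - \<phi> (i + 2) b))"

text \<open>The quotient is a priori defined only where the denominator does not vanish;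
  \<open>D \<phi> i\<close> is its holomorphic extension to the ball.\<close>

definition D :: "(3 \<Rightarrow> scalar_fun) \<Rightarrow> 3 \<Rightarrow> vector_fun" where
  "D \<phi> i = (THE f. f \<in> holo_forms 2 \<and> (\<forall>b\<in>Ball2. D_denom \<phi> i b \<noteq> 0 \<longrightarrow>
     (\<forall>m. f b m = 9 * sqrt_m3 * sym_vec 2 (\<Phi> \<phi> i b) m / D_denom \<phi> i b)))"

definition x_form :: "(3 \<Rightarrow> scalar_fun) \<Rightarrow> 4 \<Rightarrow> scalar_fun" where
  "x_form \<phi> i = (\<lambda>b.
     if i = 1 then \<phi> 0 b + \<phi> 1 b + \<phi> 2 b
     else if i = 2 then - 3 * \<phi> 0 b + \<phi> 1 b + \<phi> 2 b
     else if i = 3 then \<phi> 0 b - 3 * \<phi> 1 b + \<phi> 2 b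
     else \<phi> 0 b + \<phi> 1 b - 3 * \<phi> 2 b)"

text \<open>The standard generators of the ring of scalar-valued modular forms: substitution is a
  bijection from the polynomial ring onto the graded ring.\<close>

definition standard_generators :: "complex \<Rightarrow> (3 \<Rightarrow> scalar_fun) \<Rightarrow> bool" where
  "standard_generators e \<phi> \<longleftrightarrow>
     (\<forall>i. \<phi> i \<in> scalar_MF 3) \<and>
     (\<forall>i. \<exists>c. has_FJ_expansion (as_vector (\<phi> i)) c \<and> (\<forall>u. c 0 u 0 = 1)) \<and>
     bij_betw (subst_forms \<phi>) polynomials3 M_ring \<and>
     (\<forall>\<sigma> i. \<sigma> permutes UNIV \<longrightarrow> S4_acts e 0 3 \<sigma> (as_vector (x_form \<phi> i))
        (vscale (of_int (sign \<sigma>)) (as_vector (x_form \<phi> (\<sigma> i)))))"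

end

(*
  The differences x_i - x_j vanish exactly along the mirrors of the group. With J the Jacobian determinant
  of (phi_0, phi_1, phi_2) and P the product of the six differences, comparing orders of vanishing along
  the mirrors shows that J^3 is a constant multiple of P^2. Hence zeta = P / J extends to the ball,
  P is a multiple of zeta^3 and J a multiple of zeta^2, and near a general point of a mirror the
  difference defining it is zeta^3 times a unit. So a bracket of two differences is divisible by zeta^2
  there, and the quotients defining the D_i are bounded outside a countable set.

  If f has weight (2,k), pairing f with two brackets and multiplying by a suitable difference gives a
  function N divisible by zeta^4: N^3 is a scalar-valued form vanishing to order 4 on each mirror, and
  (N / zeta^4)^3 is again a form. The quotients N / zeta^4 are the coefficients of f in terms
  of the D_i. Cusp conditions are automatic: Koecher's principle gives a Fourier-Jacobi expansion, and its
  constant term is killed by translations and by diag(1, 1, rho).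

  That only countably many points of the ball have the same ratios (phi_0 : phi_1 : phi_2) is seen from
  Eisenstein series: they are polynomials in the phi_i, and their values determine the multiset of
  numbers h(z, y), y running through the isotropic vectors of the lattice.
*)
theory Submission
imports Defs "HOL-Complex_Analysis.Conformal_Mappings"
begin

section \<open>Holomorphic functions of two variables\<close>

text \<open>The hypothesis controls scalar forms with trivial character only, whereas
  \<open>J\<close> transforms with the extra factor 1/det g and N with 1/det g^2. Since det g is a
  cube root of unity on \<Gamma>[sqrt(-3)], cubes fall under the hypothesis, and the cube root is
  recovered from boundedness. The exponents are dictated by weights: J has weight 12 and P weight
  18, so J^3 / P^2 has weight 0 and is constant once it is holomorphic. Holomorphy has to be shown
  before the order n of x_3 - x_4 along u = 0 is known: u -> \<rho> u yields n >= 3, J has order at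
  least n - 1, and 3 (n - 1) >= 2 n is enough; constancy of the quotient forces n = 3 in return.
  Likewise \<zeta>^4 has weight 24 and factor 1/det g^2, which leaves weight k - 5 for the
  coefficients. Mirrors are treated one at a time, moved to u = 0 by the group. Points where two
  differences vanish have one of finitely many ratios (phi_0 : phi_1 : phi_2); this is why the
  fibres must be countable and why the extension theorem tolerates a countable exceptional
  set.\<close>

lemma hol2_open:
  assumes "open S"
  shows "f holomorphic2_on S \<longleftrightarrow>
    (\<forall>b\<in>S. \<exists>p q. (f has_derivative (\<lambda>(x, y). p * x + q * y)) (at b))"
  unfolding holomorphic2_on_def using at_within_open[OF _ assms] by auto

lemma hol2_subset: "f holomorphic2_on S \<Longrightarrow> T \<subseteq> S \<Longrightarrow> f holomorphic2_on T"
  unfolding holomorphic2_on_def by (meson has_derivative_subset subsetD)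

lemma hol2_locally:
  assumes "open S" "\<And>b. b \<in> S \<Longrightarrow> \<exists>T. open T \<and> b \<in> T \<and> f holomorphic2_on T"
  shows "f holomorphic2_on S"
  unfolding hol2_open[OF assms(1)] using assms(2) hol2_open by blast

lemma hol2_cong:
  assumes "\<And>b. b \<in> S \<Longrightarrow> f b = g b"
  shows "f holomorphic2_on S \<longleftrightarrow> g holomorphic2_on S"
proof -
  have "g holomorphic2_on S" if f: "f holomorphic2_on S" and e: "\<And>b. b \<in> S \<Longrightarrow> g b = f b" for f g
    unfolding holomorphic2_on_def
  proof
    fix b assume b: "b \<in> S"
    then obtain p q where "(f has_derivative (\<lambda>(x, y). p * x + q * y)) (at b within S)"
      using f unfolding holomorphic2_on_def by blast
    from has_derivative_transform[OF b e this]
    show "\<exists>p q. (g has_derivative (\<lambda>(x, y). p * x + q * y)) (at b within S)" by blast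
  qed
  then show ?thesis using assms by metis
qed

lemma hol2_imp_continuous_on: "f holomorphic2_on S \<Longrightarrow> continuous_on S f"
  unfolding holomorphic2_on_def continuous_on_eq_continuous_within
  using has_derivative_continuous by blast

lemma hol2_const [simp]: "(\<lambda>b. c) holomorphic2_on S"
  unfolding holomorphic2_on_def
  by (auto intro!: exI[of _ 0] derivative_eq_intros simp: case_prod_beta)

lemma hol2_fst: "fst holomorphic2_on S"
proof -
  have "(fst has_derivative (\<lambda>(x, y). 1 * x + 0 * y)) (at b within S)" for b :: "complex \<times> complex"
    by (auto intro!: derivative_eq_intros simp: case_prod_beta)
  then show ?thesis unfolding holomorphic2_on_def by blast
qed

lemma hol2_snd: "snd holomorphic2_on S"
proof -
  have "(snd has_derivative (\<lambda>(x, y). 0 * x + 1 * y)) (at b within S)" for b :: "complex \<times> complex"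
    by (auto intro!: derivative_eq_intros simp: case_prod_beta)
  then show ?thesis unfolding holomorphic2_on_def by blast
qed

lemma hol2_add:
  assumes "f holomorphic2_on S" "g holomorphic2_on S"
  shows "(\<lambda>b. f b + g b) holomorphic2_on S"
  unfolding holomorphic2_on_def
proof
  fix b assume "b \<in> S"
  then obtain p q p' q' where
    "(f has_derivative (\<lambda>(x, y). p * x + q * y)) (at b within S)"
    "(g has_derivative (\<lambda>(x, y). p' * x + q' * y)) (at b within S)"
    using assms unfolding holomorphic2_on_def by meson
  from has_derivative_add[OF this]
  have "((\<lambda>b. f b + g b) has_derivative (\<lambda>(x, y). (p + p') * x + (q + q') * y)) (at b within S)"
    by (simp add: case_prod_unfold algebra_simps)
  then show "\<exists>p q. ((\<lambda>b. f b + g b) has_derivative (\<lambda>(x, y). p * x + q * y)) (at b within S)"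
    by blast
qed

lemma hol2_mult:
  assumes "f holomorphic2_on S" "g holomorphic2_on S"
  shows "(\<lambda>b. f b * g b) holomorphic2_on S"
  unfolding holomorphic2_on_def
proof
  fix b assume "b \<in> S"
  then obtain p q p' q' where
    "(f has_derivative (\<lambda>(x, y). p * x + q * y)) (at b within S)"
    "(g has_derivative (\<lambda>(x, y). p' * x + q' * y)) (at b within S)"
    using assms unfolding holomorphic2_on_def by meson
  from has_derivative_mult[OF this]
  have "((\<lambda>b. f b * g b) has_derivative
      (\<lambda>(x, y). (f b * p' + p * g b) * x + (f b * q' + q * g b) * y)) (at b within S)"
    by (simp add: case_prod_unfold algebra_simps)
  then show "\<exists>p q. ((\<lambda>b. f b * g b) has_derivative (\<lambda>(x, y). p * x + q * y)) (at b within S)"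
    by blast
qed

lemma hol2_compose_outer:
  assumes "f holomorphic2_on S" "open S" "g holomorphic_on A" "open A" "f ` S \<subseteq> A"
  shows "(\<lambda>b. g (f b)) holomorphic2_on S"
  unfolding hol2_open[OF assms(2)]
proof
  fix b assume b: "b \<in> S"
  then obtain p q where 1: "(f has_derivative (\<lambda>(x, y). p * x + q * y)) (at b)"
    using assms(1) unfolding hol2_open[OF assms(2)] by meson
  have "(g has_field_derivative deriv g (f b)) (at (f b))"
    using assms b holomorphic_derivI by blast
  then have "(g has_derivative (\<lambda>h. deriv g (f b) * h)) (at (f b))"
    by (simp add: has_field_derivative_def)
  from has_derivative_compose[OF 1 this]
  have "((\<lambda>b. g (f b)) has_derivative (\<lambda>(x, y). (deriv g (f b) * p) * x + (deriv g (f b) * q) * y)) (at b)"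
    by (simp add: case_prod_unfold algebra_simps)
  then show "\<exists>p q. ((\<lambda>b. g (f b)) has_derivative (\<lambda>(x, y). p * x + q * y)) (at b)" by blast
qed

lemma hol2_inverse:
  assumes "f holomorphic2_on S" "open S" "\<And>b. b \<in> S \<Longrightarrow> f b \<noteq> 0"
  shows "(\<lambda>b. inverse (f b)) holomorphic2_on S"
  by (rule hol2_compose_outer[OF assms(1,2), of inverse "-{0}"])
    (use assms(3) in \<open>auto intro!: holomorphic_intros\<close>)

lemma hol2_divide:
  assumes "f holomorphic2_on S" "g holomorphic2_on S" "open S" "\<And>b. b \<in> S \<Longrightarrow> g b \<noteq> 0"
  shows "(\<lambda>b. f b / g b) holomorphic2_on S"
  unfolding divide_inverse by (intro hol2_mult hol2_inverse assms)

lemma hol2_uminus: "f holomorphic2_on S \<Longrightarrow> (\<lambda>b. - f b) holomorphic2_on S"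
  using hol2_mult[of "\<lambda>_. -1" S f] by simp

lemma hol2_diff:
  "f holomorphic2_on S \<Longrightarrow> g holomorphic2_on S \<Longrightarrow> (\<lambda>b. f b - g b) holomorphic2_on S"
  using hol2_add[of f S "\<lambda>b. - g b"] hol2_uminus[of g S] by simp

lemma hol2_power: "f holomorphic2_on S \<Longrightarrow> (\<lambda>b. f b ^ n) holomorphic2_on S"
  by (induction n) (auto intro: hol2_mult)

lemma hol2_sum: "(\<And>i. i \<in> I \<Longrightarrow> f i holomorphic2_on S) \<Longrightarrow> (\<lambda>b. \<Sum>i\<in>I. f i b) holomorphic2_on S"
  by (induction I rule: infinite_finite_induct) (auto intro: hol2_add)

lemma hol2_prod: "(\<And>i. i \<in> I \<Longrightarrow> f i holomorphic2_on S) \<Longrightarrow> (\<lambda>b. \<Prod>i\<in>I. f i b) holomorphic2_on S"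
  by (induction I rule: infinite_finite_induct) (auto intro: hol2_mult)

lemmas hol2_intros = hol2_const hol2_fst hol2_snd hol2_add hol2_mult hol2_diff hol2_uminus
  hol2_power hol2_sum hol2_prod

lemma hol2_compose:
  assumes "f holomorphic2_on T" "open T" "g holomorphic2_on S" "h holomorphic2_on S" "open S"
    "\<And>b. b \<in> S \<Longrightarrow> (g b, h b) \<in> T"
  shows "(\<lambda>b. f (g b, h b)) holomorphic2_on S"
  unfolding hol2_open[OF assms(5)]
proof
  fix b assume b: "b \<in> S"
  then obtain p q p' q' where
    1: "(g has_derivative (\<lambda>(x, y). p * x + q * y)) (at b)"
       "(h has_derivative (\<lambda>(x, y). p' * x + q' * y)) (at b)"
    using assms(3,4) unfolding hol2_open[OF assms(5)] by meson
  obtain s t where 2: "(f has_derivative (\<lambda>(x, y). s * x + t * y)) (at (g b, h b))"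
    using assms(1,6) b unfolding hol2_open[OF assms(2)] by meson
  from has_derivative_compose[OF has_derivative_Pair[OF 1] 2]
  have "((\<lambda>b. f (g b, h b)) has_derivative (\<lambda>(x, y). (s * p + t * p') * x + (s * q + t * q') * y)) (at b)"
    by (simp add: case_prod_unfold algebra_simps)
  then show "\<exists>p q. ((\<lambda>b. f (g b, h b)) has_derivative (\<lambda>(x, y). p * x + q * y)) (at b)" by blast
qed

lemma hol2_curve_deriv:
  assumes "(f has_derivative (\<lambda>(x, y). s * x + t * y)) (at (g z, h z))"
    "(g has_field_derivative p) (at z)" "(h has_field_derivative q) (at z)"
  shows "((\<lambda>z. f (g z, h z)) has_field_derivative s * p + t * q) (at z)"
proof -
  note [THEN has_field_derivative_imp_has_derivative] = assms(2,3)
  from has_derivative_compose[OF has_derivative_Pair[OF this] assms(1)]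
  have "((\<lambda>z. f (g z, h z)) has_derivative (\<lambda>x. (s * p + t * q) * x)) (at z)"
    by (simp add: algebra_simps)
  then show ?thesis unfolding has_field_derivative_def .
qed

lemma hol2_curve:
  assumes "f holomorphic2_on T" "open T" "g holomorphic_on A" "h holomorphic_on A" "open A"
    "\<And>b. b \<in> A \<Longrightarrow> (g b, h b) \<in> T"
  shows "(\<lambda>b. f (g b, h b)) holomorphic_on A"
proof (rule holomorphic_onI)
  fix z assume z: "z \<in> A"
  then obtain s t where "(f has_derivative (\<lambda>(x, y). s * x + t * y)) (at (g z, h z))"
    using assms(1,6) unfolding hol2_open[OF assms(2)] by meson
  from hol2_curve_deriv[where g = g and h = h, OF this] z assms(3-5)
  have "((\<lambda>b. f (g b, h b)) has_field_derivative s * deriv g z + t * deriv h z) (at z)"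
    by (simp add: holomorphic_derivI)
  then show "(\<lambda>b. f (g b, h b)) field_differentiable at z within A"
    using field_differentiable_at_within field_differentiable_def by blast
qed

lemma hol2_partials:
  assumes "(f has_derivative (\<lambda>(x, y). p * x + q * y)) (at (a, b))"
  shows "((\<lambda>z. f (z, b)) has_field_derivative p) (at a)"
    "((\<lambda>z. f (a, z)) has_field_derivative q) (at b)"
    "d_u f (a, b) = p" "d_v f (a, b) = q"
proof -
  show 1: "((\<lambda>z. f (z, b)) has_field_derivative p) (at a)"
    using hol2_curve_deriv[of f p q "\<lambda>z. z" a "\<lambda>_. b" 1 0] assms by simp
  show 2: "((\<lambda>z. f (a, z)) has_field_derivative q) (at b)"
    using hol2_curve_deriv[of f p q "\<lambda>_. a" b "\<lambda>z. z" 0 1] assms by simp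
  show "d_u f (a, b) = p" "d_v f (a, b) = q"
    using 1 2 by (auto simp: d_u_def d_v_def DERIV_imp_deriv)
qed

lemma hol2_has_derivative:
  assumes "f holomorphic2_on S" "open S" "b \<in> S"
  shows "(f has_derivative (\<lambda>(x, y). d_u f b * x + d_v f b * y)) (at b)"
proof -
  obtain p q where "(f has_derivative (\<lambda>(x, y). p * x + q * y)) (at b)"
    using assms hol2_open by blast
  with hol2_partials[of f p q "fst b" "snd b"] show ?thesis by simp
qed

section \<open>Circle integrals with parameters and Osgood's lemma\<close>

lemma contour_integral_circlepath_eq:
  "contour_integral (circlepath c r) f =
    integral {0..1} (\<lambda>t. f (c + of_real r * exp (2 * of_real pi * \<i> * of_real t)) *
      (2 * of_real pi * \<i> * of_real r * exp (2 * of_real pi * \<i> * of_real t)))"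
  unfolding contour_integral_integral vector_derivative_circlepath by (simp add: circlepath)

lemma circle_point_in_sphere:
  "0 \<le> r \<Longrightarrow> c + of_real r * exp (2 * of_real pi * \<i> * of_real t) \<in> sphere c r"
  by (simp add: dist_norm norm_mult norm_exp_eq_Re)

lemma continuous_on_circle_integral:
  fixes g :: "'a::topological_space \<Rightarrow> complex \<Rightarrow> complex"
  assumes "continuous_on (U \<times> sphere c r) (\<lambda>(x, z). g x z)" "0 \<le> r"
  shows "continuous_on U (\<lambda>x. contour_integral (circlepath c r) (g x))"
proof -
  have "continuous_on (U \<times> cbox 0 1) (\<lambda>(x, t). g x (c + of_real r * exp (2 * of_real pi * \<i> * of_real t)) *
      (2 * of_real pi * \<i> * of_real r * exp (2 * of_real pi * \<i> * of_real t)))"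
    unfolding case_prod_beta
    by (intro continuous_intros continuous_on_compose2[OF assms(1)[unfolded case_prod_beta],
          of _ "\<lambda>p. (fst p, c + of_real r * exp (2 * of_real pi * \<i> * of_real (snd p)))", simplified])
      (use circle_point_in_sphere[OF assms(2)] in auto)
  from integral_continuous_on_param[OF this] show ?thesis
    by (simp add: contour_integral_circlepath_eq cbox_interval)
qed

text \<open>Cauchy's formula turns the derivative into an integral over the boundary circle, where
  the integrand inherits joint continuity from \<open>f\<close>.\<close>

lemma continuous_on_deriv_param:
  fixes f :: "complex \<Rightarrow> 'a::topological_space \<Rightarrow> complex"
  assumes "continuous_on (cball a r \<times> T) (\<lambda>(z, y). f z y)"
    "\<And>y. y \<in> T \<Longrightarrow> (\<lambda>z. f z y) holomorphic_on ball a r"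
  shows "continuous_on (ball a r \<times> T) (\<lambda>(x, y). deriv (\<lambda>z. f z y) x)"
proof (cases "r > 0")
  case True
  have "continuous_on ((ball a r \<times> T) \<times> sphere a r) (\<lambda>(p, z). f z (snd p) / (z - fst p)^2)"
    unfolding case_prod_beta
    by (intro continuous_intros continuous_on_compose2[OF assms(1)[unfolded case_prod_beta],
          of _ "\<lambda>p. (snd p, snd (fst p))", simplified]) (auto simp: dist_commute)
  from continuous_on_circle_integral[OF this] True
  have "continuous_on (ball a r \<times> T) (\<lambda>p. 1 / (2 * of_real pi * \<i>) *
      contour_integral (circlepath a r) (\<lambda>z. f z (snd p) / (z - fst p)^2))"
    by (intro continuous_intros) auto
  moreover have "deriv (\<lambda>z. f z y) x = 1 / (2 * of_real pi * \<i>) *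
      contour_integral (circlepath a r) (\<lambda>z. f z y / (z - x)^2)" if "x \<in> ball a r" "y \<in> T" for x y
  proof -
    have "continuous_on (cball a r) (\<lambda>z. f z y)"
      using continuous_on_compose2[OF assms(1), of "cball a r" "\<lambda>z. (z, y)"] that
      by (simp add: image_subset_iff continuous_on_Pair)
    from Cauchy_derivative_integral_circlepath[OF this assms(2) that(1)] that
    show ?thesis by (simp add: DERIV_imp_deriv)
  qed
  ultimately show ?thesis
    by (elim continuous_on_eq) auto
next
  case False
  then have "ball a r \<times> T = {}" by auto
  then show ?thesis by (simp only: continuous_on_empty)
qed

text \<open>Differentiation under the integral sign. The joint continuity of the differentiated
  integrand demanded by Leibniz's rule comes from \<open>continuous_on_deriv_param\<close>, so joint
  continuity of \<open>g\<close> is the only regularity to be assumed.\<close>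

lemma holomorphic_circle_integral:
  fixes g :: "complex \<Rightarrow> complex \<Rightarrow> complex"
  assumes "open U" "continuous_on (U \<times> sphere c r) (\<lambda>(x, z). g x z)" "0 \<le> r"
    "\<And>z. z \<in> sphere c r \<Longrightarrow> (\<lambda>x. g x z) holomorphic_on U"
  shows "(\<lambda>x. contour_integral (circlepath c r) (g x)) holomorphic_on U"
proof -
  have "(\<lambda>x. contour_integral (circlepath c r) (g x)) field_differentiable at x0" if x0: "x0 \<in> U" for x0
  proof -
    obtain s where s: "s > 0" "cball x0 s \<subseteq> U"
      using x0 assms(1) open_contains_cball by blast
    have sb: "ball x0 s \<subseteq> U" using s by (meson ball_subset_cball order_trans)
    define \<gamma> where "\<gamma> = (\<lambda>t::real. c + of_real r * exp (2 * of_real pi * \<i> * of_real t))"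
    define \<delta> where "\<delta> = (\<lambda>t::real. 2 * of_real pi * \<i> * of_real r * exp (2 * of_real pi * \<i> * of_real t))"
    have \<gamma>: "\<gamma> t \<in> sphere c r" for t
      unfolding \<gamma>_def by (rule circle_point_in_sphere[OF assms(3)])
    have c\<gamma>: "continuous_on A \<gamma>" "continuous_on A \<delta>" for A
      unfolding \<gamma>_def \<delta>_def by (intro continuous_intros)+
    have cp: "continuous_on A (\<lambda>p. (fst p, \<gamma> (snd p)))" "continuous_on A (\<lambda>p. \<delta> (snd p))"
      for A :: "(complex \<times> real) set"
      unfolding \<gamma>_def \<delta>_def by (intro continuous_intros)+
    have gc: "continuous_on (cball x0 s \<times> cbox 0 1) (\<lambda>(z, t). g z (\<gamma> t))"
      unfolding case_prod_beta
      by (rule continuous_on_compose2[OF assms(2)[unfolded case_prod_beta],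
          of _ "\<lambda>p. (fst p, \<gamma> (snd p))", simplified])
        (use \<gamma> s cp in auto)
    have h: "(\<lambda>x. g x (\<gamma> t)) holomorphic_on ball x0 s" for t
      using assms(4)[OF \<gamma>] sb holomorphic_on_subset by blast
    have cd: "continuous_on (ball x0 s \<times> cbox 0 1) (\<lambda>(x, t). deriv (\<lambda>z. g z (\<gamma> t)) x)"
      by (rule continuous_on_deriv_param[OF gc h])
    have "(\<lambda>x. integral (cbox 0 1) (\<lambda>t. g x (\<gamma> t) * \<delta> t)) holomorphic_on ball x0 s"
    proof (rule leibniz_rule_holomorphic)
      fix x and t :: real assume x: "x \<in> ball x0 s"
      have "((\<lambda>z. g z (\<gamma> t)) has_field_derivative deriv (\<lambda>z. g z (\<gamma> t)) x) (at x)"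
        by (rule holomorphic_derivI[OF h open_ball x])
      then show "((\<lambda>x. g x (\<gamma> t) * \<delta> t) has_field_derivative
          deriv (\<lambda>z. g z (\<gamma> t)) x * \<delta> t) (at x within ball x0 s)"
        by (auto intro!: derivative_eq_intros intro: has_field_derivative_at_within)
    next
      fix x assume x: "x \<in> ball x0 s"
      have "continuous_on (cbox 0 1) (\<lambda>t. g x (\<gamma> t))"
        by (rule continuous_on_compose2[OF gc, of _ "\<lambda>t. (x, t)", simplified])
          (use x in \<open>auto intro!: continuous_intros\<close>)
      then show "(\<lambda>t. g x (\<gamma> t) * \<delta> t) integrable_on cbox 0 1"
        by (intro integrable_continuous continuous_intros c\<gamma>)
    next
      show "continuous_on (ball x0 s \<times> cbox 0 1) (\<lambda>(x, t). deriv (\<lambda>z. g z (\<gamma> t)) x * \<delta> t)"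
        using cd unfolding case_prod_beta
        by (intro continuous_on_mult cp)
    qed auto
    then have "(\<lambda>x. integral (cbox 0 1) (\<lambda>t. g x (\<gamma> t) * \<delta> t)) field_differentiable at x0"
      using s by (auto simp: holomorphic_on_open field_differentiable_def)
    then show ?thesis
      by (simp add: contour_integral_circlepath_eq \<gamma>_def \<delta>_def cbox_interval)
  qed
  then show ?thesis
    by (simp add: assms(1) holomorphic_on_open field_differentiable_def)
qed

text \<open>Osgood's lemma. Continuity makes \<open>continuous_on_deriv_param\<close> applicable in
  the second variable, so one partial derivative is jointly continuous; together with the mere
  existence of the other one this gives total differentiability.\<close>

lemma hol2_osgood:
  assumes "open S" and cont: "continuous_on S f"
    and "\<And>a b. (a, b) \<in> S \<Longrightarrow> (\<lambda>z. f (z, b)) field_differentiable at a"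
    and "\<And>a b. (a, b) \<in> S \<Longrightarrow> (\<lambda>z. f (a, z)) field_differentiable at b"
  shows "f holomorphic2_on S"
  unfolding hol2_open[OF assms(1)]
proof
  fix p assume "p \<in> S"
  then obtain a b where p: "p = (a, b)" "(a, b) \<in> S" by (cases p) auto
  obtain A B where AB0: "open A" "open B" "(a, b) \<in> A \<times> B" and AB5: "A \<times> B \<subseteq> S"
    by (rule open_prod_elim[OF assms(1) p(2)])
  then have AB: "open A" "open B" "a \<in> A" "b \<in> B" by auto
  obtain r where r: "r > 0" "ball a r \<subseteq> A" using AB open_contains_ball by blast
  obtain s where s: "s > 0" "cball b s \<subseteq> B" using AB open_contains_cball by blast
  have sub: "(x, y) \<in> S" if "x \<in> ball a r" "y \<in> cball b s" for x y
    using subsetD[OF r(2) that(1)] subsetD[OF s(2) that(2)] AB5 by auto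
  have "continuous_on (cball b s \<times> ball a r) (\<lambda>(z, x). f (x, z))"
    unfolding case_prod_beta
    by (rule continuous_on_compose2[OF cont]) (use sub in \<open>auto intro!: continuous_intros\<close>)
  then have "continuous_on (ball b s \<times> ball a r) (\<lambda>(y, x). deriv (\<lambda>z. f (x, z)) y)"
  proof (rule continuous_on_deriv_param[where f = "\<lambda>z x. f (x, z)"])
    fix x assume x: "x \<in> ball a r"
    show "(\<lambda>z. f (x, z)) holomorphic_on ball b s"
    proof (rule holomorphic_onI)
      fix y assume "y \<in> ball b s"
      then have "(x, y) \<in> S" using x by (intro sub) auto
      then show "(\<lambda>z. f (x, z)) field_differentiable at y within ball b s"
        by (rule field_differentiable_at_within[OF assms(4)])
    qed
  qed
  from continuous_on_compose2[OF this, of "ball a r \<times> ball b s" "\<lambda>p. (snd p, fst p)"]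
  have "continuous_on (ball a r \<times> ball b s) (\<lambda>(x, y). deriv (\<lambda>z. f (x, z)) y)"
    by (simp add: case_prod_unfold image_subset_iff continuous_on_Pair continuous_on_fst continuous_on_snd)
  then have "continuous_on (ball a r \<times> ball b s) (\<lambda>(x, y). blinfun_mult_right (deriv (\<lambda>z. f (x, z)) y))"
    unfolding case_prod_beta
    by (rule bounded_linear.continuous_on[OF bounded_linear_blinfun_mult_right])
  then have c: "continuous (at (a, b) within ball a r \<times> ball b s)
      (\<lambda>(x, y). blinfun_mult_right (deriv (\<lambda>z. f (x, z)) y))"
    using r s by (simp add: continuous_on_eq_continuous_within)
  obtain d where d: "((\<lambda>z. f (z, b)) has_field_derivative d) (at a)"
    using assms(3) p field_differentiable_def by blast
  have "((\<lambda>(x, y). f (x, y)) has_derivative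
      (\<lambda>(tx, ty). d * tx + blinfun_mult_right (deriv (\<lambda>z. f (a, z)) b) ty))
      (at (a, b) within ball a r \<times> ball b s)"
  proof (rule has_derivative_partialsI[OF _ _ c])
    show "((\<lambda>x. f (x, b)) has_derivative (*) d) (at a within ball a r)"
      using d has_derivative_at_withinI unfolding has_field_derivative_def by blast
  next
    fix x y assume "x \<in> ball a r" "y \<in> ball b s"
    then have "((\<lambda>z. f (x, z)) has_field_derivative deriv (\<lambda>z. f (x, z)) y) (at y)"
      using assms(4) sub by (simp add: field_differentiable_derivI)
    then show "((\<lambda>y. f (x, y)) has_derivative blinfun_mult_right (deriv (\<lambda>z. f (x, z)) y))
        (at y within ball b s)"
      by (simp add: has_field_derivative_def has_derivative_at_withinI)
  qed (use s in auto)
  moreover have "open (ball a r \<times> ball b s)" "(a, b) \<in> ball a r \<times> ball b s"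
    using r s by (auto intro: open_Times)
  ultimately have "(f has_derivative (\<lambda>(x, y). d * x + deriv (\<lambda>z. f (a, z)) b * y)) (at p)"
    unfolding p by (simp add: at_within_open[of _ "ball a r \<times> ball b s"])
  then show "\<exists>s t. (f has_derivative (\<lambda>(x, y). s * x + t * y)) (at p)" by blast
qed

text \<open>By Osgood's lemma it is enough to let the parameter run in the two coordinate
  directions, where \<open>holomorphic_circle_integral\<close> applies.\<close>

lemma hol2_circle_integral:
  fixes g :: "complex \<times> complex \<Rightarrow> complex \<Rightarrow> complex"
  assumes "open U" "continuous_on (U \<times> sphere c r) (\<lambda>(x, z). g x z)" "0 \<le> r"
    "\<And>z. z \<in> sphere c r \<Longrightarrow> (\<lambda>x. g x z) holomorphic2_on U"
  shows "(\<lambda>x. contour_integral (circlepath c r) (g x)) holomorphic2_on U"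
proof (rule hol2_osgood[OF assms(1)])
  show "continuous_on U (\<lambda>x. contour_integral (circlepath c r) (g x))"
    by (rule continuous_on_circle_integral[OF assms(2,3)])
next
  have *: "(\<lambda>z. contour_integral (circlepath c r) (g (h z))) field_differentiable at a"
    if h: "h a \<in> U" "continuous_on UNIV h" "\<And>z. h z = (k z, l z)" "k holomorphic_on UNIV" "l holomorphic_on UNIV"
    for h k l a
  proof -
    define V where "V = h -` U"
    have V: "open V" "a \<in> V" "\<And>z. z \<in> V \<Longrightarrow> h z \<in> U"
      using h open_vimage[OF assms(1), of h] by (auto simp: V_def)
    have "(\<lambda>z. contour_integral (circlepath c r) (g (h z))) holomorphic_on V"
    proof (rule holomorphic_circle_integral[OF V(1) _ assms(3)])
      show "continuous_on (V \<times> sphere c r) (\<lambda>(x, z). g (h x) z)"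
        unfolding case_prod_beta
        by (rule continuous_on_compose2[OF assms(2)[unfolded case_prod_beta],
            of _ "\<lambda>p. (h (fst p), snd p)", simplified])
          (use V in \<open>auto intro!: continuous_intros continuous_on_compose2[OF h(2)]\<close>)
    next
      fix z assume "z \<in> sphere c r"
      from hol2_curve[OF assms(4)[OF this] assms(1), of k V l]
      show "(\<lambda>x. g (h x) z) holomorphic_on V"
        using V h holomorphic_on_subset[OF h(4)] holomorphic_on_subset[OF h(5)] by auto
    qed
    then show ?thesis
      using V holomorphic_on_imp_differentiable_at by blast
  qed
  fix a b assume ab: "(a, b) \<in> U"
  show "(\<lambda>z. contour_integral (circlepath c r) (g (z, b))) field_differentiable at a"
    by (rule *[where h = "\<lambda>z. (z, b)"]) (use ab in \<open>auto intro!: continuous_intros holomorphic_intros\<close>)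
  show "(\<lambda>z. contour_integral (circlepath c r) (g (a, z))) field_differentiable at b"
    by (rule *[where h = "\<lambda>z. (a, z)"]) (use ab in \<open>auto intro!: continuous_intros holomorphic_intros\<close>)
qed

section \<open>The ball, its complex lines and the identity theorem\<close>

lemma open_Ball2: "open Ball2"
proof -
  have "Ball2 = {p. 2 * Re (snd p) + (cmod (fst p))\<^sup>2 < 0}"
    by (auto simp: Ball2_def)
  moreover have "open \<dots>"
    by (intro open_Collect_less continuous_intros)
  ultimately show ?thesis by simp
qed

lemma Ball2_iff: "(u, v) \<in> Ball2 \<longleftrightarrow> 2 * Re v + (cmod u)\<^sup>2 < 0"
  by (simp add: Ball2_def)

lemma convex_Ball2: "convex Ball2"
proof (rule convexI)
  fix x y :: "complex \<times> complex" and s t :: real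
  assume xy: "x \<in> Ball2" "y \<in> Ball2" and st: "0 \<le> s" "0 \<le> t" "s + t = 1"
  obtain a b c d where ab: "x = (a, b)" "y = (c, d)" by (cases x, cases y) auto
  have x: "2 * Re b + (cmod a)\<^sup>2 < 0" and y: "2 * Re d + (cmod c)\<^sup>2 < 0"
    using xy by (auto simp: ab Ball2_iff)
  have "cmod (s *\<^sub>R a + t *\<^sub>R c) \<le> s * cmod a + t * cmod c"
    using norm_triangle_ineq[of "s *\<^sub>R a" "t *\<^sub>R c"] st by simp
  then have "(cmod (s *\<^sub>R a + t *\<^sub>R c))\<^sup>2 \<le> (s * cmod a + t * cmod c)\<^sup>2"
    by (intro power_mono) auto
  also have "\<dots> = s * (cmod a)\<^sup>2 + t * (cmod c)\<^sup>2 - s * t * (cmod a - cmod c)\<^sup>2"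
  proof -
    have s: "s = 1 - t" using st by simp
    show ?thesis unfolding s by (simp add: power2_eq_square algebra_simps)
  qed
  also have "\<dots> \<le> s * (cmod a)\<^sup>2 + t * (cmod c)\<^sup>2" using st by simp
  finally have 1: "(cmod (s *\<^sub>R a + t *\<^sub>R c))\<^sup>2 \<le> s * (cmod a)\<^sup>2 + t * (cmod c)\<^sup>2" .
  have "s * (2 * Re b + (cmod a)\<^sup>2) + t * (2 * Re d + (cmod c)\<^sup>2) < 0"
  proof (cases "s = 0")
    case False
    then have "s * (2 * Re b + (cmod a)\<^sup>2) < 0" using st x by (simp add: mult_less_0_iff)
    moreover have "t * (2 * Re d + (cmod c)\<^sup>2) \<le> 0" using st y by (simp add: mult_le_0_iff)
    ultimately show ?thesis by simp
  qed (use st y in auto)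
  with 1 show "s *\<^sub>R x + t *\<^sub>R y \<in> Ball2"
    by (simp add: ab Ball2_iff algebra_simps)
qed

lemma box_in_open:
  fixes S :: "(complex \<times> complex) set"
  assumes "open S" "(a, b) \<in> S"
  obtains r where "r > 0" "cball a r \<times> cball b r \<subseteq> S"
proof -
  obtain A B where AB: "open A" "open B" "(a, b) \<in> A \<times> B" "A \<times> B \<subseteq> S"
    by (rule open_prod_elim[OF assms])
  obtain r where r: "r > 0" "cball a r \<subseteq> A" using AB(1,3) open_contains_cball by blast
  obtain s where s: "s > 0" "cball b s \<subseteq> B" using AB(2,3) open_contains_cball by blast
  have "cball a (min r s) \<subseteq> A" "cball b (min r s) \<subseteq> B" using r s by auto
  then have "cball a (min r s) \<times> cball b (min r s) \<subseteq> S" using AB(4) by blast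
  with r s that[of "min r s"] show ?thesis by auto
qed

text \<open>Locally \<open>d_u f\<close> is the Cauchy integral of f (z, y) / (z - x)^2 over a fixed
  circle, which is holomorphic in (x, y) as an integral with parameters.\<close>

lemma hol2_d_u:
  assumes "f holomorphic2_on S" "open S"
  shows "d_u f holomorphic2_on S"
proof (rule hol2_locally[OF assms(2)])
  fix p assume "p \<in> S"
  then obtain a b where p: "p = (a, b)" "(a, b) \<in> S" by (cases p) auto
  obtain r where r: "r > 0" "cball a r \<times> cball b r \<subseteq> S"
    by (rule box_in_open[OF assms(2) p(2)])
  define U where "U = ball a r \<times> ball b r"
  have U: "open U" "p \<in> U" using r p by (auto simp: U_def open_Times)
  have US: "U \<subseteq> S" using r(2) by (force simp: U_def)
  have cb: "(z, y) \<in> S" if "z \<in> cball a r" "y \<in> ball b r" for z y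
    using that r(2) by auto
  define g where "g = (\<lambda>p z. f (z, snd p) / (z - fst p)^2)"
  have nz: "z \<noteq> fst q" if "q \<in> U" "z \<in> sphere a r" for z q
    using that by (auto simp: U_def)
  have "(\<lambda>p. contour_integral (circlepath a r) (g p)) holomorphic2_on U"
  proof (rule hol2_circle_integral[OF U(1)])
    show "continuous_on (U \<times> sphere a r) (\<lambda>(x, z). g x z)"
      unfolding case_prod_beta g_def
    proof (intro continuous_intros)
      show "continuous_on (U \<times> sphere a r) (\<lambda>p. f (snd p, snd (fst p)))"
        by (rule continuous_on_compose2[OF hol2_imp_continuous_on[OF assms(1)]])
          (use cb in \<open>auto simp: U_def intro!: continuous_intros\<close>)
    qed (use nz in fastforce)
  next
    fix z assume z: "z \<in> sphere a r"
    show "(\<lambda>x. g x z) holomorphic2_on U" unfolding g_def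
      by (intro hol2_divide hol2_intros U hol2_compose[OF assms(1,2)])
        (use z cb nz in \<open>auto simp: U_def\<close>)
  qed (use r in auto)
  then have "(\<lambda>p. 1 / (2 * of_real pi * \<i>) * contour_integral (circlepath a r) (g p)) holomorphic2_on U"
    by (intro hol2_intros)
  moreover have "d_u f q = 1 / (2 * of_real pi * \<i>) * contour_integral (circlepath a r) (g q)" if q: "q \<in> U" for q
  proof -
    obtain x y where xy: "q = (x, y)" "x \<in> ball a r" "y \<in> ball b r" using q by (auto simp: U_def)
    have c: "continuous_on (cball a r) (\<lambda>z. f (z, y))"
      by (rule continuous_on_compose2[OF hol2_imp_continuous_on[OF assms(1)]])
        (use cb xy in \<open>auto intro!: continuous_intros\<close>)
    have h: "(\<lambda>z. f (z, y)) holomorphic_on ball a r"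
      by (rule hol2_curve[OF assms]) (use cb xy in \<open>auto intro!: holomorphic_intros\<close>)
    from Cauchy_derivative_integral_circlepath(2)[OF c h xy(2)] show ?thesis
      by (simp add: d_u_def xy g_def DERIV_imp_deriv)
  qed
  ultimately have "d_u f holomorphic2_on U"
    using hol2_cong[of U "d_u f"] by simp
  with U show "\<exists>T. open T \<and> p \<in> T \<and> d_u f holomorphic2_on T" by blast
qed

lemma hol2_d_v:
  assumes "f holomorphic2_on S" "open S"
  shows "d_v f holomorphic2_on S"
proof -
  have o: "open (prod.swap -` S)" by (intro open_vimage assms continuous_on_swap)
  have h: "(\<lambda>p. f (snd p, fst p)) holomorphic2_on (prod.swap -` S)"
    by (intro hol2_compose[OF assms] hol2_intros o) (auto simp: prod.swap_def)
  have "(\<lambda>p. d_u (\<lambda>p. f (snd p, fst p)) (snd p, fst p)) holomorphic2_on S"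
    by (intro hol2_compose[OF hol2_d_u[OF h o] o] hol2_intros assms) auto
  then show ?thesis
    by (simp add: d_u_def d_v_def case_prod_unfold)
qed

lemma affine_line_Ball2:
  fixes p e :: "complex \<times> complex"
  defines "A \<equiv> {t. (fst p + t * fst e, snd p + t * snd e) \<in> Ball2}"
  shows "open A" "convex A"
proof -
  have "A = (\<lambda>t. (fst p + t * fst e, snd p + t * snd e)) -` Ball2" by (auto simp: A_def)
  then show "open A" by (auto intro!: open_vimage open_Ball2 continuous_intros)
  show "convex A"
  proof (rule convexI)
    fix x y :: complex and s t :: real
    assume *: "x \<in> A" "y \<in> A" "0 \<le> s" "0 \<le> t" "s + t = 1"
    then have s: "s = 1 - t" by simp
    have "s *\<^sub>R (fst p + x * fst e, snd p + x * snd e) + t *\<^sub>R (fst p + y * fst e, snd p + y * snd e) \<in> Ball2"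
      using * unfolding A_def by (intro convexD[OF convex_Ball2]) auto
    then show "s *\<^sub>R x + t *\<^sub>R y \<in> A"
      by (simp add: A_def s algebra_simps)
  qed
qed

lemma hol2_line:
  assumes "f holomorphic2_on Ball2"
  shows "(\<lambda>t. f (fst p + t * fst e, snd p + t * snd e)) holomorphic_on
    {t. (fst p + t * fst e, snd p + t * snd e) \<in> Ball2}"
  by (rule hol2_curve[OF assms open_Ball2])
    (auto intro!: holomorphic_intros affine_line_Ball2)

text \<open>A point of \<open>W\<close> and the point \<open>b\<close> lie on a complex line whose
  intersection with the ball is convex, hence connected; the identity theorem in one variable
  applies there.\<close>

lemma hol2_identity:
  assumes "f holomorphic2_on Ball2" "open W" "W \<noteq> {}" "W \<subseteq> Ball2" "\<And>b. b \<in> W \<Longrightarrow> f b = 0" "b \<in> Ball2"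
  shows "f b = 0"
proof -
  obtain p where p: "p \<in> W" using assms(3) by blast
  define e where "e = b - p"
  define l where "l = (\<lambda>t. (fst p + t * fst e, snd p + t * snd e))"
  define A where "A = {t. l t \<in> Ball2}"
  have A: "open A" "convex A" using affine_line_Ball2[of p e] by (auto simp: A_def l_def)
  have 01: "l 0 = p" "l 1 = b" by (auto simp: l_def e_def)
  have sub: "l -` W \<subseteq> A" using assms(4) by (auto simp: A_def)
  have "f (l 1) = 0"
  proof (rule analytic_continuation_open[of "l -` W" A "\<lambda>t. f (l t)" "\<lambda>_. 0"])
    show "open (l -` W)" unfolding l_def by (intro open_vimage assms continuous_intros)
    show "l -` W \<noteq> {}" using 01 p by auto
    show "connected A" using A convex_connected by blast
    show "(\<lambda>t. f (l t)) holomorphic_on A"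
      using hol2_line[OF assms(1), of p e] by (simp add: l_def A_def)
    show "1 \<in> A" using 01 assms(6) by (simp add: A_def)
  qed (use assms A sub in auto)
  then show ?thesis by (simp add: 01)
qed

lemma hol2_nonzero_dense:
  assumes "f holomorphic2_on Ball2" "b1 \<in> Ball2" "f b1 \<noteq> 0" "open W" "b \<in> W" "b \<in> Ball2"
  shows "\<exists>c\<in>W. c \<in> Ball2 \<and> f c \<noteq> 0"
  using hol2_identity[OF assms(1), of "W \<inter> Ball2" b1] assms open_Ball2 by blast

text \<open>The standard way below to pass from an identity of quotients, valid off the zeros of
  \<open>f\<close>, to the whole ball: a holomorphic function that is not identically zero is
  nonzero on a dense set.\<close>

lemma hol2_eq_of_dense:
  fixes g h :: "complex \<times> complex \<Rightarrow> complex"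
  assumes "f holomorphic2_on Ball2" "b1 \<in> Ball2" "f b1 \<noteq> 0"
    "open U" "U \<subseteq> Ball2" "continuous_on U g" "continuous_on U h"
    "\<And>b. b \<in> U \<Longrightarrow> f b \<noteq> 0 \<Longrightarrow> g b = h b" "b \<in> U"
  shows "g b = h b"
proof (rule ccontr)
  assume n: "g b \<noteq> h b"
  have "open (U \<inter> (\<lambda>x. g x - h x) -` (- {0}))"
    by (intro continuous_open_preimage continuous_on_diff assms) auto
  moreover have b: "b \<in> U \<inter> (\<lambda>x. g x - h x) -` (- {0})" "b \<in> Ball2" using n assms(5,9) by auto
  ultimately have "\<exists>c\<in>U \<inter> (\<lambda>x. g x - h x) -` (- {0}). c \<in> Ball2 \<and> f c \<noteq> 0"
    by (rule hol2_nonzero_dense[OF assms(1-3)])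
  then obtain c where "c \<in> U" "g c - h c \<noteq> 0" "f c \<noteq> 0" by blast
  then show False using assms(8)[of c] by simp
qed

lemma hol2_mult_eq_0:
  assumes "f holomorphic2_on Ball2" "g holomorphic2_on Ball2"
    "\<And>b. b \<in> Ball2 \<Longrightarrow> f b * g b = 0" "b1 \<in> Ball2" "f b1 \<noteq> 0" "b \<in> Ball2"
  shows "g b = 0"
  by (rule hol2_eq_of_dense[OF assms(1,4,5) open_Ball2 order_refl, of g "\<lambda>_. 0"])
    (use assms hol2_imp_continuous_on in auto)

section \<open>Removable singularities in two variables\<close>

lemma holomorphic_extend_finite:
  assumes "finite K" "open S" "f holomorphic_on S - K"
    "\<And>z. z \<in> K \<Longrightarrow> z \<in> S \<Longrightarrow> \<exists>B. eventually (\<lambda>w. cmod (f w) \<le> B) (at z)"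
  shows "\<exists>g. g holomorphic_on S \<and> (\<forall>z\<in>S - K. g z = f z)"
  using assms
proof (induction K arbitrary: S rule: finite_induct)
  case (insert x K)
  have "\<exists>g. g holomorphic_on (S - {x}) \<and> (\<forall>z\<in>(S - {x}) - K. g z = f z)"
  proof (rule insert.IH)
    have "S - {x} - K = S - insert x K" by auto
    then show "f holomorphic_on S - {x} - K" using insert.prems(2) by simp
  qed (use insert.prems in \<open>auto simp: open_delete\<close>)
  then obtain g where g: "g holomorphic_on (S - {x})" "\<And>z. z \<in> S - insert x K \<Longrightarrow> g z = f z"
    by auto
  show ?case
  proof (cases "x \<in> S")
    case False
    then show ?thesis using g by auto
  next
    case True
    obtain B where "eventually (\<lambda>w. cmod (f w) \<le> B) (at x)" using insert.prems(3) True by blast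
    moreover have "eventually (\<lambda>w. w \<in> S - K - {x}) (at x)"
    proof -
      have "open (S - K)" "x \<in> S - K"
        using insert True by (auto intro: open_Diff finite_imp_closed)
      then show ?thesis by (auto simp: eventually_at_topological)
    qed
    ultimately have "eventually (\<lambda>w. cmod (g w) \<le> B) (at x)"
      by eventually_elim (use g in auto)
    then obtain h where "h holomorphic_on S" "\<And>z. z \<in> S - {x} \<Longrightarrow> h z = g z"
      using holomorphic_on_extend_bounded[OF g(1)] True insert.prems(1) by (metis interior_open)
    then show ?thesis using g(2) by (intro exI[of _ h]) auto
  qed
qed auto

lemma hol2_locally_bounded:
  fixes f :: "complex \<times> complex \<Rightarrow> complex"
  assumes "continuous_on S f" "open S" "b \<in> S"
  obtains W C where "open W" "b \<in> W" "W \<subseteq> S" "\<And>z. z \<in> W \<Longrightarrow> cmod (f z) \<le> C"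
proof -
  have "isCont f b" using assms by (simp add: continuous_on_eq_continuous_at)
  then have "eventually (\<lambda>z. dist (f z) (f b) < 1) (nhds b)"
    by (metis continuous_at tendsto_at_iff_tendsto_nhds tendstoD zero_less_one)
  then obtain W where W: "open W" "b \<in> W" "\<And>z. z \<in> W \<Longrightarrow> dist (f z) (f b) < 1"
    by (auto simp: eventually_nhds)
  show ?thesis
  proof (rule that[of "W \<inter> S" "cmod (f b) + 1"])
    fix z assume "z \<in> W \<inter> S"
    then have "cmod (f z - f b) < 1" using W by (auto simp: dist_norm)
    moreover have "cmod (f z) \<le> cmod (f z - f b) + cmod (f b)" by (metis norm_triangle_sub add.commute)
    ultimately show "cmod (f z) \<le> cmod (f b) + 1" by simp
  qed (use W assms in auto)
qed

text \<open>On slices \<open>\<eta> = const\<close> avoiding the countable exceptional set, Riemann's theorem on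
  removable singularities applies; Cauchy's integral over a fixed circle glues these slices.\<close>

lemma polydisc_extend:
  fixes p F :: scalar_fun
  assumes r: "0 < r" "0 < s" and V: "open V" "cball 0 r \<times> ball 0 s \<subseteq> V"
    and p: "p holomorphic2_on V" "\<And>\<xi> \<eta>. cmod \<xi> = r \<Longrightarrow> cmod \<eta> < s \<Longrightarrow> p (\<xi>, \<eta>) \<noteq> 0"
    and F: "F holomorphic2_on {z \<in> V. p z \<noteq> 0}"
    and E: "countable E"
    and bd: "\<And>b. b \<in> V - E \<Longrightarrow> \<exists>W C. open W \<and> b \<in> W \<and> (\<forall>z\<in>W \<inter> V. p z \<noteq> 0 \<longrightarrow> cmod (F z) \<le> C)"
    and slice: "\<And>\<eta>. cmod \<eta> < s \<Longrightarrow> connected {\<xi>. (\<xi>, \<eta>) \<in> V}"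
  obtains G where "G holomorphic2_on (ball 0 r \<times> ball 0 s)"
    "\<And>z. z \<in> ball 0 r \<times> ball 0 s \<Longrightarrow> p z \<noteq> 0 \<Longrightarrow> G z = F z"
proof -
  have oV: "open {z \<in> V. p z \<noteq> 0}"
  proof -
    have "open (V \<inter> p -` (- {0}))"
      by (intro continuous_open_preimage hol2_imp_continuous_on[OF p(1)] V) auto
    moreover have "V \<inter> p -` (- {0}) = {z \<in> V. p z \<noteq> 0}" by auto
    ultimately show ?thesis by simp
  qed
  define U :: "(complex \<times> complex) set" where "U = ball 0 r \<times> ball 0 s"
  have U: "open U" by (simp add: U_def open_Times)
  define g where "g = (\<lambda>q z. F (z, snd q) / (z - fst q))"
  define G where "G = (\<lambda>q. 1 / (2 * of_real pi * \<i>) * contour_integral (circlepath 0 r) (g q))"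
  have inV: "(z, snd q) \<in> V" "p (z, snd q) \<noteq> 0" if "q \<in> U" "z \<in> sphere 0 r" for q z
    using that V p(2) by (auto simp: U_def)
  have nz: "z \<noteq> fst q" if "q \<in> U" "z \<in> sphere 0 r" for z q
    using that by (auto simp: U_def)
  have "(\<lambda>q. contour_integral (circlepath 0 r) (g q)) holomorphic2_on U"
  proof (rule hol2_circle_integral[OF U])
    show "continuous_on (U \<times> sphere 0 r) (\<lambda>(x, z). g x z)"
      unfolding case_prod_beta g_def
    proof (intro continuous_intros)
      show "continuous_on (U \<times> sphere 0 r) (\<lambda>p. F (snd p, snd (fst p)))"
        by (rule continuous_on_compose2[OF hol2_imp_continuous_on[OF F]])
          (use inV in \<open>auto intro!: continuous_intros\<close>)
    qed (use nz in fastforce)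
  next
    fix z :: complex assume z: "z \<in> sphere 0 r"
    show "(\<lambda>x. g x z) holomorphic2_on U" unfolding g_def
      by (intro hol2_divide hol2_intros U hol2_compose[OF F oV])
        (use z inV nz in auto)
  qed (use r in auto)
  then have G: "G holomorphic2_on U"
    unfolding G_def by (intro hol2_intros)
  define Bad where "Bad = snd ` E"
  have "countable Bad" using E by (simp add: Bad_def)
  have good: "G (\<xi>, \<eta>) = F (\<xi>, \<eta>)" if "(\<xi>, \<eta>) \<in> U" "\<eta> \<notin> Bad" "p (\<xi>, \<eta>) \<noteq> 0" for \<xi> \<eta>
  proof -
    define S where "S = {z. (z, \<eta>) \<in> V}"
    have "S = (\<lambda>z. (z, \<eta>)) -` V" by (auto simp: S_def)
    then have S: "open S" by (auto intro!: open_vimage V continuous_intros)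
    have \<eta>: "cmod \<eta> < s" and \<xi>: "cmod \<xi> < r" using that by (auto simp: U_def)
    have cS: "connected S" unfolding S_def by (rule slice[OF \<eta>])
    have sub: "cball 0 r \<subseteq> S" using V \<eta> by (auto simp: S_def)
    have hp: "(\<lambda>z. p (z, \<eta>)) holomorphic_on S"
      by (rule hol2_curve[OF p(1) V(1)]) (use S in \<open>auto simp: S_def intro!: holomorphic_intros\<close>)
    define K where "K = {z \<in> cball 0 r. p (z, \<eta>) = 0}"
    have K: "finite K"
    proof (cases "(\<lambda>z. p (z, \<eta>)) constant_on S")
      case True
      then obtain c where c: "\<And>z. z \<in> S \<Longrightarrow> p (z, \<eta>) = c" by (auto simp: constant_on_def)
      have "of_real r \<in> S" "p (of_real r, \<eta>) \<noteq> 0" using sub r p(2)[OF _ \<eta>, of "of_real r"] by auto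
      then have "K = {}" using c sub by (auto simp: K_def)
      then show ?thesis by simp
    next
      case False
      then show ?thesis unfolding K_def
        by (rule holomorphic_compact_finite_zeros[OF hp S cS compact_cball sub])
    qed
    have oS: "open (S \<inter> (\<lambda>z. p (z, \<eta>)) -` (- {0}))"
      by (intro continuous_open_preimage holomorphic_on_imp_continuous_on[OF hp] S) auto
    \<comment> \<open>\<open>T\<close> contains the closed disc, and \<open>p\<close> has no zeros
      on \<open>T - K\<close>; so after removing the finitely many singularities in
      \<open>K\<close>, Cauchy's formula on the circle involves values of \<open>F\<close>
      only.\<close>
    define T where "T = ball 0 r \<union> (S \<inter> (\<lambda>z. p (z, \<eta>)) -` (- {0}))"
    have T: "open T" using oS by (auto simp: T_def)
    have TK: "T - K = S \<inter> (\<lambda>z. p (z, \<eta>)) -` (- {0})"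
    proof -
      have "ball 0 r \<subseteq> S" using sub by (meson ball_subset_cball order_trans)
      then show ?thesis by (auto simp: T_def K_def)
    qed
    have cT: "cball 0 r \<subseteq> T"
      using sub p(2)[OF _ \<eta>] by (force simp: T_def)
    have hF: "(\<lambda>z. F (z, \<eta>)) holomorphic_on T - K"
      by (rule hol2_curve[OF F oV]) (use oS TK in \<open>auto simp: S_def intro!: holomorphic_intros\<close>)
    have "\<exists>g. g holomorphic_on T \<and> (\<forall>z\<in>T - K. g z = F (z, \<eta>))"
    proof (rule holomorphic_extend_finite[OF K T hF])
      fix z assume z: "z \<in> K" "z \<in> T"
      then have zV: "(z, \<eta>) \<in> V" using sub by (auto simp: K_def S_def)
      moreover have "(z, \<eta>) \<notin> E" using \<open>\<eta> \<notin> Bad\<close> by (force simp: Bad_def)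
      ultimately obtain W C where W: "open W" "(z, \<eta>) \<in> W" "\<And>q. q \<in> W \<inter> V \<Longrightarrow> p q \<noteq> 0 \<Longrightarrow> cmod (F q) \<le> C"
        using bd[of "(z, \<eta>)"] by blast
      have "open ((\<lambda>z. (z, \<eta>)) -` (W \<inter> V))"
        by (intro open_vimage open_Int W V continuous_intros)
      moreover have "z \<in> (\<lambda>z. (z, \<eta>)) -` (W \<inter> V)" using W zV by simp
      ultimately have e1: "eventually (\<lambda>w. (w, \<eta>) \<in> W \<inter> V) (at z)"
        unfolding eventually_at_topological by blast
      have "open (T - (K - {z}))" "z \<in> T - (K - {z})"
        using T K z by (auto intro: open_Diff finite_imp_closed)
      then have e2: "eventually (\<lambda>w. w \<in> T - K) (at z)"
        unfolding eventually_at_topological by blast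
      have "eventually (\<lambda>w. cmod (F (w, \<eta>)) \<le> C) (at z)"
        using e1 e2 by eventually_elim (use W(3) TK in auto)
      then show "\<exists>B. eventually (\<lambda>w. cmod (F (w, \<eta>)) \<le> B) (at z)" by blast
    qed
    then obtain h where h: "h holomorphic_on T" "\<And>z. z \<in> T - K \<Longrightarrow> h z = F (z, \<eta>)" by blast
    have "\<xi> \<in> T - K" using \<xi> cT that by (auto simp: K_def)
    have "((\<lambda>u. h u / (u - \<xi>)) has_contour_integral (2 * of_real pi * \<i> * h \<xi>)) (circlepath 0 r)"
    proof (rule Cauchy_integral_circlepath)
      show "continuous_on (cball 0 r) h"
        using h(1) cT holomorphic_on_imp_continuous_on holomorphic_on_subset by blast
      show "h holomorphic_on ball 0 r"
        using h(1) by (rule holomorphic_on_subset) (auto simp: T_def)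
    qed (use \<xi> in \<open>simp add: dist_norm\<close>)
    moreover have "g (\<xi>, \<eta>) u = h u / (u - \<xi>)" if "u \<in> sphere 0 r" for u
      using that cT p(2)[OF _ \<eta>, of u] h(2)[of u] by (auto simp: g_def K_def)
    ultimately have "(g (\<xi>, \<eta>) has_contour_integral (2 * of_real pi * \<i> * h \<xi>)) (circlepath 0 r)"
      using r by (elim has_contour_integral_eq) auto
    then have "contour_integral (circlepath 0 r) (g (\<xi>, \<eta>)) = 2 * of_real pi * \<i> * h \<xi>"
      by (rule contour_integral_unique)
    then show ?thesis
      using h(2)[OF \<open>\<xi> \<in> T - K\<close>] by (simp add: G_def)
  qed
  show ?thesis
  proof (rule that[of G])
    show "G holomorphic2_on ball 0 r \<times> ball 0 s" using G by (simp add: U_def)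
    fix z assume z: "z \<in> ball 0 r \<times> ball 0 s" "p z \<noteq> 0"
    define O' where "O' = U \<inter> {z \<in> V. p z \<noteq> 0}"
    have O': "open O'" "O' \<subseteq> U" "O' \<subseteq> {z \<in> V. p z \<noteq> 0}" using U oV by (auto simp: O'_def)
    show "G z = F z"
    proof (rule ccontr)
      assume n: "G z \<noteq> F z"
      have "open (O' \<inter> (\<lambda>q. G q - F q) -` (- {0}))"
        by (intro continuous_open_preimage continuous_on_diff O'
            continuous_on_subset[OF hol2_imp_continuous_on[OF G]]
            continuous_on_subset[OF hol2_imp_continuous_on[OF F]]) auto
      moreover have "z \<in> O' \<inter> (\<lambda>q. G q - F q) -` (- {0})"
        using z V n by (auto simp: O'_def U_def)
      ultimately obtain t where t: "t > 0"
          "cball (fst z) t \<times> cball (snd z) t \<subseteq> O' \<inter> (\<lambda>q. G q - F q) -` (- {0})"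
        using box_in_open[of _ "fst z" "snd z"] by (metis prod.collapse)
      \<comment> \<open>Only countably many slices meet \<open>E\<close>, so an open set on which
        \<open>G\<close> and \<open>F\<close> differ would contain a point of a good slice.\<close>
      have "uncountable (ball (snd z) t)" using t by (simp add: uncountable_ball)
      then obtain \<eta> where \<eta>: "\<eta> \<in> ball (snd z) t" "\<eta> \<notin> Bad"
        by (meson \<open>countable Bad\<close> countable_subset subsetI)
      have "(fst z, \<eta>) \<in> cball (fst z) t \<times> cball (snd z) t" using \<eta> t by auto
      then have "(fst z, \<eta>) \<in> O' \<inter> (\<lambda>q. G q - F q) -` (- {0})" using t(2) by blast
      then show False using good[of "fst z" \<eta>] \<eta> by (auto simp: O'_def)
    qed
  qed
qed

lemma open_nonzero:
  assumes "f holomorphic2_on S" "open S"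
  shows "open {z \<in> S. f z \<noteq> 0}"
proof -
  have "open (S \<inter> f -` (- {0}))"
    by (intro continuous_open_preimage hol2_imp_continuous_on assms) auto
  moreover have "S \<inter> f -` (- {0}) = {z \<in> S. f z \<noteq> 0}" by auto
  ultimately show ?thesis by simp
qed

text \<open>Coordinates are turned so that the first axis joins \<open>b0\<close> to a point with
  \<open>P \<noteq> 0\<close>. On it the zero of \<open>P\<close> at \<open>b0\<close> is isolated,
  and compactness of a small circle keeps \<open>P\<close> nonzero on the product of the circle with
  a small disc: the situation of \<open>polydisc_extend\<close>.\<close>

lemma hol2_extend_local:
  fixes P F :: scalar_fun
  assumes P: "P holomorphic2_on Ball2" and b1: "b1 \<in> Ball2" "P b1 \<noteq> 0" and E: "countable E"
    and F: "F holomorphic2_on {z \<in> Ball2. P z \<noteq> 0}"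
    and bd: "\<And>b. b \<in> Ball2 - E \<Longrightarrow>
      \<exists>W C. open W \<and> b \<in> W \<and> (\<forall>z\<in>W \<inter> Ball2. P z \<noteq> 0 \<longrightarrow> cmod (F z) \<le> C)"
    and b0: "b0 \<in> Ball2"
  shows "\<exists>W G. open W \<and> b0 \<in> W \<and> W \<subseteq> Ball2 \<and> G holomorphic2_on W \<and> (\<forall>z\<in>W. P z \<noteq> 0 \<longrightarrow> G z = F z)"
proof (cases "P b0 = 0")
  case False
  then show ?thesis
    using open_nonzero[OF P open_Ball2] F b0
    by (intro exI[of _ "{z \<in> Ball2. P z \<noteq> 0}"] exI[of _ F]) auto
next
  case True
  define e1 e2 where "e1 = fst b1 - fst b0" and "e2 = snd b1 - snd b0"
  define d where "d = e1 * cnj e1 + e2 * cnj e2"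
  have "b1 \<noteq> b0" using True b1 by auto
  then have "e1 \<noteq> 0 \<or> e2 \<noteq> 0" by (auto simp: e1_def e2_def prod_eq_iff)
  moreover have "d = of_real ((cmod e1)\<^sup>2 + (cmod e2)\<^sup>2)" by (simp only: d_def complex_norm_square of_real_add)
  ultimately have d: "d \<noteq> 0"
    by (metis of_real_eq_0_iff norm_eq_zero sum_power2_eq_zero_iff)
  \<comment> \<open>The frame consists of e = b1 - b0 and the orthogonal vector (- cnj e2, cnj e1);
    its determinant is \<open>d\<close> = |e|^2, and \<Xi> is the inverse map.\<close>
  define \<Psi> where "\<Psi> = (\<lambda>q. (fst b0 + fst q * e1 - snd q * cnj e2, snd b0 + fst q * e2 + snd q * cnj e1))"
  define \<Xi> where "\<Xi> = (\<lambda>z. (((fst z - fst b0) * cnj e1 + (snd z - snd b0) * cnj e2) / d,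
    (e1 * (snd z - snd b0) - e2 * (fst z - fst b0)) / d))"
  have \<Psi>\<Xi>: "\<Psi> (\<Xi> z) = z" for z
  proof -
    have "fst (\<Psi> (\<Xi> z)) = fst b0 + (fst z - fst b0) * (e1 * cnj e1 + e2 * cnj e2) / d"
      by (simp add: \<Psi>_def \<Xi>_def field_simps d)
    moreover have "snd (\<Psi> (\<Xi> z)) = snd b0 + (snd z - snd b0) * (e1 * cnj e1 + e2 * cnj e2) / d"
      by (simp add: \<Psi>_def \<Xi>_def field_simps d)
    ultimately show ?thesis using d by (simp add: d_def[symmetric] prod_eq_iff)
  qed
  have \<Xi>\<Psi>: "\<Xi> (\<Psi> q) = q" for q
  proof -
    have "fst (\<Xi> (\<Psi> q)) = fst q * (e1 * cnj e1 + e2 * cnj e2) / d"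
      by (simp add: \<Psi>_def \<Xi>_def field_simps d)
    moreover have "snd (\<Xi> (\<Psi> q)) = snd q * (e1 * cnj e1 + e2 * cnj e2) / d"
      by (simp add: \<Psi>_def \<Xi>_def field_simps d)
    ultimately show ?thesis using d by (simp add: d_def[symmetric] prod_eq_iff)
  qed
  have c\<Psi>: "continuous_on A \<Psi>" and c\<Xi>: "continuous_on A \<Xi>" for A
    unfolding \<Psi>_def \<Xi>_def by (intro continuous_intros; simp add: d)+
  define V where "V = \<Psi> -` Ball2"
  have V: "open V" unfolding V_def by (intro open_vimage open_Ball2 c\<Psi>)
  have h\<Psi>: "(\<lambda>q. f (\<Psi> q)) holomorphic2_on \<Psi> -` S" if "f holomorphic2_on S" "open S" for f S
    using that unfolding \<Psi>_def
    by (intro hol2_compose[OF that] hol2_intros open_vimage c\<Psi>[unfolded \<Psi>_def]) auto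
  have h\<Xi>: "(\<lambda>q. f (\<Xi> q)) holomorphic2_on \<Xi> -` S" if "f holomorphic2_on S" "open S" for f S
    using that d unfolding \<Xi>_def divide_inverse
    by (intro hol2_compose[OF that] hol2_intros open_vimage c\<Xi>[unfolded \<Xi>_def divide_inverse]) auto
  define p where "p = (\<lambda>q. P (\<Psi> q))"
  have p: "p holomorphic2_on V" unfolding p_def V_def by (rule h\<Psi>[OF P open_Ball2])
  have slice: "open {\<xi>. (\<xi>, \<eta>) \<in> V}" "convex {\<xi>. (\<xi>, \<eta>) \<in> V}" for \<eta>
    using affine_line_Ball2[of "\<Psi> (0, \<eta>)" "(e1, e2)"]
    by (auto simp: V_def \<Psi>_def algebra_simps)
  define A where "A = {\<xi>. (\<xi>, 0) \<in> V}"
  have A: "open A" "connected A" "0 \<in> A" "1 \<in> A"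
    using slice[of 0] b0 b1 convex_connected by (auto simp: A_def V_def \<Psi>_def e1_def e2_def)
  have hpA: "(\<lambda>\<xi>. p (\<xi>, 0)) holomorphic_on A"
    by (rule hol2_curve[OF p V]) (use A in \<open>auto simp: A_def intro!: holomorphic_intros\<close>)
  have "p (0, 0) = 0" "p (1, 0) \<noteq> 0"
    using True b1 by (auto simp: p_def \<Psi>_def e1_def e2_def)
  then obtain r0 where r0: "0 < r0" "ball 0 r0 \<subseteq> A" "\<And>z. z \<in> ball 0 r0 - {0} \<Longrightarrow> p (z, 0) \<noteq> 0"
    using isolated_zeros[OF hpA A(1,2,3) _ A(4)] by auto
  define r where "r = r0 / 2"
  have r: "0 < r" "r < r0" using r0 by (auto simp: r_def)
  have cA: "(\<xi>, 0) \<in> V" if "\<xi> \<in> cball 0 r" for \<xi>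
    using that r r0(2) by (auto simp: A_def subset_iff)
  \<comment> \<open>The tube lemma for the closed disc keeps the polydisc inside the domain; below,
    for the circle, it keeps \<open>p\<close> nonzero.\<close>
  have "{0} \<times> cball 0 r \<subseteq> prod.swap -` V" using cA by auto
  then obtain X where X: "0 \<in> X" "open X" "X \<times> cball 0 r \<subseteq> prod.swap -` V"
    using Elementary_Topology.tube_lemma[of "cball 0 r" "prod.swap -` V" 0] V
    by (auto intro: open_vimage continuous_on_swap)
  have oV: "open {q \<in> V. p q \<noteq> 0}" by (rule open_nonzero[OF p V])
  have o2: "open (prod.swap -` {q \<in> V. p q \<noteq> 0})"
    by (rule open_vimage[OF oV continuous_on_swap])
  have "{0} \<times> sphere 0 r \<subseteq> prod.swap -` {q \<in> V. p q \<noteq> 0}"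
    using cA r r0 by auto
  from Elementary_Topology.tube_lemma[OF compact_sphere o2 this]
  obtain Y where Y: "0 \<in> Y" "open Y" "Y \<times> sphere 0 r \<subseteq> prod.swap -` {q \<in> V. p q \<noteq> 0}"
    by (elim exE conjE)
  have "open (X \<inter> Y)" "0 \<in> X \<inter> Y" using X Y by auto
  then obtain s where s: "0 < s" "ball 0 s \<subseteq> X \<inter> Y" using open_contains_ball by blast
  have cs: "(\<xi>, \<eta>) \<in> V" if "\<xi> \<in> cball 0 r" "\<eta> \<in> ball 0 s" for \<xi> \<eta>
    using subsetD[OF X(3), of "(\<eta>, \<xi>)"] that s(2) by auto
  have ps: "p (\<xi>, \<eta>) \<noteq> 0" if "cmod \<xi> = r" "cmod \<eta> < s" for \<xi> \<eta>
    using subsetD[OF Y(3), of "(\<eta>, \<xi>)"] that s(2) by auto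
  obtain G where G: "G holomorphic2_on (ball 0 r \<times> ball 0 s)"
    "\<And>z. z \<in> ball 0 r \<times> ball 0 s \<Longrightarrow> p z \<noteq> 0 \<Longrightarrow> G z = F (\<Psi> z)"
  proof (rule polydisc_extend[OF r(1) s(1) V _ p ps, of "\<lambda>q. F (\<Psi> q)" "\<Xi> ` E"])
    show "cball 0 r \<times> ball 0 s \<subseteq> V" using cs by auto
    have "\<Psi> -` {z \<in> Ball2. P z \<noteq> 0} = {z \<in> V. p z \<noteq> 0}" by (auto simp: V_def p_def)
    then show "(\<lambda>q. F (\<Psi> q)) holomorphic2_on {z \<in> V. p z \<noteq> 0}"
      using h\<Psi>[OF F open_nonzero[OF P open_Ball2]] by simp
    show "countable (\<Xi> ` E)" using E by simp
    show "connected {\<xi>. (\<xi>, \<eta>) \<in> V}" for \<eta> using slice convex_connected by blast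
    fix b assume b: "b \<in> V - \<Xi> ` E"
    then have "\<Psi> b \<in> Ball2 - E" using \<Xi>\<Psi>[of b] by (force simp: V_def)
    from bd[OF this]
    obtain W C where W: "open W" "\<Psi> b \<in> W" "\<forall>z\<in>W \<inter> Ball2. P z \<noteq> 0 \<longrightarrow> cmod (F z) \<le> C"
      by (elim exE conjE)
    have "open (\<Psi> -` W)" by (rule open_vimage[OF W(1) c\<Psi>])
    moreover have "\<forall>z\<in>\<Psi> -` W \<inter> V. p z \<noteq> 0 \<longrightarrow> cmod (F (\<Psi> z)) \<le> C"
      using W(3) by (simp add: V_def p_def)
    ultimately show "\<exists>W C. open W \<and> b \<in> W \<and> (\<forall>z\<in>W \<inter> V. p z \<noteq> 0 \<longrightarrow> cmod (F (\<Psi> z)) \<le> C)"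
      using W(2) by (intro exI[of _ "\<Psi> -` W"] exI[of _ C]) simp
  next
    fix G assume "G holomorphic2_on (ball 0 r \<times> ball 0 s)"
      "\<And>z. z \<in> ball 0 r \<times> ball 0 s \<Longrightarrow> p z \<noteq> 0 \<Longrightarrow> G z = F (\<Psi> z)"
    then show thesis by (rule that)
  qed
  define W where "W = \<Xi> -` (ball 0 r \<times> ball 0 s)"
  have oW: "open W" unfolding W_def by (intro open_vimage open_Times open_ball c\<Xi>)
  have 0: "\<Xi> b0 = (0, 0)" by (simp add: \<Xi>_def)
  show ?thesis
  proof (intro exI[of _ W] exI[of _ "\<lambda>z. G (\<Xi> z)"] conjI ballI impI)
    show "b0 \<in> W" using 0 r s by (simp add: W_def)
    show "W \<subseteq> Ball2"
    proof
      fix z assume "z \<in> W"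
      then have "\<Xi> z \<in> V" using cs[of "fst (\<Xi> z)" "snd (\<Xi> z)"] by (auto simp: W_def mem_Times_iff)
      then show "z \<in> Ball2" by (simp add: V_def \<Psi>\<Xi>)
    qed
    show "(\<lambda>z. G (\<Xi> z)) holomorphic2_on W"
      unfolding W_def by (rule h\<Xi>[OF G(1)]) (simp add: open_Times)
    show "G (\<Xi> z) = F z" if "z \<in> W" "P z \<noteq> 0" for z
      using G(2)[of "\<Xi> z"] that by (simp add: W_def p_def \<Psi>\<Xi>)
  qed (rule oW)
qed

text \<open>Riemann's theorem with boundedness required only outside a countable set. The local
  extensions agree where \<open>P\<close> is nonzero, hence on all overlaps by density, and the
  global one is read off along the diagonal \<open>H z z\<close>.\<close>

lemma hol2_extend:
  fixes P F :: scalar_fun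
  assumes P: "P holomorphic2_on Ball2" and b1: "b1 \<in> Ball2" "P b1 \<noteq> 0" and E: "countable E"
    and F: "F holomorphic2_on {z \<in> Ball2. P z \<noteq> 0}"
    and bd: "\<And>b. b \<in> Ball2 - E \<Longrightarrow>
      \<exists>W C. open W \<and> b \<in> W \<and> (\<forall>z\<in>W \<inter> Ball2. P z \<noteq> 0 \<longrightarrow> cmod (F z) \<le> C)"
  obtains G where "G holomorphic2_on Ball2" "\<And>z. z \<in> Ball2 \<Longrightarrow> P z \<noteq> 0 \<Longrightarrow> G z = F z"
proof -
  define Q where "Q = (\<lambda>b W G. open W \<and> b \<in> W \<and> W \<subseteq> Ball2 \<and> G holomorphic2_on W \<and>
    (\<forall>z\<in>W. P z \<noteq> 0 \<longrightarrow> G z = F z))"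
  have "\<forall>b\<in>Ball2. \<exists>W G. Q b W G"
    unfolding Q_def using hol2_extend_local[OF assms] by blast
  from bchoice[OF this] obtain W where "\<forall>b\<in>Ball2. \<exists>G. Q b (W b) G" by blast
  from bchoice[OF this] obtain H where "\<forall>b\<in>Ball2. Q b (W b) (H b)" by blast
  then have WH: "\<And>b. b \<in> Ball2 \<Longrightarrow> open (W b)" "\<And>b. b \<in> Ball2 \<Longrightarrow> b \<in> W b"
    "\<And>b. b \<in> Ball2 \<Longrightarrow> W b \<subseteq> Ball2" "\<And>b. b \<in> Ball2 \<Longrightarrow> H b holomorphic2_on W b"
    "\<And>b z. b \<in> Ball2 \<Longrightarrow> z \<in> W b \<Longrightarrow> P z \<noteq> 0 \<Longrightarrow> H b z = F z"
    by (simp_all add: Q_def)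
  define G where "G = (\<lambda>z. H z z)"
  have eq: "G z = H b z" if z: "b \<in> Ball2" "z \<in> W b" for b z
  proof -
    have zB: "z \<in> Ball2" using WH(3) z by blast
    note c = continuous_on_subset[OF hol2_imp_continuous_on[OF WH(4)]]
    show ?thesis unfolding G_def
    proof (rule hol2_eq_of_dense[OF P b1, of "W z \<inter> W b" "H z" "H b"])
      show "open (W z \<inter> W b)" by (rule open_Int[OF WH(1)[OF zB] WH(1)[OF z(1)]])
      show "W z \<inter> W b \<subseteq> Ball2" by (rule order_trans[OF inf_le1 WH(3)[OF zB]])
      show "continuous_on (W z \<inter> W b) (H z)" by (rule c[OF zB inf_le1])
      show "continuous_on (W z \<inter> W b) (H b)" by (rule c[OF z(1) inf_le2])
      show "z \<in> W z \<inter> W b" using WH(2)[OF zB] z(2) by (rule IntI)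
      show "H z x = H b x" if "x \<in> W z \<inter> W b" "P x \<noteq> 0" for x
        using WH(5)[OF zB, of x] WH(5)[OF z(1), of x] that by simp
    qed
  qed
  show ?thesis
  proof (rule that[of G])
    show "G holomorphic2_on Ball2"
    proof (rule hol2_locally[OF open_Ball2])
      fix b assume b: "b \<in> Ball2"
      have "G holomorphic2_on W b"
        using hol2_cong[of "W b" G "H b"] eq[OF b] WH(4)[OF b] by simp
      then show "\<exists>T. open T \<and> b \<in> T \<and> G holomorphic2_on T" using WH b by blast
    qed
    show "G z = F z" if "z \<in> Ball2" "P z \<noteq> 0" for z
      using WH that by (simp add: G_def)
  qed
qed

lemma Ball2_axis: "(0, v) \<in> Ball2 \<longleftrightarrow> Re v < 0"
  by (simp add: Ball2_iff)

text \<open>The mean value inequality in \<open>u\<close> bounds the quotient near the mirror by the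
  maximum of \<open>d_u f\<close>, so the singularity along u = 0 is removable.\<close>

lemma hol2_div_u:
  assumes f: "f holomorphic2_on Ball2" and z: "\<And>v. Re v < 0 \<Longrightarrow> f (0, v) = 0"
  obtains g where "g holomorphic2_on Ball2" "\<And>u v. (u, v) \<in> Ball2 \<Longrightarrow> f (u, v) = u * g (u, v)"
proof -
  have o: "open {z \<in> Ball2. fst z \<noteq> 0}" by (intro open_nonzero hol2_fst open_Ball2)
  have h: "(\<lambda>b. f b / fst b) holomorphic2_on {z \<in> Ball2. fst z \<noteq> 0}"
    by (intro hol2_divide hol2_fst o hol2_subset[OF f]) auto
  obtain g where g: "g holomorphic2_on Ball2" "\<And>z. z \<in> Ball2 \<Longrightarrow> fst z \<noteq> 0 \<Longrightarrow> g z = f z / fst z"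
  proof (rule hol2_extend[OF hol2_fst, of "(-1, -1)" "{}", OF _ _ _ h])
    fix b assume "b \<in> Ball2 - {}"
    then have b: "b \<in> Ball2" by simp
    show "\<exists>W C. open W \<and> b \<in> W \<and> (\<forall>z\<in>W \<inter> Ball2. fst z \<noteq> 0 \<longrightarrow> cmod (f z / fst z) \<le> C)"
    proof (cases "fst b = 0")
      case False
      obtain W C where "open W" "b \<in> W" "\<And>z. z \<in> W \<Longrightarrow> cmod (f z / fst z) \<le> C"
        by (rule hol2_locally_bounded[OF hol2_imp_continuous_on[OF h] o, of b]) (use False b in auto)
      then show ?thesis by blast
    next
      case True
      then obtain b2 where b2: "b = (0, b2)" "(0, b2) \<in> Ball2" using b by (cases b) auto
      obtain r where r: "0 < r" "cball 0 r \<times> cball b2 r \<subseteq> Ball2"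
        by (rule box_in_open[OF open_Ball2 b2(2)])
      have "compact (d_u f ` (cball 0 r \<times> cball b2 r))"
        by (intro compact_continuous_image compact_Times compact_cball
            continuous_on_subset[OF hol2_imp_continuous_on[OF hol2_d_u[OF f open_Ball2]] r(2)])
      then obtain C where C: "\<And>q. q \<in> cball 0 r \<times> cball b2 r \<Longrightarrow> cmod (d_u f q) \<le> C"
        using compact_imp_bounded bounded_iff by (metis image_eqI)
      have "cmod (f (x, y) / x) \<le> C" if "x \<in> ball 0 r" "y \<in> ball b2 r" "x \<noteq> 0" for x y
      proof -
        have sub: "(w, y) \<in> cball 0 r \<times> cball b2 r" if "w \<in> ball 0 r" for w
          using that \<open>y \<in> ball b2 r\<close> by auto
        have "cmod (f (x, y) - f (0, y)) \<le> C * cmod (x - 0)"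
        proof (rule field_differentiable_bound[OF convex_ball])
          fix w assume w: "w \<in> ball (0::complex) r"
          show "((\<lambda>x. f (x, y)) has_field_derivative d_u f (w, y)) (at w within ball 0 r)"
            using hol2_partials(1)[OF hol2_has_derivative[OF f open_Ball2 subsetD[OF r(2) sub[OF w]]]]
            by (rule has_field_derivative_at_within)
          show "cmod (d_u f (w, y)) \<le> C" using C sub[OF w] by blast
        qed (use that r in auto)
        moreover have "f (0, y) = 0" using z subsetD[OF r(2) sub[of 0]] r by (auto simp: Ball2_axis)
        ultimately show ?thesis using that by (simp add: norm_divide divide_le_eq)
      qed
      then show ?thesis using r b2
        by (intro exI[of _ "ball 0 r \<times> ball b2 r"] exI[of _ C]) (auto simp: open_Times)
    qed
  qed (auto simp: Ball2_iff)
  show ?thesis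
  proof (rule that[OF g(1)])
    fix u v assume "(u, v) \<in> Ball2"
    then show "f (u, v) = u * g (u, v)"
      using g(2)[of "(u, v)"] z[of v] by (cases "u = 0") (auto simp: Ball2_axis)
  qed
qed

section \<open>Eisenstein integers\<close>

lemma sqrt_m3_sq: "sqrt_m3 * sqrt_m3 = - 3"
  by (simp add: sqrt_m3_def complex_eq_iff)

lemma sqrt_m3_eq: "sqrt_m3 = 1 + 2 * \<rho>"
  by (simp add: \<rho>_def field_simps)

lemma rho_sq: "\<rho> * \<rho> = - 1 - \<rho>"
  using sqrt_m3_sq by (simp add: \<rho>_def field_simps)

lemma rho_cube: "\<rho> * (\<rho> * \<rho>) = 1"
  unfolding rho_sq by (simp add: algebra_simps rho_sq)

lemma rho_nz: "\<rho> \<noteq> 0"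
  using rho_cube by auto

lemma Re_Im_rho: "Re \<rho> = - 1 / 2" "Im \<rho> = sqrt 3 / 2"
  by (simp_all add: \<rho>_def sqrt_m3_def)

lemma cnj_rho: "cnj \<rho> = - 1 - \<rho>"
  by (simp add: complex_eq_iff Re_Im_rho)

lemma cnj_sqrt_m3: "cnj sqrt_m3 = - sqrt_m3"
  by (simp add: sqrt_m3_def complex_eq_iff)

lemma rho_neq_1: "\<rho> \<noteq> 1"
  using Re_Im_rho by auto

lemma sqrt_m3_nz: "sqrt_m3 \<noteq> 0"
  using sqrt_m3_sq by auto

lemma O_F_iff: "x \<in> O_F \<longleftrightarrow> (\<exists>a b. x = of_int a + of_int b * \<rho>)"
  by (auto simp: O_F_def)

lemma O_F_mult:
  assumes "x \<in> O_F" "y \<in> O_F" shows "x * y \<in> O_F"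
proof -
  obtain a b c d where x: "x = of_int a + of_int b * \<rho>" and y: "y = of_int c + of_int d * \<rho>"
    using assms by (auto simp: O_F_iff)
  have "x * y = of_int a * of_int c + (of_int a * of_int d + of_int b * of_int c) * \<rho>
      + of_int b * of_int d * (\<rho> * \<rho>)"
    by (simp add: x y algebra_simps)
  also have "\<dots> = of_int (a * c - b * d) + of_int (a * d + b * c - b * d) * \<rho>"
    unfolding rho_sq by (simp add: algebra_simps)
  finally show ?thesis unfolding O_F_iff by blast
qed

lemma O_F_add:
  assumes "x \<in> O_F" "y \<in> O_F" shows "x + y \<in> O_F"
proof -
  obtain a b c d where x: "x = of_int a + of_int b * \<rho>" and y: "y = of_int c + of_int d * \<rho>"
    using assms by (auto simp: O_F_iff)
  have "x + y = of_int (a + c) + of_int (b + d) * \<rho>" by (simp add: x y algebra_simps)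
  then show ?thesis unfolding O_F_iff by blast
qed

lemma O_F_of_int: "of_int n \<in> O_F"
  unfolding O_F_iff by (intro exI[of _ n] exI[of _ 0]) simp

lemma O_F_rho: "\<rho> \<in> O_F"
  unfolding O_F_iff by (intro exI[of _ 0] exI[of _ 1]) simp

lemma O_F_01: "0 \<in> O_F" "1 \<in> O_F" "- 1 \<in> O_F"
  using O_F_of_int[of 0] O_F_of_int[of 1] O_F_of_int[of "-1"] by simp_all

lemma O_F_uminus: "x \<in> O_F \<Longrightarrow> - x \<in> O_F"
  using O_F_mult[OF O_F_01(3), of x] by simp

lemma O_F_diff: "x \<in> O_F \<Longrightarrow> y \<in> O_F \<Longrightarrow> x - y \<in> O_F"
  using O_F_add[of x "- y"] O_F_uminus by simp

lemma O_F_numeral: "numeral n \<in> O_F"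
  using O_F_of_int[of "numeral n"] by simp

lemma O_F_sqrt_m3: "sqrt_m3 \<in> O_F"
  unfolding sqrt_m3_eq by (intro O_F_add O_F_mult O_F_01 O_F_numeral O_F_rho)

lemmas O_F_intros = O_F_add O_F_mult O_F_diff O_F_uminus O_F_01 O_F_numeral O_F_rho O_F_sqrt_m3

lemma O_F_norm:
  "(of_int a + of_int b * \<rho>) * cnj (of_int a + of_int b * \<rho>) = of_int (a * a - a * b + b * b)"
proof -
  have "(of_int a + of_int b * \<rho>) * cnj (of_int a + of_int b * \<rho>)
      = of_int a * of_int a - of_int a * of_int b - of_int b * of_int b * \<rho>
        - of_int b * of_int b * (\<rho> * \<rho>)"
    by (simp add: cnj_rho algebra_simps)
  then show ?thesis unfolding rho_sq by (simp add: algebra_simps)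
qed

text \<open>A unit has norm 1, which leaves six candidates; the congruence modulo sqrt(-3) reads a +
  b = 1 modulo 3 and selects the three cube roots of unity.\<close>

lemma O_F_unit_cube:
  assumes x: "x \<in> O_F" "y \<in> O_F" "x * y = 1" and z: "z \<in> O_F" "x = 1 + sqrt_m3 * z"
  shows "x ^ 3 = 1"
proof -
  obtain c d where z': "z = of_int c + of_int d * \<rho>" using z by (auto simp: O_F_iff)
  obtain c' d' where y': "y = of_int c' + of_int d' * \<rho>" using x by (auto simp: O_F_iff)
  \<comment> \<open>Coordinates of 1 + sqrt(-3) z in the basis 1, \<rho>, by sqrt(-3) = 1 + 2
    \<rho>.\<close>
  define a b where "a = 1 + c - 2 * d" and "b = 2 * c - d"
  have "x = 1 + of_int c + of_int d * \<rho> + 2 * of_int c * \<rho> + 2 * of_int d * (\<rho> * \<rho>)"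
    unfolding z(2) z' sqrt_m3_eq by (simp add: algebra_simps)
  then have x': "x = of_int a + of_int b * \<rho>"
    unfolding rho_sq by (simp add: a_def b_def algebra_simps)
  have "of_int ((a * a - a * b + b * b) * (c' * c' - c' * d' + d' * d')) = (x * y) * cnj (x * y)"
    using O_F_norm[of a b] O_F_norm[of c' d'] by (simp add: x' y' mult_ac)
  then have "(a * a - a * b + b * b) * (c' * c' - c' * d' + d' * d') = 1"
    using x(3) by (metis complex_cnj_one mult_1 of_int_eq_1_iff)
  moreover have "a * a - a * b + b * b \<ge> 0"
  proof -
    have "2 * (a * a - a * b + b * b) = a * a + b * b + (a - b) * (a - b)" by (simp add: algebra_simps)
    moreover have "0 \<le> a * a + b * b + (a - b) * (a - b)" by (intro add_nonneg_nonneg zero_le_square)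
    ultimately have "0 \<le> 2 * (a * a - a * b + b * b)" by (simp only:)
    then show ?thesis by (simp only: zero_le_mult_iff) simp
  qed
  ultimately have n: "a * a - a * b + b * b = 1"
    by (smt (verit) zmult_eq_1_iff)
  \<comment> \<open>From 4 (a^2 - a b + b^2) = (2 a - b)^2 + 3 b^2, and symmetrically for
    \<open>a\<close>.\<close>
  have "\<bar>b\<bar> \<le> 1"
  proof (rule ccontr)
    assume "\<not> \<bar>b\<bar> \<le> 1"
    then have "2 * 2 \<le> \<bar>b\<bar> * \<bar>b\<bar>" by (intro mult_mono) auto
    moreover have "4 = (2 * a - b) * (2 * a - b) + 3 * (b * b)" using n by (simp add: algebra_simps)
    ultimately show False using zero_le_square[of "2 * a - b"] by (simp add: abs_mult[symmetric])
  qed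
  moreover have "\<bar>a\<bar> \<le> 1"
  proof (rule ccontr)
    assume "\<not> \<bar>a\<bar> \<le> 1"
    then have "2 * 2 \<le> \<bar>a\<bar> * \<bar>a\<bar>" by (intro mult_mono) auto
    moreover have "4 = (2 * b - a) * (2 * b - a) + 3 * (a * a)" using n by (simp add: algebra_simps)
    ultimately show False using zero_le_square[of "2 * b - a"] by (simp add: abs_mult[symmetric])
  qed
  moreover have "a + b = 1 + 3 * (c - d)" by (simp add: a_def b_def)
  ultimately have "a = 1 \<and> b = 0 \<or> a = 0 \<and> b = 1 \<or> a = -1 \<and> b = -1"
    by presburger
  then have "x = 1 \<or> x = \<rho> \<or> x = \<rho> * \<rho>" unfolding x' rho_sq by auto
  moreover have "(\<rho> * \<rho>) ^ 3 = 1"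
  proof -
    have "(\<rho> * \<rho>) ^ 3 = (\<rho> * (\<rho> * \<rho>)) * (\<rho> * (\<rho> * \<rho>))" by (simp add: power3_eq_cube mult_ac)
    then show ?thesis by (simp add: rho_cube)
  qed
  ultimately show ?thesis using rho_cube by (auto simp: power3_eq_cube mult.assoc)
qed

section \<open>The Picard modular group and its factors of automorphy\<close>

lemma matrix_inv_eqI:
  fixes A B :: "'a::field^'n^'n"
  assumes "A ** B = mat 1" shows "matrix_inv A = B"
proof -
  have BA: "B ** A = mat 1" using assms matrix_left_right_inverse by blast
  have "A ** matrix_inv A = mat 1 \<and> matrix_inv A ** A = mat 1"
    unfolding matrix_inv_def by (rule someI[of _ B]) (use assms BA in auto)
  then have "matrix_inv A = matrix_inv A ** (A ** B)" using assms by simp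
  also have "\<dots> = B" using \<open>_ \<and> _\<close> by (simp add: matrix_mul_assoc)
  finally show ?thesis .
qed

lemma matrix_inv_right: "invertible A \<Longrightarrow> A ** matrix_inv A = mat 1"
  and matrix_inv_left: "invertible A \<Longrightarrow> matrix_inv A ** A = mat 1" for A :: "'a::field^'n^'n"
  using matrix_inv_eqI unfolding invertible_def by metis+

lemma mv3: "(g *v x)$i = g$i$1 * x$1 + g$i$2 * x$2 + g$i$3 * x$3" for g :: "complex^3^3"
  by (simp add: matrix_vector_mult_def sum_3)

lemma mm3: "(g ** h)$i$j = g$i$1 * h$1$j + g$i$2 * h$2$j + g$i$3 * h$3$j" for g h :: "complex^3^3"
  by (simp add: matrix_matrix_mult_def sum_3)

lemma vec3_eq_iff: "x = y \<longleftrightarrow> x$1 = y$1 \<and> x$2 = y$2 \<and> x$3 = y$3" for x y :: "'a^3"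
  by (simp add: vec_eq_iff forall_3)

section \<open>The projective action and the congruence subgroup\<close>

definition lift :: "complex \<times> complex \<Rightarrow> complex^3" where
  "lift b = vector [snd b, 1, fst b]"

lemma lift_nth [simp]: "lift b $ 1 = snd b" "lift b $ 2 = 1" "lift b $ 3 = fst b"
  by (simp_all add: lift_def)

lemma j1_lift: "j1 g b = (g *v lift b)$2"
  by (cases b) (simp add: j1_def mv3)

lemma act_lift: "j1 g b \<noteq> 0 \<Longrightarrow> g *v lift b = j1 g b *s lift (act g b)"
  by (cases b) (simp add: vec3_eq_iff j1_lift[symmetric], simp add: act_def mv3)

lemma herm_lift: "herm (lift b) (lift b) = of_real (2 * Re (snd b) + (cmod (fst b))\<^sup>2)"
  by (simp add: herm_def complex_eq_iff cmod_power2, simp add: power2_eq_square)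

lemma herm_scale: "herm (s *s z) (t *s w) = s * cnj t * herm z w"
  by (simp add: herm_def algebra_simps)

lemma Gamma_herm: "g \<in> \<Gamma> \<Longrightarrow> herm (g *v z) (g *v w) = herm z w"
  by (simp add: \<Gamma>_def)

lemma Gamma_invertible: "g \<in> \<Gamma> \<Longrightarrow> invertible g"
  by (auto simp: \<Gamma>_def GL3_O_F_def invertible_def)

lemma Gamma_det: "g \<in> \<Gamma> \<Longrightarrow> det g \<noteq> 0"
  using Gamma_invertible invertible_det_nz by blast

text \<open>\<open>lift b\<close> has negative norm and keeps it under \<Gamma>. If the second
  coordinate vanished, the norm would be the squared modulus of the third one; dividing by
  \<open>j1\<close> only scales the norm by a positive factor, so the image stays in the
  ball.\<close>

lemma Gamma_act:
  assumes "g \<in> \<Gamma>" "b \<in> Ball2"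
  shows "j1 g b \<noteq> 0" "act g b \<in> Ball2"
proof -
  have n: "herm (g *v lift b) (g *v lift b) = of_real (2 * Re (snd b) + (cmod (fst b))\<^sup>2)"
    by (simp add: Gamma_herm[OF assms(1)] herm_lift)
  have neg: "2 * Re (snd b) + (cmod (fst b))\<^sup>2 < 0" using assms(2) by (cases b) (simp add: Ball2_iff)
  show j: "j1 g b \<noteq> 0"
  proof
    assume "j1 g b = 0"
    then have "herm (g *v lift b) (g *v lift b) = of_real ((cmod ((g *v lift b)$3))\<^sup>2)"
      unfolding complex_norm_square by (simp add: herm_def j1_lift)
    then have "(cmod ((g *v lift b)$3))\<^sup>2 = 2 * Re (snd b) + (cmod (fst b))\<^sup>2"
      using n by (metis of_real_eq_iff)
    then show False using neg by (smt (verit) zero_le_power2)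
  qed
  have "of_real (2 * Re (snd b) + (cmod (fst b))\<^sup>2)
      = j1 g b * cnj (j1 g b) * of_real (2 * Re (snd (act g b)) + (cmod (fst (act g b)))\<^sup>2)"
    using n unfolding act_lift[OF j] herm_scale herm_lift by simp
  also have "\<dots> = of_real ((cmod (j1 g b))\<^sup>2 * (2 * Re (snd (act g b)) + (cmod (fst (act g b)))\<^sup>2))"
    unfolding of_real_mult complex_norm_square ..
  finally have "2 * Re (snd b) + (cmod (fst b))\<^sup>2
      = (cmod (j1 g b))\<^sup>2 * (2 * Re (snd (act g b)) + (cmod (fst (act g b)))\<^sup>2)"
    by (metis of_real_eq_iff)
  with neg have "2 * Re (snd (act g b)) + (cmod (fst (act g b)))\<^sup>2 < 0"
    by (metis mult_nonneg_nonneg not_less zero_le_power2)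
  then show "act g b \<in> Ball2" by (cases "act g b") (simp add: Ball2_iff)
qed

text \<open>Both claims compare coordinates of \<open>(g ** h) *v lift b\<close>, whose second
  coordinate is the factor of automorphy.\<close>

lemma j1_act_mult:
  assumes "h \<in> \<Gamma>" "b \<in> Ball2"
  shows "j1 (g ** h) b = j1 g (act h b) * j1 h b"
    "g \<in> \<Gamma> \<Longrightarrow> act (g ** h) b = act g (act h b)"
proof -
  have h: "h *v lift b = j1 h b *s lift (act h b)" by (rule act_lift[OF Gamma_act(1)[OF assms]])
  have gh: "(g ** h) *v lift b = j1 h b *s (g *v lift (act h b))"
    by (simp add: matrix_vector_mul_assoc[symmetric] h vec3_eq_iff mv3 algebra_simps)
  then show 1: "j1 (g ** h) b = j1 g (act h b) * j1 h b" by (simp add: j1_lift)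
  assume g: "g \<in> \<Gamma>"
  note n = Gamma_act[OF assms] Gamma_act(1)[OF g Gamma_act(2)[OF assms]]
  have "j1 (g ** h) b *s lift (act (g ** h) b) = j1 h b *s (j1 g (act h b) *s lift (act g (act h b)))"
    using gh n 1 by (simp add: act_lift)
  then have "lift (act (g ** h) b) = lift (act g (act h b))"
    using n by (simp add: 1 vec3_eq_iff)
  then show "act (g ** h) b = act g (act h b)"
    by (simp add: vec3_eq_iff prod_eq_iff)
qed

lemma j1_one: "j1 (mat 1) b = 1" and act_one: "act (mat 1) b = b"
  by (cases b; simp add: j1_def act_def mat_def)+

lemma Gamma_mult: "g \<in> \<Gamma> \<Longrightarrow> h \<in> \<Gamma> \<Longrightarrow> g ** h \<in> \<Gamma>"
proof -
  assume g: "g \<in> \<Gamma>" and h: "h \<in> \<Gamma>"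
  obtain g' where g': "\<And>i j. g'$i$j \<in> O_F" "g ** g' = mat 1" "g' ** g = mat 1"
    using g by (auto simp: \<Gamma>_def GL3_O_F_def)
  obtain h' where h': "\<And>i j. h'$i$j \<in> O_F" "h ** h' = mat 1" "h' ** h = mat 1"
    using h by (auto simp: \<Gamma>_def GL3_O_F_def)
  have e: "g$i$j \<in> O_F" "h$i$j \<in> O_F" for i j using g h by (auto simp: \<Gamma>_def GL3_O_F_def)
  have "g ** h ** (h' ** g') = g ** (h ** h') ** g'" by (simp add: matrix_mul_assoc)
  then have 1: "g ** h ** (h' ** g') = mat 1" by (simp add: h' g')
  then have 2: "(h' ** g') ** (g ** h) = mat 1" using matrix_left_right_inverse by blast
  have "\<forall>i j. (g ** h)$i$j \<in> O_F" "\<forall>i j. (h' ** g')$i$j \<in> O_F"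
    unfolding mm3 using e g' h' by (auto intro!: O_F_intros)
  with 1 2 have "g ** h \<in> GL3_O_F" unfolding GL3_O_F_def by blast
  moreover have "herm ((g ** h) *v z) ((g ** h) *v w) = herm z w" for z w
    by (simp add: matrix_vector_mul_assoc[symmetric] Gamma_herm g h)
  ultimately show ?thesis by (simp add: \<Gamma>_def)
qed

lemma Gamma_inv:
  assumes "g \<in> \<Gamma>"
  shows "matrix_inv g \<in> \<Gamma>" "g ** matrix_inv g = mat 1" "matrix_inv g ** g = mat 1"
proof -
  show 1: "g ** matrix_inv g = mat 1" "matrix_inv g ** g = mat 1"
    using assms by (simp_all add: Gamma_invertible matrix_inv_right matrix_inv_left)
  obtain g' where g': "\<And>i j. g'$i$j \<in> O_F" "g ** g' = mat 1"
    using assms by (auto simp: \<Gamma>_def GL3_O_F_def)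
  have "matrix_inv g = g'" by (rule matrix_inv_eqI[OF g'(2)])
  then have "matrix_inv g \<in> GL3_O_F"
    using assms g' 1 unfolding GL3_O_F_def \<Gamma>_def by blast
  moreover have "herm (matrix_inv g *v z) (matrix_inv g *v w) = herm z w" for z w
    using Gamma_herm[OF assms, of "matrix_inv g *v z" "matrix_inv g *v w"]
    by (simp add: matrix_vector_mul_assoc 1)
  ultimately show "matrix_inv g \<in> \<Gamma>" by (simp add: \<Gamma>_def)
qed

lemma Gamma_entry: "g \<in> \<Gamma> \<Longrightarrow> g$i$j \<in> O_F"
  by (simp add: \<Gamma>_def GL3_O_F_def)

lemma Gamma_cong_Gamma: "g \<in> \<Gamma>_cong \<Longrightarrow> g \<in> \<Gamma>"
  by (simp add: \<Gamma>_cong_def)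

lemma Gamma_cong_iff: "g \<in> \<Gamma>_cong \<longleftrightarrow> g \<in> \<Gamma> \<and>
    (\<exists>X. (\<forall>i j. X$i$j \<in> O_F) \<and> (\<forall>i j. g$i$j = mat 1$i$j + sqrt_m3 * X$i$j))"
proof
  assume "g \<in> \<Gamma>_cong"
  then have g: "g \<in> \<Gamma>" "\<forall>i j. \<exists>x. x \<in> O_F \<and> g$i$j - mat 1$i$j = sqrt_m3 * x"
    by (auto simp: \<Gamma>_cong_def)
  then obtain f where f: "\<And>i j. f i j \<in> O_F \<and> g$i$j - mat 1$i$j = sqrt_m3 * f i j" by metis
  have "\<exists>X. (\<forall>i j. X$i$j \<in> O_F) \<and> (\<forall>i j. g$i$j = mat 1$i$j + sqrt_m3 * X$i$j)"
    by (rule exI[of _ "\<chi> i j. f i j"]) (use f in \<open>auto simp: algebra_simps\<close>)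
  with g show "g \<in> \<Gamma> \<and> (\<exists>X. (\<forall>i j. X$i$j \<in> O_F) \<and> (\<forall>i j. g$i$j = mat 1$i$j + sqrt_m3 * X$i$j))"
    by blast
next
  assume "g \<in> \<Gamma> \<and> (\<exists>X. (\<forall>i j. X$i$j \<in> O_F) \<and> (\<forall>i j. g$i$j = mat 1$i$j + sqrt_m3 * X$i$j))"
  then show "g \<in> \<Gamma>_cong" by (auto simp: \<Gamma>_cong_def)
qed

text \<open>Normality of the congruence subgroup, on which it rests that slashing with any element
  of \<Gamma> preserves the spaces of forms.\<close>

lemma Gamma_cong_conj:
  assumes "g \<in> \<Gamma>" "h \<in> \<Gamma>_cong"
  shows "g ** h ** matrix_inv g \<in> \<Gamma>_cong"
proof -
  obtain X where X: "\<And>i j. X$i$j \<in> O_F" "\<And>i j. h$i$j = mat 1$i$j + sqrt_m3 * X$i$j"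
    using assms(2) by (auto simp: Gamma_cong_iff)
  define Y where "Y = g ** X ** matrix_inv g"
  have eX: "(g ** X ** matrix_inv g)$i$j \<in> O_F" for i j
    unfolding mm3 using X(1) Gamma_entry[OF assms(1)] Gamma_entry[OF Gamma_inv(1)[OF assms(1)]]
    by (intro O_F_add O_F_mult)
  have "(g ** h ** matrix_inv g)$i$j = (g ** matrix_inv g)$i$j + sqrt_m3 * Y$i$j" for i j
    unfolding Y_def mm3 X(2) by (simp add: mat_def algebra_simps)
  then have "(g ** h ** matrix_inv g)$i$j = mat 1$i$j + sqrt_m3 * Y$i$j" for i j
    by (simp add: Gamma_inv(2)[OF assms(1)])
  moreover have "g ** h ** matrix_inv g \<in> \<Gamma>"
    using assms by (intro Gamma_mult Gamma_inv) (auto intro: Gamma_cong_Gamma)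
  ultimately show ?thesis using eX unfolding Gamma_cong_iff Y_def by blast
qed

text \<open>The determinant is a unit congruent to 1 modulo sqrt(-3). Cubing therefore removes every
  power of it from a transformation law.\<close>

lemma Gamma_cong_det:
  assumes "g \<in> \<Gamma>_cong" shows "det g ^ 3 = 1"
proof -
  obtain X where X: "\<And>i j. X$i$j \<in> O_F" "\<And>i j. g$i$j = mat 1$i$j + sqrt_m3 * X$i$j"
    using assms by (auto simp: Gamma_cong_iff)
  have g: "g \<in> \<Gamma>" using assms by (rule Gamma_cong_Gamma)
  have dO: "det h \<in> O_F" if "h \<in> \<Gamma>" for h
    unfolding det_3 using Gamma_entry[OF that] by (intro O_F_add O_F_mult O_F_diff)
  define s where "s = sqrt_m3"
  \<comment> \<open>Expansion of det (1 + s X) in powers of s: trace, principal 2 x 2 minors,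
    determinant.\<close>
  have d: "det g = 1 + s * (X$1$1 + X$2$2 + X$3$3 + s * (X$1$1 * X$2$2 + X$1$1 * X$3$3 + X$2$2 * X$3$3
      - X$1$2 * X$2$1 - X$1$3 * X$3$1 - X$2$3 * X$3$2) + s * s * det X)"
    unfolding det_3 X(2) s_def[symmetric] by (simp add: mat_def algebra_simps)
  show ?thesis
  proof (rule O_F_unit_cube)
    show "det g \<in> O_F" "det (matrix_inv g) \<in> O_F" using g dO Gamma_inv by auto
    show "det g * det (matrix_inv g) = 1"
      by (metis det_I det_mul Gamma_inv(2)[OF g])
    show "det g = 1 + sqrt_m3 * (X$1$1 + X$2$2 + X$3$3 + s * (X$1$1 * X$2$2 + X$1$1 * X$3$3 + X$2$2 * X$3$3
      - X$1$2 * X$2$1 - X$1$3 * X$3$1 - X$2$3 * X$3$2) + s * s * det X)"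
      using d by (simp add: s_def)
    show "(X$1$1 + X$2$2 + X$3$3 + s * (X$1$1 * X$2$2 + X$1$1 * X$3$3 + X$2$2 * X$3$3
      - X$1$2 * X$2$1 - X$1$3 * X$3$1 - X$2$3 * X$3$2) + s * s * det X) \<in> O_F"
      unfolding det_3 s_def using X(1) by (intro O_F_intros)
  qed
qed

section \<open>The factor of automorphy \<open>j2\<close> and the derivative of the action\<close>

lemma lo_hi: "lo 1 = 2" "lo 2 = 1" "lo 3 = 1" "hi 1 = 3" "hi 2 = 3" "hi 3 = 2"
  by (simp_all add: lo_def hi_def)

lemma j2_nth:
  "j2 g b $ 1 $ 1 = (minor g 3 2 * fst b + minor g 3 3) / det g"
  "j2 g b $ 1 $ 2 = (minor g 3 2 * snd b + minor g 3 1) / det g"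
  "j2 g b $ 2 $ 1 = (minor g 1 2 * fst b + minor g 1 3) / det g"
  "j2 g b $ 2 $ 2 = (minor g 1 2 * snd b + minor g 1 1) / det g"
  by (cases b; simp add: j2_def field_simps)+

lemma minor_eqs:
  "minor g 1 1 = g$2$2 * g$3$3 - g$2$3 * g$3$2"
  "minor g 1 2 = g$2$1 * g$3$3 - g$2$3 * g$3$1"
  "minor g 1 3 = g$2$1 * g$3$2 - g$2$2 * g$3$1"
  "minor g 3 1 = g$1$2 * g$2$3 - g$1$3 * g$2$2"
  "minor g 3 2 = g$1$1 * g$2$3 - g$1$3 * g$2$1"
  "minor g 3 3 = g$1$1 * g$2$2 - g$1$2 * g$2$1"
  by (simp_all add: minor_def lo_hi)

lemma j2_det_aux:
  "(minor g 3 2 * u + minor g 3 3) * (minor g 1 2 * v + minor g 1 1)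
    - (minor g 3 2 * v + minor g 3 1) * (minor g 1 2 * u + minor g 1 3) = j1 g (u, v) * det g"
  unfolding minor_eqs det_3 by (simp add: j1_def) algebra

text \<open>A determinant of two vectors transformed by \<open>j2\<close> picks up j1 / det g; the
  powers of det g in the transformation laws of \<open>J\<close> and \<open>NN\<close> come from
  here.\<close>

lemma det_j2:
  assumes "det g \<noteq> 0" shows "det (j2 g b) = j1 g b / det g"
proof -
  have "det (j2 g b) = ((minor g 3 2 * fst b + minor g 3 3) * (minor g 1 2 * snd b + minor g 1 1)
    - (minor g 3 2 * snd b + minor g 3 1) * (minor g 1 2 * fst b + minor g 1 3)) / (det g * det g)"
    by (simp add: det_2 j2_nth diff_divide_distrib)
  then show ?thesis using assms by (simp add: j2_det_aux)
qed

lemma hol2_j1: "j1 g holomorphic2_on S"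
proof -
  have "(\<lambda>b. g$2$1 * snd b + g$2$2 + g$2$3 * fst b) holomorphic2_on S"
    by (intro hol2_intros)
  moreover have "j1 g = (\<lambda>b. g$2$1 * snd b + g$2$2 + g$2$3 * fst b)"
    by (auto simp: j1_def)
  ultimately show ?thesis by simp
qed

lemma act_eqs:
  "fst (act g b) = (g$3$1 * snd b + g$3$2 + g$3$3 * fst b) / j1 g b"
  "snd (act g b) = (g$1$1 * snd b + g$1$2 + g$1$3 * fst b) / j1 g b"
  by (cases b; simp add: act_def)+

lemma hol2_act:
  assumes "g \<in> \<Gamma>"
  shows "(\<lambda>b. fst (act g b)) holomorphic2_on Ball2" "(\<lambda>b. snd (act g b)) holomorphic2_on Ball2"
  unfolding act_eqs
  by (intro hol2_divide hol2_intros hol2_j1 open_Ball2 Gamma_act[OF assms]; simp)+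

lemma hol2_compose_act:
  assumes "g \<in> \<Gamma>" "f holomorphic2_on Ball2"
  shows "(\<lambda>b. f (act g b)) holomorphic2_on Ball2"
  using hol2_compose[OF assms(2) open_Ball2 hol2_act[OF assms(1)] open_Ball2]
  by (simp add: Gamma_act[OF assms(1)])

text \<open>Coordinates of the derivative of \<open>act g\<close> are minors divided by \<open>j1\<^sup>2\<close>.\<close>

lemma act_deriv_aux:
  fixes g :: "complex^3^3"
  assumes "j1 g (u, v) \<noteq> 0"
  shows "((\<lambda>z. fst (act g (z, v))) has_field_derivative
      (minor g 1 2 * v + minor g 1 1) / (j1 g (u, v))^2) (at u)"
    "((\<lambda>z. snd (act g (z, v))) has_field_derivative
      - (minor g 3 2 * v + minor g 3 1) / (j1 g (u, v))^2) (at u)"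
    "((\<lambda>z. fst (act g (u, z))) has_field_derivative
      - (minor g 1 2 * u + minor g 1 3) / (j1 g (u, v))^2) (at v)"
    "((\<lambda>z. snd (act g (u, z))) has_field_derivative
      (minor g 3 2 * u + minor g 3 3) / (j1 g (u, v))^2) (at v)"
  using assms unfolding act_eqs minor_eqs
  by (auto intro!: derivative_eq_intros simp: j1_def power2_eq_square divide_simps; algebra)+

definition sym2 :: "complex^2^2 \<Rightarrow> (nat \<Rightarrow> complex) \<Rightarrow> nat \<Rightarrow> complex" where
  "sym2 A y = (\<lambda>i. if i = 0 then A$1$1 * A$1$1 * y 0 + 2 * A$1$1 * A$1$2 * y 1 + A$1$2 * A$1$2 * y 2
    else if i = 1 then A$1$1 * A$2$1 * y 0 + (A$1$1 * A$2$2 + A$1$2 * A$2$1) * y 1 + A$1$2 * A$2$2 * y 2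
    else if i = 2 then A$2$1 * A$2$1 * y 0 + 2 * A$2$1 * A$2$2 * y 1 + A$2$2 * A$2$2 * y 2
    else 0)"

lemma sym_app_2: "sym_app 2 (sym_mat 2 A) y = sym2 A y"
proof
  fix i :: nat
  have "i = 0 \<or> i = 1 \<or> i = 2 \<or> i > 2" by auto
  then show "sym_app 2 (sym_mat 2 A) y i = sym2 A y i"
    by (elim disjE)
      (simp_all add: sym_app_def sym_mat_def sym2_def numeral_2_eq_2 coeff_pCons algebra_simps
        split: nat.splits)
qed

lemma sym2_mult: "sym2 (A ** B) y = sym2 A (sym2 B y)"
proof -
  have "(A ** B)$i$j = A$i$1 * B$1$j + A$i$2 * B$2$j" for i j
    by (simp add: matrix_matrix_mult_def sum_2)
  then show ?thesis
    by (simp add: sym2_def fun_eq_iff algebra_simps)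
qed

lemma sym2_one: "(\<And>i. i > 2 \<Longrightarrow> y i = 0) \<Longrightarrow> sym2 (mat 1) y = y"
  by (auto simp: sym2_def fun_eq_iff mat_def)

lemma sym_vec_2: "sym_vec 2 x = (\<lambda>i. if i = 0 then x$1 * x$1 else if i = 1 then x$1 * x$2
    else if i = 2 then x$2 * x$2 else 0)"
  by (auto simp: sym_vec_def fun_eq_iff power2_eq_square numeral_2_eq_2 le_Suc_eq)

text \<open>The chain rule, which also yields the cocycle property of \<open>j2\<close>.\<close>

lemma nabla_act:
  assumes g: "g \<in> \<Gamma>" and f: "f holomorphic2_on Ball2" and b: "b \<in> Ball2"
  shows "j1 g b *s (j2 g b *v nabla (\<lambda>b. f (act g b)) b) = nabla f (act g b)"
proof -
  obtain u v where uv: "b = (u, v)" by (cases b)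
  define j where "j = j1 g (u, v)"
  have j: "j \<noteq> 0" using Gamma_act(1)[OF g b] by (simp add: j_def uv)
  note dg = act_deriv_aux[OF j[unfolded j_def]]
  define p q where "p = d_u f (act g b)" and "q = d_v f (act g b)"
  have fd: "(f has_derivative (\<lambda>(x, y). p * x + q * y)) (at (fst (act g b), snd (act g b)))"
    using hol2_has_derivative[OF f open_Ball2 Gamma_act(2)[OF g b]] by (simp add: p_def q_def)
  define a11 a12 a21 a22 where "a11 = minor g 3 2 * u + minor g 3 3" and "a12 = minor g 3 2 * v + minor g 3 1"
    and "a21 = minor g 1 2 * u + minor g 1 3" and "a22 = minor g 1 2 * v + minor g 1 1"
  have det: "a11 * a22 - a12 * a21 = j * det g"
    unfolding a11_def a12_def a21_def a22_def j_def by (rule j2_det_aux)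
  have "((\<lambda>z. f (fst (act g (z, v)), snd (act g (z, v)))) has_field_derivative
      p * (a22 / j^2) + q * (- a12 / j^2)) (at u)"
    by (rule hol2_curve_deriv[where g = "\<lambda>z. fst (act g (z, v))" and h = "\<lambda>z. snd (act g (z, v))"])
      (use fd dg(1,2) in \<open>simp_all add: uv a22_def a12_def j_def\<close>)
  then have 1: "d_u (\<lambda>b. f (act g b)) b = (p * a22 - q * a12) / j^2"
    by (simp add: d_u_def uv DERIV_imp_deriv diff_divide_distrib)
  have "((\<lambda>z. f (fst (act g (u, z)), snd (act g (u, z)))) has_field_derivative
      p * (- a21 / j^2) + q * (a11 / j^2)) (at v)"
    by (rule hol2_curve_deriv[where g = "\<lambda>z. fst (act g (u, z))" and h = "\<lambda>z. snd (act g (u, z))"])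
      (use fd dg(3,4) in \<open>simp_all add: uv a21_def a11_def j_def\<close>)
  then have 2: "d_v (\<lambda>b. f (act g b)) b = (q * a11 - p * a21) / j^2"
    by (simp add: d_v_def uv DERIV_imp_deriv diff_divide_distrib)
  have dg: "det g \<noteq> 0" by (rule Gamma_det[OF g])
  have e1: "j * (a11 / det g * ((p * a22 - q * a12) / j^2) + a12 / det g * ((q * a11 - p * a21) / j^2)) = p"
  proof -
    have "j * (a11 / det g * ((p * a22 - q * a12) / j^2) + a12 / det g * ((q * a11 - p * a21) / j^2))
        = p * (a11 * a22 - a12 * a21) / (j * det g)"
      using j dg by (simp add: field_simps power2_eq_square)
    then show ?thesis using j dg by (simp add: det)
  qed
  have e2: "j * (a21 / det g * ((p * a22 - q * a12) / j^2) + a22 / det g * ((q * a11 - p * a21) / j^2)) = q"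
  proof -
    have "j * (a21 / det g * ((p * a22 - q * a12) / j^2) + a22 / det g * ((q * a11 - p * a21) / j^2))
        = q * (a11 * a22 - a12 * a21) / (j * det g)"
      using j dg by (simp add: field_simps power2_eq_square)
    then show ?thesis using j dg by (simp add: det)
  qed
  have n: "nabla (\<lambda>b. f (act g b)) b $ 1 = (p * a22 - q * a12) / j^2"
    "nabla (\<lambda>b. f (act g b)) b $ 2 = (q * a11 - p * a21) / j^2"
    by (simp_all add: nabla_def 1 2)
  have m: "j2 g b $ 1 $ 1 = a11 / det g" "j2 g b $ 1 $ 2 = a12 / det g"
    "j2 g b $ 2 $ 1 = a21 / det g" "j2 g b $ 2 $ 2 = a22 / det g"
    by (simp_all add: j2_nth uv a11_def a12_def a21_def a22_def)
  have r: "nabla f (act g b) $ 1 = p" "nabla f (act g b) $ 2 = q"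
    by (simp_all add: nabla_def p_def q_def)
  show ?thesis
    unfolding vec_eq_iff forall_2
    by (simp add: matrix_vector_mult_def sum_2 n m r e1 e2 j_def[symmetric] uv[symmetric])
      (use e1 e2 in \<open>simp add: j_def uv\<close>)
qed

lemma nabla_cong:
  assumes "open S" "b \<in> S" "\<And>z. z \<in> S \<Longrightarrow> f z = h z"
  shows "nabla f b = nabla h b"
proof -
  obtain u v where uv: "b = (u, v)" by (cases b)
  have o: "open ((\<lambda>z. (z, v)) -` S)" "open ((\<lambda>z. (u, z)) -` S)"
    by (intro open_vimage assms continuous_intros)+
  have "deriv (\<lambda>z. f (z, v)) u = deriv (\<lambda>z. h (z, v)) u"
    by (intro deriv_cong_ev refl eventually_nhds_in_open[OF o(1), THEN eventually_mono])
      (use assms uv in auto)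
  moreover have "deriv (\<lambda>z. f (u, z)) v = deriv (\<lambda>z. h (u, z)) v"
    by (intro deriv_cong_ev refl eventually_nhds_in_open[OF o(2), THEN eventually_mono])
      (use assms uv in auto)
  ultimately show ?thesis by (simp add: nabla_def d_u_def d_v_def uv)
qed

text \<open>Both sides satisfy the chain rule \<open>nabla_act\<close> for the coordinate functions
  of \<open>act (g ** h)\<close>. The gradients of these functions are linearly independent, so the
  matrices agree.\<close>

lemma j2_mult:
  assumes g: "g \<in> \<Gamma>" and h: "h \<in> \<Gamma>" and b: "b \<in> Ball2"
  shows "j2 (g ** h) b = j2 g (act h b) ** j2 h b"
proof -
  have gh: "g ** h \<in> \<Gamma>" by (rule Gamma_mult[OF g h])
  note hb = Gamma_act(2)[OF h b]
  define A where "A = j2 (g ** h) b"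
  define B where "B = j2 g (act h b) ** j2 h b"
  define c where "c = j1 (g ** h) b"
  have c: "c \<noteq> 0" using Gamma_act(1)[OF gh b] by (simp add: c_def)
  have e: "A *v w = B *v w" "c *s (A *v w) = nabla f (act (g ** h) b)"
    if f: "f holomorphic2_on Ball2" and w: "w = nabla (\<lambda>b. f (act (g ** h) b)) b" for f w
  proof -
    have 1: "c *s (A *v w) = nabla f (act (g ** h) b)"
      unfolding A_def c_def w by (rule nabla_act[OF gh f b])
    then show "c *s (A *v w) = nabla f (act (g ** h) b)" .
    have w': "w = nabla (\<lambda>b. f (act g (act h b))) b"
      unfolding w by (rule nabla_cong[OF open_Ball2 b]) (simp add: j1_act_mult[OF h] g)
    have 2: "j1 h b *s (j2 h b *v w) = nabla (\<lambda>b. f (act g b)) (act h b)"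
      unfolding w' by (rule nabla_act[OF h hol2_compose_act[OF g f] b])
    have 3: "j1 g (act h b) *s (j2 g (act h b) *v nabla (\<lambda>b. f (act g b)) (act h b)) = nabla f (act g (act h b))"
      by (rule nabla_act[OF g f hb])
    have "c *s (B *v w) = nabla f (act (g ** h) b)"
      using 3 unfolding 2[symmetric] j1_act_mult[OF h b] c_def B_def
      by (simp add: j1_act_mult(2)[OF h b g] matrix_vector_mul_assoc[symmetric] vec.scale mult.commute)
    with 1 have "c *s (A *v w) = c *s (B *v w)" by simp
    then show "A *v w = B *v w" using c by (simp add: vec_eq_iff)
  qed
  have n: "nabla fst z = vector [1, 0]" "nabla snd z = vector [0, 1]" for z
    by (cases z; simp add: nabla_def d_u_def d_v_def)+
  define w1 where "w1 = nabla (\<lambda>b. fst (act (g ** h) b)) b"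
  define w2 where "w2 = nabla (\<lambda>b. snd (act (g ** h) b)) b"
  \<comment> \<open>The columns are the two gradients. Multiplication by \<open>c\<close> times
    \<open>A\<close> sends them to the unit vectors, so \<open>W\<close> is invertible and can be
    cancelled.\<close>
  define W :: "complex^2^2" where "W = (\<chi> i j. if j = 1 then w1$i else w2$i)"
  have k: "A *v w1 = B *v w1" "c *s (A *v w1) = vector [1, 0]"
    "A *v w2 = B *v w2" "c *s (A *v w2) = vector [0, 1]"
    using e[OF hol2_fst w1_def] e[OF hol2_snd w2_def] by (simp_all add: n)
  have col: "(X ** W)$i$j = (if j = 1 then (X *v w1)$i else (X *v w2)$i)" for X :: "complex^2^2" and i j
    by (auto simp: W_def matrix_matrix_mult_def matrix_vector_mult_def)
  have AB: "A ** W = B ** W" using k by (simp add: vec_eq_iff col)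
  have "(c *s (A *v w1))$i = c * (A *v w1)$i" "(c *s (A *v w2))$i = c * (A *v w2)$i" for i by simp_all
  then have k': "c * (A *v w1)$1 = 1" "c * (A *v w1)$2 = 0" "c * (A *v w2)$1 = 0" "c * (A *v w2)$2 = 1"
    using k(2,4) by (metis vector_2)+
  have d: "det (A ** W) * (c * c) = 1"
  proof -
    have "det (A ** W) = (A *v w1)$1 * (A *v w2)$2 - (A *v w2)$1 * (A *v w1)$2"
      by (simp add: det_2 col)
    then have "det (A ** W) * (c * c) = ((A *v w1)$1 * (A *v w2)$2 - (A *v w2)$1 * (A *v w1)$2) * (c * c)"
      by simp
    then have "det (A ** W) * (c * c) = (c * (A *v w1)$1) * (c * (A *v w2)$2) - (c * (A *v w2)$1) * (c * (A *v w1)$2)"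
      by (simp only: algebra_simps)
    then show ?thesis by (simp add: k')
  qed
  then have "det W \<noteq> 0" by (auto simp: det_mul)
  then have "W ** matrix_inv W = mat 1" by (simp add: invertible_det_nz matrix_inv_right)
  then have "A = A ** (W ** matrix_inv W)" "B = B ** (W ** matrix_inv W)" by simp_all
  then have "A = B" by (metis AB matrix_mul_assoc)
  then show ?thesis by (simp add: A_def B_def)
qed

lemma j2_one: "j2 (mat 1) b = mat 1"
  unfolding vec_eq_iff forall_2 j2_nth minor_eqs by (simp add: mat_def det_I[unfolded mat_def])

lemma j2_inv:
  assumes "g \<in> \<Gamma>" "b \<in> Ball2"
  shows "matrix_inv (j2 g b) = j2 (matrix_inv g) (act g b)"
proof (rule matrix_inv_eqI)
  have "j2 (matrix_inv g) (act g b) ** j2 g b = mat 1"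
    using j2_mult[OF Gamma_inv(1)[OF assms(1)] assms] by (simp add: Gamma_inv[OF assms(1)] j2_one)
  then show "j2 g b ** j2 (matrix_inv g) (act g b) = mat 1" using matrix_left_right_inverse by blast
qed

lemma hol2_j2:
  "(\<lambda>b. j2 g b $ i $ k) holomorphic2_on S"
proof -
  have "i = 1 \<or> i = 2" "k = 1 \<or> k = 2" using exhaust_2 by auto
  then show ?thesis
    by (elim disjE; simp add: j2_nth divide_inverse; intro hol2_intros)
qed

section \<open>Slash operators in weights \<open>(0,k)\<close> and \<open>(2,k)\<close>\<close>

lemma holo_forms_2:
  assumes "f \<in> holo_forms 2"
  shows "(\<lambda>b. f b i) holomorphic2_on Ball2" "i > 2 \<Longrightarrow> f b i = 0" "b \<notin> Ball2 \<Longrightarrow> f b = 0"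
  using assms unfolding holo_forms_def by blast+

lemma sym2_linear:
  "sym2 A (\<lambda>i. c * y i) i = c * sym2 A y i"
  "sym2 A (\<lambda>i. y i + z i) i = sym2 A y i + sym2 A z i"
  by (simp_all add: sym2_def algebra_simps)

lemma slash_2:
  assumes "b \<in> Ball2" "g \<in> \<Gamma>"
  shows "slash 2 k f g b = (\<lambda>i. j1 g b powi (-k) * sym2 (j2 (matrix_inv g) (act g b)) (f (act g b)) i)"
  using assms by (simp add: slash_def sym_app_2 j2_inv)

lemma hol2_sym2:
  assumes "open S" "\<And>i. (\<lambda>b. f b i) holomorphic2_on S" "\<And>i k. (\<lambda>b. A b $ i $ k) holomorphic2_on S"
  shows "(\<lambda>b. sym2 (A b) (f b) i) holomorphic2_on S"
proof -
  have "i = 0 \<or> i = 1 \<or> i = 2 \<or> i > 2" by auto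
  then show ?thesis
    by (elim disjE; simp add: sym2_def; intro hol2_intros assms)
qed

lemma hol2_powi:
  assumes "f holomorphic2_on S" "open S" "\<And>b. b \<in> S \<Longrightarrow> f b \<noteq> 0"
  shows "(\<lambda>b. f b powi k) holomorphic2_on S"
  by (cases "0 \<le> k"; simp add: power_int_def; intro hol2_power hol2_inverse assms)

lemma slash_holo_forms:
  assumes g: "g \<in> \<Gamma>" and f: "f \<in> holo_forms 2"
  shows "slash 2 k f g \<in> holo_forms 2"
proof -
  have "(\<lambda>b. slash 2 k f g b i) holomorphic2_on Ball2" for i
  proof -
    have "(\<lambda>b. j1 g b powi (-k) * sym2 (j2 (matrix_inv g) (act g b)) (f (act g b)) i) holomorphic2_on Ball2"
      by (intro hol2_mult hol2_powi hol2_j1 open_Ball2 Gamma_act(1)[OF g] hol2_sym2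
          hol2_compose_act[OF g] holo_forms_2(1)[OF f] hol2_j2)
    then show ?thesis
      using hol2_cong[of Ball2 "\<lambda>b. slash 2 k f g b i"] by (simp add: slash_2[OF _ g])
  qed
  moreover have "slash 2 k f g b i = 0" if "i > 2" for b i
    using that by (cases "b \<in> Ball2") (auto simp: slash_2[OF _ g] sym2_def, simp add: slash_def)
  moreover have "slash 2 k f g b = 0" if "b \<notin> Ball2" for b
    using that by (simp add: slash_def)
  ultimately show ?thesis by (auto simp: holo_forms_def)
qed

text \<open>The slash operator contains the inverse of \<open>j2\<close>. The equivalent functional
  equation involves \<open>j2\<close> itself, and it is in this form that transformation laws are
  verified below.\<close>

lemma slash_2_eq_iff:
  assumes g: "g \<in> \<Gamma>" and f: "f \<in> holo_forms 2" and h: "h \<in> holo_forms 2"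
  shows "slash 2 k f g = h \<longleftrightarrow> (\<forall>b\<in>Ball2. \<forall>i. f (act g b) i = j1 g b powi k * sym2 (j2 g b) (h b) i)"
proof -
  have inv: "sym2 (j2 (matrix_inv g) (act g b)) (sym2 (j2 g b) y) = y"
    "sym2 (j2 g b) (sym2 (j2 (matrix_inv g) (act g b)) y) = y"
    if "b \<in> Ball2" "\<And>i. i > 2 \<Longrightarrow> y i = 0" for b y
  proof -
    have "j2 (matrix_inv g) (act g b) ** j2 g b = mat 1"
      using j2_mult[OF Gamma_inv(1)[OF g] g that(1)] by (simp add: Gamma_inv[OF g] j2_one)
    moreover from this have "j2 g b ** j2 (matrix_inv g) (act g b) = mat 1"
      using matrix_left_right_inverse by blast
    ultimately show "sym2 (j2 (matrix_inv g) (act g b)) (sym2 (j2 g b) y) = y"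
      "sym2 (j2 g b) (sym2 (j2 (matrix_inv g) (act g b)) y) = y"
      by (simp_all add: sym2_mult[symmetric] sym2_one that(2))
  qed
  have jk: "j1 g b powi k * j1 g b powi (-k) = 1" if "b \<in> Ball2" for b
    using Gamma_act(1)[OF g that] by (simp add: power_int_minus)
  show ?thesis
  proof
    assume e: "slash 2 k f g = h"
    show "\<forall>b\<in>Ball2. \<forall>i. f (act g b) i = j1 g b powi k * sym2 (j2 g b) (h b) i"
    proof (intro ballI allI)
      fix b i assume b: "b \<in> Ball2"
      have "j1 g b powi k * sym2 (j2 g b) (h b) i
        = j1 g b powi k * (j1 g b powi (-k) * sym2 (j2 g b) (sym2 (j2 (matrix_inv g) (act g b)) (f (act g b))) i)"
        unfolding e[symmetric] slash_2[OF b g] sym2_linear(1) ..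
      also have "\<dots> = f (act g b) i"
        using jk[OF b] by (simp add: inv(2)[OF b] holo_forms_2[OF f] mult.assoc[symmetric])
      finally show "f (act g b) i = j1 g b powi k * sym2 (j2 g b) (h b) i" ..
    qed
  next
    assume e: "\<forall>b\<in>Ball2. \<forall>i. f (act g b) i = j1 g b powi k * sym2 (j2 g b) (h b) i"
    show "slash 2 k f g = h"
    proof
      fix b show "slash 2 k f g b = h b"
      proof (cases "b \<in> Ball2")
        case True
        then have fe: "f (act g b) = (\<lambda>i. j1 g b powi k * sym2 (j2 g b) (h b) i)" using e by auto
        have "slash 2 k f g b i = h b i" for i
        proof -
          have iv: "sym2 (j2 (matrix_inv g) (act g b)) (sym2 (j2 g b) (h b)) = h b"
            by (rule inv(1)[OF True]) (rule holo_forms_2(2)[OF h])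
          show ?thesis
            unfolding slash_2[OF True g] fe sym2_linear(1) iv
            using Gamma_act(1)[OF g True] by (simp add: power_int_minus)
        qed
        then show ?thesis by auto
      next
        case False
        then show ?thesis by (simp add: holo_forms_2(3)[OF h] slash_def)
      qed
    qed
  qed
qed

lemma slash_slash:
  assumes g: "g \<in> \<Gamma>" and h: "h \<in> \<Gamma>" and f: "f \<in> holo_forms 2"
  shows "slash 2 k (slash 2 k f g) h = slash 2 k f (g ** h)"
proof -
  define F where "F = slash 2 k f g"
  define G where "G = slash 2 k F h"
  have F: "F \<in> holo_forms 2" unfolding F_def by (rule slash_holo_forms[OF g f])
  have G: "G \<in> holo_forms 2" unfolding G_def by (rule slash_holo_forms[OF h F])
  have 1: "\<forall>b\<in>Ball2. \<forall>i. f (act g b) i = j1 g b powi k * sym2 (j2 g b) (F b) i"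
    using slash_2_eq_iff[OF g f F, where k = k] F_def by simp
  have 2: "\<forall>b\<in>Ball2. \<forall>i. F (act h b) i = j1 h b powi k * sym2 (j2 h b) (G b) i"
    using slash_2_eq_iff[OF h F G, where k = k] G_def by simp
  have "\<forall>b\<in>Ball2. \<forall>i. f (act (g ** h) b) i = j1 (g ** h) b powi k * sym2 (j2 (g ** h) b) (G b) i"
  proof (intro ballI allI)
    fix b i assume b: "b \<in> Ball2"
    have Fe: "F (act h b) = (\<lambda>i. j1 h b powi k * sym2 (j2 h b) (G b) i)" using 2 b by auto
    show "f (act (g ** h) b) i = j1 (g ** h) b powi k * sym2 (j2 (g ** h) b) (G b) i"
      unfolding j1_act_mult[OF h b] j1_act_mult(2)[OF h b g] j2_mult[OF g h b] sym2_mult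
      using 1 Gamma_act(2)[OF h b]
      by (simp add: Fe sym2_linear(1) power_int_mult_distrib)
  qed
  then have "slash 2 k f (g ** h) = G"
    using slash_2_eq_iff[OF Gamma_mult[OF g h] f G, where k = k] by simp
  then show ?thesis by (simp add: G_def F_def)
qed

lemma MF_2_iff: "f \<in> MF 2 k 0 \<longleftrightarrow> f \<in> holo_forms 2 \<and> (\<forall>g\<in>\<Gamma>_cong. slash 2 k f g = f)"
  by (simp add: MF_def vscale_def)

lemma MF_2_act:
  assumes "f \<in> MF 2 k 0" "g \<in> \<Gamma>_cong" "b \<in> Ball2"
  shows "f (act g b) i = j1 g b powi k * sym2 (j2 g b) (f b) i"
proof -
  have f: "f \<in> holo_forms 2" "slash 2 k f g = f" using assms unfolding MF_2_iff by blast+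
  show ?thesis
    using slash_2_eq_iff[OF Gamma_cong_Gamma[OF assms(2)] f(1) f(1), where k = k] f(2) assms(3)
    by blast
qed

text \<open>For h in the congruence subgroup, g h = (g h g^-1) g, and g h g^-1 lies in the
  congruence subgroup again.\<close>

lemma slash_MF:
  assumes g: "g \<in> \<Gamma>" and f: "f \<in> MF 2 k 0"
  shows "slash 2 k f g \<in> MF 2 k 0"
proof -
  have fh: "f \<in> holo_forms 2" and fs: "\<And>h. h \<in> \<Gamma>_cong \<Longrightarrow> slash 2 k f h = f"
    using f unfolding MF_2_iff by blast+
  have "slash 2 k (slash 2 k f g) h = slash 2 k f g" if h: "h \<in> \<Gamma>_cong" for h
  proof -
    define c where "c = g ** h ** matrix_inv g"
    have c: "c \<in> \<Gamma>_cong" unfolding c_def by (rule Gamma_cong_conj[OF g h])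
    have "c ** g = g ** h ** (matrix_inv g ** g)" by (simp add: c_def matrix_mul_assoc)
    then have cg: "c ** g = g ** h" by (simp add: Gamma_inv[OF g])
    have "slash 2 k (slash 2 k f g) h = slash 2 k f (c ** g)"
      by (simp add: slash_slash[OF g Gamma_cong_Gamma[OF h] fh] cg)
    also have "\<dots> = slash 2 k (slash 2 k f c) g"
      by (simp add: slash_slash[OF Gamma_cong_Gamma[OF c] g fh])
    also have "\<dots> = slash 2 k f g" by (simp add: fs[OF c])
    finally show ?thesis .
  qed
  then show ?thesis using slash_holo_forms[OF g fh] by (simp add: MF_2_iff)
qed

section \<open>The scalar-valued case\<close>

lemma sym_app_0: "sym_app 0 (sym_mat 0 A) y = (\<lambda>i. if i = 0 then y 0 else 0)"
  by (auto simp: sym_app_def sym_mat_def)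

lemma slash_0: "b \<in> Ball2 \<Longrightarrow> slash 0 k (as_vector f) g b = (\<lambda>i. if i = 0 then j1 g b powi (-k) * f (act g b) else 0)"
  by (auto simp: slash_def sym_app_0 as_vector_def)

lemma slash_0_eq_iff:
  assumes g: "g \<in> \<Gamma>" and h: "\<And>b. b \<notin> Ball2 \<Longrightarrow> h b = 0"
  shows "slash 0 k (as_vector f) g = as_vector h \<longleftrightarrow> (\<forall>b\<in>Ball2. f (act g b) = j1 g b powi k * h b)"
proof -
  have inv: "j1 g b powi (-k) * (j1 g b powi k * x) = x" "j1 g b powi k * (j1 g b powi (-k) * x) = x"
    if "b \<in> Ball2" for b x
    using Gamma_act(1)[OF g that] by (simp_all add: power_int_minus)
  show ?thesis
  proof
    assume e: "slash 0 k (as_vector f) g = as_vector h"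
    show "\<forall>b\<in>Ball2. f (act g b) = j1 g b powi k * h b"
    proof
      fix b assume b: "b \<in> Ball2"
      have "slash 0 k (as_vector f) g b 0 = as_vector h b 0" using e by simp
      then have "j1 g b powi (-k) * f (act g b) = h b" by (simp add: slash_0[OF b]) (simp add: as_vector_def)
      then show "f (act g b) = j1 g b powi k * h b" using inv(2)[OF b] by metis
    qed
  next
    assume e: "\<forall>b\<in>Ball2. f (act g b) = j1 g b powi k * h b"
    show "slash 0 k (as_vector f) g = as_vector h"
    proof
      fix b show "slash 0 k (as_vector f) g b = as_vector h b"
      proof (cases "b \<in> Ball2")
        case True
        have "j1 g b powi (-k) * f (act g b) = h b" using bspec[OF e True] inv(1)[OF True] by metis
        then have "slash 0 k (as_vector f) g b i = as_vector h b i" for i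
          unfolding slash_0[OF True] by (simp add: as_vector_def)
        then show ?thesis by (rule ext)
      next
        case False
        then show ?thesis using h[OF False] by (simp add: slash_def as_vector_def fun_eq_iff)
      qed
    qed
  qed
qed

lemma scalar_MF_iff: "f \<in> scalar_MF k \<longleftrightarrow> (\<forall>b. b \<notin> Ball2 \<longrightarrow> f b = 0) \<and> f holomorphic2_on Ball2 \<and>
    (\<forall>g\<in>\<Gamma>_cong. \<forall>b\<in>Ball2. f (act g b) = j1 g b powi k * f b)"
proof -
  have 1: "as_vector f b = 0 \<longleftrightarrow> f b = 0" for b
    by (auto simp: as_vector_def fun_eq_iff)
  have 2: "(\<forall>i. (\<lambda>b. as_vector f b i) holomorphic2_on Ball2) \<longleftrightarrow> f holomorphic2_on Ball2"
  proof
    assume "\<forall>i. (\<lambda>b. as_vector f b i) holomorphic2_on Ball2"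
    from spec[OF this, of 0] show "f holomorphic2_on Ball2" by (simp add: as_vector_def)
  next
    assume f: "f holomorphic2_on Ball2"
    show "\<forall>i. (\<lambda>b. as_vector f b i) holomorphic2_on Ball2"
    proof
      fix i show "(\<lambda>b. as_vector f b i) holomorphic2_on Ball2"
        by (cases "i = 0") (simp_all add: as_vector_def f)
    qed
  qed
  have 3: "as_vector f \<in> holo_forms 0 \<longleftrightarrow> (\<forall>b. b \<notin> Ball2 \<longrightarrow> f b = 0) \<and> f holomorphic2_on Ball2"
    unfolding holo_forms_def mem_Collect_eq 1 2 by (simp add: as_vector_def)
  have "slash 0 k (as_vector f) g = as_vector f \<longleftrightarrow> (\<forall>b\<in>Ball2. f (act g b) = j1 g b powi k * f b)"
    if "g \<in> \<Gamma>_cong" "\<forall>b. b \<notin> Ball2 \<longrightarrow> f b = 0" for g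
    using slash_0_eq_iff[OF Gamma_cong_Gamma[OF that(1)], of f k f] that(2) by blast
  then show ?thesis
    unfolding scalar_MF_def MF_def mem_Collect_eq 3 by (simp add: vscale_def, blast)
qed

section \<open>Explicit elements of the group\<close>

lemma O_F_cnj: assumes "x \<in> O_F" shows "cnj x \<in> O_F"
proof -
  obtain a b where "x = of_int a + of_int b * \<rho>" using assms by (auto simp: O_F_iff)
  then have "cnj x = of_int a + of_int b * (- 1 - \<rho>)" by (simp add: cnj_rho)
  then show ?thesis using O_F_of_int by (auto intro!: O_F_intros)
qed

definition mat3 :: "complex \<Rightarrow> complex \<Rightarrow> complex \<Rightarrow> complex \<Rightarrow> complex \<Rightarrow> complex \<Rightarrow> complex \<Rightarrow> complex \<Rightarrow> complex \<Rightarrow> complex^3^3" where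
  "mat3 a b c d e f g h i = vector [vector [a, b, c], vector [d, e, f], vector [g, h, i]]"

lemma mat3_nth [simp]:
  "mat3 a b c d e f g h i $ 1 $ 1 = a" "mat3 a b c d e f g h i $ 1 $ 2 = b" "mat3 a b c d e f g h i $ 1 $ 3 = c"
  "mat3 a b c d e f g h i $ 2 $ 1 = d" "mat3 a b c d e f g h i $ 2 $ 2 = e" "mat3 a b c d e f g h i $ 2 $ 3 = f"
  "mat3 a b c d e f g h i $ 3 $ 1 = g" "mat3 a b c d e f g h i $ 3 $ 2 = h" "mat3 a b c d e f g h i $ 3 $ 3 = i"
  by (simp_all add: mat3_def)

lemma GammaI:
  assumes "\<forall>i j. g$i$j \<in> O_F" "\<forall>i j. g'$i$j \<in> O_F" "g ** g' = mat 1"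
    "\<And>z w. herm (g *v z) (g *v w) = herm z w"
  shows "g \<in> \<Gamma>"
  using assms matrix_left_right_inverse[of g g'] unfolding \<Gamma>_def GL3_O_F_def by blast

lemma det_mat3: "det (mat3 a b c d e f g h i) =
    a * e * i + b * f * g + c * d * h - a * f * h - b * d * i - c * e * g"
  by (simp add: det_3)

text \<open>The unipotent elements fixing the cusp (1:0:0), a Heisenberg group; \<open>herm\<close>
  is preserved precisely under the condition b + cnj b = - a cnj a of
  \<open>transl_Gamma\<close>.\<close>

definition transl :: "complex \<Rightarrow> complex \<Rightarrow> complex^3^3" where
  "transl a b = mat3 1 b (- cnj a) 0 1 0 0 a 1"

lemma transl_Gamma:
  assumes "a \<in> O_F" "b \<in> O_F" "b + cnj b = - (a * cnj a)"
  shows "transl a b \<in> \<Gamma>"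
proof (rule GammaI[of _ "transl (- a) (cnj b)"])
  show "\<forall>i j. transl a b $ i $ j \<in> O_F" "\<forall>i j. transl (- a) (cnj b) $ i $ j \<in> O_F"
    unfolding forall_3 transl_def using assms by (auto intro!: O_F_intros O_F_cnj)
  have "cnj b + b + cnj a * a = 0" "b + cnj b + a * cnj a = 0"
    using assms(3) by (simp_all add: algebra_simps eq_neg_iff_add_eq_0)
  then show "transl a b ** transl (- a) (cnj b) = mat 1"
    unfolding vec_eq_iff forall_3 mm3 transl_def by (simp add: mat_def)
  fix z w
  have c: "cnj b = - b - a * cnj a" using assms(3) by (simp add: algebra_simps eq_neg_iff_add_eq_0)
  show "herm (transl a b *v z) (transl a b *v w) = herm z w"
    by (simp add: herm_def mv3 transl_def c algebra_simps)
qed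

lemma transl_eqs:
  "det (transl a b) = 1" "j1 (transl a b) (u, v) = 1"
  "act (transl a b) (u, v) = (u + a, v + b - cnj a * u)"
  by (simp_all add: transl_def det_mat3 j1_def act_def algebra_simps)

lemma j2_transl:
  "j2 (transl a b) z $ 1 $ 1 = 1" "j2 (transl a b) z $ 1 $ 2 = cnj a"
  "j2 (transl a b) z $ 2 $ 1 = 0" "j2 (transl a b) z $ 2 $ 2 = 1"
  by (simp_all add: j2_nth minor_eqs transl_eqs) (simp_all add: transl_def)

lemma Gamma_congI:
  assumes "g \<in> \<Gamma>" "\<forall>i j. X$i$j \<in> O_F" "\<forall>i j. g$i$j = mat 1$i$j + sqrt_m3 * X$i$j"
  shows "g \<in> \<Gamma>_cong"
  using assms unfolding Gamma_cong_iff by blast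

lemma transl_Gamma_cong:
  assumes "a \<in> O_F" "b \<in> O_F" "sqrt_m3 * b + cnj (sqrt_m3 * b) = - (3 * (a * cnj a))"
  shows "transl (sqrt_m3 * a) (sqrt_m3 * b) \<in> \<Gamma>_cong"
proof (rule Gamma_congI)
  have "sqrt_m3 * a * cnj (sqrt_m3 * a) = - (sqrt_m3 * sqrt_m3) * (a * cnj a)"
    by (simp add: cnj_sqrt_m3)
  then have e: "sqrt_m3 * a * cnj (sqrt_m3 * a) = 3 * (a * cnj a)" by (simp add: sqrt_m3_sq)
  show "transl (sqrt_m3 * a) (sqrt_m3 * b) \<in> \<Gamma>"
    by (rule transl_Gamma) (use assms e in \<open>auto intro!: O_F_intros\<close>)
  show "\<forall>i j. mat3 0 b (cnj a) 0 0 0 0 a 0 $ i $ j \<in> O_F"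
    unfolding forall_3 using assms by (auto intro!: O_F_intros O_F_cnj)
  show "\<forall>i j. transl (sqrt_m3 * a) (sqrt_m3 * b) $ i $ j = mat 1$i$j + sqrt_m3 * mat3 0 b (cnj a) 0 0 0 0 a 0 $ i $ j"
    unfolding forall_3 transl_def by (simp add: mat_def cnj_sqrt_m3)
qed

text \<open>\<open>rotm\<close> is the complex reflection of order three with mirror u = 0; it lies
  in the congruence subgroup and has determinant \<rho>. \<open>reflm\<close> acts by u -> -u, and
  \<open>swapm\<close> exchanges the cusps (1:0:0) and (0:1:0).\<close>

definition rotm :: "complex^3^3" where "rotm = mat3 1 0 0 0 1 0 0 0 \<rho>"
definition reflm :: "complex^3^3" where "reflm = mat3 (-1) 0 0 0 (-1) 0 0 0 1"
definition swapm :: "complex^3^3" where "swapm = mat3 0 1 0 1 0 0 0 0 (-1)"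

lemma rho_cnj_rho: "\<rho> * cnj \<rho> = 1"
  by (simp add: cnj_rho algebra_simps rho_sq)

lemma rho_minus_1: "sqrt_m3 * (1 + \<rho>) = \<rho> - 1"
proof -
  have "(1 + 2 * \<rho>) * (1 + \<rho>) = 1 + 3 * \<rho> + 2 * (\<rho> * \<rho>)" by (simp add: algebra_simps)
  then show ?thesis unfolding sqrt_m3_eq rho_sq by simp
qed

lemma rotm_Gamma_cong: "rotm \<in> \<Gamma>_cong"
proof (rule Gamma_congI)
  show "rotm \<in> \<Gamma>"
  proof (rule GammaI[of _ "mat3 1 0 0 0 1 0 0 0 (cnj \<rho>)"])
    show "\<forall>i j. rotm $ i $ j \<in> O_F" "\<forall>i j. mat3 1 0 0 0 1 0 0 0 (cnj \<rho>) $ i $ j \<in> O_F"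
      unfolding forall_3 rotm_def by (auto intro!: O_F_intros O_F_cnj)
    show "rotm ** mat3 1 0 0 0 1 0 0 0 (cnj \<rho>) = mat 1"
      unfolding vec_eq_iff forall_3 mm3 rotm_def by (simp add: mat_def rho_cnj_rho)
    fix z w :: "complex^3"
    have "\<rho> * z$3 * (cnj \<rho> * cnj (w$3)) = (\<rho> * cnj \<rho>) * (z$3 * cnj (w$3))" by simp
    then show "herm (rotm *v z) (rotm *v w) = herm z w"
      by (simp add: herm_def mv3 rotm_def rho_cnj_rho)
  qed
  show "\<forall>i j. mat3 0 0 0 0 0 0 0 0 (1 + \<rho>) $ i $ j \<in> O_F"
    unfolding forall_3 by (auto intro!: O_F_intros)
  show "\<forall>i j. rotm $ i $ j = mat 1$i$j + sqrt_m3 * mat3 0 0 0 0 0 0 0 0 (1 + \<rho>) $ i $ j"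
    unfolding forall_3 rotm_def by (simp add: mat_def rho_minus_1)
qed

lemma rotm_eqs: "det rotm = \<rho>" "j1 rotm (u, v) = 1" "act rotm (u, v) = (\<rho> * u, v)"
  by (simp_all add: rotm_def det_mat3 j1_def act_def)

lemma j2_rotm:
  "j2 rotm z $ 1 $ 1 = \<rho> * \<rho>" "j2 rotm z $ 1 $ 2 = 0" "j2 rotm z $ 2 $ 1 = 0" "j2 rotm z $ 2 $ 2 = 1"
  using rho_nz rho_cube by (simp_all add: j2_nth minor_eqs rotm_eqs field_simps)
    (simp_all add: rotm_def)

lemma reflm_Gamma: "reflm \<in> \<Gamma>"
  by (rule GammaI[of _ reflm])
    (auto simp: forall_3 reflm_def vec_eq_iff mm3 mat_def herm_def mv3 intro!: O_F_intros)

lemma swapm_Gamma: "swapm \<in> \<Gamma>"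
  by (rule GammaI[of _ swapm])
    (auto simp: forall_3 swapm_def vec_eq_iff mm3 mat_def herm_def mv3 intro!: O_F_intros)

lemma reflm_eqs: "det reflm = 1" "j1 reflm (u, v) = -1" "act reflm (u, v) = (- u, v)"
  by (simp_all add: reflm_def det_mat3 j1_def act_def)

lemma swapm_det: "det swapm = 1"
  by (simp add: swapm_def det_mat3)

section \<open>Fourier-Jacobi expansions and Koecher's principle\<close>

lemma MF_2_transl:
  assumes f: "f \<in> MF 2 k 0" and uv: "(u, v) \<in> Ball2"
    and g: "transl a b \<in> \<Gamma>_cong"
  shows "(u + a, v + b - cnj a * u) \<in> Ball2"
    "f (u + a, v + b - cnj a * u) 2 = f (u, v) 2"
    "f (u + a, v + b - cnj a * u) 1 = f (u, v) 1 + cnj a * f (u, v) 2"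
    "f (u + a, v + b - cnj a * u) 0 = f (u, v) 0 + 2 * cnj a * f (u, v) 1 + cnj a * cnj a * f (u, v) 2"
  using MF_2_act[OF f g uv] Gamma_act(2)[OF Gamma_cong_Gamma[OF g] uv]
  by (simp_all add: transl_eqs sym2_def j2_transl)

lemma MF_2_rot:
  assumes f: "f \<in> MF 2 k 0" and uv: "(u, v) \<in> Ball2"
  shows "(\<rho> * u, v) \<in> Ball2" "f (\<rho> * u, v) 2 = f (u, v) 2"
    "f (\<rho> * u, v) 1 = \<rho> * \<rho> * f (u, v) 1" "f (\<rho> * u, v) 0 = \<rho> * f (u, v) 0"
  using MF_2_act[OF f rotm_Gamma_cong uv] Gamma_act(2)[OF Gamma_cong_Gamma[OF rotm_Gamma_cong] uv]
    rho_cube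
  by (simp_all add: rotm_eqs sym2_def j2_rotm mult.assoc)

lemma transl_period: "transl 0 (sqrt_m3 * of_int n) \<in> \<Gamma>_cong"
  using transl_Gamma_cong[of 0 "of_int n"] by (simp add: O_F_01 O_F_of_int cnj_sqrt_m3)

lemma MF_2_period:
  assumes "f \<in> MF 2 k 0" "(u, v) \<in> Ball2"
  shows "f (u, v + sqrt_m3 * of_int n) = f (u, v)"
proof
  fix i :: nat
  have "i = 0 \<or> i = 1 \<or> i = 2 \<or> i > 2" by auto
  moreover have "f \<in> holo_forms 2" using assms by (simp add: MF_2_iff)
  ultimately show "f (u, v + sqrt_m3 * of_int n) i = f (u, v) i"
    using MF_2_transl[OF assms transl_period, of n] holo_forms_2(2)[of f i] by auto
qed

text \<open>The entry (\<rho> - 1) |\<alpha>|^2 has the prescribed real part and is divisible by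
  sqrt(-3), because \<rho> - 1 = sqrt(-3) (1 + \<rho>). So every element of sqrt(-3) O_F occurs as a
  translation of u.\<close>

lemma transl_lattice:
  assumes "\<alpha> \<in> O_F"
  shows "transl (sqrt_m3 * \<alpha>) ((\<rho> - 1) * (\<alpha> * cnj \<alpha>)) \<in> \<Gamma>_cong"
proof -
  have "(\<rho> - 1) + cnj (\<rho> - 1) = - 3" by (simp add: cnj_rho)
  then have 2: "(\<rho> - 1) * (\<alpha> * cnj \<alpha>) + cnj ((\<rho> - 1) * (\<alpha> * cnj \<alpha>)) = - (3 * (\<alpha> * cnj \<alpha>))"
    by (simp add: cnj_rho algebra_simps)
  have 3: "sqrt_m3 * ((1 + \<rho>) * (\<alpha> * cnj \<alpha>)) = (\<rho> - 1) * (\<alpha> * cnj \<alpha>)"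
    unfolding rho_minus_1[symmetric] by (simp add: mult.assoc)
  show ?thesis
    using transl_Gamma_cong[of \<alpha> "(1 + \<rho>) * (\<alpha> * cnj \<alpha>)"] 2 assms
    unfolding 3 by (simp add: O_F_intros O_F_cnj)
qed

lemma O_F_dense:
  obtains \<alpha> where "\<alpha> \<in> O_F" "cmod (w - \<alpha>) \<le> 2"
proof -
  define n where "n = \<lfloor>2 * Im w / sqrt 3\<rfloor>"
  define m where "m = \<lfloor>Re w + of_int n / 2\<rfloor>"
  define \<alpha> where "\<alpha> = of_int m + of_int n * \<rho>"
  have "\<bar>2 * Im w / sqrt 3 - of_int n\<bar> \<le> 1" unfolding n_def by linarith
  then have "\<bar>Im w - of_int n * (sqrt 3 / 2)\<bar> \<le> sqrt 3 / 2"
  proof -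
    have "\<bar>Im w - of_int n * (sqrt 3 / 2)\<bar> = \<bar>2 * Im w / sqrt 3 - of_int n\<bar> * (sqrt 3 / 2)"
      by (simp add: abs_mult[of _ "sqrt 3 / 2", simplified, symmetric] field_simps)
    also have "\<dots> \<le> 1 * (sqrt 3 / 2)" by (intro mult_right_mono) (use \<open>_ \<le> 1\<close> in auto)
    finally show ?thesis by simp
  qed
  moreover have "sqrt 3 / 2 \<le> (1::real)" using real_sqrt_le_mono[of 3 4] by simp
  ultimately have "\<bar>Im (w - \<alpha>)\<bar> \<le> 1" by (simp add: \<alpha>_def Re_Im_rho)
  moreover have "\<bar>Re w + of_int n / 2 - of_int m\<bar> \<le> 1" unfolding m_def by linarith
  then have "\<bar>Re (w - \<alpha>)\<bar> \<le> 1" by (simp add: \<alpha>_def Re_Im_rho algebra_simps)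
  ultimately have "cmod (w - \<alpha>) \<le> 2" using cmod_le[of "w - \<alpha>"] by linarith
  then show ?thesis using that[of \<alpha>] by (auto simp: \<alpha>_def O_F_iff)
qed

text \<open>Translations by sqrt(-3) O_F bring every point into the disc of radius 4, so
  \<open>h\<close> is bounded and Liouville's theorem applies.\<close>

lemma lattice_periodic_constant:
  assumes h: "h holomorphic_on UNIV" and p: "\<And>\<alpha> u. \<alpha> \<in> O_F \<Longrightarrow> h (u + sqrt_m3 * \<alpha>) = h u"
  obtains c where "\<And>u. h u = c"
proof -
  have "h u \<in> h ` cball 0 4" for u
  proof -
    obtain \<alpha> where \<alpha>: "\<alpha> \<in> O_F" "cmod (u / sqrt_m3 - \<alpha>) \<le> 2" by (rule O_F_dense)
    have "h (u + sqrt_m3 * (- \<alpha>)) = h u" by (rule p) (use \<alpha> O_F_uminus in auto)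
    moreover have "u + sqrt_m3 * (- \<alpha>) = sqrt_m3 * (u / sqrt_m3 - \<alpha>)"
      using sqrt_m3_nz by (simp add: algebra_simps)
    moreover have "cmod (sqrt_m3 * (u / sqrt_m3 - \<alpha>)) \<le> 2 * 2"
      unfolding norm_mult using \<alpha>(2) real_sqrt_le_mono[of 3 4]
      by (intro mult_mono) (auto simp: sqrt_m3_def norm_mult)
    ultimately show ?thesis by (intro image_eqI[of _ _ "u + sqrt_m3 * (- \<alpha>)"]) auto
  qed
  then have "range h \<subseteq> h ` cball 0 4" by blast
  moreover have "bounded (h ` cball 0 4)"
    by (intro compact_imp_bounded compact_continuous_image compact_cball
        holomorphic_on_imp_continuous_on holomorphic_on_subset[OF h]) auto
  ultimately have "bounded (range h)" by (rule bounded_subset[rotated])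
  from Liouville_theorem[OF h this] show ?thesis using that by (auto simp: constant_on_def)
qed

text \<open>The estimate behind Koecher's principle. On the hypersurface 2 Re v + |u|^2 = -1
  translations reduce to a compact set, and they act on the values through unipotent matrices of
  size at most (1 + |a|)^2, whence polynomial growth. For fixed \<open>v\<close> the maximum
  principle in \<open>u\<close> carries the bound into the region.\<close>

lemma MF_2_growth:
  assumes f: "f \<in> MF 2 k 0"
  obtains C where "C \<ge> 0" "\<And>u v i. 2 * Re v + (cmod u)\<^sup>2 \<le> - 1 \<Longrightarrow>
    cmod (f (u, v) i) \<le> C * (5 + sqrt (- 2 * Re v))\<^sup>2"
proof -
  have fh: "f \<in> holo_forms 2" using f by (simp add: MF_2_iff)
  \<comment> \<open>The bound 4 is what translations of \<open>u\<close> achieve, and 2 exceeds the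
    period sqrt(3) of Im v.\<close>
  define K where "K = {p::complex \<times> complex. cmod (fst p) \<le> 4 \<and> 2 * Re (snd p) + (cmod (fst p))\<^sup>2 = -1 \<and>
    0 \<le> Im (snd p) \<and> Im (snd p) \<le> 2}"
  have cl: "closed K" unfolding K_def
    by (intro closed_Collect_conj closed_Collect_le closed_Collect_eq continuous_intros)
  have "K \<subseteq> cball 0 4 \<times> cball 0 11"
  proof
    fix p assume p: "p \<in> K"
    have "(cmod (fst p))\<^sup>2 \<le> 4\<^sup>2" using p by (intro power_mono) (auto simp: K_def)
    then have a: "(cmod (fst p))\<^sup>2 \<le> 16" by simp
    have "2 * Re (snd p) + (cmod (fst p))\<^sup>2 = -1" using p by (simp add: K_def)
    then have "\<bar>Re (snd p)\<bar> \<le> 9" using a zero_le_power2[of "cmod (fst p)"] by linarith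
    moreover have "\<bar>Im (snd p)\<bar> \<le> 2" using p by (auto simp: K_def)
    ultimately have "cmod (snd p) \<le> 11" using cmod_le[of "snd p"] by linarith
    then show "p \<in> cball 0 4 \<times> cball 0 11" using p by (auto simp: K_def mem_Times_iff)
  qed
  then have bK: "bounded K" by (rule bounded_subset[OF bounded_Times[OF bounded_cball bounded_cball]])
  have K: "compact K" using cl bK by (simp add: compact_eq_bounded_closed)
  have KB: "K \<subseteq> Ball2" by (auto simp: K_def Ball2_iff)
  have "\<exists>C. \<forall>p\<in>K. cmod (f p i) \<le> C" for i
  proof -
    have "compact ((\<lambda>p. f p i) ` K)"
      by (intro compact_continuous_image K continuous_on_subset[OF hol2_imp_continuous_on KB]
          holo_forms_2(1)[OF fh])
    then show ?thesis using compact_imp_bounded bounded_iff by (metis image_eqI)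
  qed
  then obtain C where C: "\<And>p i. p \<in> K \<Longrightarrow> cmod (f p i) \<le> C i" by metis
  define M where "M = \<bar>C 0\<bar> + \<bar>C 1\<bar> + \<bar>C 2\<bar>"
  have M: "M \<ge> 0" "cmod (f p i) \<le> M" if "p \<in> K" "i = 0 \<or> i = 1 \<or> i = 2" for p i
    using C[OF that(1), of i] that(2) by (auto simp: M_def)
  have M0: "M \<ge> 0" by (auto simp: M_def)
  have bdry: "cmod (f (u, v) i) \<le> M * (5 + cmod u)\<^sup>2" if h: "2 * Re v + (cmod u)\<^sup>2 = - 1" for u v i
  proof -
    obtain \<alpha> where \<alpha>: "\<alpha> \<in> O_F" "cmod (u / sqrt_m3 - \<alpha>) \<le> 2" by (rule O_F_dense)
    define a b where "a = sqrt_m3 * \<alpha>" and "b = (\<rho> - 1) * (\<alpha> * cnj \<alpha>)"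
    have T: "transl a b \<in> \<Gamma>_cong" unfolding a_def b_def by (rule transl_lattice[OF \<alpha>(1)])
    have s4: "cmod sqrt_m3 \<le> 2" using real_sqrt_le_mono[of 3 4] by (simp add: sqrt_m3_def norm_mult)
    have ba: "b + cnj b = - (a * cnj a)"
    proof -
      have "a * cnj a = - (sqrt_m3 * sqrt_m3) * (\<alpha> * cnj \<alpha>)" by (simp add: a_def cnj_sqrt_m3)
      then have "a * cnj a = 3 * (\<alpha> * cnj \<alpha>)" by (simp add: sqrt_m3_sq)
      then show ?thesis by (simp add: b_def cnj_rho algebra_simps)
    qed
    define u0 where "u0 = u - a"
    define v1 where "v1 = v - b + cnj a * u0"
    define n where "n = \<lfloor>Im v1 / sqrt 3\<rfloor>"
    define v0 where "v0 = v1 + sqrt_m3 * of_int (- n)"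
    have "u0 = sqrt_m3 * (u / sqrt_m3 - \<alpha>)" using sqrt_m3_nz by (simp add: u0_def a_def algebra_simps)
    then have "cmod u0 = cmod sqrt_m3 * cmod (u / sqrt_m3 - \<alpha>)" by (simp only: norm_mult)
    also have "\<dots> \<le> 2 * 2" using \<alpha>(2) s4 by (intro mult_mono) auto
    finally have u0: "cmod u0 \<le> 2 * 2" .
    have hv1: "2 * Re v1 + (cmod u0)\<^sup>2 = -1"
    proof -
      have "of_real (2 * Re v1 + (cmod u0)\<^sup>2) = v1 + cnj v1 + u0 * cnj u0"
        by (simp only: complex_norm_square of_real_add complex_add_cnj)
      also have "\<dots> = v + cnj v - (b + cnj b) + (cnj a * u0 + a * cnj u0 + u0 * cnj u0)"
        by (simp add: v1_def algebra_simps)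
      also have "\<dots> = v + cnj v + (u0 + a) * cnj (u0 + a)" by (simp add: ba algebra_simps)
      also have "\<dots> = of_real (2 * Re v + (cmod u)\<^sup>2)"
        by (simp only: complex_norm_square of_real_add complex_add_cnj u0_def diff_add_cancel)
      finally show ?thesis using h by (metis of_real_eq_iff)
    qed
    have im: "0 \<le> Im v1 - n * sqrt 3" "Im v1 - n * sqrt 3 \<le> sqrt 3"
    proof -
      have "of_int n \<le> Im v1 / sqrt 3" "Im v1 / sqrt 3 \<le> of_int n + 1" unfolding n_def by linarith+
      then show "0 \<le> Im v1 - n * sqrt 3" "Im v1 - n * sqrt 3 \<le> sqrt 3" by (simp_all add: field_simps)
    qed
    have s2: "sqrt 3 \<le> (2::real)" using real_sqrt_le_mono[of 3 4] by simp
    have K0: "(u0, v0) \<in> K" using u0 hv1 im s2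
      by (simp add: K_def v0_def sqrt_m3_def mult.commute)
    have B1: "(u0, v1) \<in> Ball2" using hv1 by (simp add: Ball2_iff)
    have f0: "f (u0, v0) = f (u0, v1)" unfolding v0_def by (rule MF_2_period[OF f B1])
    have uv: "(u0 + a, v1 + b - cnj a * u0) = (u, v)" by (simp add: u0_def v1_def)
    note t = MF_2_transl[OF f B1 T, unfolded uv, folded f0]
    define A where "A = cmod a"
    have A: "A \<ge> 0" by (simp add: A_def)
    have "A \<le> cmod u + cmod u0" unfolding A_def using norm_triangle_ineq4[of u u0] by (simp add: u0_def)
    then have Au: "1 + A \<le> 5 + cmod u" using u0 by simp
    have A2: "(1 + A)\<^sup>2 \<le> (5 + cmod u)\<^sup>2" using Au A by (intro power_mono) auto
    note m = M(2)[OF K0]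
    have "cmod (f (u, v) i) \<le> M * (1 + A)\<^sup>2"
    proof -
      have i: "i = 0 \<or> i = 1 \<or> i = 2 \<or> i > 2" by auto
      have e: "M * (1 + A)\<^sup>2 = M + 2 * (A * M) + A * (A * M)" by (simp add: power2_eq_square algebra_simps)
      have p: "0 \<le> A * M" "0 \<le> A * (A * M)" using A M0 by auto
      have "cmod (f (u, v) 2) \<le> M + 2 * (A * M) + A * (A * M)" using t(2) m[of 2] p by simp
      moreover have "cmod (f (u, v) 1) \<le> M + 2 * (A * M) + A * (A * M)"
      proof -
        have "cmod (f (u, v) 1) \<le> cmod (f (u0, v0) 1) + A * cmod (f (u0, v0) 2)"
          unfolding t(3) A_def using norm_triangle_ineq[of "f (u0, v0) 1" "cnj a * f (u0, v0) 2"] by (simp add: norm_mult)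
        also have "\<dots> \<le> M + A * M" using m[of 1] m[of 2] A by (intro add_mono mult_left_mono) auto
        finally show ?thesis using p by simp
      qed
      moreover have "cmod (f (u, v) 0) \<le> M + 2 * (A * M) + A * (A * M)"
      proof -
        have "cmod (f (u, v) 0) \<le> cmod (f (u0, v0) 0) + cmod (2 * cnj a * f (u0, v0) 1) + cmod (cnj a * cnj a * f (u0, v0) 2)"
          unfolding t(4) by (intro order_trans[OF norm_triangle_ineq] add_mono norm_triangle_ineq order_refl)
        also have "\<dots> = cmod (f (u0, v0) 0) + 2 * (A * cmod (f (u0, v0) 1)) + A * (A * cmod (f (u0, v0) 2))"
          by (simp add: norm_mult A_def)
        also have "\<dots> \<le> M + 2 * (A * M) + A * (A * M)"
          using m[of 0] m[of 1] m[of 2] A by (intro add_mono mult_left_mono) auto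
        finally show ?thesis .
      qed
      moreover have "i > 2 \<Longrightarrow> cmod (f (u, v) i) \<le> M + 2 * (A * M) + A * (A * M)"
        using holo_forms_2(2)[OF fh, of i] p M0 by simp
      ultimately show ?thesis using i unfolding e by auto
    qed
    also have "\<dots> \<le> M * (5 + cmod u)\<^sup>2" using A2 M0 by (intro mult_left_mono)
    finally show ?thesis .
  qed
  show ?thesis
  proof (rule that[OF M0])
    fix u v i assume h: "2 * Re v + (cmod u)\<^sup>2 \<le> - 1"
    \<comment> \<open>Radius of the circle in which the slice of constant \<open>v\<close> meets the
      hypersurface.\<close>
    define m where "m = sqrt (- 2 * Re v - 1)"
    have m2: "- 2 * Re v - 1 \<ge> 0" using h zero_le_power2[of "cmod u"] by linarith
    have mm: "m\<^sup>2 = - 2 * Re v - 1" "m \<ge> 0" using m2 by (auto simp: m_def)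
    have um: "cmod u \<le> m" using h mm(1) by (intro power2_le_imp_le[OF _ mm(2)]) auto
    have ms: "m \<le> sqrt (- 2 * Re v)" unfolding m_def by (intro real_sqrt_le_mono) auto
    have fr: "cmod (f (\<xi>, v) i) \<le> M * (5 + sqrt (- 2 * Re v))\<^sup>2" if "cmod \<xi> = m" for \<xi>
    proof -
      have "cmod (f (\<xi>, v) i) \<le> M * (5 + cmod \<xi>)\<^sup>2"
        by (rule bdry) (use that mm in simp)
      also have "\<dots> \<le> M * (5 + sqrt (- 2 * Re v))\<^sup>2"
        using that ms mm M0 by (intro mult_left_mono power_mono) auto
      finally show ?thesis .
    qed
    show "cmod (f (u, v) i) \<le> M * (5 + sqrt (- 2 * Re v))\<^sup>2"
    proof (cases "m = 0")
      case True
      then show ?thesis using um by (intro fr) auto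
    next
      case False
      have sub: "(\<xi>, v) \<in> Ball2" if "\<xi> \<in> cball 0 m" for \<xi>
      proof -
        have "(cmod \<xi>)\<^sup>2 \<le> m\<^sup>2" using that by (intro power_mono) auto
        then show ?thesis using mm by (simp add: Ball2_iff)
      qed
      have o: "open {\<xi>. (\<xi>, v) \<in> Ball2}"
        using open_vimage[OF open_Ball2, of "\<lambda>\<xi>. (\<xi>, v)"] by (simp add: vimage_def continuous_on_Pair)
      have hol: "(\<lambda>\<xi>. f (\<xi>, v) i) holomorphic_on {\<xi>. (\<xi>, v) \<in> Ball2}"
        by (rule hol2_curve[OF holo_forms_2(1)[OF fh] open_Ball2]) (auto intro!: holomorphic_intros o)
      show ?thesis
      proof (rule maximum_modulus_frontier[where S = "cball 0 m" and f = "\<lambda>\<xi>. f (\<xi>, v) i"])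
        show "(\<lambda>\<xi>. f (\<xi>, v) i) holomorphic_on interior (cball 0 m)"
          by (rule holomorphic_on_subset[OF hol]) (use sub in auto)
        show "continuous_on (closure (cball 0 m)) (\<lambda>\<xi>. f (\<xi>, v) i)"
          by (rule continuous_on_subset[OF holomorphic_on_imp_continuous_on[OF hol]]) (use sub in auto)
        show "\<And>z. z \<in> frontier (cball 0 m) \<Longrightarrow> cmod (f (z, v) i) \<le> M * (5 + sqrt (- 2 * Re v))\<^sup>2"
          using fr False mm by (auto simp: frontier_cball)
        show "u \<in> cball 0 m" using um by simp
      qed auto
    qed
  qed
qed

section \<open>The coordinate w at the cusp\<close>

definition FJw :: "complex \<Rightarrow> complex" where
  "FJw v = exp (of_real (2 * pi) * v / of_real (sqrt 3))"

definition FJlog :: "complex \<Rightarrow> complex" where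
  "FJlog w = of_real (sqrt 3 / (2 * pi)) * Ln w"

lemma FJlog_FJw: obtains n where "FJlog (FJw v) = v + sqrt_m3 * of_int n"
proof -
  define x where "x = of_real (2 * pi) * v / of_real (sqrt 3)"
  have "exp (Ln (exp x)) = exp x" by simp
  then obtain n where n: "Ln (exp x) = x + complex_of_real (of_int (2 * n) * pi) * \<i>"
    using exp_eq by metis
  have "FJlog (FJw v) = v + sqrt_m3 * of_int n"
    unfolding FJlog_def FJw_def x_def[symmetric] n
    by (simp add: x_def sqrt_m3_def field_simps)
  then show ?thesis by (rule that)
qed

lemma FJw_FJlog: "w \<noteq> 0 \<Longrightarrow> FJw (FJlog w) = w"
  by (simp add: FJw_def FJlog_def)

lemma Re_FJlog: "w \<noteq> 0 \<Longrightarrow> Re (FJlog w) = sqrt 3 / (2 * pi) * ln (cmod w)"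
  by (simp add: FJlog_def)

lemma norm_FJw: "cmod (FJw v) = exp (2 * pi * Re v / sqrt 3)"
  by (simp add: FJw_def norm_exp_eq_Re)

text \<open>\<open>f\<close> as a function of w = exp (2 pi v / sqrt 3). For forms the choice of the
  principal branch in \<open>FJlog\<close> is immaterial: other branches differ by periods sqrt(-3)
  n of v.\<close>

definition FJfun :: "vector_fun \<Rightarrow> nat \<Rightarrow> complex \<times> complex \<Rightarrow> complex" where
  "FJfun f i = (\<lambda>(u, w). f (u, FJlog w) i)"

definition FJdom :: "(complex \<times> complex) set" where
  "FJdom = {p. snd p \<noteq> 0 \<and> (fst p, FJlog (snd p)) \<in> Ball2}"

lemma FJdom_iff: "(u, w) \<in> FJdom \<longleftrightarrow> w \<noteq> 0 \<and> sqrt 3 / pi * ln (cmod w) + (cmod u)\<^sup>2 < 0"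
  by (auto simp: FJdom_def Ball2_iff Re_FJlog)

lemma open_FJdom: "open FJdom"
proof -
  have "continuous_on {p :: complex \<times> complex. snd p \<noteq> 0} (\<lambda>p. sqrt 3 / pi * ln (cmod (snd p)) + (cmod (fst p))\<^sup>2)"
    by (intro continuous_intros) auto
  moreover have o: "open {p :: complex \<times> complex. snd p \<noteq> 0}"
    by (intro open_Collect_neq continuous_intros)
  ultimately have "open ({p :: complex \<times> complex. snd p \<noteq> 0} \<inter>
      (\<lambda>p. sqrt 3 / pi * ln (cmod (snd p)) + (cmod (fst p))\<^sup>2) -` {..<0})"
    by (intro continuous_open_preimage) auto
  also have "\<dots> = FJdom" by (auto simp: FJdom_iff)
  finally show ?thesis .
qed

text \<open>\<open>FJlog\<close> jumps along the negative real axis. Near \<open>w0\<close> it is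
  replaced by the branch \<open>L\<close>, which is holomorphic there and differs from it by periods
  of \<open>f\<close>.\<close>

lemma hol2_FJfun:
  assumes f: "f \<in> MF 2 k 0"
  shows "FJfun f i holomorphic2_on FJdom"
proof (rule hol2_locally[OF open_FJdom])
  fix p assume p: "p \<in> FJdom"
  define w0 where "w0 = snd p"
  have w0: "w0 \<noteq> 0" using p by (simp add: FJdom_def w0_def)
  have fh: "f \<in> holo_forms 2" using f by (simp add: MF_2_iff)
  define L where "L = (\<lambda>w. FJlog w0 + of_real (sqrt 3 / (2 * pi)) * Ln (w / w0))"
  define T where "T = FJdom \<inter> (\<lambda>p. snd p / w0) -` (- \<real>\<^sub>\<le>\<^sub>0)"
  have T: "open T" unfolding T_def
    by (intro open_Int open_FJdom open_vimage continuous_intros) (use w0 in auto)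
  have pT: "p \<in> T" using p w0 by (simp add: T_def w0_def)
  have L: "\<exists>n. FJlog w = L w + sqrt_m3 * of_int n" if "w \<noteq> 0" for w
  proof -
    have "FJw (L w) = FJw (FJlog w0) * exp (Ln (w / w0))"
    proof -
      have "of_real (2 * pi) * (A + of_real (sqrt 3 / (2 * pi)) * B) / of_real (sqrt 3)
          = of_real (2 * pi) * A / of_real (sqrt 3) + B" for A B :: complex
        by (simp add: field_simps)
      then show ?thesis unfolding FJw_def L_def by (simp only: exp_add)
    qed
    also have "\<dots> = w" using w0 that by (simp add: FJw_FJlog)
    finally show ?thesis using FJlog_FJw[of "L w"] by metis
  qed
  have inB: "(fst q, L (snd q)) \<in> Ball2" and eq: "FJfun f i q = f (fst q, L (snd q)) i" if "q \<in> T" for q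
  proof -
    have q: "snd q \<noteq> 0" "(fst q, FJlog (snd q)) \<in> Ball2" using that by (auto simp: T_def FJdom_def)
    obtain n where n: "FJlog (snd q) = L (snd q) + sqrt_m3 * of_int n" using L[OF q(1)] by blast
    show B: "(fst q, L (snd q)) \<in> Ball2" using q(2) unfolding n by (simp add: Ball2_iff sqrt_m3_def)
    show "FJfun f i q = f (fst q, L (snd q)) i"
      using MF_2_period[OF f B, of n] by (simp add: FJfun_def case_prod_unfold n)
  qed
  have hL: "(\<lambda>q. L (snd q)) holomorphic2_on T"
  proof -
    have "(\<lambda>q. Ln (snd q / w0)) holomorphic2_on T"
      by (rule hol2_compose_outer[where g = Ln and A = "- \<real>\<^sub>\<le>\<^sub>0"])
        (use T w0 in \<open>auto simp: T_def divide_inverse intro!: hol2_intros holomorphic_intros\<close>)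
    then show ?thesis unfolding L_def by (intro hol2_intros)
  qed
  have "(\<lambda>q. f (fst q, L (snd q)) i) holomorphic2_on T"
    by (rule hol2_compose[OF holo_forms_2(1)[OF fh] open_Ball2 hol2_fst hL T inB])
  then have "FJfun f i holomorphic2_on T"
    using hol2_cong[of T "FJfun f i"] eq by simp
  then show "\<exists>T. open T \<and> p \<in> T \<and> FJfun f i holomorphic2_on T" using T pT by blast
qed

lemma FJ_radius:
  assumes "(u, v) \<in> Ball2"
  shows "FJw v \<in> ball 0 (exp (- pi / sqrt 3 * (cmod u)\<^sup>2)) - {0}"
proof -
  have "2 * Re v < - (cmod u)\<^sup>2" using assms by (simp add: Ball2_iff)
  then have "pi / sqrt 3 * (2 * Re v) < pi / sqrt 3 * (- (cmod u)\<^sup>2)"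
    by (intro mult_strict_left_mono) auto
  then show ?thesis by (simp add: norm_FJw FJw_def dist_norm norm_exp_eq_Re mult_ac)
qed

lemma FJdom_radius: "w \<in> ball 0 (exp (- pi / sqrt 3 * (cmod u)\<^sup>2)) - {0} \<longleftrightarrow> (u, w) \<in> FJdom"
proof (cases "w = 0")
  case False
  have "cmod w < exp (- pi / sqrt 3 * (cmod u)\<^sup>2) \<longleftrightarrow> ln (cmod w) < - pi / sqrt 3 * (cmod u)\<^sup>2"
    using False by (metis exp_less_cancel_iff exp_ln zero_less_norm_iff)
  also have "\<dots> \<longleftrightarrow> sqrt 3 / pi * ln (cmod w) + (cmod u)\<^sup>2 < 0"
    using pi_gt_zero by (simp add: field_simps, auto)
  finally show ?thesis using False by (simp add: FJdom_iff)
qed (simp add: FJdom_iff)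

text \<open>By \<open>MF_2_growth\<close> the function is at most of logarithmic size at w = 0;
  multiplied by w it tends to 0, so the singularity is removable. This is Koecher's
  principle.\<close>

lemma FJfun_extend:
  assumes f: "f \<in> MF 2 k 0"
  obtains g where "g holomorphic_on ball 0 (exp (- pi / sqrt 3 * (cmod u)\<^sup>2))"
    "\<And>v. (u, v) \<in> Ball2 \<Longrightarrow> f (u, v) i = g (FJw v)"
    "\<And>w. (u, w) \<in> FJdom \<Longrightarrow> g w = FJfun f i (u, w)"
proof -
  define R where "R = exp (- pi / sqrt 3 * (cmod u)\<^sup>2)"
  have R: "R > 0" by (simp add: R_def)
  note dom = FJdom_radius[of _ u, folded R_def]
  have hol: "(\<lambda>w. FJfun f i (u, w)) holomorphic_on ball 0 R - {0}"
    by (rule hol2_curve[OF hol2_FJfun[OF f] open_FJdom])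
      (use dom in \<open>auto intro!: holomorphic_intros\<close>)
  obtain C where C: "C \<ge> 0" "\<And>u v i. 2 * Re v + (cmod u)\<^sup>2 \<le> - 1 \<Longrightarrow>
    cmod (f (u, v) i) \<le> C * (5 + sqrt (- 2 * Re v))\<^sup>2"
    using MF_2_growth[OF f] by blast
  define \<kappa> where "\<kappa> = sqrt 3 / pi"
  have \<kappa>: "\<kappa> > 0" by (simp add: \<kappa>_def)
  define r where "r = exp (- (1 + (cmod u)\<^sup>2) / \<kappa>)"
  have r: "r > 0" by (simp add: r_def)
  \<comment> \<open>Combines (5 + sqrt t)^2 <= 50 + 2 t with - ln |w| <= 2 / sqrt |w|, the latter
    from ln y <= y - 1 at y = 1 / sqrt |w|.\<close>
  have bd: "cmod (w * FJfun f i (u, w)) \<le> C * (50 * cmod w + 4 * \<kappa> * sqrt (cmod w))"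
    if w: "w \<noteq> 0" "cmod w < r" for w
  proof -
    have lw: "ln (cmod w) < - (1 + (cmod u)\<^sup>2) / \<kappa>"
      using w by (metis exp_less_cancel_iff exp_ln r_def zero_less_norm_iff)
    define t where "t = - (\<kappa> * ln (cmod w))"
    have "\<kappa> * ln (cmod w) < - (1 + (cmod u)\<^sup>2)" using lw \<kappa> by (simp add: field_simps)
    then have t: "t > 1 + (cmod u)\<^sup>2" by (simp add: t_def)
    have t0: "t > 0" using t zero_le_power2[of "cmod u"] by linarith
    have Re: "- 2 * Re (FJlog w) = t" using w by (simp add: Re_FJlog t_def \<kappa>_def)
    have "cmod (FJfun f i (u, w)) \<le> C * (5 + sqrt t)\<^sup>2"
      using C(2)[of "FJlog w" u i] t Re by (simp add: FJfun_def)
    also have "\<dots> \<le> C * (50 + 2 * t)"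
    proof (intro mult_left_mono C)
      have "(5 + sqrt t)\<^sup>2 + (5 - sqrt t)\<^sup>2 = 50 + 2 * (sqrt t)\<^sup>2" by (simp add: power2_eq_square algebra_simps)
      moreover have "(sqrt t)\<^sup>2 = t" using t0 by simp
      ultimately show "(5 + sqrt t)\<^sup>2 \<le> 50 + 2 * t" using zero_le_power2[of "5 - sqrt t"] by linarith
    qed
    finally have 1: "cmod (FJfun f i (u, w)) \<le> C * (50 + 2 * t)" .
    define y where "y = 1 / sqrt (cmod w)"
    have y: "y > 0" using w by (simp add: y_def)
    have "ln y \<le> y - 1" by (rule ln_le_minus_one[OF y])
    moreover have "ln y = - ln (cmod w) / 2" using w by (simp add: y_def ln_div ln_sqrt)
    ultimately have "- ln (cmod w) \<le> 2 * y" by simp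
    then have "t \<le> \<kappa> * (2 * y)" using \<kappa> mult_left_mono[of "- ln (cmod w)" "2 * y" \<kappa>] by (simp add: t_def)
    then have "cmod w * (50 + 2 * t) \<le> cmod w * (50 + 4 * \<kappa> * y)" by (intro mult_left_mono) auto
    also have "\<dots> = 50 * cmod w + 4 * \<kappa> * (cmod w * y)" by (simp add: algebra_simps)
    also have "cmod w * y = sqrt (cmod w)" using w by (simp add: y_def real_div_sqrt)
    finally have 2: "cmod w * (50 + 2 * t) \<le> 50 * cmod w + 4 * \<kappa> * sqrt (cmod w)" .
    have "cmod (w * FJfun f i (u, w)) \<le> cmod w * (C * (50 + 2 * t))"
      unfolding norm_mult using 1 by (intro mult_left_mono) auto
    also have "\<dots> = C * (cmod w * (50 + 2 * t))" by simp
    also have "\<dots> \<le> C * (50 * cmod w + 4 * \<kappa> * sqrt (cmod w))" using 2 C by (intro mult_left_mono)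
    finally show ?thesis .
  qed
  have "((\<lambda>w. (w - 0) * FJfun f i (u, w)) \<longlongrightarrow> 0) (at 0)"
  proof (rule Lim_null_comparison)
    show "\<forall>\<^sub>F w in at 0. cmod ((w - 0) * FJfun f i (u, w)) \<le> C * (50 * cmod w + 4 * \<kappa> * sqrt (cmod w))"
      unfolding eventually_at using r bd by (intro exI[of _ r]) auto
    have "((\<lambda>w::complex. C * (50 * cmod w + 4 * \<kappa> * sqrt (cmod w))) \<longlongrightarrow> C * (50 * cmod 0 + 4 * \<kappa> * sqrt (cmod 0))) (at 0)"
      by (intro tendsto_intros)
    then show "((\<lambda>w::complex. C * (50 * cmod w + 4 * \<kappa> * sqrt (cmod w))) \<longlongrightarrow> 0) (at 0)" by simp
  qed
  then obtain g where g: "g holomorphic_on ball 0 R" "\<And>w. w \<in> ball 0 R - {0} \<Longrightarrow> g w = FJfun f i (u, w)"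
    using holomorphic_on_extend_lim[OF hol] R by auto
  show ?thesis
  proof (rule that[of g])
    show "g holomorphic_on ball 0 (exp (- pi / sqrt 3 * (cmod u)\<^sup>2))" using g(1) by (simp add: R_def)
    show "g w = FJfun f i (u, w)" if "(u, w) \<in> FJdom" for w using g(2) dom that by blast
    fix v assume v: "(u, v) \<in> Ball2"
    obtain n where n: "FJlog (FJw v) = v + sqrt_m3 * of_int n" by (rule FJlog_FJw)
    have "g (FJw v) = FJfun f i (u, FJw v)"
      by (rule g(2)) (use FJ_radius[OF v] in \<open>simp add: R_def\<close>)
    also have "\<dots> = f (u, v) i" using MF_2_period[OF f v, of n] by (simp add: FJfun_def n)
    finally show "f (u, v) i = g (FJw v)" ..
  qed
qed

lemma tendsto_FJw: "((\<lambda>x::real. FJw (of_real x + s)) \<longlongrightarrow> 0) at_bot"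
proof (rule tendsto_norm_zero_cancel)
  have "filterlim (\<lambda>x. 2 * pi / sqrt 3 * x) at_bot at_bot"
    by (rule filterlim_tendsto_pos_mult_at_bot[OF tendsto_const _ filterlim_ident]) simp
  from tendsto_mult_right_zero[OF filterlim_compose[OF exp_at_bot this], of "exp (2 * pi * Re s / sqrt 3)"]
  have "((\<lambda>x. exp (2 * pi * Re s / sqrt 3) * exp (2 * pi / sqrt 3 * x)) \<longlongrightarrow> 0) at_bot" .
  then show "((\<lambda>x. cmod (FJw (of_real x + s))) \<longlongrightarrow> 0) at_bot"
    by (simp add: norm_FJw exp_add[symmetric] add_divide_distrib distrib_left add.commute)
qed

lemma eventually_less_at_bot: "eventually (\<lambda>x. x < c) at_bot" for c :: real
  unfolding eventually_at_bot_dense by blast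

text \<open>The constant terms vanish: the translations force \<open>c\<^sub>2 = 0\<close> and the rest to be constant,
  and the rotation \<open>u \<mapsto> \<rho>u\<close> kills these constants.\<close>

lemma MF_2_FJ:
  assumes f: "f \<in> MF 2 k 0"
  shows "\<exists>c. has_FJ_expansion f c \<and> c 0 = 0"
proof -
  have fh: "f \<in> holo_forms 2" using f by (simp add: MF_2_iff)
  define R where "R = (\<lambda>u. exp (- pi / sqrt 3 * (cmod u)\<^sup>2))"
  have "\<exists>g. g holomorphic_on ball 0 (R u) \<and> (\<forall>v. (u, v) \<in> Ball2 \<longrightarrow> f (u, v) i = g (FJw v)) \<and>
      (\<forall>w. (u, w) \<in> FJdom \<longrightarrow> g w = FJfun f i (u, w))" for u i
    using FJfun_extend[OF f, of u i] unfolding R_def by metis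
  then obtain g where g: "\<And>u i. g u i holomorphic_on ball 0 (R u)"
    "\<And>u i v. (u, v) \<in> Ball2 \<Longrightarrow> f (u, v) i = g u i (FJw v)"
    "\<And>u i w. (u, w) \<in> FJdom \<Longrightarrow> g u i w = FJfun f i (u, w)" by metis
  have R: "R u > 0" for u by (simp add: R_def)
  define c where "c i u = g u i 0" for i u
  \<comment> \<open>\<open>c i u\<close> is the limit of component \<open>i\<close> as Re v tends to
    minus infinity along any horizontal line, so each functional equation of \<open>f\<close>
    descends to \<open>c\<close>.\<close>
  have lim: "((\<lambda>x. f (u, of_real x + s) i) \<longlongrightarrow> c i u) at_bot" for u s i
  proof -
    have "isCont (g u i) 0"
      using holomorphic_on_imp_continuous_on[OF g(1)[of u i]] R[of u]
      by (simp add: continuous_on_eq_continuous_at)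
    then have "((\<lambda>x. g u i (FJw (of_real x + s))) \<longlongrightarrow> c i u) at_bot"
      unfolding c_def by (rule isCont_tendsto_compose[OF _ tendsto_FJw])
    moreover have "eventually (\<lambda>x. g u i (FJw (of_real x + s)) = f (u, of_real x + s) i) at_bot"
      using eventually_less_at_bot[of "- (cmod u)\<^sup>2 / 2 - Re s"]
    proof eventually_elim
      case (elim x)
      then have "(u, of_real x + s) \<in> Ball2" by (simp add: Ball2_iff)
      then show ?case using g(2) by simp
    qed
    ultimately show ?thesis by (rule Lim_transform_eventually)
  qed
  have inB: "eventually (\<lambda>x. (u, of_real x) \<in> Ball2) at_bot" for u
    using eventually_less_at_bot[of "- (cmod u)\<^sup>2 / 2"] by eventually_elim (simp add: Ball2_iff)
  have cT: "c 2 (u + a) = c 2 u" "c 1 (u + a) = c 1 u + cnj a * c 2 u"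
    "c 0 (u + a) = c 0 u + 2 * cnj a * c 1 u + cnj a * cnj a * c 2 u"
    if T: "transl a b \<in> \<Gamma>_cong" for a b u
  proof -
    have l: "((\<lambda>x. f (u + a, of_real x + (b - cnj a * u)) i) \<longlongrightarrow> c i (u + a)) at_bot" for i
      by (rule lim)
    have l0: "((\<lambda>x. f (u, of_real x) i) \<longlongrightarrow> c i u) at_bot" for i using lim[of u 0 i] by simp
    have e: "eventually (\<lambda>x. f (u + a, of_real x + (b - cnj a * u)) 2 = f (u, of_real x) 2 \<and>
       f (u + a, of_real x + (b - cnj a * u)) 1 = f (u, of_real x) 1 + cnj a * f (u, of_real x) 2 \<and>
       f (u + a, of_real x + (b - cnj a * u)) 0 = f (u, of_real x) 0 + 2 * cnj a * f (u, of_real x) 1 +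
         cnj a * cnj a * f (u, of_real x) 2) at_bot"
      using inB[of u]
    proof eventually_elim
      case (elim x)
      from MF_2_transl[OF f elim T] show ?case by (simp add: add_diff_eq)
    qed
    show "c 2 (u + a) = c 2 u"
      by (rule tendsto_unique[OF trivial_limit_at_bot_linorder l[of 2]])
        (rule Lim_transform_eventually[OF l0[of 2]], use e in \<open>eventually_elim, simp\<close>)
    show "c 1 (u + a) = c 1 u + cnj a * c 2 u"
      by (rule tendsto_unique[OF trivial_limit_at_bot_linorder l[of 1]])
        (rule Lim_transform_eventually[OF tendsto_add[OF l0[of 1] tendsto_mult[OF tendsto_const l0[of 2]]]],
         use e in \<open>eventually_elim, simp\<close>)
    show "c 0 (u + a) = c 0 u + 2 * cnj a * c 1 u + cnj a * cnj a * c 2 u"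
      by (rule tendsto_unique[OF trivial_limit_at_bot_linorder l[of 0]])
        (rule Lim_transform_eventually[OF tendsto_add[OF tendsto_add[OF l0[of 0] tendsto_mult[OF tendsto_const l0[of 1]]]
            tendsto_mult[OF tendsto_const l0[of 2]]]],
         use e in \<open>eventually_elim, simp\<close>)
  qed
  have cR: "c 1 (\<rho> * u) = \<rho> * \<rho> * c 1 u" "c 0 (\<rho> * u) = \<rho> * c 0 u" for u
  proof -
    have l: "((\<lambda>x. f (\<rho> * u, of_real x) i) \<longlongrightarrow> c i (\<rho> * u)) at_bot"
      "((\<lambda>x. f (u, of_real x) i) \<longlongrightarrow> c i u) at_bot" for i
      using lim[of "\<rho> * u" 0 i] lim[of u 0 i] by simp_all
    have e: "eventually (\<lambda>x. f (\<rho> * u, of_real x) 1 = \<rho> * \<rho> * f (u, of_real x) 1 \<and>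
       f (\<rho> * u, of_real x) 0 = \<rho> * f (u, of_real x) 0) at_bot"
      using inB[of u] by eventually_elim (intro conjI MF_2_rot[OF f])
    show "c 1 (\<rho> * u) = \<rho> * \<rho> * c 1 u"
      by (rule tendsto_unique[OF trivial_limit_at_bot_linorder l(1)[of 1]])
        (rule Lim_transform_eventually[OF tendsto_mult[OF tendsto_const l(2)[of 1]]], use e in \<open>eventually_elim, simp\<close>)
    show "c 0 (\<rho> * u) = \<rho> * c 0 u"
      by (rule tendsto_unique[OF trivial_limit_at_bot_linorder l(1)[of 0]])
        (rule Lim_transform_eventually[OF tendsto_mult[OF tendsto_const l(2)[of 0]]], use e in \<open>eventually_elim, simp\<close>)
  qed
  \<comment> \<open>For all parameters near \<open>u\<close> the constant term is Cauchy's integral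
    over one and the same circle in w.\<close>
  have hc: "c i holomorphic_on UNIV" for i
  proof -
    have "c i field_differentiable at u" for u
    proof -
      define M where "M = cmod u + 1"
      define r where "r = exp (- pi / sqrt 3 * M\<^sup>2) / 2"
      have r: "r > 0" by (simp add: r_def)
      have rR: "r < R x" if "x \<in> ball u 1" for x
      proof -
        have "cmod x \<le> M" using that norm_triangle_sub[of x u] by (simp add: M_def dist_norm norm_minus_commute)
        then have "(cmod x)\<^sup>2 \<le> M\<^sup>2" by (intro power_mono) auto
        then have "- pi / sqrt 3 * M\<^sup>2 \<le> - pi / sqrt 3 * (cmod x)\<^sup>2" by (simp add: divide_right_mono mult_left_mono)
        then have "2 * r \<le> R x" unfolding r_def R_def by simp
        then show ?thesis using r by simp
      qed
      have dom: "(x, w) \<in> FJdom" if "x \<in> ball u 1" "w \<in> sphere 0 r" for x w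
        using FJdom_radius[of w x] rR[OF that(1)] that(2) r by (auto simp: R_def)
      have "(\<lambda>x. contour_integral (circlepath 0 r) (\<lambda>w. FJfun f i (x, w) / w)) holomorphic_on ball u 1"
      proof (rule holomorphic_circle_integral)
        show "continuous_on (ball u 1 \<times> sphere 0 r) (\<lambda>(x, w). FJfun f i (x, w) / w)"
          unfolding case_prod_unfold
        proof (intro continuous_intros)
          show "continuous_on (ball u 1 \<times> sphere 0 r) (\<lambda>p. FJfun f i (fst p, snd p))"
            by (rule continuous_on_compose2[OF hol2_imp_continuous_on[OF hol2_FJfun[OF f]]])
              (use dom in \<open>auto intro!: continuous_intros\<close>)
        qed (use r in auto)
        fix w :: complex assume w: "w \<in> sphere 0 r"
        have "(\<lambda>x. FJfun f i (x, w)) holomorphic_on ball u 1"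
          by (rule hol2_curve[OF hol2_FJfun[OF f] open_FJdom]) (use dom w in \<open>auto intro!: holomorphic_intros\<close>)
        then show "(\<lambda>x. FJfun f i (x, w) / w) holomorphic_on ball u 1"
          by (intro holomorphic_intros) (use w r in auto)
      qed (use r in auto)
      then have h: "(\<lambda>x. contour_integral (circlepath 0 r) (\<lambda>w. FJfun f i (x, w) / w) / (2 * of_real pi * \<i>)) holomorphic_on ball u 1"
        by (intro holomorphic_intros) auto
      have eq: "contour_integral (circlepath 0 r) (\<lambda>w. FJfun f i (x, w) / w) / (2 * of_real pi * \<i>) = c i x"
        if x: "x \<in> ball u 1" for x
      proof -
        have "((\<lambda>w. g x i w / (w - 0)) has_contour_integral (2 * of_real pi * \<i> * g x i 0)) (circlepath 0 r)"
        proof (rule Cauchy_integral_circlepath)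
          have s: "cball 0 r \<subseteq> ball 0 (R x)" using rR[OF x] by auto
          show "continuous_on (cball 0 r) (g x i)"
            by (rule continuous_on_subset[OF holomorphic_on_imp_continuous_on[OF g(1)] s])
          show "g x i holomorphic_on ball 0 r"
            by (rule holomorphic_on_subset[OF g(1)]) (use s in auto)
        qed (use r in auto)
        then have "((\<lambda>w. FJfun f i (x, w) / w) has_contour_integral (2 * of_real pi * \<i> * g x i 0)) (circlepath 0 r)"
          by (rule has_contour_integral_eq) (use g(3) dom[OF x] r in auto)
        then show ?thesis by (simp add: contour_integral_unique c_def)
      qed
      have "c i holomorphic_on ball u 1" by (rule holomorphic_transform[OF h eq])
      then show ?thesis by (rule holomorphic_on_imp_differentiable_at) auto
    qed
    then show ?thesis by (simp add: holomorphic_on_def field_differentiable_at_within)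
  qed
  have Tl: "transl (sqrt_m3 * \<alpha>) ((\<rho> - 1) * (\<alpha> * cnj \<alpha>)) \<in> \<Gamma>_cong" if "\<alpha> \<in> O_F" for \<alpha>
    by (rule transl_lattice[OF that])
  obtain k2 where k2: "\<And>u. c 2 u = k2"
    by (rule lattice_periodic_constant[OF hc[of 2]]) (use cT(1)[OF Tl] in blast)+
  \<comment> \<open>A translation changes \<open>c 1\<close> by a constant, so its derivative is
    periodic and \<open>c 1\<close> is affine.\<close>
  have dc: "deriv (c 1) (u + sqrt_m3 * \<alpha>) = deriv (c 1) u" if "\<alpha> \<in> O_F" for \<alpha> u
  proof -
    have "(c 1 has_field_derivative deriv (c 1) (u + sqrt_m3 * \<alpha>)) (at (u + sqrt_m3 * \<alpha>))"
      by (rule holomorphic_derivI[OF hc open_UNIV]) simp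
    then have "((\<lambda>x. c 1 (x + sqrt_m3 * \<alpha>)) has_field_derivative deriv (c 1) (u + sqrt_m3 * \<alpha>)) (at u)"
      by (simp add: DERIV_shift)
    then have "((\<lambda>x. c 1 x + cnj (sqrt_m3 * \<alpha>) * k2) has_field_derivative deriv (c 1) (u + sqrt_m3 * \<alpha>)) (at u)"
      unfolding cT(2)[OF Tl[OF that]] k2 .
    moreover have "((\<lambda>x. c 1 x + cnj (sqrt_m3 * \<alpha>) * k2) has_field_derivative deriv (c 1) u + 0) (at u)"
      by (intro DERIV_add DERIV_const holomorphic_derivI[OF hc open_UNIV]) simp
    ultimately show ?thesis by (metis DERIV_unique add_0_right)
  qed
  obtain k1 where k1: "\<And>u. deriv (c 1) u = k1"
    by (rule lattice_periodic_constant[OF holomorphic_deriv[OF hc[of 1] open_UNIV] dc]) blast+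
  have lin: "c 1 u = k1 * u + c 1 0" for u
  proof -
    have "((\<lambda>x. c 1 x - k1 * x) has_field_derivative 0) (at x)" for x
      using holomorphic_derivI[OF hc[of 1] open_UNIV, of x] k1
      by (auto intro!: derivative_eq_intros)
    then obtain d where "\<And>x. c 1 x - k1 * x = d"
      using has_field_derivative_zero_constant[of UNIV "\<lambda>x. c 1 x - k1 * x"] by auto
    then have "c 1 u - k1 * u = c 1 0 - k1 * 0" by metis
    then show ?thesis by (simp add: algebra_simps)
  qed
  have eq1: "k1 * (sqrt_m3 * \<alpha>) = cnj (sqrt_m3 * \<alpha>) * k2" if "\<alpha> \<in> O_F" for \<alpha>
    using cT(2)[OF Tl[OF that], of 0] lin[of "sqrt_m3 * \<alpha>"] k2 by simp
  \<comment> \<open>The left side of \<open>eq1\<close> is complex linear in \<alpha>, the right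
    side conjugate linear; \<alpha> = 1 and \<alpha> = sqrt(-3) give opposite signs.\<close>
  have "k1 = - k2" using eq1[OF O_F_01(2)] sqrt_m3_nz by (simp add: cnj_sqrt_m3) (metis mult_cancel_left mult.commute mult_minus_left)
  moreover have "k1 = k2" using eq1[OF O_F_sqrt_m3] by (simp add: sqrt_m3_sq cnj_sqrt_m3)
  ultimately have k0: "k1 = 0" "k2 = 0" by auto
  have c1: "c 1 u = 0" for u
  proof -
    have "c 1 0 = \<rho> * \<rho> * c 1 0" using cR(1)[of 0] by simp
    then have "(1 - \<rho> * \<rho>) * c 1 0 = 0" by (simp add: algebra_simps)
    moreover have "\<rho> * \<rho> \<noteq> 1" using rho_cube rho_neq_1 by auto
    ultimately have "c 1 0 = 0" by auto
    then show ?thesis using lin[of u] k0 by simp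
  qed
  obtain k3 where k3: "\<And>u. c 0 u = k3"
    by (rule lattice_periodic_constant[OF hc[of 0]]) (use cT(3)[OF Tl] k2 k0 c1 in simp)+
  have c0: "c 0 u = 0" for u using cR(2)[of 0] k3 rho_neq_1 by simp
  have c_gt: "c i u = 0" if "i > 2" for i u
    using tendsto_unique[OF trivial_limit_at_bot_linorder lim[of u 0 i], of 0] holo_forms_2(2)[OF fh that] by simp
  have cz: "c i u = 0" for i u
  proof -
    have "i = 0 \<or> i = 1 \<or> i = 2 \<or> i > 2" by auto
    then show ?thesis using c0 c1 k2 k0 c_gt by auto
  qed
  define d where "d n u i = (deriv ^^ n) (g u i) 0 / fact n" for n u i
  have "has_FJ_expansion f d"
    unfolding has_FJ_expansion_def
  proof (intro allI impI)
    fix u v i assume uv: "(u, v) \<in> Ball2"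
    have "FJw v \<in> ball 0 (R u)" using FJ_radius[OF uv] by (simp add: R_def)
    from holomorphic_power_series[OF g(1) this]
    show "(\<lambda>n. d n u i * exp (of_real (2 * pi) * v / of_real (sqrt 3)) ^ n) sums f (u, v) i"
      by (simp add: d_def g(2)[OF uv] FJw_def)
  qed
  moreover have "d 0 = 0" using cz by (simp add: fun_eq_iff d_def c_def)
  ultimately show ?thesis by blast
qed

text \<open>By \<open>slash_MF\<close> the forms slashed with \<Gamma> are forms of the same kind,
  so the vanishing at the standard cusp yields the vanishing at every cusp.\<close>

theorem CF_2_eq_MF_2: "CF 2 k 0 = MF 2 k 0"
  unfolding CF_def using MF_2_FJ slash_MF by blast

section \<open>Power sums and Eisenstein series\<close>

text \<open>Linearity in \<open>p\<close>; the factor with exponent \<open>m \<ge> 2\<close> keeps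
  all sums in the range where power sums are given.\<close>

lemma power_sums_poly:
  fixes \<alpha> \<beta> :: "'a \<Rightarrow> complex"
  assumes "\<And>m. m \<ge> 2 \<Longrightarrow> \<exists>s. ((\<lambda>x. \<alpha> x ^ m) has_sum s) A \<and> ((\<lambda>x. \<beta> x ^ m) has_sum s) A"
    and "m \<ge> 2"
  shows "\<exists>s. ((\<lambda>x. \<alpha> x ^ m * poly p (\<alpha> x)) has_sum s) A \<and> ((\<lambda>x. \<beta> x ^ m * poly p (\<beta> x)) has_sum s) A"
  using assms(2)
proof (induction p arbitrary: m)
  case 0
  then show ?case by (intro exI[of _ 0]) simp
next
  case (pCons a p)
  obtain s where s: "((\<lambda>x. \<alpha> x ^ m) has_sum s) A" "((\<lambda>x. \<beta> x ^ m) has_sum s) A"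
    using assms(1)[OF pCons.prems] by blast
  obtain t where t: "((\<lambda>x. \<alpha> x ^ Suc m * poly p (\<alpha> x)) has_sum t) A" "((\<lambda>x. \<beta> x ^ Suc m * poly p (\<beta> x)) has_sum t) A"
    using pCons.IH[of "Suc m"] pCons.prems by auto
  have "((\<lambda>x. a * \<alpha> x ^ m + \<alpha> x ^ Suc m * poly p (\<alpha> x)) has_sum (a * s + t)) A"
    "((\<lambda>x. a * \<beta> x ^ m + \<beta> x ^ Suc m * poly p (\<beta> x)) has_sum (a * s + t)) A"
    by (intro has_sum_add has_sum_cmult_right s t)+
  then show ?case by (intro exI[of _ "a * s + t"]) (simp add: algebra_simps)
qed

lemma summable_on_finite_large:
  fixes \<alpha> :: "'a \<Rightarrow> complex"
  assumes "(\<lambda>x. cmod (\<alpha> x) ^ 2) summable_on A" "\<epsilon> > 0"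
  shows "finite {x \<in> A. cmod (\<alpha> x) \<ge> \<epsilon>}"
proof (rule ccontr)
  assume inf: "infinite {x \<in> A. cmod (\<alpha> x) \<ge> \<epsilon>}"
  define T where "T = infsum (\<lambda>x. cmod (\<alpha> x) ^ 2) A"
  obtain n where n: "real n * \<epsilon>^2 > T" using assms(2) reals_Archimedean3[of "\<epsilon>^2"] by auto
  obtain F where F: "finite F" "card F = n" "F \<subseteq> {x \<in> A. cmod (\<alpha> x) \<ge> \<epsilon>}"
    using infinite_arbitrarily_large[OF inf] by blast
  have "real n * \<epsilon>^2 = (\<Sum>x\<in>F. \<epsilon>^2)" using F by simp
  also have "\<dots> \<le> (\<Sum>x\<in>F. cmod (\<alpha> x) ^ 2)" using F assms(2) by (intro sum_mono power_mono) auto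
  also have "\<dots> \<le> T" unfolding T_def by (rule finite_sum_le_infsum[OF assms(1)]) (use F in auto)
  finally show False using n by simp
qed

text \<open>The polynomials \<open>t\<^sup>2 \<Prod>(1 - t/w) (t/c)\<^sup>M\<close> isolate the value \<open>c\<close> as \<open>M \<rightarrow> \<infinity>\<close>.\<close>

lemma power_sums_values:
  fixes \<alpha> \<beta> :: "'a \<Rightarrow> complex"
  assumes ps: "\<And>m. m \<ge> 2 \<Longrightarrow> \<exists>s. ((\<lambda>x. \<alpha> x ^ m) has_sum s) A \<and> ((\<lambda>x. \<beta> x ^ m) has_sum s) A"
    and sm: "(\<lambda>x. cmod (\<alpha> x) ^ 2) summable_on A" "(\<lambda>x. cmod (\<beta> x) ^ 2) summable_on A"
    and c: "c \<noteq> 0" "y \<in> A" "\<beta> y = c"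
  shows "\<exists>x\<in>A. \<alpha> x = c"
proof (rule ccontr)
  assume no: "\<not> (\<exists>x\<in>A. \<alpha> x = c)"
  define \<epsilon> where "\<epsilon> = cmod c / 2"
  have \<epsilon>: "\<epsilon> > 0" using c by (simp add: \<epsilon>_def)
  \<comment> \<open>The finitely many values of modulus at least |c| / 2 in either family, except
    \<open>c\<close>; all smaller values are damped by (t / c)^M.\<close>
  define W where "W = \<alpha> ` {x \<in> A. cmod (\<alpha> x) \<ge> \<epsilon>} \<union> \<beta> ` {x \<in> A. cmod (\<beta> x) \<ge> \<epsilon>} - {c}"
  have W: "finite W" unfolding W_def using summable_on_finite_large[OF sm(1) \<epsilon>] summable_on_finite_large[OF sm(2) \<epsilon>] by auto
  have W0: "w \<noteq> 0" "w \<noteq> c" if "w \<in> W" for w using that \<epsilon> by (auto simp: W_def)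
  define q where "q = (\<Prod>w\<in>W. [:1, - 1 / w:])"
  have q0: "poly q w = 0" if "w \<in> W" for w
    using that W W0(1)[OF that] by (auto simp: q_def poly_prod prod_zero_iff)
  have qc: "poly q c \<noteq> 0"
    using W W0 by (auto simp: q_def poly_prod prod_zero_iff field_simps)
  have "compact (poly q ` cball 0 \<epsilon>)" by (intro compact_continuous_image compact_cball continuous_intros)
  then obtain K where K: "\<And>t. t \<in> cball 0 \<epsilon> \<Longrightarrow> cmod (poly q t) \<le> K"
    using compact_imp_bounded bounded_iff by (metis image_eqI)
  have K0: "K \<ge> 0" using K[of 0] \<epsilon> by (auto intro: order_trans[OF norm_ge_zero])
  define p where "p M = q * [:0, 1 / c:] ^ M" for M :: nat
  have pp: "poly (p M) t = poly q t * (t / c) ^ M" for M t by (simp add: p_def)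
  have small: "cmod (t ^ 2 * poly (p M) t) \<le> cmod t ^ 2 * (K * (1 / 2) ^ M)" if "t \<in> W \<or> cmod t < \<epsilon>" for t M
  proof (cases "t \<in> W")
    case True
    then show ?thesis using K0 by (simp add: pp q0)
  next
    case False
    then have t: "cmod t < \<epsilon>" using that by auto
    have "cmod (t / c) \<le> 1 / 2" using t c by (simp add: \<epsilon>_def norm_divide field_simps)
    then have "cmod (t / c) ^ M \<le> (1 / 2) ^ M" by (intro power_mono) auto
    then have "cmod (poly q t) * cmod (t / c) ^ M \<le> K * (1 / 2) ^ M"
      using K[of t] t K0 by (intro mult_mono) auto
    then show ?thesis unfolding pp norm_mult norm_power by (intro mult_left_mono) auto
  qed
  define B where "B = {x \<in> A. \<beta> x = c}"
  have "B \<subseteq> {x \<in> A. cmod (\<beta> x) \<ge> \<epsilon>}" using c by (auto simp: B_def \<epsilon>_def)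
  then have fB: "finite B" using summable_on_finite_large[OF sm(2) \<epsilon>] finite_subset by blast
  have cB: "card B \<ge> 1" using fB c by (auto simp: B_def Suc_le_eq card_gt_0_iff)
  define a b where "a = infsum (\<lambda>x. cmod (\<alpha> x) ^ 2) A" and "b = infsum (\<lambda>x. cmod (\<beta> x) ^ 2) (A - B)"
  have smb: "(\<lambda>x. cmod (\<beta> x) ^ 2) summable_on (A - B)"
    by (rule summable_on_subset_banach[OF sm(2)]) auto
  \<comment> \<open>As M grows the \<alpha>-sum tends to 0, whereas the terms of the \<beta>-sum
    with value \<open>c\<close> contribute the fixed amount card B times c^2 q(c).\<close>
  have key: "cmod (c ^ 2 * poly q c) \<le> (a + b) * K * (1 / 2) ^ M" for M
  proof -
    obtain s where s: "((\<lambda>x. \<alpha> x ^ 2 * poly (p M) (\<alpha> x)) has_sum s) A" "((\<lambda>x. \<beta> x ^ 2 * poly (p M) (\<beta> x)) has_sum s) A"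
      using power_sums_poly[OF ps, of 2 "p M"] by auto
    have k: "((\<lambda>x. cmod (\<alpha> x) ^ 2 * (K * (1 / 2) ^ M)) has_sum (a * (K * (1 / 2) ^ M))) A"
      unfolding a_def by (intro has_sum_cmult_left has_sum_infsum sm)
    have "cmod (\<alpha> x ^ 2 * poly (p M) (\<alpha> x)) \<le> cmod (\<alpha> x) ^ 2 * (K * (1 / 2) ^ M)" if "x \<in> A" for x
      using that no by (intro small) (auto simp: W_def)
    from norm_infsum_le[OF s(1) k this] have 1: "cmod s \<le> a * (K * (1 / 2) ^ M)" .
    have "((\<lambda>x. \<beta> x ^ 2 * poly (p M) (\<beta> x)) has_sum (s - (\<Sum>x\<in>B. \<beta> x ^ 2 * poly (p M) (\<beta> x)))) (A - B)"
      by (rule has_sum_Diff[OF s(2) has_sum_finite[OF fB]]) (auto simp: B_def)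
    moreover have "(\<Sum>x\<in>B. \<beta> x ^ 2 * poly (p M) (\<beta> x)) = of_nat (card B) * (c ^ 2 * poly q c)"
      using c by (simp add: B_def pp)
    ultimately have s2: "((\<lambda>x. \<beta> x ^ 2 * poly (p M) (\<beta> x)) has_sum (s - of_nat (card B) * (c ^ 2 * poly q c))) (A - B)" by simp
    have k2: "((\<lambda>x. cmod (\<beta> x) ^ 2 * (K * (1 / 2) ^ M)) has_sum (b * (K * (1 / 2) ^ M))) (A - B)"
      unfolding b_def by (intro has_sum_cmult_left has_sum_infsum smb)
    have "cmod (\<beta> x ^ 2 * poly (p M) (\<beta> x)) \<le> cmod (\<beta> x) ^ 2 * (K * (1 / 2) ^ M)" if "x \<in> A - B" for x
      using that by (intro small) (auto simp: W_def B_def)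
    from norm_infsum_le[OF s2 k2 this]
    have 2: "cmod (s - of_nat (card B) * (c ^ 2 * poly q c)) \<le> b * (K * (1 / 2) ^ M)" .
    have "1 * cmod (c ^ 2 * poly q c) \<le> real (card B) * cmod (c ^ 2 * poly q c)"
      using cB by (intro mult_right_mono) auto
    also have "\<dots> = cmod (of_nat (card B) * (c ^ 2 * poly q c))" by (simp add: norm_mult)
    also have "\<dots> \<le> cmod s + cmod (s - of_nat (card B) * (c ^ 2 * poly q c))"
      by (metis norm_triangle_sub norm_minus_commute add.commute)
    also have "\<dots> \<le> (a + b) * K * (1 / 2) ^ M" using 1 2 by (simp add: algebra_simps)
    finally show ?thesis by simp
  qed
  have "(\<lambda>M. (a + b) * K * (1 / 2) ^ M) \<longlonglongrightarrow> (a + b) * K * 0"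
    by (intro tendsto_mult tendsto_const LIMSEQ_power_zero) auto
  then have "cmod (c ^ 2 * poly q c) \<le> (a + b) * K * 0"
    by (rule LIMSEQ_le_const) (use key in blast)
  then show False using qc c by simp
qed

text \<open>Osgood's lemma reduces this to Weierstrass's theorem on the coordinate slices.\<close>

lemma hol2_uniform_limit:
  assumes S: "open S" and f: "\<And>n. f n holomorphic2_on S" and u: "uniform_limit S f g F" and F: "F \<noteq> bot"
  shows "g holomorphic2_on S"
proof (rule hol2_osgood[OF S])
  show "continuous_on S g"
    by (rule uniform_limit_theorem[OF always_eventually u F]) (use f hol2_imp_continuous_on in blast)
next
  have *: "(\<lambda>z. g (h z)) field_differentiable at a"
    if h: "h a \<in> S" "continuous_on UNIV h" "\<And>n. (\<lambda>z. f n (h z)) holomorphic_on h -` S" for h and a :: complex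
  proof -
    have o: "open (h -` S)" using h S by (intro open_vimage)
    then obtain r where r: "r > 0" "cball a r \<subseteq> h -` S" using h(1) open_contains_cball by (metis vimageI)
    have "uniform_limit (cball a r) (\<lambda>n z. f n (h z)) (\<lambda>z. g (h z)) F"
      using r(2) by (intro uniform_limit_compose'[OF u]) auto
    moreover have "continuous_on (cball a r) (\<lambda>z. f n (h z)) \<and> (\<lambda>z. f n (h z)) holomorphic_on ball a r" for n
      using h(3)[of n] r(2) by (meson ball_subset_cball holomorphic_on_imp_continuous_on holomorphic_on_subset order_trans)
    ultimately have "(\<lambda>z. g (h z)) holomorphic_on ball a r"
      by (elim holomorphic_uniform_limit[OF always_eventually _ F, rotated]) auto
    then show ?thesis using r(1) by (intro holomorphic_on_imp_differentiable_at) auto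
  qed
  fix a b assume ab: "(a, b) \<in> S"
  have o: "open ((\<lambda>z. (z, b)) -` S)" "open ((\<lambda>z. (a, z)) -` S)"
    by (intro open_vimage S continuous_intros)+
  show "(\<lambda>z. g (z, b)) field_differentiable at a"
    by (rule *[of "\<lambda>z. (z, b)"])
      (use ab o in \<open>auto intro!: continuous_intros hol2_curve[OF f S] holomorphic_intros\<close>)
  show "(\<lambda>z. g (a, z)) field_differentiable at b"
    by (rule *[of "\<lambda>z. (a, z)"])
      (use ab o in \<open>auto intro!: continuous_intros hol2_curve[OF f S] holomorphic_intros\<close>)
qed

section \<open>Convergence and modularity of Eisenstein series\<close>

lemma summable_on_int: "(\<lambda>n::int. 1 / (1 + real_of_int \<bar>n\<bar>)^2) summable_on UNIV"
proof -
  have "summable (\<lambda>n. norm (1 / (1 + real n)^2))"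
    using inverse_power_summable[of 2, where 'a=real] summable_Suc_iff[of "\<lambda>n. inverse (real n ^ 2)"]
    by (simp add: divide_inverse add.commute)
  then have n: "(\<lambda>n. 1 / (1 + real n)^2) summable_on UNIV" by (rule norm_summable_imp_summable_on)
  have 1: "(\<lambda>n::int. 1 / (1 + real_of_int \<bar>n\<bar>)^2) summable_on (int ` UNIV)"
    by (subst summable_on_reindex) (use n in \<open>auto simp: o_def\<close>)
  have 2: "(\<lambda>n::int. 1 / (1 + real_of_int \<bar>n\<bar>)^2) summable_on ((\<lambda>n. - int n) ` UNIV)"
    by (subst summable_on_reindex) (use n in \<open>auto simp: o_def inj_on_def\<close>)
  have 3: "(\<lambda>n::int. 1 / (1 + real_of_int \<bar>n\<bar>)^2) summable_on ((\<lambda>n. - int n) ` UNIV - int ` UNIV)"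
    by (rule summable_on_subset_banach[OF 2]) auto
  have "UNIV = int ` UNIV \<union> ((\<lambda>n. - int n) ` UNIV - int ` UNIV)"
  proof -
    have "x = int (nat x) \<or> x = - int (nat (- x))" for x :: int by auto
    then have "x \<in> range int \<or> x \<in> range (\<lambda>n. - int n)" for x :: int by blast
    then show ?thesis by auto
  qed
  with summable_on_Un_disjoint[OF 1 3] show ?thesis by simp
qed

lemma summable_on_times:
  fixes f g :: "_ \<Rightarrow> real"
  assumes "f summable_on A" "g summable_on B" "\<And>x. f x \<ge> 0" "\<And>x. g x \<ge> 0"
  shows "(\<lambda>p. f (fst p) * g (snd p)) summable_on A \<times> B"
proof (rule summable_on_SigmaI[where g = "\<lambda>x. f x * infsum g B"])
  show "((\<lambda>y. f (fst (x, y)) * g (snd (x, y))) has_sum f x * infsum g B) B" for x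
    using assms by (simp add: has_sum_cmult_right)
  show "(\<lambda>x. f x * infsum g B) summable_on A"
    by (intro summable_on_cmult_left assms)
qed (use assms in auto)

text \<open>The exponent 4 permits domination on the rank-two lattice O_F by a product of two
  inverse squares.\<close>

definition lat_wt :: "complex \<Rightarrow> real" where "lat_wt x = 1 / (1 + cmod x)^4"

lemma lat_wt_nonneg: "lat_wt x \<ge> 0" by (simp add: lat_wt_def)

lemma summable_lat_wt: "lat_wt summable_on O_F"
proof -
  define h where "h = (\<lambda>p. of_int (fst p) + of_int (snd p) * \<rho>)"
  have O: "O_F = h ` (UNIV \<times> UNIV)" by (auto simp: O_F_def h_def image_iff, blast)
  have im: "Im (h p) = of_int (snd p) * (sqrt 3 / 2)" "Re (h p) = of_int (fst p) - of_int (snd p) / 2" for p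
    by (simp_all add: h_def Re_Im_rho)
  have inj: "inj h"
  proof (rule injI)
    fix p q assume "h p = h q"
    then have "Im (h p) = Im (h q)" "Re (h p) = Re (h q)" by simp_all
    then show "p = q" by (simp add: im prod_eq_iff)
  qed
  have n2: "(cmod (h p))\<^sup>2 = (of_int (fst p) - of_int (snd p) / 2)\<^sup>2 + 3 / 4 * (of_int (snd p))\<^sup>2" for p
    by (simp add: cmod_power2 im power_mult_distrib power_divide)
  have b1: "real_of_int \<bar>snd p\<bar> / 2 \<le> cmod (h p)" for p
    by (rule power2_le_imp_le) (simp_all add: n2 power_divide)
  have b2: "real_of_int \<bar>fst p\<bar> / 2 \<le> cmod (h p)" for p
  proof (rule power2_le_imp_le)
    define a b where "a = real_of_int (fst p)" and "b = real_of_int (snd p)"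
    have "(a - b / 2)\<^sup>2 + 3 / 4 * b\<^sup>2 - a\<^sup>2 / 4 = (a / 2 - b)\<^sup>2 + a\<^sup>2 / 2"
      by (simp add: power2_eq_square algebra_simps)
    then have "a\<^sup>2 / 4 \<le> (a - b / 2)\<^sup>2 + 3 / 4 * b\<^sup>2"
      using zero_le_power2[of "a / 2 - b"] zero_le_power2[of a] by linarith
    then show "(real_of_int \<bar>fst p\<bar> / 2)\<^sup>2 \<le> (cmod (h p))\<^sup>2" by (simp add: n2 a_def b_def power_divide)
  qed simp
  define w where "w = (\<lambda>n::int. 1 / (1 + real_of_int \<bar>n\<bar>)^2)"
  have le: "lat_wt (h p) \<le> 16 * (w (fst p) * w (snd p))" for p
  proof -
    define x A B where "x = 1 + cmod (h p)" and "A = 1 + real_of_int \<bar>fst p\<bar>" and "B = 1 + real_of_int \<bar>snd p\<bar>"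
    have AB: "A / 2 \<le> x" "B / 2 \<le> x" "A > 0" "B > 0" using b1[of p] b2[of p] by (auto simp: x_def A_def B_def)
    have "(A / 2)^2 * (B / 2)^2 \<le> x^2 * x^2" using AB by (intro mult_mono power_mono) auto
    then have "A^2 * B^2 / 16 \<le> x^4" by (simp add: power_divide power_add[symmetric])
    then have "1 / x^4 \<le> 1 / (A^2 * B^2 / 16)" using AB by (intro divide_left_mono) (auto intro!: mult_pos_pos simp: x_def)
    then show ?thesis by (simp add: lat_wt_def w_def x_def A_def B_def)
  qed
  have "(\<lambda>p. w (fst p) * w (snd p)) summable_on UNIV \<times> UNIV"
    unfolding w_def by (intro summable_on_times summable_on_int) auto
  then have "(\<lambda>p. 16 * (w (fst p) * w (snd p))) summable_on UNIV" by (simp add: summable_on_cmult_right)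
  then have "(\<lambda>p. lat_wt (h p)) summable_on UNIV"
  proof (rule summable_on_comparison_test)
    show "lat_wt (h p) \<le> 16 * (w (fst p) * w (snd p))" for p by (rule le)
  qed (rule lat_wt_nonneg)
  then show ?thesis unfolding O by (subst summable_on_reindex) (use inj in \<open>auto simp: o_def\<close>)
qed

text \<open>All nonzero isotropic lattice vectors, primitive or not. The set is stable under
  \<Gamma>, which makes sums over it modular.\<close>

definition iso_vecs :: "(complex^3) set" where
  "iso_vecs = {y. (\<forall>i. y$i \<in> O_F) \<and> y \<noteq> 0 \<and> herm y y = 0}"

definition vec_wt :: "complex^3 \<Rightarrow> real" where
  "vec_wt y = lat_wt (y$1) * (lat_wt (y$2) * lat_wt (y$3))"

lemma summable_vec_wt: "vec_wt summable_on iso_vecs"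
proof -
  define h :: "complex \<times> complex \<times> complex \<Rightarrow> complex^3" where "h = (\<lambda>(a, b, c). vector [a, b, c])"
  have inj: "inj_on h A" for A by (auto simp: inj_on_def h_def vec3_eq_iff)
  have "(\<lambda>p. lat_wt (fst p) * (lat_wt (fst (snd p)) * lat_wt (snd (snd p)))) summable_on O_F \<times> O_F \<times> O_F"
    by (intro summable_on_times[of lat_wt O_F "\<lambda>q. lat_wt (fst q) * lat_wt (snd q)"]
        summable_on_times summable_lat_wt mult_nonneg_nonneg lat_wt_nonneg)
  then have "vec_wt summable_on h ` (O_F \<times> O_F \<times> O_F)"
    by (subst summable_on_reindex[OF inj]) (simp add: o_def vec_wt_def h_def case_prod_unfold)
  moreover have "iso_vecs \<subseteq> h ` (O_F \<times> O_F \<times> O_F)"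
  proof
    fix y assume "y \<in> iso_vecs"
    then show "y \<in> h ` (O_F \<times> O_F \<times> O_F)"
      by (intro image_eqI[of _ _ "(y$1, y$2, y$3)"]) (auto simp: iso_vecs_def h_def vec3_eq_iff)
  qed
  ultimately show ?thesis by (rule summable_on_subset_banach)
qed

lemma O_F_norm_ge_1: assumes "x \<in> O_F" "x \<noteq> 0" shows "cmod x \<ge> 1"
proof -
  obtain a b where x: "x = of_int a + of_int b * \<rho>" using assms by (auto simp: O_F_iff)
  have e: "complex_of_real ((cmod x)\<^sup>2) = of_int (a * a - a * b + b * b)"
    unfolding complex_norm_square x by (rule O_F_norm)
  then have e': "(cmod x)\<^sup>2 = of_int (a * a - a * b + b * b)"
    by (metis of_real_eq_iff of_real_of_int_eq)
  have "(cmod x)\<^sup>2 > 0" using assms by simp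
  then have "a * a - a * b + b * b \<ge> 1" unfolding e' by linarith
  then have "(cmod x)\<^sup>2 \<ge> 1" unfolding e' by linarith
  then show ?thesis by (simp add: power2_le_imp_le abs_square_le_1[symmetric] linorder_not_less[symmetric] power_less_one_iff)
qed

text \<open>For isotropic \<open>y\<close> and h = herm (lift (u, v)) y one has -2 Re (h y_2) = - (2
  Re v + |u|^2) |y_2|^2 + |u y_2 - y_3|^2. Both terms on the right are nonnegative on the ball, so
  |h| controls y_2 and y_3, and then y_1, which occurs linearly in h.\<close>

lemma iso_bound:
  assumes y: "herm y y = 0" and r: "r0 > 0" "2 * Re v + (cmod u)\<^sup>2 \<le> - r0" and M: "cmod u \<le> M" "cmod v \<le> M"
  defines "H \<equiv> cmod (herm (lift (u, v)) y)"
  defines "A \<equiv> 2 / r0" and "B \<equiv> M * (2 / r0) + 2 / sqrt r0"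
  shows "cmod (y$2) \<le> A * H" "cmod (y$3) \<le> B * H" "cmod (y$1) \<le> (1 + M * A + M * B) * H"
proof -
  define h where "h = herm (lift (u, v)) y"
  have h: "h = v * cnj (y$2) + cnj (y$1) + u * cnj (y$3)" by (simp add: h_def herm_def)
  have H: "H = cmod h" by (simp add: H_def h_def)
  have M0: "M \<ge> 0" using M norm_ge_zero order_trans by blast
  have A0: "A > 0" using r by (simp add: A_def)
  have "Re (herm y y) = 0" using y by simp
  then have iso: "2 * (Re (y$1) * Re (y$2) + Im (y$1) * Im (y$2)) + (cmod (y$3))\<^sup>2 = 0"
    by (simp add: herm_def cmod_power2) (simp add: power2_eq_square algebra_simps)
  have "- 2 * Re (h * y$2) = (- (2 * Re v + (cmod u)\<^sup>2)) * (cmod (y$2))\<^sup>2 + (cmod (u * y$2 - y$3))\<^sup>2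
      - (2 * (Re (y$1) * Re (y$2) + Im (y$1) * Im (y$2)) + (cmod (y$3))\<^sup>2)"
    unfolding h cmod_power2 by (simp add: power2_eq_square algebra_simps)
  then have "(- (2 * Re v + (cmod u)\<^sup>2)) * (cmod (y$2))\<^sup>2 + (cmod (u * y$2 - y$3))\<^sup>2 = - 2 * Re (h * y$2)"
    using iso by linarith
  also have "\<dots> \<le> 2 * (H * cmod (y$2))"
    using abs_Re_le_cmod[of "h * y$2"] by (simp add: H norm_mult abs_le_iff)
  finally have k: "(- (2 * Re v + (cmod u)\<^sup>2)) * (cmod (y$2))\<^sup>2 + (cmod (u * y$2 - y$3))\<^sup>2 \<le> 2 * (H * cmod (y$2))" .
  have "r0 * (cmod (y$2))\<^sup>2 \<le> (- (2 * Re v + (cmod u)\<^sup>2)) * (cmod (y$2))\<^sup>2"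
    using r by (intro mult_right_mono) auto
  with k have k1: "r0 * (cmod (y$2))\<^sup>2 + (cmod (u * y$2 - y$3))\<^sup>2 \<le> 2 * (H * cmod (y$2))" by linarith
  have H0: "H \<ge> 0" by (simp add: H)
  show 2: "cmod (y$2) \<le> A * H"
  proof (cases "y$2 = 0")
    case False
    have "(r0 * cmod (y$2)) * cmod (y$2) \<le> (2 * H) * cmod (y$2)"
    proof -
      have "(r0 * cmod (y$2)) * cmod (y$2) = r0 * (cmod (y$2))\<^sup>2" "(2 * H) * cmod (y$2) = 2 * (H * cmod (y$2))"
        by (simp_all add: power2_eq_square)
      then show ?thesis using k1 zero_le_power2[of "cmod (u * y$2 - y$3)"] by linarith
    qed
    then have "r0 * cmod (y$2) \<le> 2 * H" using False by (simp add: mult_le_cancel_right)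
    then show ?thesis using r by (simp add: A_def field_simps)
  qed (use A0 H0 in simp)
  have "(cmod (u * y$2 - y$3))\<^sup>2 \<le> 2 * (H * cmod (y$2))"
    using k1 r zero_le_power2[of "cmod (y$2)"] mult_nonneg_nonneg[of r0 "(cmod (y$2))\<^sup>2"] by linarith
  also have "\<dots> \<le> 2 * (H * (A * H))" using 2 H0 by (intro mult_left_mono) auto
  also have "\<dots> = (2 / sqrt r0 * H)\<^sup>2" using r by (simp add: A_def power_mult_distrib power_divide power2_eq_square[of H])
  finally have "cmod (u * y$2 - y$3) \<le> 2 / sqrt r0 * H"
    by (rule power2_le_imp_le) (use r H0 in auto)
  moreover have "cmod (y$3) \<le> cmod (u * y$2) + cmod (u * y$2 - y$3)"
    using norm_triangle_ineq4[of "u * y$2" "u * y$2 - y$3"] by simp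
  moreover have "cmod (u * y$2) \<le> M * (A * H)" unfolding norm_mult using 2 M M0 by (intro mult_mono) auto
  ultimately show 3: "cmod (y$3) \<le> B * H" by (simp add: A_def B_def algebra_simps)
  have "cnj (y$1) = h - v * cnj (y$2) - u * cnj (y$3)" by (simp add: h)
  then have "cmod (y$1) = cmod (h - v * cnj (y$2) - u * cnj (y$3))" by (metis complex_mod_cnj)
  also have "\<dots> \<le> H + cmod (v * cnj (y$2)) + cmod (u * cnj (y$3))"
    unfolding H using norm_triangle_ineq4[of "h - v * cnj (y$2)" "u * cnj (y$3)"]
      norm_triangle_ineq4[of h "v * cnj (y$2)"] by linarith
  also have "\<dots> \<le> H + M * (A * H) + M * (B * H)"
    unfolding norm_mult complex_mod_cnj using 2 3 M M0 by (intro add_mono mult_mono) auto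
  finally show "cmod (y$1) \<le> (1 + M * A + M * B) * H" by (simp add: algebra_simps)
qed

text \<open>12 = 3 * 4: each 1 + |y_i| is at most a multiple of |h|, so |h|^12 dominates the three
  fourth powers in \<open>vec_wt\<close>; the remaining factor |h|^(k - 12) is bounded below by a
  power of a constant.\<close>

lemma iso_term_bound:
  assumes r: "r0 > 0" and M: "M \<ge> 0"
  obtains C where "C > 0" "\<And>u v y k. y \<in> iso_vecs \<Longrightarrow> 2 * Re v + (cmod u)\<^sup>2 \<le> - r0 \<Longrightarrow> cmod u \<le> M \<Longrightarrow> cmod v \<le> M
    \<Longrightarrow> k \<ge> 12 \<Longrightarrow> herm (lift (u, v)) y \<noteq> 0 \<and> cmod (inverse (herm (lift (u, v)) y) ^ k) \<le> C ^ k * vec_wt y"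
proof -
  define A B where "A = 2 / r0" and "B = M * (2 / r0) + 2 / sqrt r0"
  define C0 where "C0 = 1 + M * A + M * B + A + B"
  have AB: "A > 0" "B > 0" using r M by (auto simp: A_def B_def add_nonneg_pos)
  have C0: "C0 \<ge> 1" using AB M by (auto simp: C0_def)
  show ?thesis
  proof (rule that[of "2 * C0"])
    show "2 * C0 > 0" using C0 by simp
    fix u v y and k :: nat
    assume y: "y \<in> iso_vecs" and h: "2 * Re v + (cmod u)\<^sup>2 \<le> - r0" "cmod u \<le> M" "cmod v \<le> M" and k: "k \<ge> 12"
    define H where "H = cmod (herm (lift (u, v)) y)"
    have H0: "H \<ge> 0" by (simp add: H_def)
    have hy: "herm y y = 0" using y by (simp add: iso_vecs_def)
    note ib = iso_bound[OF hy r h, folded H_def A_def B_def]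
    have yi: "cmod (y$i) \<le> C0 * H" for i
    proof -
      have "A * H \<le> C0 * H" "B * H \<le> C0 * H" "(1 + M * A + M * B) * H \<le> C0 * H"
        using H0 AB M by (intro mult_right_mono; auto simp: C0_def)+
      then show ?thesis using ib exhaust_3[of i] by (auto intro: order_trans)
    qed
    \<comment> \<open>A nonzero coordinate has modulus at least 1, which keeps |h| away from
      0.\<close>
    obtain i where "y$i \<noteq> 0" using y by (auto simp: iso_vecs_def vec_eq_iff)
    then have "1 \<le> cmod (y$i)" using y O_F_norm_ge_1 by (auto simp: iso_vecs_def)
    then have H1: "1 \<le> C0 * H" using yi order_trans by blast
    then have Hp: "H > 0" using C0 H0 by (cases "H = 0") auto
    have X: "1 + cmod (y$i) \<le> 2 * C0 * H" for i using H1 yi[of i] by simp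
    have "((1 + cmod (y$1))^4 * ((1 + cmod (y$2))^4 * (1 + cmod (y$3))^4)) * 1
        \<le> ((2 * C0 * H)^4 * ((2 * C0 * H)^4 * (2 * C0 * H)^4)) * (2 * C0 * H)^(k - 12)"
      by (intro mult_mono power_mono X one_le_power) (use H1 Hp C0 in \<open>auto intro!: mult_nonneg_nonneg\<close>)
    also have "\<dots> = (2 * C0)^k * H^k"
    proof -
      have "((2 * C0 * H)^4 * ((2 * C0 * H)^4 * (2 * C0 * H)^4)) * (2 * C0 * H)^(k - 12) = (2 * C0 * H)^(4 + (4 + 4) + (k - 12))"
        by (simp only: power_add)
      also have "4 + (4 + 4) + (k - 12) = k" using k by simp
      finally show ?thesis by (simp add: power_mult_distrib)
    qed
    finally have "1 / ((2 * C0)^k * H^k) \<le> 1 / ((1 + cmod (y$1))^4 * ((1 + cmod (y$2))^4 * (1 + cmod (y$3))^4))"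
      by (intro divide_left_mono) (use Hp C0 in \<open>auto intro!: mult_pos_pos zero_less_power add_pos_nonneg\<close>)
    then have "1 / H^k \<le> (2 * C0)^k * vec_wt y"
      using Hp C0 by (simp add: vec_wt_def lat_wt_def field_simps)
    then show "herm (lift (u, v)) y \<noteq> 0 \<and> cmod (inverse (herm (lift (u, v)) y) ^ k) \<le> (2 * C0) ^ k * vec_wt y"
      using Hp by (auto simp: H_def norm_power norm_inverse divide_inverse power_inverse)
  qed
qed

definition eis :: "nat \<Rightarrow> scalar_fun" where
  "eis k = (\<lambda>b. if b \<in> Ball2 then \<Sum>\<^sub>\<infinity>y\<in>iso_vecs. inverse (herm (lift b) y) ^ k else 0)"

lemma iso_term_point:
  assumes "b \<in> Ball2"
  obtains C where "C > 0" "\<And>y k. y \<in> iso_vecs \<Longrightarrow> k \<ge> 12 \<Longrightarrow>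
    herm (lift b) y \<noteq> 0 \<and> cmod (inverse (herm (lift b) y) ^ k) \<le> C ^ k * vec_wt y"
proof -
  obtain u v where b: "b = (u, v)" by (cases b)
  have r: "- (2 * Re v + (cmod u)\<^sup>2) > 0" using assms by (simp add: b Ball2_iff)
  obtain C where "C > 0" "\<And>u' v' y k. y \<in> iso_vecs \<Longrightarrow> 2 * Re v' + (cmod u')\<^sup>2 \<le> - (- (2 * Re v + (cmod u)\<^sup>2)) \<Longrightarrow>
      cmod u' \<le> max (cmod u) (cmod v) \<Longrightarrow> cmod v' \<le> max (cmod u) (cmod v)
    \<Longrightarrow> k \<ge> 12 \<Longrightarrow> herm (lift (u', v')) y \<noteq> 0 \<and> cmod (inverse (herm (lift (u', v')) y) ^ k) \<le> C ^ k * vec_wt y"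
    by (rule iso_term_bound[OF r, of "max (cmod u) (cmod v)"]) (auto simp: max_def)
  then show ?thesis using that[of C] by (auto simp: b)
qed

lemma eis_summable:
  assumes "b \<in> Ball2" "k \<ge> 12"
  shows "(\<lambda>y. cmod (inverse (herm (lift b) y) ^ k)) summable_on iso_vecs"
    "(\<lambda>y. inverse (herm (lift b) y) ^ k) summable_on iso_vecs"
proof -
  obtain C where C: "\<And>y. y \<in> iso_vecs \<Longrightarrow> cmod (inverse (herm (lift b) y) ^ k) \<le> C ^ k * vec_wt y"
    using iso_term_point[OF assms(1)] assms(2) by metis
  show "(\<lambda>y. cmod (inverse (herm (lift b) y) ^ k)) summable_on iso_vecs"
    by (rule summable_on_comparison_test[OF summable_on_cmult_right[OF summable_vec_wt, of "C ^ k"]]) (use C in auto)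
  then show "(\<lambda>y. inverse (herm (lift b) y) ^ k) summable_on iso_vecs" by (rule abs_summable_summable)
qed

lemma hol2_eis:
  assumes k: "k \<ge> 12"
  shows "eis k holomorphic2_on Ball2"
proof (rule hol2_locally[OF open_Ball2])
  fix p assume "p \<in> Ball2"
  then obtain a c where p: "p = (a, c)" "(a, c) \<in> Ball2" by (cases p) auto
  obtain r where r: "r > 0" "cball a r \<times> cball c r \<subseteq> Ball2" by (rule box_in_open[OF open_Ball2 p(2)])
  define Q where "Q = cball a r \<times> cball c r"
  have Q: "compact Q" "Q \<subseteq> Ball2" "(a, c) \<in> Q" using r by (auto simp: Q_def compact_Times)
  \<comment> \<open>The maximum of 2 Re v + |u|^2 on the compact box provides a uniform gap
    \<open>r0\<close> for the M-test.\<close>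
  have "continuous_on Q (\<lambda>p. 2 * Re (snd p) + (cmod (fst p))\<^sup>2)" by (intro continuous_intros)
  from continuous_attains_sup[OF Q(1) _ this] Q(3)
  have "\<exists>x\<in>Q. \<forall>y\<in>Q. 2 * Re (snd y) + (cmod (fst y))\<^sup>2 \<le> 2 * Re (snd x) + (cmod (fst x))\<^sup>2" by blast
  then obtain q where q: "q \<in> Q" "\<And>p. p \<in> Q \<Longrightarrow> 2 * Re (snd p) + (cmod (fst p))\<^sup>2 \<le> 2 * Re (snd q) + (cmod (fst q))\<^sup>2" by blast
  define r0 where "r0 = - (2 * Re (snd q) + (cmod (fst q))\<^sup>2)"
  have r0: "r0 > 0" using subsetD[OF Q(2) q(1)] by (cases q) (simp add: r0_def Ball2_iff)
  define M where "M = cmod a + cmod c + r"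
  have M: "M \<ge> 0" using r by (simp add: M_def)
  have bM: "cmod u \<le> M" "cmod v \<le> M" if "(u, v) \<in> Q" for u v
  proof -
    have "cmod (u - a) \<le> r" "cmod (v - c) \<le> r" using that by (auto simp: Q_def dist_norm norm_minus_commute)
    then show "cmod u \<le> M" "cmod v \<le> M" unfolding M_def
      using norm_triangle_sub[of u a] norm_triangle_sub[of v c] norm_ge_zero[of a] norm_ge_zero[of c]
      by linarith+
  qed
  obtain C where C: "\<And>u v y. y \<in> iso_vecs \<Longrightarrow> 2 * Re v + (cmod u)\<^sup>2 \<le> - r0 \<Longrightarrow> cmod u \<le> M \<Longrightarrow> cmod v \<le> M
    \<Longrightarrow> herm (lift (u, v)) y \<noteq> 0 \<and> cmod (inverse (herm (lift (u, v)) y) ^ k) \<le> C ^ k * vec_wt y"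
    using iso_term_bound[OF r0 M] k by metis
  have C': "herm (lift b) y \<noteq> 0" "cmod (inverse (herm (lift b) y) ^ k) \<le> C ^ k * vec_wt y" if "y \<in> iso_vecs" "b \<in> Q" for y b
    using C[of y "snd b" "fst b"] q(2)[OF that(2)] bM[of "fst b" "snd b"] that by (auto simp: r0_def)
  define T where "T = ball a r \<times> ball c r"
  have T: "open T" "T \<subseteq> Q" "p \<in> T" using r p by (auto simp: T_def Q_def open_Times)
  have "uniform_limit T (\<lambda>X b. \<Sum>y\<in>X. inverse (herm (lift b) y) ^ k) (\<lambda>b. \<Sum>\<^sub>\<infinity>y\<in>iso_vecs. inverse (herm (lift b) y) ^ k)
      (finite_subsets_at_top iso_vecs)"
    by (rule Weierstrass_m_test_general[OF _ summable_on_cmult_right[OF summable_vec_wt, of "C ^ k"]])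
      (use C' T(2) in auto)
  then have ul: "uniform_limit T (\<lambda>X b. \<Sum>y\<in>X \<inter> iso_vecs. inverse (herm (lift b) y) ^ k) (\<lambda>b. \<Sum>\<^sub>\<infinity>y\<in>iso_vecs. inverse (herm (lift b) y) ^ k)
      (finite_subsets_at_top iso_vecs)"
    by (rule uniform_limit_cong[THEN iffD1, rotated -1])
      (auto intro!: eventually_finite_subsets_at_top_weakI simp: Int_absorb2)
  have "(\<lambda>b. \<Sum>\<^sub>\<infinity>y\<in>iso_vecs. inverse (herm (lift b) y) ^ k) holomorphic2_on T"
  proof (rule hol2_uniform_limit[OF T(1) _ ul])
    have "(\<lambda>b. inverse (herm (lift b) y) ^ k) holomorphic2_on T" if "y \<in> iso_vecs" for y
      using C'(1)[OF that] T(2) unfolding herm_def lift_nth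
      by (intro hol2_power hol2_inverse hol2_intros T) auto
    then show "(\<lambda>b. \<Sum>y\<in>X \<inter> iso_vecs. inverse (herm (lift b) y) ^ k) holomorphic2_on T" for X
      by (intro hol2_sum) auto
  qed simp
  moreover have "eis k b = (\<Sum>\<^sub>\<infinity>y\<in>iso_vecs. inverse (herm (lift b) y) ^ k)" if "b \<in> T" for b
    using subsetD[OF Q(2) subsetD[OF T(2) that]] by (simp add: eis_def)
  ultimately have "eis k holomorphic2_on T"
    by (simp only: hol2_cong[of T "eis k"])
  then show "\<exists>T. open T \<and> p \<in> T \<and> eis k holomorphic2_on T" using T by blast
qed

text \<open>The inverse of \<open>g\<close> permutes \<open>iso_vecs\<close>, and herm (lift b)
  (g^-1 y) = j1 g b * herm (lift (act g b)) y.\<close>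

lemma eis_act:
  assumes g: "g \<in> \<Gamma>" and b: "b \<in> Ball2"
  shows "eis k (act g b) = j1 g b powi (int k) * eis k b"
proof -
  define h where "h = matrix_inv g"
  have h: "h \<in> \<Gamma>" "g ** h = mat 1" "h ** g = mat 1" unfolding h_def by (rule Gamma_inv[OF g])+
  have iso: "x *v y \<in> iso_vecs" if x: "x \<in> \<Gamma>" "y \<in> iso_vecs" for x y
  proof -
    have "matrix_inv x *v (x *v y) = y" by (simp add: matrix_vector_mul_assoc Gamma_inv[OF x(1)])
    moreover have "y \<noteq> 0" using x(2) by (simp add: iso_vecs_def)
    ultimately have "x *v y \<noteq> 0" by auto
    moreover have "(x *v y)$i \<in> O_F" for i
      unfolding mv3 using x Gamma_entry[OF x(1)] by (intro O_F_add O_F_mult) (auto simp: iso_vecs_def)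
    ultimately show ?thesis using x Gamma_herm[OF x(1)] by (simp add: iso_vecs_def)
  qed
  have bij: "bij_betw (\<lambda>y. h *v y) iso_vecs iso_vecs"
    by (rule bij_betw_byWitness[where f' = "\<lambda>y. g *v y"])
      (use iso g h in \<open>auto simp: matrix_vector_mul_assoc\<close>)
  note n = Gamma_act[OF g b]
  have t: "inverse (herm (lift (act g b)) y) ^ k = j1 g b ^ k * inverse (herm (lift b) (h *v y)) ^ k" for y
  proof -
    have "herm (lift b) (h *v y) = herm (g *v lift b) (g *v (h *v y))" by (rule Gamma_herm[OF g, symmetric])
    also have "\<dots> = herm (j1 g b *s lift (act g b)) (1 *s y)"
      by (simp add: matrix_vector_mul_assoc h act_lift n)
    also have "\<dots> = j1 g b * herm (lift (act g b)) y" unfolding herm_scale by simp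
    finally have e: "herm (lift b) (h *v y) = j1 g b * herm (lift (act g b)) y" .
    show ?thesis using n unfolding e by (simp add: power_mult_distrib field_simps)
  qed
  have "(\<Sum>\<^sub>\<infinity>y\<in>iso_vecs. inverse (herm (lift (act g b)) y) ^ k)
      = j1 g b ^ k * (\<Sum>\<^sub>\<infinity>y\<in>iso_vecs. inverse (herm (lift b) (h *v y)) ^ k)"
    unfolding t by (rule infsum_cmult_right')
  also have "(\<Sum>\<^sub>\<infinity>y\<in>iso_vecs. inverse (herm (lift b) (h *v y)) ^ k) = (\<Sum>\<^sub>\<infinity>y\<in>iso_vecs. inverse (herm (lift b) y) ^ k)"
    by (rule infsum_reindex_bij_betw[OF bij, of "\<lambda>y. inverse (herm (lift b) y) ^ k"])
  finally show ?thesis using n b by (simp add: eis_def)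
qed

lemma eis_MF: "k \<ge> 12 \<Longrightarrow> eis k \<in> scalar_MF (int k)"
  unfolding scalar_MF_iff using hol2_eis eis_act Gamma_cong_Gamma by (auto simp: eis_def)

section \<open>Functions of scalar weight\<close>

text \<open>Like \<open>scalar_MF\<close>, but without the convention that functions vanish outside
  the ball, so that constants qualify and products need no case distinction.\<close>

definition WM :: "int \<Rightarrow> scalar_fun \<Rightarrow> bool" where
  "WM k f \<longleftrightarrow> f holomorphic2_on Ball2 \<and> (\<forall>g\<in>\<Gamma>_cong. \<forall>b\<in>Ball2. f (act g b) = j1 g b powi k * f b)"

lemma WM_scalar_MF: "WM k f \<Longrightarrow> (\<lambda>b. if b \<in> Ball2 then f b else 0) \<in> scalar_MF k"
  using Gamma_act(2) Gamma_cong_Gamma hol2_cong[of Ball2 f "\<lambda>b. if b \<in> Ball2 then f b else 0"]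
  unfolding scalar_MF_iff WM_def by simp

lemma scalar_MF_WM: "f \<in> scalar_MF k \<Longrightarrow> WM k f"
  unfolding scalar_MF_iff WM_def by blast

lemma WM_hol: "WM k f \<Longrightarrow> f holomorphic2_on Ball2"
  by (simp add: WM_def)

lemma WM_add: "WM k f \<Longrightarrow> WM k g \<Longrightarrow> WM k (\<lambda>b. f b + g b)"
  unfolding WM_def by (auto intro: hol2_add simp: algebra_simps)

lemma WM_mult: "WM k f \<Longrightarrow> WM l g \<Longrightarrow> WM (k + l) (\<lambda>b. f b * g b)"
  unfolding WM_def
  using Gamma_act(1) Gamma_cong_Gamma by (auto intro: hol2_mult simp: power_int_add)

lemma WM_const: "WM 0 (\<lambda>b. c)"
  unfolding WM_def by simp

lemma WM_zero: "WM k (\<lambda>b. 0)"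
  unfolding WM_def by simp

lemma WM_cmult: "WM k f \<Longrightarrow> WM k (\<lambda>b. c * f b)"
  using WM_mult[OF WM_const[of c], of k f] by simp

lemma WM_diff: "WM k f \<Longrightarrow> WM k g \<Longrightarrow> WM k (\<lambda>b. f b - g b)"
  using WM_add[of k f "\<lambda>b. (-1) * g b"] WM_cmult[of k g "-1"] by simp

lemma WM_power: "WM k f \<Longrightarrow> WM (int n * k) (\<lambda>b. f b ^ n)"
proof (induction n)
  case 0
  then show ?case using WM_const[of 1] by simp
next
  case (Suc n)
  have "WM (k + int n * k) (\<lambda>b. f b * f b ^ n)" using Suc by (intro WM_mult)
  then show ?case by (simp add: algebra_simps)
qed

lemma WM_sum: "(\<And>i. i \<in> I \<Longrightarrow> WM k (f i)) \<Longrightarrow> WM k (\<lambda>b. \<Sum>i\<in>I. f i b)"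
  by (induction I rule: infinite_finite_induct) (auto intro: WM_add WM_zero)

lemma WM_slash:
  assumes f: "WM k f" and h: "h \<in> \<Gamma>"
  shows "WM k (\<lambda>b. j1 h b powi (- k) * f (act h b))"
proof -
  have "j1 h (act g b) powi (- k) * f (act h (act g b)) = j1 g b powi k * (j1 h b powi (- k) * f (act h b))"
    if g: "g \<in> \<Gamma>_cong" and b: "b \<in> Ball2" for g b
  proof -
    have gG: "g \<in> \<Gamma>" by (rule Gamma_cong_Gamma[OF g])
    define c where "c = h ** g ** matrix_inv h"
    have c: "c \<in> \<Gamma>_cong" unfolding c_def by (rule Gamma_cong_conj[OF h g])
    have cG: "c \<in> \<Gamma>" by (rule Gamma_cong_Gamma[OF c])
    have "c ** h = h ** g ** (matrix_inv h ** h)" by (simp add: c_def matrix_mul_assoc)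
    then have ch: "c ** h = h ** g" by (simp add: Gamma_inv[OF h])
    have gb: "act g b \<in> Ball2" and hb: "act h b \<in> Ball2" using Gamma_act b gG h by auto
    have 1: "act h (act g b) = act c (act h b)"
      using j1_act_mult(2)[OF gG b h] j1_act_mult(2)[OF h b cG] ch by simp
    have 2: "j1 h (act g b) * j1 g b = j1 c (act h b) * j1 h b"
      using j1_act_mult(1)[OF gG b, of h] j1_act_mult(1)[OF h b, of c] ch by simp
    note nz = Gamma_act(1)[OF h gb] Gamma_act(1)[OF gG b] Gamma_act(1)[OF cG hb] Gamma_act(1)[OF h b]
    have "j1 c (act h b) = j1 h (act g b) * j1 g b / j1 h b" using 2 nz by (simp add: field_simps)
    then have 3: "j1 c (act h b) powi k = j1 h (act g b) powi k * j1 g b powi k * j1 h b powi (- k)"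
      by (simp add: power_int_mult_distrib power_int_divide_distrib power_int_minus divide_inverse power_int_inverse)
    have "f (act c (act h b)) = j1 c (act h b) powi k * f (act h b)"
      using f c hb unfolding WM_def by blast
    then show ?thesis unfolding 1 using nz by (simp add: 3 power_int_minus)
  qed
  moreover have "(\<lambda>b. j1 h b powi (- k) * f (act h b)) holomorphic2_on Ball2"
    by (intro hol2_mult hol2_powi hol2_j1 open_Ball2 Gamma_act(1)[OF h] hol2_compose_act[OF h] WM_hol[OF f])
  ultimately show ?thesis unfolding WM_def by blast
qed

lemma three_eq_0: "(3::3) = 0" by simp
lemma four_neq: "(1::4) \<noteq> 2" "(1::4) \<noteq> 3" "(1::4) \<noteq> 4" "(2::4) \<noteq> 3" "(2::4) \<noteq> 4" "(3::4) \<noteq> 4"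
  by simp_all

lemma nabla_mult:
  assumes "f holomorphic2_on Ball2" "g holomorphic2_on Ball2" "b \<in> Ball2"
  shows "nabla (\<lambda>b. f b * g b) b = f b *s nabla g b + g b *s nabla f b"
proof -
  obtain u v where b: "b = (u, v)" by (cases b)
  note f = hol2_partials(1,2)[OF hol2_has_derivative[OF assms(1) open_Ball2 assms(3), unfolded b]]
  note g = hol2_partials(1,2)[OF hol2_has_derivative[OF assms(2) open_Ball2 assms(3), unfolded b]]
  have "d_u (\<lambda>b. f b * g b) b = f b * d_u g b + g b * d_u f b"
    using DERIV_imp_deriv[OF DERIV_mult[OF f(1) g(1)]] unfolding b by (subst d_u_def) (simp add: algebra_simps)
  moreover have "d_v (\<lambda>b. f b * g b) b = f b * d_v g b + g b * d_v f b"
    using DERIV_imp_deriv[OF DERIV_mult[OF f(2) g(2)]] unfolding b by (subst d_v_def) (simp add: algebra_simps)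
  ultimately show ?thesis by (simp add: nabla_def vec_eq_iff forall_2)
qed

lemma nabla_lin:
  assumes "f holomorphic2_on Ball2" "g holomorphic2_on Ball2" "b \<in> Ball2"
  shows "nabla (\<lambda>b. s * f b + t * g b) b = s *s nabla f b + t *s nabla g b"
proof -
  obtain u v where b: "b = (u, v)" by (cases b)
  note f = hol2_partials(1,2)[OF hol2_has_derivative[OF assms(1) open_Ball2 assms(3), unfolded b]]
  note g = hol2_partials(1,2)[OF hol2_has_derivative[OF assms(2) open_Ball2 assms(3), unfolded b]]
  have "d_u (\<lambda>b. s * f b + t * g b) b = s * d_u f b + t * d_u g b"
    using DERIV_imp_deriv[OF DERIV_add[OF DERIV_cmult[OF f(1)] DERIV_cmult[OF g(1)]]] unfolding b
    by (subst d_u_def) simp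
  moreover have "d_v (\<lambda>b. s * f b + t * g b) b = s * d_v f b + t * d_v g b"
    using DERIV_imp_deriv[OF DERIV_add[OF DERIV_cmult[OF f(2)] DERIV_cmult[OF g(2)]]] unfolding b
    by (subst d_v_def) simp
  ultimately show ?thesis by (simp add: nabla_def vec_eq_iff forall_2)
qed

lemma uncountable_half_plane: "uncountable {v. Re v < 0}"
proof
  assume "countable {v. Re v < 0}"
  moreover have "ball (-1) 1 \<subseteq> {v. Re v < 0}"
  proof
    fix v :: complex assume "v \<in> ball (-1) 1"
    then have "cmod (v + 1) < 1" by (simp add: dist_norm norm_minus_commute)
    then have "\<bar>Re (v + 1)\<bar> < 1" using abs_Re_le_cmod[of "v + 1"] by linarith
    then show "v \<in> {v. Re v < 0}" by auto
  qed
  ultimately have "countable (ball (-1 :: complex) 1)" using countable_subset by blast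
  then show False using uncountable_ball[of 1 "-1 :: complex"] by simp
qed

section \<open>Consequences of the structure of the ring of scalar-valued forms\<close>

locale generators =
  fixes e :: complex and \<phi> :: "3 \<Rightarrow> scalar_fun"
  assumes e: "e = 1 \<or> e = - 1" and sg: "standard_generators e \<phi>"
begin

abbreviation X :: "4 \<Rightarrow> scalar_fun" where "X \<equiv> x_form \<phi>"

lemma phi_MF: "\<phi> i \<in> scalar_MF 3"
  using sg by (auto simp: standard_generators_def)

lemma phi_WM: "WM 3 (\<phi> i)"
  by (rule scalar_MF_WM[OF phi_MF])

lemma phi_hol: "\<phi> i holomorphic2_on Ball2"
  by (rule WM_hol[OF phi_WM])

lemma X_eqs:
  "X 1 b = \<phi> 0 b + \<phi> 1 b + \<phi> 2 b" "X 2 b = - 3 * \<phi> 0 b + \<phi> 1 b + \<phi> 2 b"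
  "X 3 b = \<phi> 0 b - 3 * \<phi> 1 b + \<phi> 2 b" "X 4 b = \<phi> 0 b + \<phi> 1 b - 3 * \<phi> 2 b"
  by (simp_all add: x_form_def)

lemma X_lin: obtains p q r where "\<And>b. X i b = p * \<phi> 0 b + q * \<phi> 1 b + r * \<phi> 2 b"
proof -
  have "\<exists>p q r. \<forall>b. X i b = p * \<phi> 0 b + q * \<phi> 1 b + r * \<phi> 2 b"
  proof -
    consider "i = 1" | "i = 2" | "i = 3" | "i = 4" using exhaust_4[of i] by blast
    then show ?thesis
    proof cases
      case 1 show ?thesis by (rule exI[of _ 1], rule exI[of _ 1], rule exI[of _ 1]) (simp add: 1 X_eqs)
    next
      case 2 show ?thesis by (rule exI[of _ "-3"], rule exI[of _ 1], rule exI[of _ 1]) (simp add: 2 X_eqs)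
    next
      case 3 show ?thesis by (rule exI[of _ 1], rule exI[of _ "-3"], rule exI[of _ 1]) (simp add: 3 X_eqs)
    next
      case 4 show ?thesis by (rule exI[of _ 1], rule exI[of _ 1], rule exI[of _ "-3"]) (simp add: 4 X_eqs)
    qed
  qed
  then show ?thesis using that by blast
qed

lemma X_WM: "WM 3 (X i)"
proof -
  obtain p q r where "\<forall>b. X i b = p * \<phi> 0 b + q * \<phi> 1 b + r * \<phi> 2 b" using X_lin[of i] by blast
  then have "X i = (\<lambda>b. p * \<phi> 0 b + q * \<phi> 1 b + r * \<phi> 2 b)" by auto
  then show ?thesis by (auto intro!: WM_add WM_cmult phi_WM)
qed

lemma X_hol: "X i holomorphic2_on Ball2"
  by (rule WM_hol[OF X_WM])

lemma phi_X: "\<phi> 0 b = (X 1 b - X 2 b) / 4" "\<phi> 1 b = (X 1 b - X 3 b) / 4" "\<phi> 2 b = (X 1 b - X 4 b) / 4"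
  by (simp_all add: X_eqs)

definition mono :: "(3 \<Rightarrow> nat) \<Rightarrow> scalar_fun" where
  "mono x b = \<phi> 0 b ^ x 0 * \<phi> 1 b ^ x 1 * \<phi> 2 b ^ x 2"

lemma sum_3': "sum f (UNIV :: 3 set) = f 0 + f 1 + f 2"
  unfolding sum_3 three_eq_0 by (simp add: algebra_simps)

text \<open>Surjectivity of the substitution, read in a single weight: only monomials of degree n /
  3 occur.\<close>

lemma WM_polynomial:
  assumes "WM n f"
  obtains I p where "finite I" "\<And>x. x \<in> I \<Longrightarrow> n = 3 * int (x 0 + x 1 + x 2)"
    "\<And>b. b \<in> Ball2 \<Longrightarrow> f b = (\<Sum>x\<in>I. p x * mono x b)"
proof -
  define F where "F = (\<lambda>b. if b \<in> Ball2 then f b else 0)"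
  have F: "F \<in> scalar_MF n" unfolding F_def by (rule WM_scalar_MF[OF assms])
  have z: "0 \<in> scalar_MF k" for k unfolding scalar_MF_iff by (simp add: zero_fun_def)
  have "homogeneous n F \<in> M_ring"
    using F z by (auto simp: M_ring_def dsum_def homogeneous_def)
  then obtain p where p: "p \<in> polynomials3" "subst_forms \<phi> p = homogeneous n F"
    using sg unfolding standard_generators_def bij_betw_def by (metis imageE)
  define I where "I = {x. p x \<noteq> 0 \<and> n = 3 * int (\<Sum>i\<in>UNIV. x i)}"
  show ?thesis
  proof (rule that[of I p])
    show "finite I" using p(1) by (rule_tac finite_subset[of _ "{x. p x \<noteq> 0}"]) (auto simp: I_def polynomials3_def)
    show "\<And>x. x \<in> I \<Longrightarrow> n = 3 * int (x 0 + x 1 + x 2)" by (simp add: I_def sum_3')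
    fix b assume b: "b \<in> Ball2"
    have "f b = homogeneous n F n b" using b by (simp add: homogeneous_def F_def)
    also have "\<dots> = (\<Sum>x\<in>I. p x * (\<Prod>i\<in>UNIV. \<phi> i b ^ x i))"
      unfolding p(2)[symmetric] subst_forms_def I_def using b by simp
    also have "\<dots> = (\<Sum>x\<in>I. p x * mono x b)"
      unfolding mono_def UNIV_3 three_eq_0 by (intro sum.cong refl) (simp add: mult_ac)
    finally show "f b = (\<Sum>x\<in>I. p x * mono x b)" .
  qed
qed

lemma WM_homogeneous:
  assumes "WM (3 * int d) f" "b \<in> Ball2" "b' \<in> Ball2" "\<And>i. \<phi> i b' = \<mu> * \<phi> i b"
  shows "f b' = \<mu> ^ d * f b"
proof -
  obtain I p where I: "finite I" "\<And>x. x \<in> I \<Longrightarrow> 3 * int d = 3 * int (x 0 + x 1 + x 2)"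
    "\<And>b. b \<in> Ball2 \<Longrightarrow> f b = (\<Sum>x\<in>I. p x * mono x b)"
    using WM_polynomial[OF assms(1)] by blast
  have "mono x b' = \<mu> ^ d * mono x b" if "x \<in> I" for x
  proof -
    have "d = x 0 + x 1 + x 2" using I(2)[OF that] by simp
    then show ?thesis by (simp add: mono_def assms(4) power_mult_distrib power_add mult_ac)
  qed
  then show ?thesis by (simp add: I(3) assms sum_distrib_left mult_ac)
qed

lemma WM_0_const:
  assumes "WM 0 f" obtains c where "\<And>b. b \<in> Ball2 \<Longrightarrow> f b = c"
proof -
  obtain I p where I: "finite I" "\<And>x. x \<in> I \<Longrightarrow> 0 = 3 * int (x 0 + x 1 + x 2)"
    "\<And>b. b \<in> Ball2 \<Longrightarrow> f b = (\<Sum>x\<in>I. p x * mono x b)"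
    using WM_polynomial[OF assms] by blast
  have "mono x b = 1" if "x \<in> I" for x b
  proof -
    have "x 0 = 0 \<and> x 1 = 0 \<and> x 2 = 0" using I(2)[OF that] by auto
    then show ?thesis by (simp add: mono_def)
  qed
  then show ?thesis using that[of "\<Sum>x\<in>I. p x"] I(3) by simp
qed

section \<open>Countability of the fibres of (phi_0 : phi_1 : phi_2)\<close>

definition fiber :: "complex \<Rightarrow> complex \<Rightarrow> complex \<Rightarrow> (complex \<times> complex) set" where
  "fiber p q r = {b \<in> Ball2. \<exists>\<mu>. \<phi> 0 b = \<mu> * p \<and> \<phi> 1 b = \<mu> * q \<and> \<phi> 2 b = \<mu> * r}"

text \<open>Sixth powers are natural here: the six units of O_F act on \<open>iso_vecs\<close> and
  scale \<open>herm\<close> by units, so the sums cancel in weights not divisible by 6. The bound m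
  >= 2 is the convergence condition 12 <= 6 m.\<close>

lemma eis_power_sums:
  assumes "b \<in> Ball2" "m \<ge> 2"
  shows "((\<lambda>y. (inverse (herm (lift b) y) ^ 6) ^ m) has_sum eis (6 * m) b) iso_vecs"
  using eis_summable(2)[OF assms(1), of "6 * m"] assms by (simp add: eis_def power_mult)

lemma eis_WM: "m \<ge> 2 \<Longrightarrow> WM (3 * int (2 * m)) (eis (6 * m))"
  using scalar_MF_WM[OF eis_MF[of "6 * m"]] by simp

text \<open>At (u, v) these vectors have the values 1, v and v + u + cnj \<rho> under
  \<open>herm\<close>, from which the point can be recovered.\<close>

lemma special_iso:
  "vector [1, 0, 0] \<in> iso_vecs" "vector [0, 1, 0] \<in> iso_vecs" "vector [\<rho>, 1, 1] \<in> iso_vecs"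
  by (auto simp: iso_vecs_def forall_3 herm_def vec3_eq_iff cnj_rho intro: O_F_intros)

text \<open>\<open>eis (6 m)\<close> is homogeneous of degree 2 m in the phi_i, so the families
  \<mu>^2 h^-6 at \<open>b\<close> and h^-6 at \<open>b'\<close> have equal power sums, and each
  value of the latter occurs in the former. These values are nonzero, which excludes \<mu> =
  0.\<close>

lemma eis_values:
  assumes b: "b \<in> Ball2" "b' \<in> Ball2" and \<mu>: "\<And>i. \<phi> i b' = \<mu> * \<phi> i b" and y: "y \<in> iso_vecs"
  shows "\<exists>x\<in>iso_vecs. inverse (herm (lift b') y) ^ 6 = \<mu>^2 * inverse (herm (lift b) x) ^ 6" "\<mu> \<noteq> 0"
proof -
  have ps: "\<exists>s. ((\<lambda>x. (\<mu>^2 * inverse (herm (lift b) x) ^ 6) ^ m) has_sum s) iso_vecs \<and>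
      ((\<lambda>x. (inverse (herm (lift b') x) ^ 6) ^ m) has_sum s) iso_vecs" if m: "m \<ge> 2" for m
  proof -
    have "eis (6 * m) b' = \<mu> ^ (2 * m) * eis (6 * m) b" by (rule WM_homogeneous[OF eis_WM[OF m] b \<mu>])
    then have "((\<lambda>x. (inverse (herm (lift b') x) ^ 6) ^ m) has_sum (\<mu>^2) ^ m * eis (6 * m) b) iso_vecs"
      using eis_power_sums[OF b(2) m] by (simp add: power_mult)
    moreover have "((\<lambda>x. (\<mu>^2) ^ m * (inverse (herm (lift b) x) ^ 6) ^ m) has_sum (\<mu>^2) ^ m * eis (6 * m) b) iso_vecs"
      by (intro has_sum_cmult_right eis_power_sums[OF b(1) m])
    ultimately show ?thesis by (intro exI[of _ "(\<mu>^2) ^ m * eis (6 * m) b"]) (simp add: power_mult_distrib)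
  qed
  have sq: "(\<lambda>x. cmod (inverse (herm (lift b) x) ^ 6) ^ 2) summable_on iso_vecs" if "b \<in> Ball2" for b
    using eis_summable(1)[OF that, of 12] by (simp add: norm_power flip: power_mult)
  have sm1: "(\<lambda>x. cmod (\<mu>^2 * inverse (herm (lift b) x) ^ 6) ^ 2) summable_on iso_vecs"
    using summable_on_cmult_right[OF sq[OF b(1)], of "cmod (\<mu>^2) ^ 2"] by (simp add: norm_mult power_mult_distrib)
  have nz: "inverse (herm (lift b') y) ^ 6 \<noteq> 0"
    using iso_term_point[OF b(2)] y by (metis inverse_nonzero_iff_nonzero order_refl power_not_zero)
  show ex: "\<exists>x\<in>iso_vecs. inverse (herm (lift b') y) ^ 6 = \<mu>^2 * inverse (herm (lift b) x) ^ 6"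
    using power_sums_values[OF ps sm1 sq[OF b(2)] nz y refl] by metis
  show "\<mu> \<noteq> 0" using ex nz by auto
qed

text \<open>If all phi_i vanished at \<open>b\<close>, \<open>eis_values\<close> would apply to b' =
  b with \<mu> = 0.\<close>

lemma phi_nonzero: assumes "b \<in> Ball2" shows "\<exists>i. \<phi> i b \<noteq> 0"
  using eis_values(2)[OF assms assms, of 0] special_iso(1) by (metis mult_zero_left)

lemma countable_iso_vecs: "countable iso_vecs"
proof -
  have "O_F = (\<lambda>(a, b). of_int a + of_int b * \<rho>) ` UNIV" by (auto simp: O_F_def image_iff)
  then have "countable O_F" by (metis countableI_type countable_image)
  then have "countable ((\<lambda>(a, b, c). vector [a, b, c] :: complex^3) ` (O_F \<times> O_F \<times> O_F))" by auto
  moreover have "iso_vecs \<subseteq> (\<lambda>(a, b, c). vector [a, b, c] :: complex^3) ` (O_F \<times> O_F \<times> O_F)"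
  proof
    fix y assume "y \<in> iso_vecs"
    then show "y \<in> (\<lambda>(a, b, c). vector [a, b, c]) ` (O_F \<times> O_F \<times> O_F)"
      by (intro image_eqI[of _ _ "(y$1, y$2, y$3)"]) (auto simp: iso_vecs_def vec3_eq_iff)
  qed
  ultimately show ?thesis using countable_subset by blast
qed

lemma countable_roots: assumes "countable A" shows "countable {z::complex. z ^ 6 \<in> A}"
proof -
  have "{z::complex. z ^ 6 \<in> A} = (\<Union>a\<in>A. {z. z ^ 6 = a})" by auto
  moreover have "finite {z::complex. z ^ 6 = a}" for a
  proof -
    have "{z::complex. z ^ 6 = a} = {z. poly (monom 1 6 - [:a:]) z = 0}" by (simp add: poly_monom)
    moreover have "monom 1 6 - [:a:] \<noteq> (0 :: complex poly)"
      by (metis coeff_0 coeff_diff coeff_monom coeff_pCons_Suc diff_zero numeral_eq_Suc pred_numeral_simps(3) coeff_0 zero_neq_one)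
    ultimately show ?thesis using poly_roots_finite by metis
  qed
  ultimately show ?thesis using countable_UN[OF assms] countable_finite by (metis (no_types, lifting))
qed

text \<open>Fix a point \<open>b\<close> of the fibre. At any other point the vector (1, 0, 0)
  leaves countably many possibilities for \<mu>^2, and the two remaining special vectors determine v
  and v + u + cnj \<rho> up to countably many sixth roots.\<close>

lemma countable_fiber: "countable (fiber p q r)"
proof (cases "fiber p q r = {}")
  case False
  then obtain b \<nu> where b: "b \<in> Ball2" "\<phi> 0 b = \<nu> * p" "\<phi> 1 b = \<nu> * q" "\<phi> 2 b = \<nu> * r"
    by (auto simp: fiber_def)
  have \<nu>: "\<nu> \<noteq> 0" using phi_nonzero[OF b(1)] b exhaust_3 by (metis mult_zero_left three_eq_0)
  define V where "V = (\<lambda>x. inverse (herm (lift b) x) ^ 6) ` iso_vecs"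
  have V: "countable V" by (simp add: V_def countable_iso_vecs)
  define A where "A = (\<lambda>(x, y). inverse (x / y)) ` (V \<times> V)"
  define R where "R = {z::complex. z ^ 6 \<in> A}"
  have R: "countable R" unfolding R_def A_def by (intro countable_roots) (use V in auto)
  define S where "S = (\<lambda>(s, t). (s - t - cnj \<rho>, t)) ` (R \<times> R)"
  have S: "countable S" unfolding S_def using R by auto
  have "fiber p q r \<subseteq> S"
  proof
    fix b' assume "b' \<in> fiber p q r"
    then obtain \<nu>' where b': "b' \<in> Ball2" "\<phi> 0 b' = \<nu>' * p" "\<phi> 1 b' = \<nu>' * q" "\<phi> 2 b' = \<nu>' * r"
      by (auto simp: fiber_def)
    define \<mu> where "\<mu> = \<nu>' / \<nu>"
    have \<mu>: "\<phi> i b' = \<mu> * \<phi> i b" for i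
      using exhaust_3[of i, unfolded three_eq_0] \<nu> b b' by (auto simp: \<mu>_def)
    have ev: "\<exists>x\<in>V. inverse (herm (lift b') y) ^ 6 = \<mu>^2 * x" if "y \<in> iso_vecs" for y
      using eis_values(1)[OF b(1) b'(1) \<mu> that] by (auto simp: V_def)
    have h: "herm (lift b') (vector [1, 0, 0]) = 1" "herm (lift b') (vector [0, 1, 0]) = snd b'"
      "herm (lift b') (vector [\<rho>, 1, 1]) = snd b' + cnj \<rho> + fst b'" by (simp_all add: herm_def)
    obtain x0 where x0: "x0 \<in> V" "1 = \<mu>^2 * x0" using ev[OF special_iso(1)] by (auto simp: h)
    have m: "\<mu>^2 = inverse x0" using x0(2) by (metis inverse_unique mult.commute)
    have inR: "herm (lift b') y \<in> R" if y: "y \<in> iso_vecs" for y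
    proof -
      obtain x where x: "x \<in> V" "inverse (herm (lift b') y) ^ 6 = inverse x0 * x" using ev[OF y] by (auto simp: m)
      have "herm (lift b') y ^ 6 = inverse (x / x0)"
        using x(2) by (metis divide_inverse inverse_inverse_eq mult.commute power_inverse)
      then show ?thesis using x x0 by (auto simp: R_def A_def)
    qed
    have "snd b' \<in> R" "snd b' + cnj \<rho> + fst b' \<in> R" using inR[OF special_iso(2)] inR[OF special_iso(3)] by (simp_all add: h)
    then show "b' \<in> S" unfolding S_def by (intro image_eqI[of _ _ "(snd b' + cnj \<rho> + fst b', snd b')"]) (auto simp: prod_eq_iff)
  qed
  then show ?thesis using S countable_subset by blast
qed simp

end

section \<open>Order of vanishing along the mirror u = 0\<close>

text \<open>Where \<open>g\<close> is nonzero, \<open>r\<close> vanishes off a countable set, hence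
  everywhere by continuity, as discs are uncountable; the identity theorem extends this to the half
  plane.\<close>

lemma half_plane_zero:
  assumes r: "r holomorphic_on {v. Re v < 0}" and g: "g holomorphic_on {v. Re v < 0}"
    and C: "countable C" and v0: "Re v0 < 0" "g v0 \<noteq> 0"
    and z: "\<And>v. Re v < 0 \<Longrightarrow> v \<notin> C \<Longrightarrow> g v ^ m * r v = 0"
    and v: "Re v < 0"
  shows "r v = (0 :: complex)"
proof -
  define H where "H = {v. Re v < 0}"
  have H: "open H" "convex H" unfolding H_def by (auto intro: open_halfspace_Re_lt convex_halfspace_Re_lt)
  have cont: "continuous_on H r" "continuous_on H g"
    using r g by (auto simp: H_def intro: holomorphic_on_imp_continuous_on)
  define W where "W = H \<inter> g -` (- {0})"
  have W: "open W" unfolding W_def by (intro continuous_open_preimage cont H) auto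
  have rW: "r w = 0" if w: "w \<in> W" for w
  proof (rule ccontr)
    assume n: "r w \<noteq> 0"
    have "open (W \<inter> r -` (- {0}))"
      by (intro continuous_open_preimage continuous_on_subset[OF cont(1)] W) (auto simp: W_def)
    then obtain d where d: "d > 0" "ball w d \<subseteq> W \<inter> r -` (- {0})"
      using w n open_contains_ball by (metis ComplI IntI singletonD vimageI)
    have "uncountable (ball w d)" using d by (simp add: uncountable_ball)
    then obtain x where x: "x \<in> ball w d" "x \<notin> C" using C by (meson countable_subset subsetI)
    then have "x \<in> W" "r x \<noteq> 0" using d by auto
    then show False using z[of x] x by (auto simp: W_def H_def)
  qed
  show ?thesis
    by (rule analytic_continuation_open[of W H r "\<lambda>_. 0"])
      (use W H rW v0 v r convex_connected in \<open>auto simp: W_def H_def\<close>)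
qed

lemma hol2_axis:
  assumes "f holomorphic2_on Ball2"
  shows "(\<lambda>v. f (0, v)) holomorphic_on {v. Re v < 0}"
  by (rule hol2_curve[OF assms open_Ball2])
    (auto simp: Ball2_axis open_halfspace_Re_lt intro!: holomorphic_intros)

text \<open>Division by \<open>u\<close> can be continued while the quotient vanishes on the mirror.
  It must stop: on the slice through \<open>b1\<close> the function is not identically zero, so its
  order at u = 0 is finite.\<close>

lemma hol2_order:
  assumes f: "f holomorphic2_on Ball2" and b1: "b1 \<in> Ball2" "f b1 \<noteq> 0"
  obtains n h v0 where "h holomorphic2_on Ball2" "\<And>b. b \<in> Ball2 \<Longrightarrow> f b = fst b ^ n * h b"
    "Re v0 < 0" "h (0, v0) \<noteq> 0"
proof (rule ccontr)
  assume no: "\<not> thesis"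
  have all: "\<exists>h. h holomorphic2_on Ball2 \<and> (\<forall>b\<in>Ball2. f b = fst b ^ n * h b)" for n
  proof (induction n)
    case 0
    show ?case using f by (intro exI[of _ f]) simp
  next
    case (Suc n)
    then obtain h where h: "h holomorphic2_on Ball2" "\<And>b. b \<in> Ball2 \<Longrightarrow> f b = fst b ^ n * h b" by blast
    have "\<And>v. Re v < 0 \<Longrightarrow> h (0, v) = 0" using no that[OF h] by blast
    from hol2_div_u[OF h(1) this] obtain k where k: "k holomorphic2_on Ball2" "\<And>u v. (u, v) \<in> Ball2 \<Longrightarrow> h (u, v) = u * k (u, v)"
      by blast
    have "f b = fst b ^ Suc n * k b" if "b \<in> Ball2" for b
      using h(2)[OF that] k(2)[of "fst b" "snd b"] that by simp
    then show ?case using k(1) by blast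
  qed
  obtain u1 v1 where uv: "b1 = (u1, v1)" by (cases b1)
  define S where "S = {u. (u, v1) \<in> Ball2}"
  have "S = (\<lambda>u. (u, v1)) -` Ball2" by (auto simp: S_def)
  then have oS: "open S" by (auto intro!: open_vimage open_Ball2 continuous_intros)
  have cS: "connected S"
    using affine_line_Ball2(2)[of "(0, v1)" "(1, 0)"] by (simp add: S_def convex_connected)
  have "2 * Re v1 + (cmod u1)\<^sup>2 < 0" using b1 by (simp add: uv Ball2_iff)
  then have "Re v1 < 0" using zero_le_power2[of "cmod u1"] by linarith
  then have S: "0 \<in> S" "u1 \<in> S" using b1 by (auto simp: S_def uv Ball2_axis)
  have hol: "(\<lambda>u. k (u, v1)) holomorphic_on S" if "k holomorphic2_on Ball2" for k
    by (rule hol2_curve[OF that open_Ball2]) (use oS in \<open>auto simp: S_def intro!: holomorphic_intros\<close>)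
  show False
  proof (cases "f (0, v1) = 0")
    case False
    moreover have "Re v1 < 0" using S(1) by (simp add: S_def Ball2_axis)
    ultimately show False using no that[of f 0 v1] f by simp
  next
    case True
    have nc: "\<not> (\<lambda>u. f (u, v1)) constant_on S"
    proof
      assume "(\<lambda>u. f (u, v1)) constant_on S"
      then have "f (u1, v1) = f (0, v1)" using S unfolding constant_on_def by metis
      then show False using True b1 by (simp add: uv)
    qed
    obtain g r n where g: "0 < n" "0 < r" "ball 0 r \<subseteq> S" "g holomorphic_on ball 0 r"
      "\<And>w. w \<in> ball 0 r \<Longrightarrow> f (w, v1) = (w - 0)^n * g w" "\<And>w. w \<in> ball 0 r \<Longrightarrow> g w \<noteq> 0"
      using holomorphic_factor_zero_nonconstant[OF hol[OF f] oS cS S(1) True nc] by metis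
    \<comment> \<open>One division more than the order \<open>n\<close> on the slice permits; it
      would force g 0 = 0.\<close>
    obtain h where h: "h holomorphic2_on Ball2" "\<And>b. b \<in> Ball2 \<Longrightarrow> f b = fst b ^ Suc n * h b" using all[of "Suc n"] by blast
    have eq: "g w = w * h (w, v1)" if "w \<in> ball 0 r - {0}" for w
    proof -
      have "w ^ n * g w = w ^ n * (w * h (w, v1))"
        using g(5)[of w] h(2)[of "(w, v1)"] that g(3) by (auto simp: S_def)
      then show ?thesis using that by simp
    qed
    have "isCont g 0" using g(2,4) by (metis centre_in_ball continuous_on_eq_continuous_at holomorphic_on_imp_continuous_on open_ball)
    moreover have "isCont (\<lambda>w. w * h (w, v1)) 0"
      using holomorphic_on_imp_continuous_on[OF hol[OF h(1)]] oS S(1)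
      by (intro continuous_intros) (auto simp: continuous_on_eq_continuous_at)
    ultimately have t: "(g \<longlongrightarrow> g 0) (at 0)" "((\<lambda>w. w * h (w, v1)) \<longlongrightarrow> 0 * h (0, v1)) (at 0)"
      by (auto simp: isCont_def)
    have "eventually (\<lambda>w. w * h (w, v1) = g w) (at 0)"
      unfolding eventually_at using g(2) eq by (intro exI[of _ r]) auto
    then have "(g \<longlongrightarrow> 0 * h (0, v1)) (at 0)" by (rule Lim_transform_eventually[OF t(2)])
    then have "g 0 = 0" using tendsto_unique[OF _ t(1)] by simp
    then show False using g(2,6) by simp
  qed
qed

lemma hol2_u_nonzero: "(-1, -1) \<in> Ball2" "fst (-1 :: complex, -1 :: complex) \<noteq> 0"
  by (auto simp: Ball2_iff)

lemma hol2_eq_off_mirror: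
  assumes "f holomorphic2_on Ball2" "g holomorphic2_on Ball2"
    "\<And>b. b \<in> Ball2 \<Longrightarrow> fst b \<noteq> 0 \<Longrightarrow> f b = g b" "b \<in> Ball2"
  shows "f b = g b"
  by (rule hol2_eq_of_dense[OF hol2_fst hol2_u_nonzero open_Ball2 order_refl])
    (use assms hol2_imp_continuous_on in auto)

context generators
begin

section \<open>Permutations of the x_i by elements of the group\<close>

text \<open>Retains of \<open>h\<close> only its effect on the \<open>X i\<close>, a permutation and
  a sign. Elements of the congruence subgroup have \<open>id\<close> and 1
  (\<open>Tr_cong\<close>).\<close>

definition Tr :: "complex^3^3 \<Rightarrow> (4 \<Rightarrow> 4) \<Rightarrow> complex \<Rightarrow> bool" where
  "Tr h \<tau> s \<longleftrightarrow> h \<in> \<Gamma> \<and> s * s = 1 \<and> inj \<tau> \<and>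
    (\<forall>i. \<forall>b\<in>Ball2. X i (act h b) = s * j1 h b ^ 3 * X (\<tau> i) b)"

lemma X_outside: "b \<notin> Ball2 \<Longrightarrow> X i b = 0"
proof -
  assume b: "b \<notin> Ball2"
  have "\<phi> i b = 0" for i using phi_MF[of i] b unfolding scalar_MF_iff by blast
  then show ?thesis by (simp add: x_form_def)
qed

text \<open>The inverse appears because \<sigma> acts by slashing with g^-1.\<close>

lemma S4_Tr:
  assumes g: "g \<in> \<Gamma>1" and ind: "induces e g \<sigma>"
  shows "Tr (matrix_inv g) \<sigma> (of_int (sign \<sigma>))"
proof -
  have perm: "\<sigma> permutes UNIV" using ind by (simp add: induces_def)
  have gG: "matrix_inv g \<in> \<Gamma>" using g Gamma_inv(1) by (simp add: \<Gamma>1_def)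
  define s where "s = complex_of_int (sign \<sigma>)"
  have "X i (act (matrix_inv g) b) = s * j1 (matrix_inv g) b ^ 3 * X (\<sigma> i) b" if b: "b \<in> Ball2" for i b
  proof -
    have "S4_acts e 0 3 \<sigma> (as_vector (X i)) (vscale s (as_vector (X (\<sigma> i))))"
      using sg perm unfolding standard_generators_def s_def by blast
    then have "slash 0 3 (as_vector (X i)) (matrix_inv g) = vscale s (as_vector (X (\<sigma> i)))"
      using g ind unfolding S4_acts_def by blast
    also have "\<dots> = as_vector (\<lambda>b. s * X (\<sigma> i) b)" by (auto simp: vscale_def as_vector_def fun_eq_iff)
    finally have sl: "slash 0 3 (as_vector (X i)) (matrix_inv g) = as_vector (\<lambda>b. s * X (\<sigma> i) b)" .
    have "\<forall>b\<in>Ball2. X i (act (matrix_inv g) b) = j1 (matrix_inv g) b powi 3 * (s * X (\<sigma> i) b)"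
      by (subst slash_0_eq_iff[OF gG, symmetric]) (use sl X_outside in auto)
    then show ?thesis using b by (simp add: mult_ac)
  qed
  moreover have "s * s = 1" by (cases "sign \<sigma> = 1") (auto simp: s_def sign_def)
  ultimately show ?thesis using gG permutes_inj[OF perm] unfolding Tr_def s_def by blast
qed

lemma mat_1_cong: "mat 1 \<in> \<Gamma>1_cong"
proof -
  have "transl 0 0 = mat 1" unfolding vec_eq_iff forall_3 transl_def by (simp add: mat_def)
  then have "mat 1 \<in> \<Gamma>_cong" using transl_period[of 0] by simp
  then show ?thesis by (auto simp: \<Gamma>1_cong_def \<Gamma>1_def det_I intro: Gamma_cong_Gamma)
qed

lemma transl_1_cong: "transl a b \<in> \<Gamma>_cong \<Longrightarrow> transl a b \<in> \<Gamma>1_cong"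
  by (auto simp: \<Gamma>1_cong_def \<Gamma>1_def transl_eqs intro: Gamma_cong_Gamma)

lemma cusp_eqs: "cusp e 1 = vector [1, 0, 0]" "cusp e 2 = vector [0, 1, 0]"
  "cusp e 3 = vector [\<rho>, 1, e]" "cusp e 4 = vector [\<rho>, 1, - e]"
  by (simp_all add: cusp_def)

lemma inducesI:
  assumes "bij \<sigma>"
    "\<exists>h\<in>\<Gamma>1_cong. \<exists>t. t \<noteq> 0 \<and> h *v (g *v cusp e 1) = t *s cusp e (\<sigma> 1)"
    "\<exists>h\<in>\<Gamma>1_cong. \<exists>t. t \<noteq> 0 \<and> h *v (g *v cusp e 2) = t *s cusp e (\<sigma> 2)"
    "\<exists>h\<in>\<Gamma>1_cong. \<exists>t. t \<noteq> 0 \<and> h *v (g *v cusp e 3) = t *s cusp e (\<sigma> 3)"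
    "\<exists>h\<in>\<Gamma>1_cong. \<exists>t. t \<noteq> 0 \<and> h *v (g *v cusp e 4) = t *s cusp e (\<sigma> 4)"
  shows "induces e g \<sigma>"
  unfolding induces_def forall_4 using assms by (auto intro: bij_imp_permutes)

lemma ee: "e * e = 1" "cnj e = e" "e \<in> O_F" "e \<noteq> 0"
  using e by (auto intro: O_F_intros)

text \<open>The permutations (1 2)(3 4) and (2 3 4) of the cusps, induced by \<open>swapm\<close>
  and by \<open>transl e \<rho>\<close>; together they generate the alternating group.\<close>

definition sig_s :: "4 \<Rightarrow> 4" where "sig_s = Transposition.transpose 1 2 \<circ> Transposition.transpose 3 4"
definition sig_t :: "4 \<Rightarrow> 4" where "sig_t = Transposition.transpose 2 3 \<circ> Transposition.transpose 3 4"

lemma sig_eqs: "sig_s 1 = 2" "sig_s 2 = 1" "sig_s 3 = 4" "sig_s 4 = 3"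
  "sig_t 1 = 1" "sig_t 2 = 3" "sig_t 3 = 4" "sig_t 4 = 2"
  by (simp_all add: sig_s_def sig_t_def Transposition.transpose_def)

lemma induces_reflm: "induces e reflm (Transposition.transpose 3 4)"
  by (rule inducesI; (rule bexI[OF _ mat_1_cong])?)
    (auto simp: cusp_eqs reflm_def vec3_eq_iff mv3 Transposition.transpose_def intro: exI[of _ "-1"])

lemma Gamma1_reflm: "reflm \<in> \<Gamma>1" and Gamma1_swapm: "swapm \<in> \<Gamma>1"
  by (simp_all add: \<Gamma>1_def reflm_Gamma swapm_Gamma reflm_eqs swapm_det)

text \<open>\<open>swapm\<close> maps (\<rho>, 1, x) to (1, \<rho>, -x), which is not a chosen
  representative; this translation carries it to a multiple of (\<rho>, 1, -x).\<close>

lemma swap_corr: "x = e \<or> x = - e \<Longrightarrow> transl (sqrt_m3 * (x * \<rho>)) (\<rho> - 1) \<in> \<Gamma>1_cong"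
proof -
  assume x: "x = e \<or> x = - e"
  have xx: "x * cnj x = 1" "x \<in> O_F" using x ee by (auto intro: O_F_uminus)
  have "x * \<rho> * cnj (x * \<rho>) = (x * cnj x) * (\<rho> * cnj \<rho>)" by simp
  then have "x * \<rho> * cnj (x * \<rho>) = 1" using xx rho_cnj_rho by simp
  then have "transl (sqrt_m3 * (x * \<rho>)) (\<rho> - 1) \<in> \<Gamma>_cong"
    using transl_lattice[of "x * \<rho>"] xx by (simp add: O_F_intros)
  then show ?thesis by (rule transl_1_cong)
qed

lemma sqrt_rho: "sqrt_m3 * \<rho> = - 2 - \<rho>"
proof -
  have "(1 + 2 * \<rho>) * \<rho> = \<rho> + 2 * (\<rho> * \<rho>)" by (simp add: algebra_simps)
  then show ?thesis unfolding sqrt_m3_eq rho_sq by simp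
qed

lemma rho_rho: "\<rho> * (\<rho> * y) = - y - \<rho> * y"
  by (simp add: mult.assoc[symmetric] rho_sq) (simp add: algebra_simps)

lemma induces_swapm: "induces e swapm sig_s"
proof (rule inducesI)
  show "bij sig_s" unfolding sig_s_def by (intro bij_comp bij_transpose)
  have sw: "swapm *v vector [a, b, c] = vector [b, a, - c]" for a b c
    by (simp add: vec3_eq_iff mv3 swapm_def)
  have aux: "transl (sqrt_m3 * (x * \<rho>)) (\<rho> - 1) *v vector [1, \<rho>, - x] = \<rho> *s vector [\<rho>, 1, - x]"
    if "x = e \<or> x = - e" for x
  proof -
    have xx: "x * x = 1" "cnj x = x" using that ee by auto
    have a: "sqrt_m3 * (x * \<rho>) = x * (- 2 - \<rho>)" using sqrt_rho by (simp add: mult.left_commute)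
    have "x * (x * y) = y" for y using xx by (simp add: mult.assoc[symmetric])
    then show ?thesis
      unfolding a by (simp add: vec3_eq_iff mv3 transl_def xx cnj_rho algebra_simps rho_sq rho_rho)
  qed
  show "\<exists>h\<in>\<Gamma>1_cong. \<exists>t. t \<noteq> 0 \<and> h *v (swapm *v cusp e 3) = t *s cusp e (sig_s 3)"
    using aux[of e] swap_corr[of e] rho_nz unfolding sig_eqs cusp_eqs sw by blast
  show "\<exists>h\<in>\<Gamma>1_cong. \<exists>t. t \<noteq> 0 \<and> h *v (swapm *v cusp e 4) = t *s cusp e (sig_s 4)"
    using aux[of "-e"] swap_corr[of "-e"] rho_nz unfolding sig_eqs cusp_eqs sw minus_minus by blast
  show "\<exists>h\<in>\<Gamma>1_cong. \<exists>t. t \<noteq> 0 \<and> h *v (swapm *v cusp e 1) = t *s cusp e (sig_s 1)"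
    "\<exists>h\<in>\<Gamma>1_cong. \<exists>t. t \<noteq> 0 \<and> h *v (swapm *v cusp e 2) = t *s cusp e (sig_s 2)"
    unfolding sig_eqs cusp_eqs sw
    by (rule bexI[OF _ mat_1_cong], rule exI[of _ 1], simp)+
qed

lemma Gamma1_transl: "transl e \<rho> \<in> \<Gamma>1"
  using transl_Gamma[of e \<rho>] ee by (simp add: \<Gamma>1_def transl_eqs O_F_rho cnj_rho)

lemma induces_transl: "induces e (transl e \<rho>) sig_t"
proof (rule inducesI)
  show "bij sig_t" unfolding sig_t_def by (intro bij_comp bij_transpose)
  have tr: "transl a b *v vector [x, y, z] = vector [x + b * y - cnj a * z, y, a * y + z]" for a b x y z
    by (simp add: vec3_eq_iff mv3 transl_def)
  show "\<exists>h\<in>\<Gamma>1_cong. \<exists>t. t \<noteq> 0 \<and> h *v (transl e \<rho> *v cusp e 1) = t *s cusp e (sig_t 1)"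
    unfolding sig_eqs cusp_eqs tr
    by (rule bexI[OF _ mat_1_cong], rule exI[of _ 1]) simp
  show "\<exists>h\<in>\<Gamma>1_cong. \<exists>t. t \<noteq> 0 \<and> h *v (transl e \<rho> *v cusp e 2) = t *s cusp e (sig_t 2)"
    unfolding sig_eqs cusp_eqs tr
    by (rule bexI[OF _ mat_1_cong], rule exI[of _ 1]) (simp add: vec3_eq_iff)
  \<comment> \<open>The image (2 \<rho> - 1, 1, 2 e) of the third cusp is brought to (\<rho>, 1, -e)
    by the translation with parameters -3 e and -5 - \<rho>. Both are multiples of sqrt(-3), as the
    congruence condition demands.\<close>
  have b1: "sqrt_m3 * (1 + 3 * \<rho>) = - 5 - \<rho>"
  proof -
    have "(1 + 2 * \<rho>) * (1 + 3 * \<rho>) = 1 + 5 * \<rho> + 6 * (\<rho> * \<rho>)" by (simp add: algebra_simps)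
    then show ?thesis unfolding sqrt_m3_eq rho_sq by simp
  qed
  have "(e * sqrt_m3) * cnj (e * sqrt_m3) = 3"
  proof -
    have "(e * sqrt_m3) * cnj (e * sqrt_m3) = - (e * e) * (sqrt_m3 * sqrt_m3)" by (simp add: ee(2) cnj_sqrt_m3)
    then show ?thesis by (simp add: ee sqrt_m3_sq)
  qed
  then have "transl (sqrt_m3 * (e * sqrt_m3)) (sqrt_m3 * (1 + 3 * \<rho>)) \<in> \<Gamma>1_cong"
    by (intro transl_1_cong transl_Gamma_cong) (use ee in \<open>auto intro!: O_F_intros simp: b1 cnj_rho\<close>)
  moreover have "sqrt_m3 * (e * sqrt_m3) = - 3 * e"
  proof -
    have "sqrt_m3 * (e * sqrt_m3) = e * (sqrt_m3 * sqrt_m3)" by simp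
    then show ?thesis unfolding sqrt_m3_sq by simp
  qed
  ultimately have h3: "transl (- 3 * e) (- 5 - \<rho>) \<in> \<Gamma>1_cong" by (simp only: b1)
  show "\<exists>h\<in>\<Gamma>1_cong. \<exists>t. t \<noteq> 0 \<and> h *v (transl e \<rho> *v cusp e 3) = t *s cusp e (sig_t 3)"
    unfolding sig_eqs cusp_eqs tr
    by (rule bexI[OF _ h3], rule exI[of _ 1]) (simp add: tr vec3_eq_iff ee algebra_simps)
  \<comment> \<open>The image (1 + 2 \<rho>, 1, 0) of the fourth cusp differs from the second cusp
    by the period sqrt(-3).\<close>
  have h4: "transl 0 (sqrt_m3 * of_int (-1)) \<in> \<Gamma>1_cong" by (rule transl_1_cong[OF transl_period])
  show "\<exists>h\<in>\<Gamma>1_cong. \<exists>t. t \<noteq> 0 \<and> h *v (transl e \<rho> *v cusp e 4) = t *s cusp e (sig_t 4)"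
    unfolding sig_eqs cusp_eqs tr
    by (rule bexI[OF _ h4], rule exI[of _ 1]) (simp add: tr vec3_eq_iff ee sqrt_m3_eq algebra_simps)
qed

lemma Tr_comp:
  assumes "Tr h \<tau> s" "Tr h' \<tau>' s'"
  shows "Tr (h ** h') (\<tau>' \<circ> \<tau>) (s * s')"
  unfolding Tr_def
proof (intro conjI allI ballI)
  note a = assms[unfolded Tr_def]
  show "h ** h' \<in> \<Gamma>" using a by (auto intro: Gamma_mult)
  show "s * s' * (s * s') = 1"
  proof -
    have "s * s' * (s * s') = (s * s) * (s' * s')" by simp
    then show ?thesis using a by simp
  qed
  show "inj (\<tau>' \<circ> \<tau>)" using a by (auto intro: inj_compose)
  fix i b assume b: "b \<in> Ball2"
  have h: "h \<in> \<Gamma>" "h' \<in> \<Gamma>" using a by auto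
  have hb: "act h' b \<in> Ball2" using Gamma_act(2)[OF h(2) b] .
  have "X i (act (h ** h') b) = s * j1 h (act h' b) ^ 3 * X (\<tau> i) (act h' b)"
    using a hb j1_act_mult(2)[OF h(2) b h(1)] by simp
  also have "X (\<tau> i) (act h' b) = s' * j1 h' b ^ 3 * X (\<tau>' (\<tau> i)) b" using a b by simp
  finally show "X i (act (h ** h') b) = s * s' * j1 (h ** h') b ^ 3 * X ((\<tau>' \<circ> \<tau>) i) b"
    by (simp add: j1_act_mult(1)[OF h(2) b] power_mult_distrib)
qed

lemma Tr_reflm: "Tr reflm (Transposition.transpose 3 4) (-1)"
proof -
  have "reflm ** reflm = mat 1" by (simp add: vec_eq_iff forall_3 mm3 reflm_def mat_def)
  then have "matrix_inv reflm = reflm" by (rule matrix_inv_eqI)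
  then show ?thesis using S4_Tr[OF Gamma1_reflm induces_reflm] by (simp add: sign_swap_id)
qed

lemma Tr_one: "Tr (mat 1) id 1"
  using mat_1_cong by (auto simp: Tr_def \<Gamma>1_cong_def j1_one act_one intro: Gamma_cong_Gamma)

text \<open>The alternating group is transitive on pairs, so questions about the zeros of X i - X j
  can be moved to X 3 - X 4 and the axis u = 0.\<close>

lemma Tr_pair:
  assumes "i \<noteq> j"
  obtains h \<tau> s where "Tr h \<tau> s" "{\<tau> i, \<tau> j} = {3, 4}"
proof -
  define T where "T \<tau> = (\<exists>h s. Tr h \<tau> s)" for \<tau>
  have comp: "T (\<tau>' \<circ> \<tau>)" if "T \<tau>" "T \<tau>'" for \<tau> \<tau>' using that Tr_comp unfolding T_def by blast
  have s: "T sig_s" unfolding T_def using S4_Tr[OF Gamma1_swapm induces_swapm] by blast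
  have t: "T sig_t" unfolding T_def using S4_Tr[OF Gamma1_transl induces_transl] by blast
  have i: "T id" unfolding T_def using Tr_one by blast
  note tt = comp[OF t t]
  have "\<exists>\<tau>. T \<tau> \<and> {\<tau> 3, \<tau> 4} = {3, 4}" using i by (intro exI[of _ id]) simp
  moreover have "\<exists>\<tau>. T \<tau> \<and> {\<tau> 2, \<tau> 3} = {3, 4}" using t by (intro exI[of _ sig_t]) (simp add: sig_eqs)
  moreover have "\<exists>\<tau>. T \<tau> \<and> {\<tau> 2, \<tau> 4} = {3, 4}" using tt by (intro exI[of _ "sig_t \<circ> sig_t"]) (auto simp: sig_eqs)
  moreover have "\<exists>\<tau>. T \<tau> \<and> {\<tau> 1, \<tau> 4} = {3, 4}" using comp[OF s t] by (intro exI[of _ "sig_t \<circ> sig_s"]) (auto simp: sig_eqs)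
  moreover have "\<exists>\<tau>. T \<tau> \<and> {\<tau> 1, \<tau> 3} = {3, 4}" using comp[OF s tt] by (intro exI[of _ "sig_t \<circ> sig_t \<circ> sig_s"]) (auto simp: sig_eqs o_def)
  moreover have "\<exists>\<tau>. T \<tau> \<and> {\<tau> 1, \<tau> 2} = {3, 4}" using comp[OF t comp[OF s tt]]
    by (intro exI[of _ "sig_t \<circ> sig_t \<circ> sig_s \<circ> sig_t"]) (auto simp: sig_eqs o_def)
  ultimately have "\<exists>\<tau>. T \<tau> \<and> {\<tau> i, \<tau> j} = {3, 4}"
    using assms exhaust_4[of i] exhaust_4[of j] by (elim disjE) (simp_all add: insert_commute)
  then show ?thesis using that unfolding T_def by blast
qed

text \<open>The sign of the transposition cancels against the cube of j1 = -1.\<close>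

lemma X_refl: "(u, v) \<in> Ball2 \<Longrightarrow> X i (- u, v) = X (Transposition.transpose 3 4 i) (u, v)"
proof -
  assume b: "(u, v) \<in> Ball2"
  have "X i (act reflm (u, v)) = -1 * j1 reflm (u, v) ^ 3 * X (Transposition.transpose 3 4 i) (u, v)"
    using Tr_reflm b unfolding Tr_def by blast
  then show ?thesis by (simp add: reflm_eqs)
qed

lemma X_rot: "(u, v) \<in> Ball2 \<Longrightarrow> X i (\<rho> * u, v) = X i (u, v)"
  using X_WM[of i] rotm_Gamma_cong unfolding WM_def by (metis mult_1 power_int_1_left rotm_eqs(2,3))

lemma axis_X34: "Re v < 0 \<Longrightarrow> X 3 (0, v) = X 4 (0, v)"
  using X_refl[of 0 v 3] by (simp add: Ball2_axis Transposition.transpose_def)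

lemma axis_phi12: "Re v < 0 \<Longrightarrow> \<phi> 1 (0, v) = \<phi> 2 (0, v)"
  using axis_X34[of v] by (simp add: X_eqs)

lemma countable_axis_fiber: "countable {v. (0, v) \<in> fiber p q r}"
proof -
  have "countable (Pair (0::complex) ` {v. (0, v) \<in> fiber p q r})"
    by (rule countable_subset[OF _ countable_fiber[of p q r]]) auto
  then show ?thesis by (rule countable_image_inj_on) (simp add: inj_on_def)
qed

text \<open>On the axis phi_1 = phi_2; a further coincidence leaves only the ratios (0:1:1), (1:0:0)
  and (1:1:1), each with a countable fibre.\<close>

lemma axis_pair_countable:
  assumes "i \<noteq> j" "{i, j} \<noteq> {3, 4}"
  shows "countable {v. Re v < 0 \<and> X i (0, v) = X j (0, v)}"
proof (rule countable_subset)
  show "countable ({v. (0, v) \<in> fiber 0 1 1} \<union> {v. (0, v) \<in> fiber 1 0 0} \<union> {v. (0, v) \<in> fiber 1 1 1})"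
    by (intro countable_Un countable_axis_fiber)
  show "{v. Re v < 0 \<and> X i (0, v) = X j (0, v)} \<subseteq>
      {v. (0, v) \<in> fiber 0 1 1} \<union> {v. (0, v) \<in> fiber 1 0 0} \<union> {v. (0, v) \<in> fiber 1 1 1}"
  proof
    fix v assume v: "v \<in> {v. Re v < 0 \<and> X i (0, v) = X j (0, v)}"
    define a c where "a = \<phi> 0 (0, v)" and "c = \<phi> 1 (0, v)"
    have c2: "\<phi> 2 (0, v) = c" using axis_phi12 v by (simp add: c_def)
    have x: "X 1 (0, v) = a + c + c" "X 2 (0, v) = - 3 * a + c + c" "X 3 (0, v) = a - 2 * c" "X 4 (0, v) = a - 2 * c"
      using c2 by (simp_all add: X_eqs a_def c_def)
    have d: "X 1 (0, v) - X 2 (0, v) = 4 * a" "X 1 (0, v) - X 3 (0, v) = 4 * c" "X 1 (0, v) - X 4 (0, v) = 4 * c"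
      "X 2 (0, v) - X 3 (0, v) = 4 * (c - a)" "X 2 (0, v) - X 4 (0, v) = 4 * (c - a)"
      unfolding x by (simp_all add: algebra_simps)
    have eq: "X i (0, v) = X j (0, v)" using v by simp
    have "a = 0 \<or> c = 0 \<or> a = c"
      using eq assms exhaust_4[of i] exhaust_4[of j] d by (elim disjE) (simp_all add: insert_commute)
    then have "(0, v) \<in> fiber 0 1 1 \<or> (0, v) \<in> fiber 1 0 0 \<or> (0, v) \<in> fiber 1 1 1"
      using v c2 by (auto simp: fiber_def Ball2_axis a_def c_def)
    then show "v \<in> {v. (0, v) \<in> fiber 0 1 1} \<union> {v. (0, v) \<in> fiber 1 0 0} \<union> {v. (0, v) \<in> fiber 1 1 1}" by blast
  qed
qed

text \<open>A form vanishing on the mirror \<open>u = 0\<close> is divisible by \<open>x\<^sub>3 - x\<^sub>4\<close>: modulo this difference it is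
  a binary form in \<open>\<phi>\<^sub>0, \<phi>\<^sub>1\<close>, and \<open>\<phi>\<^sub>0/\<phi>\<^sub>1\<close> takes uncountably many values on the mirror.\<close>

lemma WM_div_mirror:
  assumes R: "WM w R" and z: "\<And>v. Re v < 0 \<Longrightarrow> R (0, v) = 0"
  obtains R' where "WM (w - 3) R'" "\<And>b. b \<in> Ball2 \<Longrightarrow> R b = (X 3 b - X 4 b) * R' b"
proof -
  obtain I p where I: "finite I" "\<And>x. x \<in> I \<Longrightarrow> w = 3 * int (x 0 + x 1 + x 2)"
    "\<And>b. b \<in> Ball2 \<Longrightarrow> R b = (\<Sum>x\<in>I. p x * mono x b)"
    using WM_polynomial[OF R] by blast
  show ?thesis
  proof (cases "I = {}")
    case True
    then show ?thesis using that[of "\<lambda>_. 0"] I(3) WM_zero by simp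
  next
    case False
    then obtain x0 where "x0 \<in> I" by blast
    define d where "d = x0 0 + x0 1 + x0 2"
    have w: "w = 3 * int d" using I(2)[OF \<open>x0 \<in> I\<close>] by (simp add: d_def)
    have dx: "x 0 + x 1 + x 2 = d" if "x \<in> I" for x using I(2)[OF that] unfolding w by simp
    \<comment> \<open>The polynomial restricted to phi_1 = phi_2 and dehomogenized: coefficients are
      collected by the exponent of phi_0.\<close>
    define q where "q = (\<Sum>x\<in>I. monom (p x) (x 0))"
    have q0: "q = 0"
    proof (rule ccontr)
      assume "q \<noteq> 0"
      then have fin: "finite {t. poly q t = 0}" by (rule poly_roots_finite)
      have "{v. Re v < 0} \<subseteq> {v. (0, v) \<in> fiber 1 0 0} \<union> (\<Union>t\<in>{t. poly q t = 0}. {v. (0, v) \<in> fiber t 1 1})"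
      proof
        fix v assume "v \<in> {v. Re v < 0}"
        then have v: "Re v < 0" by simp
        have b: "(0, v) \<in> Ball2" using v by (simp add: Ball2_axis)
        define a c where "a = \<phi> 0 (0, v)" and "c = \<phi> 1 (0, v)"
        have c2: "\<phi> 2 (0, v) = c" using axis_phi12 v by (simp add: c_def)
        show "v \<in> {v. (0, v) \<in> fiber 1 0 0} \<union> (\<Union>t\<in>{t. poly q t = 0}. {v. (0, v) \<in> fiber t 1 1})"
        proof (cases "c = 0")
          case True
          then show ?thesis using b c2 by (auto simp: fiber_def c_def)
        next
          case False
          have "0 = R (0, v)" using z[OF v] by simp
          also have "\<dots> = (\<Sum>x\<in>I. p x * mono x (0, v))" by (rule I(3)[OF b])
          also have "\<dots> = (\<Sum>x\<in>I. c ^ d * (p x * (a / c) ^ x 0))"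
          proof (rule sum.cong[OF refl])
            fix x assume "x \<in> I"
            then have "c ^ d = c ^ x 0 * (c ^ x 1 * c ^ x 2)" using dx by (metis power_add add.assoc)
            then show "p x * mono x (0, v) = c ^ d * (p x * (a / c) ^ x 0)"
              using False by (simp add: mono_def a_def[symmetric] c_def[symmetric] c2 power_divide)
          qed
          also have "\<dots> = c ^ d * poly q (a / c)"
            by (simp add: q_def poly_sum poly_monom sum_distrib_left)
          finally have "poly q (a / c) = 0" using False by simp
          moreover have "(0, v) \<in> fiber (a / c) 1 1" using b c2 False by (auto simp: fiber_def a_def c_def)
          ultimately show ?thesis by blast
        qed
      qed
      moreover have "countable ({v. (0, v) \<in> fiber 1 0 0} \<union> (\<Union>t\<in>{t. poly q t = 0}. {v. (0, v) \<in> fiber t 1 1}))"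
        using fin by (intro countable_Un countable_UN countable_axis_fiber) (simp add: countable_finite)
      ultimately show False using uncountable_half_plane countable_subset by blast
    qed
    \<comment> \<open>Since q = 0, replacing phi_2 by phi_1 makes the polynomial vanish identically,
      and this zero may be subtracted from \<open>R\<close>.\<close>
    have bin: "(\<Sum>x\<in>I. p x * (a ^ x 0 * c ^ (d - x 0))) = 0" for a c
    proof -
      have "(\<Sum>x\<in>I. p x * (a ^ x 0 * c ^ (d - x 0))) = (\<Sum>x\<in>I. \<Sum>j\<le>d. coeff (monom (p x) (x 0)) j * (a ^ j * c ^ (d - j)))"
      proof (rule sum.cong[OF refl])
        fix x assume "x \<in> I"
        then have "x 0 \<in> {..d}" using dx by fastforce
        then show "p x * (a ^ x 0 * c ^ (d - x 0)) = (\<Sum>j\<le>d. coeff (monom (p x) (x 0)) j * (a ^ j * c ^ (d - j)))"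
          by (subst sum.remove[of _ "x 0"]) (auto intro!: sum.neutral)
      qed
      also have "\<dots> = (\<Sum>j\<le>d. coeff q j * (a ^ j * c ^ (d - j)))"
        by (subst sum.swap) (simp add: q_def coeff_sum sum_distrib_right)
      finally show ?thesis by (simp add: q0)
    qed
    \<comment> \<open>In each monomial phi_2^m - phi_1^m is divided by phi_2 - phi_1; the factor 1/4
      comes from X 3 - X 4 = 4 (phi_2 - phi_1).\<close>
    define R' where "R' b = (\<Sum>x\<in>I. \<Sum>i<x 2. (p x / 4) * (\<phi> 0 b ^ x 0 * \<phi> 1 b ^ x 1 * (\<phi> 1 b ^ (x 2 - Suc i) * \<phi> 2 b ^ i)))" for b
    show ?thesis
    proof (rule that[of R'])
      have "WM (w - 3) (\<lambda>b. (p x / 4) * (\<phi> 0 b ^ x 0 * \<phi> 1 b ^ x 1 * (\<phi> 1 b ^ (x 2 - Suc i) * \<phi> 2 b ^ i)))"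
        if "x \<in> I" "i < x 2" for x i
      proof -
        have "WM (int (x 0) * 3 + int (x 1) * 3 + (int (x 2 - Suc i) * 3 + int i * 3))
          (\<lambda>b. \<phi> 0 b ^ x 0 * \<phi> 1 b ^ x 1 * (\<phi> 1 b ^ (x 2 - Suc i) * \<phi> 2 b ^ i))"
          by (intro WM_mult WM_power phi_WM)
        moreover have "int (x 0) * 3 + int (x 1) * 3 + (int (x 2 - Suc i) * 3 + int i * 3) = w - 3"
          using I(2)[OF that(1)] that(2) by (simp add: of_nat_diff algebra_simps)
        ultimately show ?thesis by (intro WM_cmult) simp
      qed
      then show "WM (w - 3) R'" unfolding R'_def by (intro WM_sum) auto
      fix b assume b: "b \<in> Ball2"
      have "R b = (\<Sum>x\<in>I. p x * mono x b) - (\<Sum>x\<in>I. p x * (\<phi> 0 b ^ x 0 * \<phi> 1 b ^ (d - x 0)))"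
        by (simp add: I(3)[OF b] bin)
      also have "\<dots> = (\<Sum>x\<in>I. p x * mono x b - p x * (\<phi> 0 b ^ x 0 * \<phi> 1 b ^ (d - x 0)))"
        by (simp add: sum_subtractf)
      also have "\<dots> = (\<Sum>x\<in>I. (X 3 b - X 4 b) * (\<Sum>i<x 2. (p x / 4) * (\<phi> 0 b ^ x 0 * \<phi> 1 b ^ x 1 * (\<phi> 1 b ^ (x 2 - Suc i) * \<phi> 2 b ^ i))))"
      proof (rule sum.cong[OF refl])
        fix x assume "x \<in> I"
        then have "d - x 0 = x 1 + x 2" using dx by fastforce
        then have "p x * mono x b - p x * (\<phi> 0 b ^ x 0 * \<phi> 1 b ^ (d - x 0))
          = p x * \<phi> 0 b ^ x 0 * \<phi> 1 b ^ x 1 * (\<phi> 2 b ^ x 2 - \<phi> 1 b ^ x 2)"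
          by (simp add: mono_def power_add algebra_simps)
        also have "\<dots> = p x * \<phi> 0 b ^ x 0 * \<phi> 1 b ^ x 1 * ((\<phi> 2 b - \<phi> 1 b) * (\<Sum>i<x 2. \<phi> 1 b ^ (x 2 - Suc i) * \<phi> 2 b ^ i))"
          by (simp add: power_diff_sumr2)
        also have "\<phi> 2 b - \<phi> 1 b = (X 3 b - X 4 b) / 4" by (simp add: X_eqs)
        finally show "p x * mono x b - p x * (\<phi> 0 b ^ x 0 * \<phi> 1 b ^ (d - x 0)) = (X 3 b - X 4 b) *
          (\<Sum>i<x 2. (p x / 4) * (\<phi> 0 b ^ x 0 * \<phi> 1 b ^ x 1 * (\<phi> 1 b ^ (x 2 - Suc i) * \<phi> 2 b ^ i)))"
          by (simp add: sum_distrib_left mult_ac)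
      qed
      finally show "R b = (X 3 b - X 4 b) * R' b" by (simp add: R'_def sum_distrib_left)
    qed
  qed
qed

end

section \<open>The Jacobian determinant and its cubic root\<close>

definition w2 :: "complex^2 \<Rightarrow> complex^2 \<Rightarrow> complex" where
  "w2 x y = x$1 * y$2 - x$2 * y$1"

lemma w2_matrix: "w2 (A *v x) (A *v y) = det A * w2 x y"
  by (simp add: w2_def matrix_vector_mult_def sum_2 det_2 algebra_simps)

text \<open>The 3 x 3 determinant with columns (f, d_u f, d_v f), (g, d_u g, d_v g), (h, d_u h, d_v
  h), expanded along the row of values.\<close>

definition J3 :: "scalar_fun \<Rightarrow> scalar_fun \<Rightarrow> scalar_fun \<Rightarrow> scalar_fun" where
  "J3 f g h z = f z * w2 (nabla g z) (nabla h z) - g z * w2 (nabla f z) (nabla h z) + h z * w2 (nabla f z) (nabla g z)"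

lemma nabla_nth: "nabla f b $ 1 = d_u f b" "nabla f b $ 2 = d_v f b"
  by (simp_all add: nabla_def)

lemma hol2_J3:
  assumes "f holomorphic2_on Ball2" "g holomorphic2_on Ball2" "h holomorphic2_on Ball2"
  shows "J3 f g h holomorphic2_on Ball2"
  unfolding J3_def[abs_def] w2_def nabla_nth
  by (intro hol2_intros hol2_d_u hol2_d_v open_Ball2 assms)

text \<open>The gradient \<nu> of the automorphy factor enters as a multiple of the row of values
  and drops out of the determinant. The weight is 12 = 9 + 2 + 1: three factors j1^3, two from the
  chain rule, one from det j2.\<close>

lemma J3_act:
  assumes h: "h \<in> \<Gamma>" and z: "z \<in> Ball2"
    and a: "a holomorphic2_on Ball2" "a' holomorphic2_on Ball2" "\<And>b. b \<in> Ball2 \<Longrightarrow> a (act h b) = j1 h b ^ 3 * a' b"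
    and b: "b holomorphic2_on Ball2" "b' holomorphic2_on Ball2" "\<And>z. z \<in> Ball2 \<Longrightarrow> b (act h z) = j1 h z ^ 3 * b' z"
    and c: "c holomorphic2_on Ball2" "c' holomorphic2_on Ball2" "\<And>b. b \<in> Ball2 \<Longrightarrow> c (act h b) = j1 h b ^ 3 * c' b"
  shows "J3 a b c (act h z) = j1 h z ^ 12 / det h * J3 a' b' c' z"
proof -
  define j where "j = j1 h z"
  define p where "p = j ^ 3"
  define \<nu> where "\<nu> = nabla (\<lambda>b. j1 h b ^ 3) z"
  define A where "A = j2 h z"
  have N: "nabla f (act h z) = j *s (A *v (p *s nabla f' z + f' z *s \<nu>))"
    if f: "f holomorphic2_on Ball2" "f' holomorphic2_on Ball2" "\<And>b. b \<in> Ball2 \<Longrightarrow> f (act h b) = j1 h b ^ 3 * f' b" for f f'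
  proof -
    have "nabla (\<lambda>b. f (act h b)) z = nabla (\<lambda>b. j1 h b ^ 3 * f' b) z"
      by (rule nabla_cong[OF open_Ball2 z f(3)])
    also have "\<dots> = p *s nabla f' z + f' z *s \<nu>"
      using nabla_mult[OF hol2_power[OF hol2_j1] f(2) z, of h 3] by (simp add: p_def j_def \<nu>_def)
    finally show ?thesis using nabla_act[OF h f(1) z] by (simp add: j_def A_def)
  qed
  have w: "w2 (j *s (A *v x)) (j *s (A *v y)) = j ^ 3 / det h * w2 x y" for x y
  proof -
    have "w2 (j *s (A *v x)) (j *s (A *v y)) = j * j * w2 (A *v x) (A *v y)" by (simp add: w2_def algebra_simps)
    also have "\<dots> = j * j * (j / det h * w2 x y)"
      unfolding w2_matrix A_def by (simp add: det_j2[OF Gamma_det[OF h]] j_def)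
    finally show ?thesis by (simp add: power3_eq_cube)
  qed
  have "J3 a b c (act h z) = (p * (j ^ 3 / det h)) *
      (a' z * w2 (p *s nabla b' z + b' z *s \<nu>) (p *s nabla c' z + c' z *s \<nu>)
       - b' z * w2 (p *s nabla a' z + a' z *s \<nu>) (p *s nabla c' z + c' z *s \<nu>)
       + c' z * w2 (p *s nabla a' z + a' z *s \<nu>) (p *s nabla b' z + b' z *s \<nu>))"
  proof -
    have pj: "j1 h z ^ 3 = p" by (simp add: p_def j_def)
    have Na: "nabla a (act h z) = j *s (A *v (p *s nabla a' z + a' z *s \<nu>))" by (rule N[OF a])
    have Nb: "nabla b (act h z) = j *s (A *v (p *s nabla b' z + b' z *s \<nu>))" by (rule N[OF b])
    have Nc: "nabla c (act h z) = j *s (A *v (p *s nabla c' z + c' z *s \<nu>))" by (rule N[OF c])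
    show ?thesis unfolding J3_def Na Nb Nc w a(3)[OF z] b(3)[OF z] c(3)[OF z] pj
      by (simp only: ring_distribs mult_ac diff_conv_add_uminus mult_minus_right mult_minus_left)
  qed
  also have "\<dots> = (p * (j ^ 3 / det h)) * (p * p * J3 a' b' c' z)"
    by (rule arg_cong[where f = "\<lambda>x. (p * (j ^ 3 / det h)) * x"])
      (simp add: J3_def w2_def algebra_simps)
  also have "\<dots> = j ^ 12 / det h * J3 a' b' c' z" by (simp add: p_def power_add[symmetric] mult_ac)
  finally show ?thesis by (simp add: j_def)
qed

context generators
begin

definition J :: scalar_fun where "J = J3 (\<phi> 0) (\<phi> 1) (\<phi> 2)"

lemma hol2_J: "J holomorphic2_on Ball2"
  unfolding J_def by (intro hol2_J3 phi_hol)

lemma nabla_lin3: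
  assumes "b \<in> Ball2"
  shows "nabla (\<lambda>b. p * \<phi> 0 b + q * \<phi> 1 b + r * \<phi> 2 b) b = p *s nabla (\<phi> 0) b + q *s nabla (\<phi> 1) b + r *s nabla (\<phi> 2) b"
proof -
  have "nabla (\<lambda>b. 1 * (p * \<phi> 0 b + q * \<phi> 1 b) + r * \<phi> 2 b) b = 1 *s nabla (\<lambda>b. p * \<phi> 0 b + q * \<phi> 1 b) b + r *s nabla (\<phi> 2) b"
    by (rule nabla_lin[OF _ phi_hol assms]) (intro hol2_intros phi_hol)
  also have "nabla (\<lambda>b. p * \<phi> 0 b + q * \<phi> 1 b) b = p *s nabla (\<phi> 0) b + q *s nabla (\<phi> 1) b"
    by (rule nabla_lin[OF phi_hol phi_hol assms])
  finally show ?thesis by simp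
qed

lemma J3_lin:
  assumes b: "b \<in> Ball2"
  shows "J3 (\<lambda>b. p1 * \<phi> 0 b + q1 * \<phi> 1 b + r1 * \<phi> 2 b) (\<lambda>b. p2 * \<phi> 0 b + q2 * \<phi> 1 b + r2 * \<phi> 2 b)
     (\<lambda>b. p3 * \<phi> 0 b + q3 * \<phi> 1 b + r3 * \<phi> 2 b) b
    = (p1 * (q2 * r3 - r2 * q3) - q1 * (p2 * r3 - r2 * p3) + r1 * (p2 * q3 - q2 * p3)) * J b"
  unfolding J_def J3_def nabla_lin3[OF b] w2_def by (simp add: algebra_simps)

lemma phi_act:
  assumes "Tr h \<tau> s"
  obtains p q r where "\<And>b. b \<in> Ball2 \<Longrightarrow> \<phi> k (act h b) = j1 h b ^ 3 * (p * \<phi> 0 b + q * \<phi> 1 b + r * \<phi> 2 b)"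
proof -
  have k: "k = 0 \<or> k = 1 \<or> k = 2" using exhaust_3[of k, unfolded three_eq_0] by auto
  define m :: 4 where "m = (if k = 0 then 2 else if k = 1 then 3 else 4)"
  have km: "\<phi> k b = (X 1 b - X m b) / 4" for b using k by (auto simp: m_def phi_X)
  obtain p q r where 1: "\<forall>b. X (\<tau> 1) b = p * \<phi> 0 b + q * \<phi> 1 b + r * \<phi> 2 b" using X_lin[of "\<tau> 1"] by blast
  obtain p' q' r' where 2: "\<forall>b. X (\<tau> m) b = p' * \<phi> 0 b + q' * \<phi> 1 b + r' * \<phi> 2 b" using X_lin[of "\<tau> m"] by blast
  show ?thesis
  proof (rule that[of "s * (p - p') / 4" "s * (q - q') / 4" "s * (r - r') / 4"])
    fix b assume b: "b \<in> Ball2"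
    have "X i (act h b) = s * j1 h b ^ 3 * X (\<tau> i) b" for i using assms b unfolding Tr_def by blast
    then show "\<phi> k (act h b) = j1 h b ^ 3 * (s * (p - p') / 4 * \<phi> 0 b + s * (q - q') / 4 * \<phi> 1 b + s * (r - r') / 4 * \<phi> 2 b)"
      by (simp add: km 1 2 field_simps)
  qed
qed

lemma J_act:
  assumes "Tr h \<tau> s"
  obtains \<kappa> where "\<And>b. b \<in> Ball2 \<Longrightarrow> J (act h b) = j1 h b ^ 12 * (\<kappa> * J b)"
proof -
  have h: "h \<in> \<Gamma>" using assms by (simp add: Tr_def)
  obtain p1 q1 r1 where 1: "\<And>b. b \<in> Ball2 \<Longrightarrow> \<phi> 0 (act h b) = j1 h b ^ 3 * (p1 * \<phi> 0 b + q1 * \<phi> 1 b + r1 * \<phi> 2 b)"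
    using phi_act[OF assms, of 0] by blast
  obtain p2 q2 r2 where 2: "\<And>b. b \<in> Ball2 \<Longrightarrow> \<phi> 1 (act h b) = j1 h b ^ 3 * (p2 * \<phi> 0 b + q2 * \<phi> 1 b + r2 * \<phi> 2 b)"
    using phi_act[OF assms, of 1] by blast
  obtain p3 q3 r3 where 3: "\<And>b. b \<in> Ball2 \<Longrightarrow> \<phi> 2 (act h b) = j1 h b ^ 3 * (p3 * \<phi> 0 b + q3 * \<phi> 1 b + r3 * \<phi> 2 b)"
    using phi_act[OF assms, of 2] by blast
  define \<kappa> where "\<kappa> = (p1 * (q2 * r3 - r2 * q3) - q1 * (p2 * r3 - r2 * p3) + r1 * (p2 * q3 - q2 * p3)) / det h"
  show ?thesis
  proof (rule that[of \<kappa>])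
    fix b assume b: "b \<in> Ball2"
    show "J (act h b) = j1 h b ^ 12 * (\<kappa> * J b)"
      unfolding J_def
      by (subst J3_act[OF h b phi_hol _ 1 phi_hol _ 2 phi_hol _ 3])
        (auto intro!: hol2_intros phi_hol simp: J3_lin[OF b] \<kappa>_def J_def[symmetric])
  qed
qed

lemma J_cong:
  assumes "g \<in> \<Gamma>_cong" "b \<in> Ball2"
  shows "J (act g b) = j1 g b ^ 12 / det g * J b"
  unfolding J_def
  by (rule J3_act) (use assms phi_hol phi_WM in \<open>auto simp: WM_def intro: Gamma_cong_Gamma\<close>)

lemma J_cube_WM: "WM 36 (\<lambda>b. J b ^ 3)"
proof -
  have "J (act g b) ^ 3 = j1 g b powi 36 * J b ^ 3" if g: "g \<in> \<Gamma>_cong" and b: "b \<in> Ball2" for g b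
    unfolding J_cong[OF g b] using Gamma_cong_det[OF g]
    by (simp add: power_mult_distrib power_divide flip: power_mult)
  then show ?thesis unfolding WM_def by (auto intro: hol2_power hol2_J)
qed

section \<open>Division of forms by the differences x_i - x_j\<close>

definition dp :: "4 \<times> 4 \<Rightarrow> scalar_fun" where
  "dp q b = X (fst q) b - X (snd q) b"

lemma dp_WM: "WM 3 (dp q)"
  unfolding dp_def[abs_def] by (intro WM_diff X_WM)

lemma dp_hol: "dp q holomorphic2_on Ball2"
  by (rule WM_hol[OF dp_WM])

text \<open>The order \<open>n\<close> of vanishing of \<open>x\<^sub>3 - x\<^sub>4\<close> along \<open>u = 0\<close> is \<open>3\<close>, but this is only known
  once the Jacobian has been determined.\<close>

lemma div_step:
  assumes hf: "hf holomorphic2_on Ball2" "\<And>b. b \<in> Ball2 \<Longrightarrow> X 3 b - X 4 b = fst b ^ n * hf b"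
      "Re v0 < 0" "hf (0, v0) \<noteq> 0" and n: "n > 0" "3 * e' \<ge> n * m"
    and F: "\<And>h \<tau> s. Tr h \<tau> s \<Longrightarrow> \<exists>K. K holomorphic2_on Ball2 \<and> (\<forall>b\<in>Ball2. F (act h b) = fst b ^ e' * K b)"
    and ij: "i \<noteq> j" "c < m" and Q: "finite Q" "\<And>q. q \<in> Q \<Longrightarrow> fst q \<noteq> snd q \<and> {fst q, snd q} \<noteq> {i, j}"
    and R: "WM w R" "\<And>b. b \<in> Ball2 \<Longrightarrow> F b ^ 3 = dp (i, j) b ^ c * (\<Prod>q\<in>Q. dp q b ^ cc q) * R b"
  shows "\<exists>R'. WM (w - 3) R' \<and> (\<forall>b\<in>Ball2. R b = dp (i, j) b * R' b)"
proof -
  obtain h \<tau> s where T: "Tr h \<tau> s" "{\<tau> i, \<tau> j} = {3, 4}" by (rule Tr_pair[OF ij(1)])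
  have h: "h \<in> \<Gamma>" and ss: "s * s = 1" and inj: "inj \<tau>"
    and Xh: "\<And>k b. b \<in> Ball2 \<Longrightarrow> X k (act h b) = s * j1 h b ^ 3 * X (\<tau> k) b"
    using T(1) unfolding Tr_def by blast+
  have s0: "s \<noteq> 0" using ss by auto
  define t :: complex where "t = (if \<tau> i = 3 then 1 else -1)"
  have tt: "t * t = 1" by (simp add: t_def)
  have t: "X (\<tau> i) b - X (\<tau> j) b = t * (X 3 b - X 4 b)" for b
    using T(2) by (auto simp: t_def doubleton_eq_iff)
  have dph: "dp q (act h b) = s * j1 h b ^ 3 * (X (\<tau> (fst q)) b - X (\<tau> (snd q)) b)" if "b \<in> Ball2" for q b
    using Xh[OF that] by (simp add: dp_def algebra_simps)
  obtain K where K: "K holomorphic2_on Ball2" "\<And>b. b \<in> Ball2 \<Longrightarrow> F (act h b) = fst b ^ e' * K b" using F[OF T(1)] by blast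
  define Rh where "Rh = (\<lambda>b. j1 h b powi (- w) * R (act h b))"
  have Rh: "WM w Rh" unfolding Rh_def by (rule WM_slash[OF R(1) h])
  \<comment> \<open>Excess of the guaranteed order of F^3 along the mirror over the order of the
    factor dp (i, j)^c already split off.\<close>
  define r where "r = 3 * e' - n * c"
  have nc: "n * c < n * m" using n ij by simp
  have r: "r > 0" "3 * e' = n * c + r" using n(2) nc unfolding r_def by linarith+
  \<comment> \<open>F^3 at \<open>act h b\<close>, with the power of \<open>u\<close> contributed by
    dp (i, j) removed; it still vanishes at u = 0 because \<open>r\<close> is positive.\<close>
  define E where "E = (\<lambda>b. (s * j1 h b ^ 3 * t * hf b) ^ c *
    (\<Prod>q\<in>Q. (s * j1 h b ^ 3 * (X (\<tau> (fst q)) b - X (\<tau> (snd q)) b)) ^ cc q) * R (act h b))"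
  have E: "E holomorphic2_on Ball2" unfolding E_def
    by (intro hol2_intros hol2_j1 hf(1) X_hol hol2_compose_act[OF h] WM_hol[OF R(1)])
  have eq: "E b = fst b ^ r * K b ^ 3" if b: "b \<in> Ball2" for b
  proof (rule hol2_eq_off_mirror[OF E _ _ b])
    show "(\<lambda>b. fst b ^ r * K b ^ 3) holomorphic2_on Ball2" by (intro hol2_intros K)
    fix b assume b: "b \<in> Ball2" and u: "fst b \<noteq> 0"
    have hb: "act h b \<in> Ball2" by (rule Gamma_act(2)[OF h b])
    have "fst b ^ (n * c) * (fst b ^ r * K b ^ 3) = (F (act h b)) ^ 3"
    proof -
      have "fst b ^ (n * c) * fst b ^ r = fst b ^ (3 * e')" by (simp add: r(2) power_add)
      then show ?thesis unfolding K(2)[OF b] by (simp add: power_mult_distrib mult.assoc[symmetric] power_mult power_commutes mult.commute[of e' 3] flip: power_mult)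
    qed
    also have "\<dots> = fst b ^ (n * c) * E b"
      unfolding R(2)[OF hb] dph[OF b] fst_conv snd_conv t hf(2)[OF b] E_def
      by (simp only: power_mult_distrib power_mult[of "fst b"] mult_ac(1)) (simp only: mult_ac)
    finally show "E b = fst b ^ r * K b ^ 3" using u by simp
  qed
  \<comment> \<open>The other differences can vanish on the axis too, but only at countably many
    points, which \<open>half_plane_zero\<close> tolerates.\<close>
  define C where "C = (\<Union>q\<in>Q. {v. Re v < 0 \<and> X (\<tau> (fst q)) (0, v) = X (\<tau> (snd q)) (0, v)})"
  have C: "countable C" unfolding C_def
  proof (rule countable_UN[OF countable_finite[OF Q(1)]])
    fix q assume q: "q \<in> Q"
    show "countable {v. Re v < 0 \<and> X (\<tau> (fst q)) (0, v) = X (\<tau> (snd q)) (0, v)}"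
    proof (rule axis_pair_countable)
      show "\<tau> (fst q) \<noteq> \<tau> (snd q)" using Q(2)[OF q] inj by (auto dest: injD)
      have "\<tau> ` {fst q, snd q} \<noteq> \<tau> ` {i, j}" using Q(2)[OF q] inj by (simp only: inj_image_eq_iff) simp
      then show "{\<tau> (fst q), \<tau> (snd q)} \<noteq> {3, 4}" using T(2) by simp
    qed
  qed
  have "Rh (0, v) = 0" if v: "Re v < 0" for v
  proof (rule half_plane_zero[OF hol2_axis[OF WM_hol[OF Rh]] hol2_axis[OF hf(1)] C hf(3,4) _ v])
    fix v assume v: "Re v < 0" "v \<notin> C"
    have b: "(0, v) \<in> Ball2" using v by (simp add: Ball2_axis)
    have j: "j1 h (0, v) \<noteq> 0" by (rule Gamma_act(1)[OF h b])
    have "E (0, v) = 0" using eq[OF b] r by simp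
    moreover have "(\<Prod>q\<in>Q. (s * j1 h (0, v) ^ 3 * (X (\<tau> (fst q)) (0, v) - X (\<tau> (snd q)) (0, v))) ^ cc q) \<noteq> 0"
      using v j s0 Q(1) by (auto simp: C_def)
    ultimately have "(s * j1 h (0, v) ^ 3 * t * hf (0, v)) ^ c * R (act h (0, v)) = 0"
      by (auto simp: E_def)
    then have "hf (0, v) ^ c * R (act h (0, v)) = 0"
      using j s0 tt by (auto simp: power_mult_distrib)
    then show "hf (0, v) ^ c * Rh (0, v) = 0" by (auto simp: Rh_def)
  qed
  then obtain R1 where R1: "WM (w - 3) R1" "\<And>b. b \<in> Ball2 \<Longrightarrow> Rh b = (X 3 b - X 4 b) * R1 b"
    using WM_div_mirror[OF Rh] by blast
  define h' where "h' = matrix_inv h"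
  have h': "h' \<in> \<Gamma>" "h ** h' = mat 1" using Gamma_inv[OF h] by (auto simp: h'_def)
  \<comment> \<open>The quotient found at the axis is transported back by the inverse of
    \<open>h\<close>; the factor t s accounts for the sign in dp (i, j).\<close>
  define R' where "R' = (\<lambda>b. (t * s) * (j1 h' b powi (- (w - 3)) * R1 (act h' b)))"
  have "WM (w - 3) R'" unfolding R'_def by (intro WM_cmult WM_slash[OF R1(1)] h')
  moreover have "R b = dp (i, j) b * R' b" if b: "b \<in> Ball2" for b
  proof -
    define b' where "b' = act h' b"
    have b': "b' \<in> Ball2" unfolding b'_def by (rule Gamma_act(2)[OF h'(1) b])
    have hb': "act h b' = b" using j1_act_mult(2)[OF h'(1) b h] h' by (simp add: b'_def act_one)
    have jj: "j1 h b' * j1 h' b = 1" using j1_act_mult(1)[OF h'(1) b, of h] h' by (simp add: b'_def j1_one)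
    define k where "k = j1 h b'"
    have k: "k \<noteq> 0" "j1 h' b = inverse k" using jj by (auto simp: k_def inverse_unique)
    have d: "dp (i, j) b = s * k ^ 3 * (t * (X 3 b' - X 4 b'))"
      using dph[OF b', of "(i, j)"] by (simp add: hb' t k_def)
    have "R b = k powi w * Rh b'" using k by (simp add: Rh_def hb' k_def[symmetric] power_int_minus)
    also have "\<dots> = k powi w * ((X 3 b' - X 4 b') * R1 b')" by (simp add: R1(2)[OF b'])
    also have "k powi w = k ^ 3 * k powi (w - 3)" using k(1) by (simp add: power_int_diff)
    also have "k ^ 3 * k powi (w - 3) * ((X 3 b' - X 4 b') * R1 b')
       = (s * s) * (t * t) * (k ^ 3 * k powi (w - 3) * ((X 3 b' - X 4 b') * R1 b'))" using ss tt by simp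
    also have "\<dots> = dp (i, j) b * R' b"
    proof -
      have "inverse k powi (- (w - 3)) = k powi (w - 3)" by (simp only: power_int_inverse power_int_minus inverse_inverse_eq)
      then show ?thesis unfolding d R'_def b'_def[symmetric] k(2) by (simp only: mult_ac)
    qed
    finally show ?thesis .
  qed
  ultimately show ?thesis by blast
qed

definition PP :: "(4 \<times> 4) set" where
  "PP = {(1, 2), (1, 3), (1, 4), (2, 3), (2, 4), (3, 4)}"

definition Pd :: scalar_fun where "Pd b = (\<Prod>q\<in>PP. dp q b)"

lemma PP: "finite PP" "card PP = 6" "q \<in> PP \<Longrightarrow> fst q \<noteq> snd q"
  "q \<in> PP \<Longrightarrow> q' \<in> PP \<Longrightarrow> q \<noteq> q' \<Longrightarrow> {fst q, snd q} \<noteq> {fst q', snd q'}"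
  by (auto simp: PP_def doubleton_eq_iff)

text \<open>Differences are split off one at a time. While some pair has been used fewer than
  \<open>m\<close> times, \<open>div_step\<close> divides by it once more; after 6 m divisions, each
  lowering the weight by 3, every pair has been used exactly \<open>m\<close> times.\<close>

lemma div_all:
  assumes hf: "hf holomorphic2_on Ball2" "\<And>b. b \<in> Ball2 \<Longrightarrow> X 3 b - X 4 b = fst b ^ n * hf b"
      "Re v0 < 0" "hf (0, v0) \<noteq> 0" and n: "n > 0" "3 * e' \<ge> n * m"
    and F: "\<And>h \<tau> s. Tr h \<tau> s \<Longrightarrow> \<exists>K. K holomorphic2_on Ball2 \<and> (\<forall>b\<in>Ball2. F (act h b) = fst b ^ e' * K b)"
    and F3: "WM w (\<lambda>b. F b ^ 3)"
  shows "\<exists>R. WM (w - 18 * int m) R \<and> (\<forall>b\<in>Ball2. F b ^ 3 = Pd b ^ m * R b)"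
proof -
  have "\<exists>cc R. (\<forall>q\<in>PP. cc q \<le> m) \<and> sum cc PP = k \<and> WM (w - 3 * int k) R \<and>
      (\<forall>b\<in>Ball2. F b ^ 3 = (\<Prod>q\<in>PP. dp q b ^ cc q) * R b)" if "k \<le> 6 * m" for k
    using that
  proof (induction k)
    case 0
    show ?case by (rule exI[of _ "\<lambda>_. 0"], rule exI[of _ "\<lambda>b. F b ^ 3"]) (use F3 in simp)
  next
    case (Suc k)
    then obtain cc R where cc: "\<forall>q\<in>PP. cc q \<le> m" "sum cc PP = k" and R: "WM (w - 3 * int k) R"
      "\<forall>b\<in>Ball2. F b ^ 3 = (\<Prod>q\<in>PP. dp q b ^ cc q) * R b" by auto
    have "\<exists>p\<in>PP. cc p < m"
    proof (rule ccontr)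
      assume "\<not> (\<exists>p\<in>PP. cc p < m)"
      then have "sum cc PP = (\<Sum>p\<in>PP. m)" using cc by (intro sum.cong) (auto simp: le_antisym)
      then show False using cc Suc.prems PP by simp
    qed
    then obtain p where p: "p \<in> PP" "cc p < m" by blast
    have "\<exists>R'. WM (w - 3 * int k - 3) R' \<and> (\<forall>b\<in>Ball2. R b = dp (fst p, snd p) b * R' b)"
    proof (rule div_step[where Q = "PP - {p}", OF hf n F PP(3)[OF p(1)] p(2)])
      show "F b ^ 3 = dp (fst p, snd p) b ^ cc p * (\<Prod>q\<in>PP - {p}. dp q b ^ cc q) * R b" if "b \<in> Ball2" for b
        using R(2) that prod.remove[OF PP(1) p(1), of "\<lambda>q. dp q b ^ cc q"] by simp
    qed (use PP p R in auto)
    then obtain R' where R': "WM (w - 3 * int k - 3) R'" "\<And>b. b \<in> Ball2 \<Longrightarrow> R b = dp p b * R' b" by auto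
    define c' where "c' = cc(p := Suc (cc p))"
    show ?case
    proof (intro exI[of _ c'] exI[of _ R'] conjI)
      show "\<forall>q\<in>PP. c' q \<le> m" using cc p by (auto simp: c'_def)
      have "sum c' (PP - {p}) = sum cc (PP - {p})" by (intro sum.cong) (auto simp: c'_def)
      then show "sum c' PP = Suc k" using cc(2) sum.remove[OF PP(1) p(1), of cc] sum.remove[OF PP(1) p(1), of c']
        by (simp add: c'_def)
      show "WM (w - 3 * int (Suc k)) R'" using R'(1) by (simp add: algebra_simps)
      show "\<forall>b\<in>Ball2. F b ^ 3 = (\<Prod>q\<in>PP. dp q b ^ c' q) * R' b"
      proof
        fix b assume b: "b \<in> Ball2"
        have "(\<Prod>q\<in>PP - {p}. dp q b ^ c' q) = (\<Prod>q\<in>PP - {p}. dp q b ^ cc q)"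
          by (intro prod.cong) (auto simp: c'_def)
        then show "F b ^ 3 = (\<Prod>q\<in>PP. dp q b ^ c' q) * R' b"
          using R(2) b R'(2)[OF b] prod.remove[OF PP(1) p(1), of "\<lambda>q. dp q b ^ cc q"]
            prod.remove[OF PP(1) p(1), of "\<lambda>q. dp q b ^ c' q"]
          by (simp add: c'_def mult_ac)
      qed
    qed
  qed
  from this[of "6 * m"] obtain cc R where cc: "\<forall>q\<in>PP. cc q \<le> m" "sum cc PP = 6 * m"
    and R: "WM (w - 3 * int (6 * m)) R" "\<forall>b\<in>Ball2. F b ^ 3 = (\<Prod>q\<in>PP. dp q b ^ cc q) * R b" by auto
  have "cc q = m" if q: "q \<in> PP" for q
  proof (rule ccontr)
    assume "cc q \<noteq> m"
    then have "cc q < m" using cc q by fastforce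
    then have "sum cc PP < (\<Sum>q\<in>PP. m)" using cc q PP(1) by (intro sum_strict_mono_ex1) auto
    then show False using cc PP by simp
  qed
  then have "(\<Prod>q\<in>PP. dp q b ^ cc q) = Pd b ^ m" for b by (simp add: Pd_def prod_power_distrib)
  then show ?thesis using R by (intro exI[of _ R]) simp
qed

text \<open>Injectivity of the substitution enters here: otherwise phi_1 = phi_2, and two distinct
  polynomials would have the same image.\<close>

lemma phi_12_neq: "\<exists>b\<in>Ball2. X 3 b \<noteq> X 4 b"
proof (rule ccontr)
  assume "\<not> ?thesis"
  then have eq: "\<And>b. b \<in> Ball2 \<Longrightarrow> \<phi> 1 b = \<phi> 2 b" by (auto simp: X_eqs)
  define P where "P k = (\<lambda>x :: 3 \<Rightarrow> nat. if x = (\<lambda>i. if i = k then 1 else 0) then 1 else (0::complex))" for k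
  have "P k \<in> polynomials3" for k
    by (auto simp: polynomials3_def P_def intro: finite_subset[of _ "{\<lambda>i. if i = k then 1 else 0}"])
  moreover have "subst_forms \<phi> (P 1) = subst_forms \<phi> (P 2)"
  proof -
    have s: "subst_forms \<phi> (P k) n b = (if b \<in> Ball2 \<and> n = 3 then \<phi> k b else 0)" for k n b
    proof -
      define e where "e = (\<lambda>i::3. if i = k then 1 else (0::nat))"
      have se: "(\<Sum>i\<in>UNIV. e i) = 1" by (simp add: e_def)
      have pe: "(\<Prod>i\<in>UNIV. \<phi> i b ^ e i) = \<phi> k b" by (simp add: e_def if_distrib[of "\<lambda>m. _ ^ m"] cong: if_cong)
      have S: "{x. P k x \<noteq> 0 \<and> n = 3 * int (\<Sum>i\<in>UNIV. x i)} = (if n = 3 then {e} else {})"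
        using se by (auto simp: P_def e_def[symmetric] simp del: of_nat_sum)
      have "P k e = 1" by (simp add: P_def e_def)
      then show ?thesis unfolding subst_forms_def S using pe by simp
    qed
    show ?thesis by (intro ext) (simp add: s eq)
  qed
  moreover have "inj_on (subst_forms \<phi>) polynomials3" using sg by (simp add: standard_generators_def bij_betw_def)
  ultimately have "P 1 = P 2" by (auto dest: inj_onD)
  then have "P 1 (\<lambda>i. if i = 1 then 1 else 0) = P 2 (\<lambda>i. if i = 1 then 1 else 0)" by simp
  moreover have "(\<lambda>i::3. if i = 1 then 1 else (0::nat)) \<noteq> (\<lambda>i. if i = 2 then 1 else 0)"
  proof
    assume "(\<lambda>i::3. if i = 1 then 1 else (0::nat)) = (\<lambda>i. if i = 2 then 1 else 0)"
    from fun_cong[OF this, of 1] show False by simp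
  qed
  ultimately show False by (simp add: P_def)
qed

end

lemma nabla_fst_power: "nabla (\<lambda>b. fst b ^ n) b = vector [of_nat n * fst b ^ (n - 1), 0]"
proof -
  have "deriv (\<lambda>z. z ^ n) a = of_nat n * a ^ (n - 1)" for a :: complex
    by (rule DERIV_imp_deriv) (auto intro!: derivative_eq_intros)
  then show ?thesis by (cases b) (simp add: nabla_def d_u_def d_v_def)
qed

lemma nabla_fst_power_mult:
  assumes "k holomorphic2_on Ball2" "b \<in> Ball2" "n > 0"
  shows "nabla (\<lambda>b. fst b ^ n * k b) b
    = fst b ^ (n - 1) *s (fst b *s nabla k b + vector [of_nat n * k b, 0])"
proof -
  have n: "fst b ^ n = fst b ^ (n - 1) * fst b" using assms(3) by (simp add: power_eq_if)
  have f: "(\<lambda>b. fst b ^ n) holomorphic2_on Ball2" by (intro hol2_intros)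
  show ?thesis unfolding nabla_mult[OF f assms(1,2)] nabla_fst_power n
    by (simp add: vec_eq_iff forall_2 algebra_simps)
qed

lemma cube_le_imp:
  fixes x :: real
  assumes "x \<ge> 0" "x ^ 3 \<le> C"
  shows "x \<le> C + 1"
proof (cases "x \<le> 1")
  case True
  have "0 \<le> x ^ 3" using assms(1) by simp
  then show ?thesis using True assms(2) by linarith
next
  case False
  then have "x ^ 1 \<le> x ^ 3" by (intro power_increasing) auto
  then show ?thesis using assms(2) by simp
qed

context generators
begin

section \<open>The order of the Jacobian and the root zeta\<close>

text \<open>The two forms agree on the axis, so the order is positive; invariance under u -> \<rho>
  u gives \<rho>^n = 1, which excludes 1 and 2.\<close>

lemma X34_order:
  obtains n h v0 where "h holomorphic2_on Ball2" "\<And>b. b \<in> Ball2 \<Longrightarrow> X 3 b - X 4 b = fst b ^ n * h b"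
    "Re v0 < 0" "h (0, v0) \<noteq> 0" "n \<ge> 3"
proof -
  define f where "f = (\<lambda>b. X 3 b - X 4 b)"
  have f: "f holomorphic2_on Ball2" unfolding f_def by (intro hol2_intros X_hol)
  obtain b1 where b1: "b1 \<in> Ball2" "f b1 \<noteq> 0" using phi_12_neq unfolding f_def by (metis eq_iff_diff_eq_0)
  obtain n h v0 where h: "h holomorphic2_on Ball2" "\<And>b. b \<in> Ball2 \<Longrightarrow> f b = fst b ^ n * h b"
    and v0: "Re v0 < 0" "h (0, v0) \<noteq> 0" by (rule hol2_order[OF f b1], rule that)
  have n0: "n \<noteq> 0"
  proof
    assume "n = 0"
    then have "f (0, v0) \<noteq> 0" using h(2)[of "(0, v0)"] v0 by (simp add: Ball2_axis)
    then show False using axis_X34[OF v0(1)] by (simp add: f_def)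
  qed
  have rot: "\<rho> ^ n * h (act rotm b) = h b" if b: "b \<in> Ball2" for b
  proof (rule hol2_eq_off_mirror[OF _ h(1) _ b])
    show "(\<lambda>b. \<rho> ^ n * h (act rotm b)) holomorphic2_on Ball2"
      by (intro hol2_intros hol2_compose_act h(1) Gamma_cong_Gamma rotm_Gamma_cong)
    fix b :: "complex \<times> complex" assume b: "b \<in> Ball2" "fst b \<noteq> 0"
    obtain u v where uv: "b = (u, v)" by (cases b)
    have rb: "(\<rho> * u, v) \<in> Ball2"
      using Gamma_act(2)[OF Gamma_cong_Gamma[OF rotm_Gamma_cong] b(1)] by (simp add: uv rotm_eqs)
    have "f (\<rho> * u, v) = f (u, v)" using X_rot b(1) by (simp add: f_def uv)
    then have "u ^ n * (\<rho> ^ n * h (\<rho> * u, v)) = u ^ n * h (u, v)"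
      using h(2)[OF rb] h(2)[OF b(1)] by (simp add: uv power_mult_distrib mult_ac)
    then show "\<rho> ^ n * h (act rotm b) = h b" using b(2) by (simp add: uv rotm_eqs)
  qed
  have "\<rho> ^ n * h (0, v0) = h (0, v0)" using rot[of "(0, v0)"] v0 by (simp add: Ball2_axis rotm_eqs)
  then have "\<rho> ^ n = 1" using v0 by simp
  then have "n \<noteq> 1" "n \<noteq> 2" using rho_neq_1 rho_cube
    by (auto simp: power2_eq_square power3_eq_cube)
  then show ?thesis using that[of h n v0] h v0 n0 by (auto simp: f_def)
qed

text \<open>Otherwise \<open>\<phi> 0 / \<phi> 1\<close> would be locally constant on the mirror \<open>u = 0\<close>, contradicting countable fibres.\<close>

lemma axis_wronskian: "\<exists>v. Re v < 0 \<and> \<phi> 1 (0, v) * d_v (\<phi> 0) (0, v) \<noteq> \<phi> 0 (0, v) * d_v (\<phi> 1) (0, v)"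
proof (rule ccontr)
  assume "\<not> ?thesis"
  then have W: "\<phi> 1 (0, v) * d_v (\<phi> 0) (0, v) = \<phi> 0 (0, v) * d_v (\<phi> 1) (0, v)" if "Re v < 0" for v
    using that by blast
  have op: "open {v. Re v < 0}" by (rule open_halfspace_Re_lt)
  have der: "((\<lambda>v. \<phi> i (0, v)) has_field_derivative d_v (\<phi> i) (0, v)) (at v)" if "Re v < 0" for i v
    unfolding d_v_def using holomorphic_derivI[OF hol2_axis[OF phi_hol] op] that by simp
  have "\<exists>v1. Re v1 < 0 \<and> \<phi> 1 (0, v1) \<noteq> 0"
  proof (rule ccontr)
    assume "\<not> ?thesis"
    then have "{v. Re v < 0} \<subseteq> {v. (0, v) \<in> fiber 1 0 0}"
      using axis_phi12 by (auto simp: fiber_def Ball2_axis)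
    then show False using countable_axis_fiber countable_subset uncountable_half_plane by blast
  qed
  then obtain v1 where v1: "Re v1 < 0" "\<phi> 1 (0, v1) \<noteq> 0" by blast
  have "continuous_on {v. Re v < 0} (\<lambda>v. \<phi> 1 (0, v))"
    by (intro holomorphic_on_imp_continuous_on hol2_axis phi_hol)
  then have "open ({v. Re v < 0} \<inter> (\<lambda>v. \<phi> 1 (0, v)) -` (- {0}))"
    by (rule continuous_open_preimage[OF _ op]) auto
  then obtain r where r: "r > 0" "ball v1 r \<subseteq> {v. Re v < 0} \<inter> (\<lambda>v. \<phi> 1 (0, v)) -` (- {0})"
    using v1 unfolding open_contains_ball by blast
  have "((\<lambda>v. \<phi> 0 (0, v) / \<phi> 1 (0, v)) has_field_derivative 0) (at v within ball v1 r)" if "v \<in> ball v1 r" for v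
  proof -
    have v: "Re v < 0" "\<phi> 1 (0, v) \<noteq> 0" using r(2) that by auto
    have "((\<lambda>v. \<phi> 0 (0, v) / \<phi> 1 (0, v)) has_field_derivative
      (d_v (\<phi> 0) (0, v) * \<phi> 1 (0, v) - \<phi> 0 (0, v) * d_v (\<phi> 1) (0, v)) / (\<phi> 1 (0, v) * \<phi> 1 (0, v))) (at v)"
      by (rule DERIV_divide[OF der der]) (use v in auto)
    moreover have "d_v (\<phi> 0) (0, v) * \<phi> 1 (0, v) - \<phi> 0 (0, v) * d_v (\<phi> 1) (0, v) = 0"
      using W[OF v(1)] by (simp only: mult.commute diff_self)
    ultimately have "((\<lambda>v. \<phi> 0 (0, v) / \<phi> 1 (0, v)) has_field_derivative 0) (at v)" by simp
    then show ?thesis by (rule has_field_derivative_at_within)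
  qed
  note der0 = this
  obtain c where c: "\<And>v. v \<in> ball v1 r \<Longrightarrow> \<phi> 0 (0, v) / \<phi> 1 (0, v) = c"
    using has_field_derivative_zero_constant[OF convex_ball der0] by blast
  have "ball v1 r \<subseteq> {v. (0, v) \<in> fiber c 1 1}"
  proof
    fix v assume v: "v \<in> ball v1 r"
    have v': "Re v < 0" "\<phi> 1 (0, v) \<noteq> 0" using r(2) v by auto
    have "\<phi> 0 (0, v) = \<phi> 1 (0, v) * c" unfolding c[OF v, symmetric] using v'(2) by simp
    then show "v \<in> {v. (0, v) \<in> fiber c 1 1}" using axis_phi12[of v] v'(1)
      by (auto simp: fiber_def Ball2_axis intro!: exI[of _ "\<phi> 1 (0, v)"])
  qed
  then show False using countable_axis_fiber countable_subset uncountable_ball[OF r(1)] by blast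
qed

text \<open>Replacing phi_2 by phi_2 - phi_1 = u^n k leaves the determinant unchanged, and u^(n - 1)
  divides both this difference and its gradient. The leading coefficient on the axis is h times a
  Wronskian of phi_0 and phi_1, up to a constant.\<close>

lemma J_order:
  assumes h: "h holomorphic2_on Ball2" "\<And>b. b \<in> Ball2 \<Longrightarrow> X 3 b - X 4 b = fst b ^ n * h b" "n > 0"
  obtains K where "K holomorphic2_on Ball2" "\<And>b. b \<in> Ball2 \<Longrightarrow> J b = fst b ^ (n - 1) * K b"
    "\<And>v. Re v < 0 \<Longrightarrow> K (0, v) = of_nat n * h (0, v) / 4 * (\<phi> 1 (0, v) * d_v (\<phi> 0) (0, v) - \<phi> 0 (0, v) * d_v (\<phi> 1) (0, v))"
proof -
  define k where "k = (\<lambda>b. h b / 4)"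
  have k: "k holomorphic2_on Ball2"
  proof -
    have "(\<lambda>b. 1 / 4 * h b) holomorphic2_on Ball2" by (intro hol2_intros h(1))
    then show ?thesis by (simp add: k_def)
  qed
  have d: "0 * \<phi> 0 b + (-1) * \<phi> 1 b + 1 * \<phi> 2 b = fst b ^ n * k b" if "b \<in> Ball2" for b
    using h(2)[OF that] by (simp add: X_eqs k_def field_simps)
  define V where "V = (\<lambda>b. fst b *s nabla k b + vector [of_nat n * k b, 0])"
  have V: "V b $ 1 = fst b * d_u k b + of_nat n * k b" "V b $ 2 = fst b * d_v k b" for b
    by (simp_all add: V_def nabla_nth)
  define K where "K = (\<lambda>b. \<phi> 0 b * w2 (nabla (\<phi> 1) b) (V b) - \<phi> 1 b * w2 (nabla (\<phi> 0) b) (V b)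
    + fst b * k b * w2 (nabla (\<phi> 0) b) (nabla (\<phi> 1) b))"
  show ?thesis
  proof (rule that[of K])
    show "K holomorphic2_on Ball2" unfolding K_def w2_def V nabla_nth
      by (intro hol2_intros hol2_d_u hol2_d_v open_Ball2 phi_hol k)
    show "K (0, v) = of_nat n * h (0, v) / 4 * (\<phi> 1 (0, v) * d_v (\<phi> 0) (0, v) - \<phi> 0 (0, v) * d_v (\<phi> 1) (0, v))"
      if "Re v < 0" for v
      by (simp add: K_def w2_def V nabla_nth k_def field_simps)
    fix b assume b: "b \<in> Ball2"
    have "J b = J3 (\<lambda>b. 1 * \<phi> 0 b + 0 * \<phi> 1 b + 0 * \<phi> 2 b) (\<lambda>b. 0 * \<phi> 0 b + 1 * \<phi> 1 b + 0 * \<phi> 2 b)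
       (\<lambda>b. 0 * \<phi> 0 b + (-1) * \<phi> 1 b + 1 * \<phi> 2 b) b"
      unfolding J3_lin[OF b] by simp
    also have "\<dots> = J3 (\<phi> 0) (\<phi> 1) (\<lambda>b. 0 * \<phi> 0 b + (-1) * \<phi> 1 b + 1 * \<phi> 2 b) b" by simp
    also have "\<dots> = \<phi> 0 b * w2 (nabla (\<phi> 1) b) (fst b ^ (n - 1) *s V b)
       - \<phi> 1 b * w2 (nabla (\<phi> 0) b) (fst b ^ (n - 1) *s V b) + fst b ^ n * k b * w2 (nabla (\<phi> 0) b) (nabla (\<phi> 1) b)"
    proof -
      have "nabla (\<lambda>b. 0 * \<phi> 0 b + (-1) * \<phi> 1 b + 1 * \<phi> 2 b) b = fst b ^ (n - 1) *s V b"
        unfolding V_def nabla_fst_power_mult[OF k b h(3), symmetric] by (rule nabla_cong[OF open_Ball2 b d])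
      then show ?thesis unfolding J3_def d[OF b] by simp
    qed
    also have "\<dots> = fst b ^ (n - 1) * K b"
    proof -
      have n: "fst b ^ n = fst b ^ (n - 1) * fst b" using h(3) by (simp add: power_eq_if)
      show ?thesis unfolding K_def w2_def n by (simp add: algebra_simps)
    qed
    finally show "J b = fst b ^ (n - 1) * K b" .
  qed
qed

text \<open>By 3 (n - 1) >= 2 n, J^3 is divisible by Pd^2 with a quotient of weight 36 - 36 = 0. The
  quotient is a nonzero constant since the Wronskian keeps J from vanishing identically, and
  comparing orders along u = 0 now settles n.\<close>

lemma J_Pd:
  obtains c h v0 b1 where "c \<noteq> 0" "\<And>b. b \<in> Ball2 \<Longrightarrow> J b ^ 3 = c * Pd b ^ 2" "b1 \<in> Ball2" "J b1 \<noteq> 0"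
    "h holomorphic2_on Ball2" "\<And>b. b \<in> Ball2 \<Longrightarrow> X 3 b - X 4 b = fst b ^ 3 * h b"
    "Re v0 < 0" "h (0, v0) \<noteq> 0"
proof -
  obtain n h v0 where h: "h holomorphic2_on Ball2" "\<And>b. b \<in> Ball2 \<Longrightarrow> X 3 b - X 4 b = fst b ^ n * h b"
    "Re v0 < 0" "h (0, v0) \<noteq> 0" and n: "n \<ge> 3" by (rule X34_order, rule that)
  have n0: "n > 0" using n by simp
  obtain K where K: "K holomorphic2_on Ball2" "\<And>b. b \<in> Ball2 \<Longrightarrow> J b = fst b ^ (n - 1) * K b"
    "\<And>v. Re v < 0 \<Longrightarrow> K (0, v) = of_nat n * h (0, v) / 4 * (\<phi> 1 (0, v) * d_v (\<phi> 0) (0, v) - \<phi> 0 (0, v) * d_v (\<phi> 1) (0, v))"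
    by (rule J_order[OF h(1,2) n0], assumption, rule that)
  have "\<exists>b1\<in>Ball2. J b1 \<noteq> 0"
  proof (rule ccontr)
    assume "\<not> ?thesis"
    then have J0: "J b = 0" if "b \<in> Ball2" for b using that by blast
    have K0: "K b = 0" if "b \<in> Ball2" for b
      by (rule hol2_eq_off_mirror[OF K(1) hol2_const _ that]) (use K(2) J0 in auto)
    have ax: "(\<lambda>v. \<phi> i (0, v)) holomorphic_on {v. Re v < 0}" "(\<lambda>v. d_v (\<phi> i) (0, v)) holomorphic_on {v. Re v < 0}" for i
      by (intro hol2_axis hol2_d_v open_Ball2 phi_hol)+
    have "\<phi> 1 (0, v) * d_v (\<phi> 0) (0, v) - \<phi> 0 (0, v) * d_v (\<phi> 1) (0, v) = 0" if v: "Re v < 0" for v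
    proof (rule half_plane_zero[OF _ hol2_axis[OF h(1)] countable_empty h(3,4) _ v, of _ 1])
      show "(\<lambda>v. \<phi> 1 (0, v) * d_v (\<phi> 0) (0, v) - \<phi> 0 (0, v) * d_v (\<phi> 1) (0, v)) holomorphic_on {v. Re v < 0}"
        by (intro holomorphic_intros ax)
      fix v assume v: "Re v < 0"
      show "h (0, v) ^ 1 * (\<phi> 1 (0, v) * d_v (\<phi> 0) (0, v) - \<phi> 0 (0, v) * d_v (\<phi> 1) (0, v)) = 0"
        using K(3)[OF v] K0[of "(0, v)"] n0 v by (auto simp: Ball2_axis)
    qed
    then show False using axis_wronskian by auto
  qed
  then obtain b1 where b1: "b1 \<in> Ball2" "J b1 \<noteq> 0" by blast
  have "\<exists>R. WM (36 - 18 * int 2) R \<and> (\<forall>b\<in>Ball2. J b ^ 3 = Pd b ^ 2 * R b)"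
  proof (rule div_all[where e' = "n - 1" and m = 2, OF h n0 _ _ J_cube_WM])
    show "3 * (n - 1) \<ge> n * 2" using n by simp
    fix g \<tau> s assume T: "Tr g \<tau> s"
    obtain \<kappa> where \<kappa>: "\<And>b. b \<in> Ball2 \<Longrightarrow> J (act g b) = j1 g b ^ 12 * (\<kappa> * J b)" using J_act[OF T] by blast
    show "\<exists>K. K holomorphic2_on Ball2 \<and> (\<forall>b\<in>Ball2. J (act g b) = fst b ^ (n - 1) * K b)"
      by (rule exI[of _ "\<lambda>b. j1 g b ^ 12 * (\<kappa> * K b)"]) (auto simp: \<kappa> K(2) intro!: hol2_intros hol2_j1 K(1))
  qed
  then obtain R where R: "WM 0 R" "\<And>b. b \<in> Ball2 \<Longrightarrow> J b ^ 3 = Pd b ^ 2 * R b" by auto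
  obtain c where "\<And>b. b \<in> Ball2 \<Longrightarrow> R b = c" using WM_0_const[OF R(1)] by blast
  then have c: "J b ^ 3 = c * Pd b ^ 2" if "b \<in> Ball2" for b using R(2)[OF that] that by simp
  have c0: "c \<noteq> 0" using c[OF b1(1)] b1(2) by auto
  have "n = 3"
  proof (rule ccontr)
    assume "n \<noteq> 3"
    \<comment> \<open>3 (n - 1) exceeds 2 n by this \<open>r\<close>; if it were positive, h Q would
      vanish on the axis, although Q is nonzero there off a countable set.\<close>
    define r where "r = n - 3"
    have r: "r > 0" "3 * (n - 1) = n + n + r" using n \<open>n \<noteq> 3\<close> by (auto simp: r_def)
    define Q where "Q = (\<lambda>b. \<Prod>q\<in>PP - {(3, 4)}. dp q b)"
    have Q: "Pd b = (X 3 b - X 4 b) * Q b" for b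
      using prod.remove[OF PP(1), of "(3, 4)" "\<lambda>q. dp q b"] by (simp add: Pd_def Q_def dp_def PP_def)
    have Qh: "Q holomorphic2_on Ball2" unfolding Q_def by (intro hol2_intros dp_hol)
    have eq: "c * (h b * Q b) ^ 2 = fst b ^ r * K b ^ 3" if b: "b \<in> Ball2" for b
    proof (rule hol2_eq_off_mirror[OF _ _ _ b])
      show "(\<lambda>b. c * (h b * Q b) ^ 2) holomorphic2_on Ball2" "(\<lambda>b. fst b ^ r * K b ^ 3) holomorphic2_on Ball2"
        by (intro hol2_intros h(1) Qh K(1))+
      fix b assume b: "b \<in> Ball2" "fst b \<noteq> 0"
      define u where "u = fst b"
      have "(u ^ n * u ^ n) * (c * (h b * Q b) ^ 2) = c * Pd b ^ 2"
        unfolding Q h(2)[OF b(1)] u_def by (simp add: power2_eq_square mult_ac)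
      also have "\<dots> = (u ^ (n - 1)) ^ 3 * K b ^ 3" using c[OF b(1)] K(2)[OF b(1)] by (simp add: u_def power_mult_distrib)
      also have "(u ^ (n - 1)) ^ 3 = u ^ (n + n + r)" unfolding r(2)[symmetric] by (simp add: mult.commute flip: power_mult)
      also have "\<dots> * K b ^ 3 = (u ^ n * u ^ n) * (u ^ r * K b ^ 3)" by (simp add: power_add)
      finally show "c * (h b * Q b) ^ 2 = fst b ^ r * K b ^ 3" using b(2) by (simp add: u_def)
    qed
    define C where "C = (\<Union>q\<in>PP - {(3, 4)}. {v. Re v < 0 \<and> X (fst q) (0, v) = X (snd q) (0, v)})"
    have C: "countable C" unfolding C_def
    proof (rule countable_UN[OF countable_finite])
      show "finite (PP - {(3, 4)})" using PP by simp
      fix q assume "q \<in> PP - {(3, 4)}"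
      then have "fst q \<noteq> snd q" "{fst q, snd q} \<noteq> {3, 4}"
        using PP(3)[of q] PP(4)[of q "(3, 4)"] by (auto simp: PP_def)
      then show "countable {v. Re v < 0 \<and> X (fst q) (0, v) = X (snd q) (0, v)}" by (rule axis_pair_countable)
    qed
    have "(1 :: complex) = 0"
    proof (rule half_plane_zero[OF holomorphic_on_const hol2_axis[OF h(1)] C h(3,4) _ h(3), of 1])
      fix v assume v: "Re v < 0" "v \<notin> C"
      have "Q (0, v) \<noteq> 0" using v PP(1) by (auto simp: Q_def C_def dp_def)
      then show "h (0, v) ^ 1 * 1 = 0" using eq[of "(0, v)"] v(1) r(1) c0 by (simp add: Ball2_axis power_0_left)
    qed
    then show False by simp
  qed
  then show ?thesis using that[OF c0 c b1 h(1) _ h(3,4)] h(2) by simp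
qed

text \<open>From J^3 = c Pd^2 the cube of Pd / J is Pd / c, which is locally bounded, so the
  quotient extends across the zeros of J. Both identities hold off these zeros, hence
  everywhere.\<close>

lemma zeta_exists:
  obtains \<zeta> c h v0 b1 where "c \<noteq> 0" "\<zeta> holomorphic2_on Ball2" "\<And>b. b \<in> Ball2 \<Longrightarrow> Pd b = c * \<zeta> b ^ 3"
    "\<And>b. b \<in> Ball2 \<Longrightarrow> J b = c * \<zeta> b ^ 2" "b1 \<in> Ball2" "\<zeta> b1 \<noteq> 0"
    "h holomorphic2_on Ball2" "\<And>b. b \<in> Ball2 \<Longrightarrow> X 3 b - X 4 b = fst b ^ 3 * h b"
proof -
  obtain c h v0 b1 where c: "c \<noteq> 0" "\<And>b. b \<in> Ball2 \<Longrightarrow> J b ^ 3 = c * Pd b ^ 2" and b1: "b1 \<in> Ball2" "J b1 \<noteq> 0"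
    and h: "h holomorphic2_on Ball2" "\<And>b. b \<in> Ball2 \<Longrightarrow> X 3 b - X 4 b = fst b ^ 3 * h b"
    by (rule J_Pd, rule that)
  have Pd_hol: "Pd holomorphic2_on Ball2" unfolding Pd_def[abs_def] by (intro hol2_intros dp_hol)
  have F: "(\<lambda>b. Pd b / J b) holomorphic2_on {z \<in> Ball2. J z \<noteq> 0}"
    by (rule hol2_divide[OF hol2_subset[OF Pd_hol] hol2_subset[OF hol2_J] open_nonzero[OF hol2_J open_Ball2]]) auto
  have bd: "\<exists>W C. open W \<and> b \<in> W \<and> (\<forall>z\<in>W \<inter> Ball2. J z \<noteq> 0 \<longrightarrow> cmod (Pd z / J z) \<le> C)"
    if b: "b \<in> Ball2 - {}" for b
  proof -
    obtain W C where W: "open W" "b \<in> W" "W \<subseteq> Ball2" and C: "\<And>z. z \<in> W \<Longrightarrow> cmod (Pd z) \<le> C"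
      using hol2_locally_bounded[OF hol2_imp_continuous_on[OF Pd_hol] open_Ball2, of b] b by blast
    have "cmod (Pd z / J z) \<le> C / cmod c + 1" if z: "z \<in> W \<inter> Ball2" "J z \<noteq> 0" for z
    proof (rule cube_le_imp)
      have P0: "Pd z \<noteq> 0" using c(2)[of z] z by auto
      have "(Pd z / J z) ^ 3 = Pd z ^ 3 / (c * Pd z ^ 2)" unfolding power_divide using c(2)[of z] z by simp
      also have "\<dots> = Pd z / c" using P0 c(1) by (simp add: power2_eq_square power3_eq_cube)
      finally have "cmod (Pd z / J z) ^ 3 = cmod (Pd z) / cmod c" by (metis norm_divide norm_power)
      also have "\<dots> \<le> C / cmod c" using C z by (intro divide_right_mono) auto
      finally show "cmod (Pd z / J z) ^ 3 \<le> C / cmod c" .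
    qed simp
    then show ?thesis using W by blast
  qed
  obtain \<zeta> where \<zeta>: "\<zeta> holomorphic2_on Ball2" "\<And>z. z \<in> Ball2 \<Longrightarrow> J z \<noteq> 0 \<Longrightarrow> \<zeta> z = Pd z / J z"
    by (rule hol2_extend[OF hol2_J b1 countable_empty F bd], assumption, rule that)
  have off: "Pd b = c * \<zeta> b ^ 3 \<and> J b = c * \<zeta> b ^ 2" if b: "b \<in> Ball2" "J b \<noteq> 0" for b
  proof -
    have P0: "Pd b \<noteq> 0" using c(2)[OF b(1)] b(2) by auto
    have "c * (Pd b / J b) ^ 3 = Pd b ^ 3 * c / J b ^ 3" by (simp add: power_divide)
    also have "\<dots> = Pd b" unfolding c(2)[OF b(1)] using P0 c(1) by (simp add: power2_eq_square power3_eq_cube)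
    finally have 1: "Pd b = c * \<zeta> b ^ 3" using \<zeta>(2)[OF b] by simp
    have "c * (Pd b / J b) ^ 2 = c * Pd b ^ 2 / J b ^ 2" by (simp add: power_divide)
    also have "\<dots> = J b" unfolding c(2)[OF b(1), symmetric] using b(2) by (simp add: power2_eq_square power3_eq_cube)
    finally have 2: "J b = c * \<zeta> b ^ 2" using \<zeta>(2)[OF b] by simp
    show ?thesis using 1 2 by (rule conjI)
  qed
  have "Pd b = c * \<zeta> b ^ 3" if b: "b \<in> Ball2" for b
  proof (rule hol2_eq_of_dense[OF hol2_J b1 open_Ball2 order_refl _ _ _ b])
    show "continuous_on Ball2 Pd" "continuous_on Ball2 (\<lambda>b. c * \<zeta> b ^ 3)"
      by (intro hol2_imp_continuous_on hol2_intros Pd_hol \<zeta>(1))+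
    show "Pd b = c * \<zeta> b ^ 3" if "b \<in> Ball2" "J b \<noteq> 0" for b using off[OF that] by simp
  qed
  moreover have "J b = c * \<zeta> b ^ 2" if b: "b \<in> Ball2" for b
  proof (rule hol2_eq_of_dense[OF hol2_J b1 open_Ball2 order_refl _ _ _ b])
    show "continuous_on Ball2 J" "continuous_on Ball2 (\<lambda>b. c * \<zeta> b ^ 2)"
      by (intro hol2_imp_continuous_on hol2_intros hol2_J \<zeta>(1))+
    show "J b = c * \<zeta> b ^ 2" if "b \<in> Ball2" "J b \<noteq> 0" for b using off[OF that] by simp
  qed
  moreover have "\<zeta> b1 \<noteq> 0" using off[OF b1] b1(2) by auto
  ultimately show ?thesis by (intro that[OF c(1) \<zeta>(1) _ _ b1(1) _ h])
qed

end

section \<open>Brackets and their quotients\<close>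

lemma nabla_act3:
  assumes h: "h \<in> \<Gamma>" and z: "z \<in> Ball2"
    and f: "f holomorphic2_on Ball2" "f' holomorphic2_on Ball2" "\<And>b. b \<in> Ball2 \<Longrightarrow> f (act h b) = j1 h b ^ 3 * f' b"
  shows "nabla f (act h z) = j1 h z *s (j2 h z *v (j1 h z ^ 3 *s nabla f' z + f' z *s nabla (\<lambda>b. j1 h b ^ 3) z))"
proof -
  have "nabla (\<lambda>b. f (act h b)) z = nabla (\<lambda>b. j1 h b ^ 3 * f' b) z"
    by (rule nabla_cong[OF open_Ball2 z f(3)])
  also have "\<dots> = j1 h z ^ 3 *s nabla f' z + f' z *s nabla (\<lambda>b. j1 h b ^ 3) z"
    using nabla_mult[OF hol2_power[OF hol2_j1] f(2) z, of h 3] by simp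
  finally show ?thesis using nabla_act[OF h f(1) z] by simp
qed

abbreviation br :: "scalar_fun \<Rightarrow> scalar_fun \<Rightarrow> complex \<times> complex \<Rightarrow> complex^2" where
  "br f g \<equiv> bracket 3 3 f g"

lemma br_nth:
  "br f g z $ 1 = 1 / 3 * (f z * d_u g z - g z * d_u f z)"
  "br f g z $ 2 = 1 / 3 * (f z * d_v g z - g z * d_v f z)"
  by (simp_all add: bracket_def nabla_nth field_simps)

lemma hol2_br:
  assumes "f holomorphic2_on Ball2" "g holomorphic2_on Ball2"
  shows "(\<lambda>z. br f g z $ i) holomorphic2_on Ball2"
  using exhaust_2[of i]
proof
  assume i: "i = 1"
  show ?thesis unfolding i br_nth by (intro hol2_intros hol2_d_u open_Ball2 assms)
next
  assume i: "i = 2"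
  show ?thesis unfolding i br_nth by (intro hol2_intros hol2_d_v open_Ball2 assms)
qed

text \<open>As in \<open>J3_act\<close> the gradient of the automorphy factor cancels; the weight is
  7 = 3 + 3 + 1.\<close>

lemma br_act:
  assumes h: "h \<in> \<Gamma>" and z: "z \<in> Ball2"
    and f: "f holomorphic2_on Ball2" "f' holomorphic2_on Ball2" "\<And>b. b \<in> Ball2 \<Longrightarrow> f (act h b) = j1 h b ^ 3 * f' b"
    and g: "g holomorphic2_on Ball2" "g' holomorphic2_on Ball2" "\<And>b. b \<in> Ball2 \<Longrightarrow> g (act h b) = j1 h b ^ 3 * g' b"
  shows "br f g (act h z) = j1 h z ^ 7 *s (j2 h z *v br f' g' z)"
proof -
  define j where "j = j1 h z"
  define p where "p = j ^ 3"
  define A where "A = j2 h z"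
  define \<nu> where "\<nu> = nabla (\<lambda>b. j1 h b ^ 3) z"
  have nf: "nabla f (act h z) = j *s (A *v (p *s nabla f' z + f' z *s \<nu>))"
    unfolding j_def A_def p_def \<nu>_def by (rule nabla_act3[OF h z f])
  have ng: "nabla g (act h z) = j *s (A *v (p *s nabla g' z + g' z *s \<nu>))"
    unfolding j_def A_def p_def \<nu>_def by (rule nabla_act3[OF h z g])
  have j7: "j ^ 7 = j * (p * p)" by (simp add: p_def eval_nat_numeral mult_ac)
  have "br f g (act h z) = (1 / 3 * (p * f' z)) *s nabla g (act h z) - (1 / 3 * (p * g' z)) *s nabla f (act h z)"
    by (simp add: bracket_def f(3)[OF z] g(3)[OF z] p_def j_def)
  also have "\<dots> = (j * (p * p)) *s (A *v br f' g' z)"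
    unfolding nf ng bracket_def
    by (simp add: vec_eq_iff forall_2 matrix_vector_mult_def sum_2 algebra_simps)
  finally show ?thesis unfolding j7[symmetric] by (simp add: j_def A_def)
qed

lemma sym_vec_2_scale: "sym_vec 2 (c *s x) m = c ^ 2 * sym_vec 2 x m"
  by (simp add: sym_vec_2 power2_eq_square mult_ac)

lemma sym_vec_2_matrix: "sym_vec 2 (A *v x) m = sym2 A (sym_vec 2 x) m"
  by (metis sym_app_2 sym_mat_sym_vec)

lemma sym_vec_2_uminus: "sym_vec 2 (- x) = sym_vec 2 x"
proof
  show "sym_vec 2 (- x) m = sym_vec 2 x m" for m
    unfolding vector_sneg_minus1[of x] sym_vec_2_scale by simp
qed

lemma UNIV_4_eq:
  fixes a b c l :: 4
  assumes "distinct [l, a, b, c]"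
  shows "UNIV = {l, a, b, c}"
proof (rule sym, rule card_subset_eq)
  show "card {l, a, b, c} = card (UNIV :: 4 set)" using assms by simp
qed auto

context generators
begin

text \<open>Brackets of differences are alternating in a, b, c (\<open>Wv_swap\<close>), so up to
  sign they depend only on the index left out.\<close>

definition Wv :: "4 \<Rightarrow> 4 \<Rightarrow> 4 \<Rightarrow> complex \<times> complex \<Rightarrow> complex^2" where
  "Wv a b c = br (dp (a, b)) (dp (a, c))"

lemma dp_d:
  assumes "z \<in> Ball2"
  shows "d_u (dp (a, b)) z = d_u (X a) z - d_u (X b) z" "d_v (dp (a, b)) z = d_v (X a) z - d_v (X b) z"
proof -
  have "nabla (\<lambda>b'. 1 * X a b' + (-1) * X b b') z = 1 *s nabla (X a) z + (-1) *s nabla (X b) z"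
    by (rule nabla_lin[OF X_hol X_hol assms])
  moreover have "dp (a, b) = (\<lambda>b'. 1 * X a b' + (-1) * X b b')" by (simp add: dp_def fun_eq_iff)
  ultimately have *: "nabla (dp (a, b)) z = nabla (X a) z - nabla (X b) z" by simp
  show "d_u (dp (a, b)) z = d_u (X a) z - d_u (X b) z" "d_v (dp (a, b)) z = d_v (X a) z - d_v (X b) z"
    using arg_cong[OF *, of "\<lambda>x. x $ 1"] arg_cong[OF *, of "\<lambda>x. x $ 2"] by (simp_all add: nabla_nth)
qed

lemma Wv_swap:
  assumes "z \<in> Ball2"
  shows "Wv b a c z = - Wv a b c z" "Wv a c b z = - Wv a b c z"
  unfolding vec_eq_iff forall_2 vector_uminus_component Wv_def br_nth dp_d[OF assms] dp_def fst_conv snd_conv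
  by (simp_all add: algebra_simps)

lemma hol2_Wv: "(\<lambda>z. Wv a b c z $ i) holomorphic2_on Ball2"
  unfolding Wv_def by (intro hol2_br dp_hol)

lemma Wv_perm:
  assumes z: "z \<in> Ball2" and d: "distinct [a, b, c]" and s: "{a, b, c} = {p, q, r}"
  shows "Wv a b c z = Wv p q r z \<or> Wv a b c z = - Wv p q r z"
proof -
  have "a = p \<or> a = q \<or> a = r" "b = p \<or> b = q \<or> b = r" "c = p \<or> c = q \<or> c = r" using s by blast+
  then have *: "(a = p \<and> b = q \<and> c = r) \<or> (a = p \<and> b = r \<and> c = q) \<or> (a = q \<and> b = p \<and> c = r)
     \<or> (a = q \<and> b = r \<and> c = p) \<or> (a = r \<and> b = p \<and> c = q) \<or> (a = r \<and> b = q \<and> c = p)"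
    using d by auto
  have 1: "Wv q p r z = - Wv p q r z" "Wv p r q z = - Wv p q r z" by (rule Wv_swap[OF z])+
  have 2: "Wv q r p z = Wv p q r z" using Wv_swap(2)[OF z, of q r p] 1(1) by simp
  have 3: "Wv r p q z = Wv p q r z" using Wv_swap(1)[OF z, of r p q] 1(2) by simp
  have 4: "Wv r q p z = - Wv p q r z" using Wv_swap(2)[OF z, of r q p] 3 by simp
  show ?thesis using * by (elim disjE conjE) (simp_all add: 1 2 3 4)
qed

text \<open>\<open>l\<close> is the omitted index. The sign depends on the chosen order of the
  others and disappears in symmetric squares.\<close>

definition Wl :: "4 \<Rightarrow> complex \<times> complex \<Rightarrow> complex^2" where
  "Wl l = (if l = 1 then Wv 2 3 4 else if l = 2 then Wv 1 3 4 else if l = 3 then Wv 1 2 4 else Wv 1 2 3)"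

lemma hol2_Wl: "(\<lambda>z. Wl l z $ i) holomorphic2_on Ball2"
  by (simp add: Wl_def hol2_Wv)

lemma Wl_sym:
  assumes z: "z \<in> Ball2" and d: "distinct [l, a, b, c]"
  shows "sym_vec 2 (Wv a b c z) = sym_vec 2 (Wl l z)"
proof -
  obtain p q r where pqr: "Wl l = Wv p q r" "distinct [l, p, q, r]"
  proof -
    have "l = 1 \<or> l = 2 \<or> l = 3 \<or> l = 4" by (rule exhaust_4)
    then show ?thesis
      using that[of 2 3 4] that[of 1 3 4] that[of 1 2 4] that[of 1 2 3] four_neq
      by (elim disjE) (simp_all add: Wl_def)
  qed
  have "UNIV - {l} = {a, b, c}" using UNIV_4_eq[OF d] d by auto
  moreover have "UNIV - {l} = {p, q, r}" using UNIV_4_eq[OF pqr(2)] pqr(2) by auto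
  ultimately have "{a, b, c} = {p, q, r}" by simp
  then have "Wv a b c z = Wl l z \<or> Wv a b c z = - Wl l z"
    unfolding pqr(1) using Wv_perm[OF z, of a b c] d by simp
  then show ?thesis using sym_vec_2_uminus by auto
qed

text \<open>Pd divided by \<open>El l\<close> is, up to sign, the product of the three differences
  without \<open>l\<close>. Writing the quotients as El l / Pd gives all four of them the same
  denominator.\<close>

definition El :: "4 \<Rightarrow> scalar_fun" where
  "El l z = (\<Prod>m\<in>UNIV - {l}. X l z - X m z)"

lemma hol2_El: "El l holomorphic2_on Ball2"
  unfolding El_def[abs_def] by (intro hol2_intros X_hol)

text \<open>Covers the points where two differences vanish (\<open>Bad_I\<close>): up to constants
  the differences are the phi_i and the phi_i - phi_j, and two such equations make all nonzero phi_i
  equal.\<close>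

definition Bad :: "(complex \<times> complex) set" where
  "Bad = (\<Union>p\<in>{0, 1}. \<Union>q\<in>{0, 1}. \<Union>r\<in>{0, 1}. fiber p q r)"

lemma countable_Bad: "countable Bad"
  unfolding Bad_def by (intro countable_UN countable_finite countable_fiber) auto

lemma dp_phi: "dp (1, 2) b = 4 * \<phi> 0 b" "dp (1, 3) b = 4 * \<phi> 1 b" "dp (1, 4) b = 4 * \<phi> 2 b"
  "dp (2, 3) b = 4 * (\<phi> 1 b - \<phi> 0 b)" "dp (2, 4) b = 4 * (\<phi> 2 b - \<phi> 0 b)" "dp (3, 4) b = 4 * (\<phi> 2 b - \<phi> 1 b)"
  by (simp_all add: dp_def X_eqs)

lemma Bad_I:
  assumes b: "b \<in> Ball2" and q: "q \<in> PP" "q' \<in> PP" "q \<noteq> q'" "dp q b = 0" "dp q' b = 0"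
  shows "b \<in> Bad"
proof -
  define \<mu> where "\<mu> = (if \<phi> 0 b \<noteq> 0 then \<phi> 0 b else if \<phi> 1 b \<noteq> 0 then \<phi> 1 b else \<phi> 2 b)"
  have \<mu>: "(\<phi> 0 b = 0 \<or> \<phi> 0 b = \<mu>) \<and> (\<phi> 1 b = 0 \<or> \<phi> 1 b = \<mu>) \<and> (\<phi> 2 b = 0 \<or> \<phi> 2 b = \<mu>)"
    using q unfolding PP_def by (auto simp: dp_phi \<mu>_def)
  define t where "t i = (if \<phi> i b = 0 then 0 else 1 :: complex)" for i
  have "b \<in> fiber (t 0) (t 1) (t 2)" using \<mu> b by (auto simp: fiber_def t_def intro!: exI[of _ \<mu>])
  then show ?thesis unfolding Bad_def t_def by (auto split: if_splits)
qed

definition Uq :: "4 \<times> 4 \<Rightarrow> scalar_fun" where "Uq q z = (\<Prod>p\<in>PP - {q}. dp p z)"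

lemma hol2_Uq: "Uq q holomorphic2_on Ball2"
  unfolding Uq_def[abs_def] by (intro hol2_intros dp_hol)

lemma Pd_Uq: "q \<in> PP \<Longrightarrow> Pd z = dp q z * Uq q z"
  unfolding Pd_def Uq_def by (rule prod.remove) (simp_all add: PP)

lemma Uq_nz: "z \<in> Ball2 \<Longrightarrow> z \<notin> Bad \<Longrightarrow> q \<in> PP \<Longrightarrow> dp q z = 0 \<Longrightarrow> Uq q z \<noteq> 0"
  unfolding Uq_def using Bad_I[of z q] PP(1) by auto

lemma hol2_Pd: "Pd holomorphic2_on Ball2"
  unfolding Pd_def[abs_def] by (intro hol2_intros dp_hol)

end

section \<open>The quotients \<open>G l\<close>\<close>

text \<open>Collects the data supplied by \<open>zeta_exists\<close>. The point \<open>bz\<close>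
  witnesses that \<zeta>, and with it Pd, is not identically zero, as the density arguments
  require.\<close>

locale mirror_root = generators +
  fixes \<zeta> :: scalar_fun and cz :: complex and h34 :: scalar_fun and bz :: "complex \<times> complex"
  assumes cz: "cz \<noteq> 0" and zeta_hol: "\<zeta> holomorphic2_on Ball2"
    and zeta_Pd: "\<And>b. b \<in> Ball2 \<Longrightarrow> Pd b = cz * \<zeta> b ^ 3"
    and zeta_J: "\<And>b. b \<in> Ball2 \<Longrightarrow> J b = cz * \<zeta> b ^ 2"
    and bz: "bz \<in> Ball2" "\<zeta> bz \<noteq> 0"
    and h34: "h34 holomorphic2_on Ball2" "\<And>b. b \<in> Ball2 \<Longrightarrow> X 3 b - X 4 b = fst b ^ 3 * h34 b"
begin

lemma Pd_bz: "Pd bz \<noteq> 0"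
  using zeta_Pd[OF bz(1)] bz(2) cz by simp

text \<open>Where \<open>Uq q\<close> is nonzero, dp q = cz \<zeta>^3 / Uq. Both this function and
  its gradient are divisible by \<zeta>^2, hence so is its bracket with any
  \<open>f\<close>.\<close>

lemma br_local:
  assumes q: "q \<in> PP" and f: "f holomorphic2_on Ball2"
  obtains K where "\<And>i. continuous_on {b \<in> Ball2. Uq q b \<noteq> 0} (\<lambda>b. K b $ i)"
    "\<And>b. b \<in> Ball2 \<Longrightarrow> Uq q b \<noteq> 0 \<Longrightarrow> br (dp q) f b = \<zeta> b ^ 2 *s K b"
proof -
  define U where "U = Uq q"
  define N where "N = {b \<in> Ball2. U b \<noteq> 0}"
  \<comment> \<open>Solves the product rule for dp q * U = cz * \<zeta>^3 for the derivative of dp q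
    and divides by \<zeta>^2; \<open>d\<close> stands for either partial derivative.\<close>
  define \<kappa> where "\<kappa> d = (\<lambda>b. 1 / 3 * ((cz * \<zeta> b / U b) * d f b
    - f b * ((3 * cz * d \<zeta> b - cz * \<zeta> b * d U b / U b) / U b)))" for d :: "scalar_fun \<Rightarrow> scalar_fun"
  have U: "U holomorphic2_on Ball2" unfolding U_def by (rule hol2_Uq)
  have cont: "continuous_on N g" if "g holomorphic2_on Ball2" for g
    by (rule continuous_on_subset[OF hol2_imp_continuous_on[OF that]]) (auto simp: N_def)
  have c\<kappa>: "continuous_on N (\<kappa> d)" if d: "d = d_u \<or> d = d_v" for d
  proof -
    have "\<And>g. g holomorphic2_on Ball2 \<Longrightarrow> continuous_on N (d g)"
      using d cont hol2_d_u[OF _ open_Ball2] hol2_d_v[OF _ open_Ball2] by blast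
    then show ?thesis unfolding \<kappa>_def using cont[OF U] cont[OF f] cont[OF zeta_hol] U f zeta_hol
      by (intro continuous_intros) (auto simp: N_def)
  qed
  have main: "1 / 3 * (dp q b * d f b - f b * d (dp q) b) = \<zeta> b ^ 2 * \<kappa> d b"
    if b: "b \<in> Ball2" "U b \<noteq> 0" and e: "dp q b * d U b + U b * d (dp q) b = 3 * cz * \<zeta> b ^ 2 * d \<zeta> b" for b d
  proof -
    have "dp q b * U b = cz * \<zeta> b ^ 3" using Pd_Uq[OF q, of b] zeta_Pd[OF b(1)] by (simp add: U_def)
    then have 1: "dp q b = \<zeta> b ^ 2 * (cz * \<zeta> b / U b)" using b(2) by (simp add: field_simps power2_eq_square power3_eq_cube)
    have "U b * d (dp q) b = 3 * cz * \<zeta> b ^ 2 * d \<zeta> b - dp q b * d U b" using e by (simp add: algebra_simps)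
    then have "d (dp q) b = (3 * cz * \<zeta> b ^ 2 * d \<zeta> b - dp q b * d U b) / U b" using b(2) by (simp add: field_simps)
    also have "\<dots> = \<zeta> b ^ 2 * ((3 * cz * d \<zeta> b - cz * \<zeta> b * d U b / U b) / U b)"
      unfolding 1 using b(2) by (simp add: diff_divide_distrib algebra_simps)
    finally show ?thesis unfolding \<kappa>_def by (subst 1) (simp only: algebra_simps)
  qed
  have nab: "dp q b *s nabla U b + U b *s nabla (dp q) b = (3 * cz * \<zeta> b ^ 2) *s nabla \<zeta> b" if b: "b \<in> Ball2" for b
  proof -
    have "nabla (\<lambda>b. dp q b * U b) b = nabla (\<lambda>b. cz * (\<zeta> b * (\<zeta> b * \<zeta> b)) + 0 * \<zeta> b) b"
      by (rule nabla_cong[OF open_Ball2 b])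
        (use Pd_Uq[OF q] zeta_Pd in \<open>simp add: U_def power3_eq_cube mult_ac\<close>)
    also have "\<dots> = cz *s nabla (\<lambda>b. \<zeta> b * (\<zeta> b * \<zeta> b)) b + 0 *s nabla \<zeta> b"
      by (rule nabla_lin[OF _ zeta_hol b]) (intro hol2_intros zeta_hol)
    also have "nabla (\<lambda>b. \<zeta> b * (\<zeta> b * \<zeta> b)) b = (3 * \<zeta> b ^ 2) *s nabla \<zeta> b"
      unfolding nabla_mult[OF zeta_hol hol2_mult[OF zeta_hol zeta_hol] b] nabla_mult[OF zeta_hol zeta_hol b]
      by (simp add: vec_eq_iff power2_eq_square algebra_simps)
    finally show ?thesis unfolding nabla_mult[OF dp_hol U b] by (simp add: mult_ac)
  qed
  define K where "K = (\<lambda>b. vector [\<kappa> d_u b, \<kappa> d_v b] :: complex^2)"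
  show ?thesis
  proof (rule that[of K])
    fix i :: 2
    have "continuous_on N (\<lambda>b. K b $ i)"
      using exhaust_2[of i] c\<kappa>[of d_u] c\<kappa>[of d_v] by (auto simp: K_def)
    then show "continuous_on {b \<in> Ball2. Uq q b \<noteq> 0} (\<lambda>b. K b $ i)" by (simp add: N_def U_def)
  next
    fix b assume b: "b \<in> Ball2" "Uq q b \<noteq> 0"
    then have b': "U b \<noteq> 0" by (simp add: U_def)
    have u: "dp q b * d_u U b + U b * d_u (dp q) b = 3 * cz * \<zeta> b ^ 2 * d_u \<zeta> b"
      "dp q b * d_v U b + U b * d_v (dp q) b = 3 * cz * \<zeta> b ^ 2 * d_v \<zeta> b"
      using arg_cong[OF nab[OF b(1)], of "\<lambda>x. x $ 1"] arg_cong[OF nab[OF b(1)], of "\<lambda>x. x $ 2"]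
      by (simp_all add: nabla_nth)
    show "br (dp q) f b = \<zeta> b ^ 2 *s K b"
      using main[where d = d_u, OF b(1) b' u(1)] main[where d = d_v, OF b(1) b' u(2)]
      by (simp only: vec_eq_iff forall_2 br_nth K_def vector_scalar_mult_def vector_2 vec_lambda_beta simp_thms)
  qed
qed

text \<open>The quotient El l * Sym^2 (Wl l) / Pd, multiplied out so that the condition is
  meaningful at the zeros of Pd.\<close>

definition Gspec :: "4 \<Rightarrow> vector_fun \<Rightarrow> bool" where
  "Gspec l f \<longleftrightarrow> f \<in> holo_forms 2 \<and> (\<forall>z\<in>Ball2. \<forall>m. Pd z * f z m = El l z * sym_vec 2 (Wl l z) m)"

lemma sym_vec_cont:
  assumes "\<And>i. continuous_on N (\<lambda>b. K b $ i)"
  shows "continuous_on N (\<lambda>b. sym_vec 2 (K b) m)"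
proof -
  have *: "continuous_on N (\<lambda>b. K b $ 1 * K b $ 1)" "continuous_on N (\<lambda>b. K b $ 1 * K b $ 2)"
    "continuous_on N (\<lambda>b. K b $ 2 * K b $ 2)" by (intro continuous_intros assms)+
  consider "m = 0" | "m = 1" | "m = 2" | "m > 2" by linarith
  then show ?thesis by cases (use * in \<open>simp_all add: sym_vec_2\<close>)
qed

text \<open>Let i, j be the indices of the difference vanishing at \<open>z\<close>. If
  \<open>l\<close> is one of them, this difference is a factor of \<open>El l\<close>. Otherwise the
  bracket can be written with X i - X j as an entry, so its symmetric square is divisible by
  \<zeta>^4, while Pd is cz \<zeta>^3.\<close>

lemma quotient_local:
  assumes z: "z \<in> Ball2" "z \<notin> Bad"
  shows "\<exists>N F. open N \<and> z \<in> N \<and> N \<subseteq> Ball2 \<and> continuous_on N F \<and>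
    (\<forall>b\<in>N. Pd b \<noteq> 0 \<longrightarrow> El l b * sym_vec 2 (Wl l b) m / Pd b = F b)"
proof (cases "Pd z = 0")
  case False
  have c: "continuous_on Ball2 (\<lambda>b. sym_vec 2 (Wl l b) m)"
    by (rule sym_vec_cont[OF hol2_imp_continuous_on[OF hol2_Wl]])
  show ?thesis
  proof (intro exI conjI ballI impI)
    show "open {b \<in> Ball2. Pd b \<noteq> 0}" by (rule open_nonzero[OF hol2_Pd open_Ball2])
    show "continuous_on {b \<in> Ball2. Pd b \<noteq> 0} (\<lambda>b. El l b * sym_vec 2 (Wl l b) m / Pd b)"
      by (intro continuous_intros continuous_on_subset[OF c] continuous_on_subset[OF hol2_imp_continuous_on[OF hol2_Pd]]
        continuous_on_subset[OF hol2_imp_continuous_on[OF hol2_El]]) auto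
  qed (use z False in auto)
next
  case True
  then obtain q where q: "q \<in> PP" "dp q z = 0" using PP(1) by (auto simp: Pd_def)
  define N where "N = {b \<in> Ball2. Uq q b \<noteq> 0}"
  have N: "open N" "z \<in> N" "N \<subseteq> Ball2"
    using open_nonzero[OF hol2_Uq open_Ball2, of q] Uq_nz[OF z q] z by (auto simp: N_def)
  have cont: "continuous_on N g" if "g holomorphic2_on Ball2" for g
    by (rule continuous_on_subset[OF hol2_imp_continuous_on[OF that] N(3)])
  define i j where "i = fst q" and "j = snd q"
  have ij: "i \<noteq> j" "q = (i, j)" using PP(3)[OF q(1)] by (auto simp: i_def j_def)
  show ?thesis
  proof (cases "l = i \<or> l = j")
    case True
    define k where "k = (if l = i then j else i)"
    define s :: complex where "s = (if l = i then 1 else -1)"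
    have kl: "k \<noteq> l" using True ij by (auto simp: k_def)
    have "X l b - X k b = s * dp q b" for b using True ij by (auto simp: k_def s_def dp_def)
    then have E: "El l b = dp q b * (s * (\<Prod>m\<in>UNIV - {l} - {k}. X l b - X m b))" for b
      unfolding El_def using prod.remove[of "UNIV - {l}" k "\<lambda>m. X l b - X m b"] kl by simp
    define F where "F = (\<lambda>b. s * (\<Prod>m\<in>UNIV - {l} - {k}. X l b - X m b) * sym_vec 2 (Wl l b) m / Uq q b)"
    have c: "continuous_on N (\<lambda>b. s * (\<Prod>m\<in>UNIV - {l} - {k}. X l b - X m b))"
      by (intro cont hol2_intros X_hol)
    have "continuous_on N F" unfolding F_def
      by (intro continuous_intros c cont[OF hol2_Uq] sym_vec_cont[OF cont[OF hol2_Wl]])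
        (simp add: N_def)
    moreover have "El l b * sym_vec 2 (Wl l b) m / Pd b = F b" if "b \<in> N" "Pd b \<noteq> 0" for b
      using that(2) unfolding E Pd_Uq[OF q(1)] F_def by simp
    ultimately show ?thesis using N by blast
  next
    case False
    have "\<exists>c. c \<notin> {l, i, j}"
    proof (rule ccontr)
      assume "\<not> ?thesis"
      then have "UNIV = {l, i, j}" by auto
      then have "card (UNIV :: 4 set) = card {l, i, j}" by (rule arg_cong)
      also have "\<dots> \<le> 3" by (simp add: card_insert_if)
      finally show False by simp
    qed
    then obtain c where "c \<notin> {l, i, j}" by blast
    then have c: "distinct [l, i, j, c]" using False ij by auto
    obtain K where K: "\<And>i. continuous_on {b \<in> Ball2. Uq q b \<noteq> 0} (\<lambda>b. K b $ i)"
      "\<And>b. b \<in> Ball2 \<Longrightarrow> Uq q b \<noteq> 0 \<Longrightarrow> br (dp q) (dp (i, c)) b = \<zeta> b ^ 2 *s K b"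
      by (rule br_local[OF q(1) dp_hol, of "(i, c)"], rule that)
    define F where "F = (\<lambda>b. El l b * \<zeta> b * sym_vec 2 (K b) m / cz)"
    have "continuous_on N F" unfolding F_def
      by (intro continuous_intros cont hol2_El zeta_hol sym_vec_cont K(1)[folded N_def]) (simp add: cz)
    moreover have "El l b * sym_vec 2 (Wl l b) m / Pd b = F b" if b: "b \<in> N" "Pd b \<noteq> 0" for b
    proof -
      have b': "b \<in> Ball2" "Uq q b \<noteq> 0" using b by (auto simp: N_def)
      have "sym_vec 2 (Wl l b) m = sym_vec 2 (Wv i j c b) m" unfolding Wl_sym[OF b'(1) c] ..
      also have "Wv i j c b = \<zeta> b ^ 2 *s K b" unfolding Wv_def using K(2)[OF b'] ij by simp
      finally have S: "sym_vec 2 (Wl l b) m = \<zeta> b ^ 4 * sym_vec 2 (K b) m"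
        unfolding sym_vec_2_scale by (simp flip: power_mult)
      have "\<zeta> b \<noteq> 0" using b(2) zeta_Pd[OF b'(1)] by auto
      then show ?thesis unfolding S zeta_Pd[OF b'(1)] F_def using cz
        by (simp add: field_simps power3_eq_cube power4_eq_xxxx)
    qed
    ultimately show ?thesis using N by blast
  qed
qed

lemma Gspec_exists: "\<exists>f. Gspec l f"
proof -
  define F where "F m = (\<lambda>b. El l b * sym_vec 2 (Wl l b) m / Pd b)" for m
  have symh: "(\<lambda>b. sym_vec 2 (Wl l b) m) holomorphic2_on Ball2" for m
  proof -
    have *: "(\<lambda>b. Wl l b $ 1 * Wl l b $ 1) holomorphic2_on Ball2" "(\<lambda>b. Wl l b $ 1 * Wl l b $ 2) holomorphic2_on Ball2"
      "(\<lambda>b. Wl l b $ 2 * Wl l b $ 2) holomorphic2_on Ball2" by (intro hol2_intros hol2_Wl)+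
    consider "m = 0" | "m = 1" | "m = 2" | "m > 2" by linarith
    then show ?thesis by cases (use * in \<open>simp_all add: sym_vec_2 hol2_const\<close>)
  qed
  have "\<exists>G. G holomorphic2_on Ball2 \<and> (\<forall>z\<in>Ball2. Pd z \<noteq> 0 \<longrightarrow> G z = F m z)" for m
  proof -
    have F: "F m holomorphic2_on {z \<in> Ball2. Pd z \<noteq> 0}" unfolding F_def
      by (intro hol2_divide hol2_mult hol2_subset[OF hol2_El] hol2_subset[OF symh] hol2_subset[OF hol2_Pd]
        open_nonzero[OF hol2_Pd open_Ball2]) auto
    have bd: "\<exists>W C. open W \<and> z \<in> W \<and> (\<forall>b\<in>W \<inter> Ball2. Pd b \<noteq> 0 \<longrightarrow> cmod (F m b) \<le> C)" if z: "z \<in> Ball2 - Bad" for z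
    proof -
      obtain N F' where N: "open N" "z \<in> N" "N \<subseteq> Ball2" "continuous_on N F'" "\<forall>b\<in>N. Pd b \<noteq> 0 \<longrightarrow> F m b = F' b"
        using quotient_local[of z l m] z unfolding F_def by blast
      obtain W C where "open W" "z \<in> W" "W \<subseteq> N" "\<And>b. b \<in> W \<Longrightarrow> cmod (F' b) \<le> C"
        using hol2_locally_bounded[OF N(4,1,2)] by blast
      then show ?thesis using N(5) by (intro exI[of _ W] exI[of _ C]) auto
    qed
    obtain G where "G holomorphic2_on Ball2" "\<And>z. z \<in> Ball2 \<Longrightarrow> Pd z \<noteq> 0 \<Longrightarrow> G z = F m z"
      by (rule hol2_extend[OF hol2_Pd bz(1) Pd_bz countable_Bad F bd], assumption, rule that)
    then show ?thesis by blast
  qed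
  then have "\<exists>G. \<forall>m. G m holomorphic2_on Ball2 \<and> (\<forall>z\<in>Ball2. Pd z \<noteq> 0 \<longrightarrow> G m z = F m z)" by (intro choice allI)
  then obtain G where G: "\<And>m. G m holomorphic2_on Ball2" "\<And>m z. z \<in> Ball2 \<Longrightarrow> Pd z \<noteq> 0 \<Longrightarrow> G m z = F m z" by blast
  define f where "f = (\<lambda>z m. if z \<in> Ball2 \<and> m \<le> 2 then G m z else 0)"
  have fh: "(\<lambda>z. f z m) holomorphic2_on Ball2" for m
  proof (cases "m \<le> 2")
    case True
    have "(\<lambda>z. f z m) holomorphic2_on Ball2 \<longleftrightarrow> G m holomorphic2_on Ball2" by (rule hol2_cong) (simp add: f_def True)
    then show ?thesis using G(1) by simp
  next
    case False
    then have "(\<lambda>z. f z m) = (\<lambda>z. 0)" by (simp add: f_def)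
    then show ?thesis by (simp add: hol2_const)
  qed
  have "f \<in> holo_forms 2" unfolding holo_forms_def using fh by (auto simp: f_def fun_eq_iff)
  moreover have "Pd z * f z m = El l z * sym_vec 2 (Wl l z) m" if z: "z \<in> Ball2" for z m
  proof (cases "m \<le> 2")
    case True
    show ?thesis
    proof (rule hol2_eq_of_dense[OF hol2_Pd bz(1) Pd_bz open_Ball2 order_refl _ _ _ z])
      show "continuous_on Ball2 (\<lambda>z. Pd z * f z m)" "continuous_on Ball2 (\<lambda>z. El l z * sym_vec 2 (Wl l z) m)"
        by (intro hol2_imp_continuous_on hol2_mult hol2_Pd fh hol2_El symh)+
      show "Pd z * f z m = El l z * sym_vec 2 (Wl l z) m" if "z \<in> Ball2" "Pd z \<noteq> 0" for z
        using that G(2)[OF that, of m] True by (simp add: f_def F_def)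
    qed
  qed (simp add: f_def sym_vec_def)
  ultimately show ?thesis unfolding Gspec_def by blast
qed

definition G :: "4 \<Rightarrow> vector_fun" where "G l = (SOME f. Gspec l f)"

lemma G: "Gspec l (G l)"
  unfolding G_def by (rule someI_ex[OF Gspec_exists])

lemma G_holo: "G l \<in> holo_forms 2"
  using G by (simp add: Gspec_def)

lemma G_eq: "z \<in> Ball2 \<Longrightarrow> Pd z * G l z m = El l z * sym_vec 2 (Wl l z) m"
  using G by (simp add: Gspec_def)

end

section \<open>Signs, weights and the relation among the \<open>G l\<close>\<close>

definition vdm :: "(4 \<Rightarrow> complex) \<Rightarrow> complex" where
  "vdm x = (x 1 - x 2) * (x 1 - x 3) * (x 1 - x 4) * (x 2 - x 3) * (x 2 - x 4) * (x 3 - x 4)"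

lemma vdm_transpose:
  assumes "a \<noteq> b"
  shows "vdm (x \<circ> Transposition.transpose a b) = - vdm x"
proof -
  have t: "Transposition.transpose a b a = b" "Transposition.transpose a b b = a"
    "\<And>c. c \<noteq> a \<Longrightarrow> c \<noteq> b \<Longrightarrow> Transposition.transpose a b c = c" for a b :: 4
    by (simp_all add: Transposition.transpose_def)
  have *: "vdm (x \<circ> Transposition.transpose 1 2) = - vdm x" "vdm (x \<circ> Transposition.transpose 1 3) = - vdm x"
    "vdm (x \<circ> Transposition.transpose 1 4) = - vdm x" "vdm (x \<circ> Transposition.transpose 2 3) = - vdm x"
    "vdm (x \<circ> Transposition.transpose 2 4) = - vdm x" "vdm (x \<circ> Transposition.transpose 3 4) = - vdm x"
    unfolding vdm_def o_def by (simp_all add: t four_neq four_neq[symmetric]) algebra+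
  from exhaust_4[of a] exhaust_4[of b] show ?thesis
    using * assms transpose_commute[of "2::4" 1] transpose_commute[of "3::4" 1] transpose_commute[of "4::4" 1]
      transpose_commute[of "3::4" 2] transpose_commute[of "4::4" 2] transpose_commute[of "4::4" 3] by (elim disjE) simp_all
qed

lemma vdm_permutes:
  assumes "\<tau> permutes (UNIV :: 4 set)"
  shows "vdm (x \<circ> \<tau>) = of_int (sign \<tau>) * vdm x"
  using assms finite
proof (induction arbitrary: x rule: permutes_induct)
  case id
  show ?case by simp
next
  case (swap a b p)
  have "vdm (x \<circ> (Transposition.transpose a b \<circ> p)) = vdm ((x \<circ> Transposition.transpose a b) \<circ> p)" by (simp add: o_assoc)
  also have "\<dots> = of_int (sign p) * vdm (x \<circ> Transposition.transpose a b)" by (rule swap)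
  also have "\<dots> = of_int (sign (Transposition.transpose a b \<circ> p)) * vdm x"
  proof (cases "a = b")
    case False
    have "permutation p" using swap finite by (metis permutation_permutes)
    then show ?thesis using vdm_transpose[OF False, of x] False
      by (simp add: sign_compose permutation_swap_id sign_swap_id)
  qed simp
  finally show ?case .
qed

lemma sum_4: "sum f (UNIV :: 4 set) = f 1 + f 2 + f 3 + f 4"
  unfolding UNIV_4 by (simp add: four_neq four_neq[symmetric] add.assoc)

lemma MF_fmul:
  assumes a: "a \<in> scalar_MF k" and f: "f \<in> MF 2 l 0"
  shows "fmul a f \<in> MF 2 (k + l) 0"
proof -
  have fh: "f \<in> holo_forms 2" using f by (simp add: MF_2_iff)
  have ah: "a holomorphic2_on Ball2" and a0: "\<And>b. b \<notin> Ball2 \<Longrightarrow> a b = 0"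
    and aa: "\<And>g b. g \<in> \<Gamma>_cong \<Longrightarrow> b \<in> Ball2 \<Longrightarrow> a (act g b) = j1 g b powi k * a b"
    using a by (auto simp: scalar_MF_iff)
  have h: "fmul a f \<in> holo_forms 2" unfolding holo_forms_def
    using holo_forms_2[OF fh] by (auto simp: fmul_def fun_eq_iff a0 intro: hol2_mult ah)
  have "slash 2 (k + l) (fmul a f) g = fmul a f" if g: "g \<in> \<Gamma>_cong" for g
  proof (subst slash_2_eq_iff[OF Gamma_cong_Gamma[OF g] h h], intro ballI allI)
    fix b i assume b: "b \<in> Ball2"
    have j: "j1 g b \<noteq> 0" by (rule Gamma_act(1)[OF Gamma_cong_Gamma[OF g] b])
    show "fmul a f (act g b) i = j1 g b powi (k + l) * sym2 (j2 g b) (fmul a f b) i"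
      unfolding fmul_def sym2_linear(1) aa[OF g b] MF_2_act[OF f g b] using j by (simp add: power_int_add mult_ac)
  qed
  then show ?thesis using h by (simp add: MF_2_iff)
qed

text \<open>Applied with p, q, r the differences X 1 - X j and A, B, C components of the brackets on
  (1,3,4), (1,2,4), (1,2,3); A - B + C then belongs to (2,3,4). The assumed Pluecker relations
  eliminate r C.\<close>

lemma plucker_sum:
  fixes p q r A B C A' B' C' :: complex
  assumes "p * A - q * B + r * C = 0" "p * A' - q * B' + r * C' = 0"
  shows "p * q * r * ((A - B + C) * (A' - B' + C')) + (- p * (q - p) * (r - p)) * (A * A')
    + (- q * (p - q) * (r - q)) * (B * B') + (- r * (p - r) * (q - r)) * (C * C') = 0"
proof -
  have c: "r * C = q * B - p * A" "r * C' = q * B' - p * A'" using assms by (simp_all add: algebra_simps)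
  have "p * q * r * ((A - B + C) * (A' - B' + C')) + (- p * (q - p) * (r - p)) * (A * A')
      + (- q * (p - q) * (r - q)) * (B * B') + (- r * (p - r) * (q - r)) * (C * C')
    = (q + r - p) * ((p * A) * (p * A')) + (p + r - q) * ((q * B) * (q * B')) + (p + q - r) * ((r * C) * (r * C'))
      - r * ((p * A) * (q * B') + (q * B) * (p * A')) + q * ((p * A) * (r * C') + (r * C) * (p * A'))
      - p * ((q * B) * (r * C') + (r * C) * (q * B'))"
    by (simp add: algebra_simps)
  also have "\<dots> = 0" unfolding c by (simp add: algebra_simps)
  finally show ?thesis .
qed

context generators
begin

lemma Wv_nth:
  assumes "z \<in> Ball2"
  shows "Wv a b c z $ i = 1 / 3 * ((X a z - X b z) * (nabla (X a) z $ i - nabla (X c) z $ i)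
    - (X a z - X c z) * (nabla (X a) z $ i - nabla (X b) z $ i))"
  using exhaust_2[of i]
proof
  assume i: "i = 1"
  show ?thesis unfolding i Wv_def br_nth nabla_nth dp_d[OF assms] by (simp add: dp_def)
next
  assume i: "i = 2"
  show ?thesis unfolding i Wv_def br_nth nabla_nth dp_d[OF assms] by (simp add: dp_def)
qed

lemma Pd_vdm: "Pd z = vdm (\<lambda>i. X i z)"
  by (simp add: Pd_def PP_def dp_def vdm_def four_neq four_neq[symmetric] mult_ac)

lemma Tr_permutes: "Tr h \<tau> s \<Longrightarrow> \<tau> permutes UNIV"
  unfolding Tr_def by (intro bij_imp_permutes) (auto simp: bij_betw_def finite_UNIV_inj_surj)

lemma Wv_act:
  assumes T: "Tr h \<tau> s" and z: "z \<in> Ball2"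
  shows "Wv a b c (act h z) = j1 h z ^ 7 *s (j2 h z *v Wv (\<tau> a) (\<tau> b) (\<tau> c) z)"
proof -
  have h: "h \<in> \<Gamma>" and ss: "s * s = 1" and Xh: "\<And>k b. b \<in> Ball2 \<Longrightarrow> X k (act h b) = s * j1 h b ^ 3 * X (\<tau> k) b"
    using T unfolding Tr_def by blast+
  have *: "br (dp (a, b)) (dp (a, c)) (act h z) = j1 h z ^ 7 *s (j2 h z *v
      br (\<lambda>z. s * dp (\<tau> a, \<tau> b) z) (\<lambda>z. s * dp (\<tau> a, \<tau> c) z) z)"
    by (rule br_act[OF h z dp_hol _ _ dp_hol])
      (auto intro!: hol2_intros X_hol simp: dp_def Xh algebra_simps)
  have d: "nabla (\<lambda>z. s * dp q z) z = s *s nabla (dp q) z" for q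
    using nabla_lin[OF dp_hol dp_hol z, of s q 0 q] by simp
  have "br (\<lambda>z. s * dp (\<tau> a, \<tau> b) z) (\<lambda>z. s * dp (\<tau> a, \<tau> c) z) z = (s * s) *s br (dp (\<tau> a, \<tau> b)) (dp (\<tau> a, \<tau> c)) z"
    unfolding bracket_def d by (simp add: vec_eq_iff forall_2 algebra_simps)
  then show ?thesis unfolding Wv_def * ss by simp
qed

lemma El_act:
  assumes T: "Tr h \<tau> s" and z: "z \<in> Ball2"
  shows "El l (act h z) = s * j1 h z ^ 9 * El (\<tau> l) z"
proof -
  have h: "h \<in> \<Gamma>" and ss: "s * s = 1" and inj: "inj \<tau>"
    and Xh: "\<And>k b. b \<in> Ball2 \<Longrightarrow> X k (act h b) = s * j1 h b ^ 3 * X (\<tau> k) b"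
    using T unfolding Tr_def by blast+
  have "El l (act h z) = (\<Prod>m\<in>UNIV - {l}. (s * j1 h z ^ 3) * (X (\<tau> l) z - X (\<tau> m) z))"
    unfolding El_def Xh[OF z] by (simp add: right_diff_distrib)
  also have "\<dots> = (s * j1 h z ^ 3) ^ 3 * (\<Prod>m\<in>UNIV - {l}. X (\<tau> l) z - X (\<tau> m) z)"
    unfolding prod.distrib[where g = "\<lambda>_. s * j1 h z ^ 3"] prod_constant by (simp add: card_Diff_singleton)
  also have "(\<Prod>m\<in>UNIV - {l}. X (\<tau> l) z - X (\<tau> m) z) = (\<Prod>m\<in>\<tau> ` (UNIV - {l}). X (\<tau> l) z - X m z)"
    by (rule prod.reindex_cong[symmetric, OF inj_on_subset[OF inj]]) auto
  also have "\<tau> ` (UNIV - {l}) = UNIV - {\<tau> l}"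
    using image_set_diff[OF inj, of UNIV "{l}"] permutes_image[OF Tr_permutes[OF T]] by simp
  also have "(s * j1 h z ^ 3) ^ 3 = (s * s) * (s * j1 h z ^ 9)" by (simp add: power3_eq_cube power_mult_distrib eval_nat_numeral mult_ac)
  finally show ?thesis by (simp add: ss El_def)
qed

lemma Pd_act:
  assumes T: "Tr h \<tau> s" and z: "z \<in> Ball2"
  shows "Pd (act h z) = j1 h z ^ 18 * of_int (sign \<tau>) * Pd z"
proof -
  have ss: "s * s = 1" and Xh: "\<And>k b. b \<in> Ball2 \<Longrightarrow> X k (act h b) = s * j1 h b ^ 3 * X (\<tau> k) b"
    using T unfolding Tr_def by blast+
  have "Pd (act h z) = vdm (\<lambda>i. (s * j1 h z ^ 3) * ((\<lambda>i. X i z) \<circ> \<tau>) i)"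
    unfolding Pd_vdm Xh[OF z] by simp
  also have "\<dots> = (s * j1 h z ^ 3) ^ 6 * vdm ((\<lambda>i. X i z) \<circ> \<tau>)"
    unfolding vdm_def right_diff_distrib[symmetric] by (simp add: eval_nat_numeral mult_ac)
  also have "(s * j1 h z ^ 3) ^ 6 = (s * s) ^ 3 * j1 h z ^ 18" by (simp add: power_mult_distrib eval_nat_numeral mult_ac)
  finally show ?thesis unfolding vdm_permutes[OF Tr_permutes[OF T]] Pd_vdm ss by simp
qed

lemma Wl_act:
  assumes T: "Tr h \<tau> s" and z: "z \<in> Ball2"
  shows "sym_vec 2 (Wl l (act h z)) m = j1 h z ^ 14 * sym2 (j2 h z) (sym_vec 2 (Wl (\<tau> l) z)) m"
proof -
  have h: "h \<in> \<Gamma>" and inj: "inj \<tau>" using T unfolding Tr_def by blast+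
  obtain a b c where d: "distinct [l, a, b, c]"
  proof -
    have "l = 1 \<or> l = 2 \<or> l = 3 \<or> l = 4" by (rule exhaust_4)
    then show ?thesis
      using that[of 2 3 4] that[of 1 3 4] that[of 1 2 4] that[of 1 2 3] four_neq
      by (elim disjE) simp_all
  qed
  have d': "distinct [\<tau> l, \<tau> a, \<tau> b, \<tau> c]" using d inj by (auto dest: injD)
  have "sym_vec 2 (Wl l (act h z)) m = sym_vec 2 (Wv a b c (act h z)) m"
    unfolding Wl_sym[OF Gamma_act(2)[OF h z] d] ..
  also have "\<dots> = (j1 h z ^ 7) ^ 2 * sym2 (j2 h z) (sym_vec 2 (Wv (\<tau> a) (\<tau> b) (\<tau> c) z)) m"
    unfolding Wv_act[OF T z] sym_vec_2_scale sym_vec_2_matrix ..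
  finally show ?thesis unfolding Wl_sym[OF z d'] by (simp flip: power_mult)
qed

lemma Tr_cong: "g \<in> \<Gamma>_cong \<Longrightarrow> Tr g id 1"
  using X_WM unfolding Tr_def WM_def by (auto intro: Gamma_cong_Gamma)

end

context mirror_root
begin

text \<open>The weight is 5 = 9 + 14 - 18, from El, the symmetric square of the bracket, and Pd. The
  sign \<open>s\<close> comes from El, as s^3 = s, and the sign of \<tau> from Pd, a Vandermonde
  product.\<close>

lemma slash_G:
  assumes T: "Tr h \<tau> s"
  shows "slash 2 5 (G l) h = vscale (s * of_int (sign \<tau>)) (G (\<tau> l))"
proof -
  have h: "h \<in> \<Gamma>" and ss: "s * s = 1" using T unfolding Tr_def by blast+
  have sg: "of_int (sign \<tau>) * of_int (sign \<tau>) = (1 :: complex)" by (simp add: sign_def)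
  have vh: "vscale (s * of_int (sign \<tau>)) (G (\<tau> l)) \<in> holo_forms 2" (is "?V \<in> _")
    unfolding holo_forms_def using holo_forms_2[OF G_holo[of "\<tau> l"]]
    by (auto simp: vscale_def fun_eq_iff intro!: hol2_intros)
  show ?thesis
  proof (subst slash_2_eq_iff[OF h G_holo vh], intro ballI allI)
    fix b i assume b: "b \<in> Ball2"
    have eqh: "\<And>i. (\<lambda>b. G l (act h b) i) holomorphic2_on Ball2"
      by (rule hol2_compose_act[OF h holo_forms_2(1)[OF G_holo]])
    have rh: "(\<lambda>b. j1 h b ^ 5 * sym2 (j2 h b) (?V b) i) holomorphic2_on Ball2"
      by (intro hol2_mult hol2_power hol2_j1 hol2_sym2 open_Ball2 hol2_j2 holo_forms_2(1)[OF vh])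
    have "G l (act h b) i = j1 h b ^ 5 * sym2 (j2 h b) (?V b) i"
    proof (rule hol2_eq_of_dense[OF hol2_Pd bz(1) Pd_bz open_Ball2 order_refl _ _ _ b])
      show "continuous_on Ball2 (\<lambda>b. G l (act h b) i)" "continuous_on Ball2 (\<lambda>b. j1 h b ^ 5 * sym2 (j2 h b) (?V b) i)"
        by (intro hol2_imp_continuous_on eqh rh)+
      fix b assume b: "b \<in> Ball2" "Pd b \<noteq> 0"
      define j where "j = j1 h b"
      define \<epsilon> :: complex where "\<epsilon> = of_int (sign \<tau>)"
      have j: "j \<noteq> 0" unfolding j_def by (rule Gamma_act(1)[OF h b(1)])
      have ee: "\<epsilon> * \<epsilon> = 1" "\<epsilon> \<noteq> 0" using sg by (auto simp: \<epsilon>_def)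
      have Gp: "(\<lambda>m. Pd b * G (\<tau> l) b m) = (\<lambda>m. El (\<tau> l) b * sym_vec 2 (Wl (\<tau> l) b) m)"
        by (rule ext) (rule G_eq[OF b(1)])
      have "(j ^ 18 * \<epsilon> * Pd b) * G l (act h b) i = Pd (act h b) * G l (act h b) i"
        unfolding Pd_act[OF T b(1)] j_def \<epsilon>_def ..
      also have "\<dots> = s * j ^ 9 * El (\<tau> l) b * (j ^ 14 * sym2 (j2 h b) (sym_vec 2 (Wl (\<tau> l) b)) i)"
        unfolding G_eq[OF Gamma_act(2)[OF h b(1)]] El_act[OF T b(1)] Wl_act[OF T b(1)] j_def ..
      also have "\<dots> = s * j ^ 23 * (El (\<tau> l) b * sym2 (j2 h b) (sym_vec 2 (Wl (\<tau> l) b)) i)"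
        by (simp add: eval_nat_numeral mult_ac)
      also have "El (\<tau> l) b * sym2 (j2 h b) (sym_vec 2 (Wl (\<tau> l) b)) i = Pd b * sym2 (j2 h b) (G (\<tau> l) b) i"
        unfolding sym2_linear(1)[symmetric] Gp ..
      also have "s * j ^ 23 * (Pd b * sym2 (j2 h b) (G (\<tau> l) b) i)
          = (\<epsilon> * \<epsilon>) * s * j ^ 23 * (Pd b * sym2 (j2 h b) (G (\<tau> l) b) i)" by (simp add: ee)
      also have "\<dots> = (j ^ 18 * \<epsilon> * Pd b) * (j ^ 5 * sym2 (j2 h b) (?V b) i)"
        unfolding vscale_def sym2_linear(1) \<epsilon>_def by (simp add: eval_nat_numeral mult_ac)
      finally show "G l (act h b) i = j1 h b ^ 5 * sym2 (j2 h b) (?V b) i"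
        using j b(2) ee(2) by (simp add: j_def)
    qed
    then show "G l (act h b) i = j1 h b powi 5 * sym2 (j2 h b) (?V b) i" by simp
  qed
qed

lemma G_MF: "G l \<in> MF 2 5 0"
  using slash_G[OF Tr_cong] G_holo by (simp add: MF_2_iff vscale_def)

text \<open>\<open>plucker_sum\<close> for the components of the brackets. This relation turns the
  permutation representation on the four forms into s[3,1].\<close>

lemma G_sum: "G 1 + G 2 + G 3 + G 4 = 0"
proof (intro ext)
  fix z m
  show "(G 1 + G 2 + G 3 + G 4) z m = 0 z m"
  proof (cases "z \<in> Ball2")
    case True
    have "G 1 z m + G 2 z m + G 3 z m + G 4 z m = 0"
    proof (rule hol2_mult_eq_0[OF hol2_Pd _ _ bz(1) Pd_bz True])
      show "(\<lambda>z. G 1 z m + G 2 z m + G 3 z m + G 4 z m) holomorphic2_on Ball2"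
        by (intro hol2_intros holo_forms_2(1)[OF G_holo])
      fix z assume z: "z \<in> Ball2"
      have E: "El 1 z = (X 1 z - X 2 z) * (X 1 z - X 3 z) * (X 1 z - X 4 z)"
        "El 2 z = (X 2 z - X 1 z) * (X 2 z - X 3 z) * (X 2 z - X 4 z)"
        "El 3 z = (X 3 z - X 1 z) * (X 3 z - X 2 z) * (X 3 z - X 4 z)"
        "El 4 z = (X 4 z - X 1 z) * (X 4 z - X 2 z) * (X 4 z - X 3 z)"
        unfolding El_def UNIV_4 by (simp_all add: four_neq four_neq[symmetric] insert_Diff_if mult.assoc)
      define p q r where "p = X 1 z - X 2 z" and "q = X 1 z - X 3 z" and "r = X 1 z - X 4 z"
      have E': "El 1 z = p * q * r" "El 2 z = - p * (q - p) * (r - p)" "El 3 z = - q * (p - q) * (r - q)"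
        "El 4 z = - r * (p - r) * (q - r)" unfolding E p_def q_def r_def by simp_all
      have rel: "p * Wv 1 3 4 z $ i - q * Wv 1 2 4 z $ i + r * Wv 1 2 3 z $ i = 0"
        "Wv 2 3 4 z $ i = Wv 1 3 4 z $ i - Wv 1 2 4 z $ i + Wv 1 2 3 z $ i" for i
      proof -
        define t :: complex where "t = 1 / 3"
        show "p * Wv 1 3 4 z $ i - q * Wv 1 2 4 z $ i + r * Wv 1 2 3 z $ i = 0"
          "Wv 2 3 4 z $ i = Wv 1 3 4 z $ i - Wv 1 2 4 z $ i + Wv 1 2 3 z $ i"
          unfolding Wv_nth[OF z] t_def[symmetric] p_def q_def r_def by (simp_all add: algebra_simps)
      qed
      have "El 1 z * (Wl 1 z $ i * Wl 1 z $ k) + El 2 z * (Wl 2 z $ i * Wl 2 z $ k) + El 3 z * (Wl 3 z $ i * Wl 3 z $ k)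
        + El 4 z * (Wl 4 z $ i * Wl 4 z $ k) = 0" for i k
        unfolding E' using four_neq plucker_sum[OF rel(1)[of i] rel(1)[of k]] by (simp add: Wl_def rel(2))
      then show "Pd z * (G 1 z m + G 2 z m + G 3 z m + G 4 z m) = 0"
        unfolding distrib_left G_eq[OF z] by (simp add: sym_vec_2)
    qed
    then show ?thesis by simp
  next
    case False
    then show ?thesis using holo_forms_2(3)[OF G_holo] by simp
  qed
qed

section \<open>Identification with the forms \<open>D \<phi> i\<close>\<close>

text \<open>phi_i is a quarter of X 1 - X (li i), so the bracket of the other two phi's involves all
  indices except \<open>li i\<close>.\<close>

definition li :: "3 \<Rightarrow> 4" where "li i = (if i = 0 then 2 else if i = 1 then 3 else 4)"

text \<open>Up to sign, brackets of the differences are 16 times brackets of the phi's, so Sym^2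
  gains 256, while Pd = 64 El D_denom. Hence G carries a factor 4, which turns 9 into 9 / 4; the
  square is the normalization of \<Phi>.\<close>

definition CD :: complex where "CD = 9 / 4 * sqrt_m3 * (- 1 / (6 * of_real pi * \<i>))\<^sup>2"

lemma CD_nz: "CD \<noteq> 0"
  using sqrt_m3_sq by (auto simp: CD_def)

definition be :: "3 \<Rightarrow> complex \<times> complex \<Rightarrow> complex^2" where
  "be i = br (\<phi> (i + 1)) (\<phi> (i + 2))"

lemma br_scale:
  assumes "z \<in> Ball2" "f holomorphic2_on Ball2" "g holomorphic2_on Ball2"
  shows "br (\<lambda>z. s * f z) (\<lambda>z. t * g z) z = (s * t) *s br f g z"
proof -
  have d: "nabla (\<lambda>z. s * f z) z = s *s nabla f z" if "f holomorphic2_on Ball2" for f s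
    using nabla_lin[OF that that assms(1), of s 0] by simp
  show ?thesis unfolding bracket_def d[OF assms(2)] d[OF assms(3)]
    by (simp add: vec_eq_iff forall_2 algebra_simps)
qed

lemma three_cases:
  fixes P :: "3 \<Rightarrow> bool"
  assumes "P 0" "P 1" "P 2"
  shows "P i"
  using exhaust_3[of i, unfolded three_eq_0] assms by auto

lemma three_arith: "(0::3) + 1 = 1" "(0::3) + 2 = 2" "(1::3) + 1 = 2" "(1::3) + 2 = 0" "(2::3) + 1 = 0" "(2::3) + 2 = 1"
proof -
  have "(2::3) + 2 = 3 + 1" by simp
  also have "\<dots> = 1" unfolding three_eq_0 by simp
  finally show "(2::3) + 2 = 1" .
qed (use three_eq_0 in simp_all)

lemma be_simps: "be 0 = br (\<phi> 1) (\<phi> 2)" "be 1 = br (\<phi> 2) (\<phi> 0)" "be 2 = br (\<phi> 0) (\<phi> 1)"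
  unfolding be_def three_arith by (rule refl)+

lemma be_Wl:
  assumes "z \<in> Ball2"
  shows "sym_vec 2 (Wl (li i) z) m = 256 * sym_vec 2 (be i z) m"
proof (rule three_cases[of _ i])
  have p: "dp (1, 2) = (\<lambda>z. 4 * \<phi> 0 z)" "dp (1, 3) = (\<lambda>z. 4 * \<phi> 1 z)" "dp (1, 4) = (\<lambda>z. 4 * \<phi> 2 z)"
    by (simp_all add: dp_phi fun_eq_iff)
  have l: "li 0 = 2" "li 1 = 3" "li 2 = 4" by (simp_all add: li_def)
  note sc = br_scale[OF assms phi_hol phi_hol]
  have sw: "br f g z = - br g f z" for f g by (simp add: vec_eq_iff forall_2 br_nth field_simps)
  show "sym_vec 2 (Wl (li 0) z) m = 256 * sym_vec 2 (be 0 z) m"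
    using four_neq by (simp add: l Wl_def Wv_def p sc be_simps sym_vec_2_scale)
  show "sym_vec 2 (Wl (li 1) z) m = 256 * sym_vec 2 (be 1 z) m"
    using four_neq sym_vec_2_uminus[of "br (\<phi> 0) (\<phi> 2) z"]
    by (simp add: l Wl_def Wv_def p sc be_simps sym_vec_2_scale sw[of "\<phi> 2" "\<phi> 0"])
  show "sym_vec 2 (Wl (li 2) z) m = 256 * sym_vec 2 (be 2 z) m"
    using four_neq by (simp add: l Wl_def Wv_def p sc be_simps sym_vec_2_scale)
qed

lemma Pd_denom: "Pd z = 64 * El (li i) z * D_denom \<phi> i z"
proof (rule three_cases[of _ i])
  have E: "El 2 z = (- 4 * \<phi> 0 z) * (4 * (\<phi> 1 z - \<phi> 0 z)) * (4 * (\<phi> 2 z - \<phi> 0 z))"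
    "El 3 z = (- 4 * \<phi> 1 z) * (4 * (\<phi> 0 z - \<phi> 1 z)) * (4 * (\<phi> 2 z - \<phi> 1 z))"
    "El 4 z = (- 4 * \<phi> 2 z) * (4 * (\<phi> 0 z - \<phi> 2 z)) * (4 * (\<phi> 1 z - \<phi> 2 z))"
    unfolding El_def UNIV_4 by (simp_all add: four_neq four_neq[symmetric] insert_Diff_if X_eqs)
  have P: "Pd z = (4 * \<phi> 0 z) * (4 * \<phi> 1 z) * (4 * \<phi> 2 z) * (4 * (\<phi> 1 z - \<phi> 0 z)) * (4 * (\<phi> 2 z - \<phi> 0 z))
     * (4 * (\<phi> 2 z - \<phi> 1 z))"
    unfolding Pd_def PP_def by (simp add: dp_phi four_neq four_neq[symmetric] mult.assoc)
  have l: "li 0 = 2" "li 1 = 3" "li 2 = 4" by (simp_all add: li_def)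
  have d: "D_denom \<phi> 0 z = \<phi> 1 z * \<phi> 2 z * (\<phi> 1 z - \<phi> 2 z)" "D_denom \<phi> 1 z = \<phi> 2 z * \<phi> 0 z * (\<phi> 2 z - \<phi> 0 z)"
    "D_denom \<phi> 2 z = \<phi> 0 z * \<phi> 1 z * (\<phi> 0 z - \<phi> 1 z)"
    unfolding D_denom_def three_arith by (rule refl)+
  show "Pd z = 64 * El (li 0) z * D_denom \<phi> 0 z" "Pd z = 64 * El (li 1) z * D_denom \<phi> 1 z"
    "Pd z = 64 * El (li 2) z * D_denom \<phi> 2 z"
    unfolding P l E d by algebra+
qed

text \<open>\<open>D\<close> is a definite description: a multiple of \<open>G\<close> provides
  existence, and uniqueness holds because the denominator is nonzero wherever Pd is, a dense
  set.\<close>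

lemma D_G: "D \<phi> i = vscale CD (G (li i))"
  unfolding D_def
proof (rule the_equality)
  have h: "vscale CD (G (li i)) \<in> holo_forms 2"
    unfolding holo_forms_def using holo_forms_2[OF G_holo[of "li i"]]
    by (auto simp: vscale_def fun_eq_iff intro!: hol2_intros)
  have main: "D_denom \<phi> i b * (CD * G (li i) b m) = 9 * sqrt_m3 * sym_vec 2 (\<Phi> \<phi> i b) m"
    if b: "b \<in> Ball2" "Pd b \<noteq> 0" for b m
  proof -
    have E: "El (li i) b \<noteq> 0" using b(2) Pd_denom[of b i] by auto
    have "El (li i) b * (64 * D_denom \<phi> i b * G (li i) b m) = El (li i) b * (256 * sym_vec 2 (be i b) m)"
      using G_eq[OF b(1), of "li i" m] unfolding be_Wl[OF b(1)] Pd_denom[of b i] by (simp add: mult_ac)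
    then have 1: "D_denom \<phi> i b * G (li i) b m = 4 * sym_vec 2 (be i b) m" using E by simp
    have "sym_vec 2 (\<Phi> \<phi> i b) m = (- 1 / (6 * of_real pi * \<i>))\<^sup>2 * sym_vec 2 (be i b) m"
      unfolding \<Phi>_def be_def sym_vec_2_scale ..
    moreover have "D_denom \<phi> i b * (CD * G (li i) b m) = CD * (D_denom \<phi> i b * G (li i) b m)" by simp
    ultimately show ?thesis unfolding 1 CD_def by simp
  qed
  have main': "D_denom \<phi> i b * (CD * G (li i) b m) = 9 * sqrt_m3 * sym_vec 2 (\<Phi> \<phi> i b) m" if b: "b \<in> Ball2" for b m
  proof (rule hol2_eq_of_dense[OF hol2_Pd bz(1) Pd_bz open_Ball2 order_refl _ _ main b])
    have dh: "D_denom \<phi> i holomorphic2_on Ball2" unfolding D_denom_def by (intro hol2_intros phi_hol)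
    show "continuous_on Ball2 (\<lambda>b. D_denom \<phi> i b * (CD * G (li i) b m))"
      by (intro hol2_imp_continuous_on hol2_mult hol2_const dh holo_forms_2(1) G_holo)
    have c: "continuous_on Ball2 (\<lambda>b. \<Phi> \<phi> i b $ k)" for k
      unfolding \<Phi>_def vector_smult_component by (intro hol2_imp_continuous_on hol2_intros hol2_br phi_hol)
    show "continuous_on Ball2 (\<lambda>b. 9 * sqrt_m3 * sym_vec 2 (\<Phi> \<phi> i b) m)"
      by (rule continuous_on_mult[OF continuous_on_const sym_vec_cont[OF c]])
  qed
  show G1: "vscale CD (G (li i)) \<in> holo_forms 2 \<and> (\<forall>b\<in>Ball2. D_denom \<phi> i b \<noteq> 0 \<longrightarrow>
     (\<forall>m. vscale CD (G (li i)) b m = 9 * sqrt_m3 * sym_vec 2 (\<Phi> \<phi> i b) m / D_denom \<phi> i b))"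
    using h main' by (auto simp: vscale_def field_simps)
  show "f = vscale CD (G (li i))" if f: "f \<in> holo_forms 2 \<and> (\<forall>b\<in>Ball2. D_denom \<phi> i b \<noteq> 0 \<longrightarrow>
     (\<forall>m. f b m = 9 * sqrt_m3 * sym_vec 2 (\<Phi> \<phi> i b) m / D_denom \<phi> i b))" for f
  proof (intro ext)
    fix z m
    show "f z m = vscale CD (G (li i)) z m"
    proof (cases "z \<in> Ball2")
      case True
      show ?thesis
      proof (rule hol2_eq_of_dense[OF hol2_Pd bz(1) Pd_bz open_Ball2 order_refl _ _ _ True])
        show "continuous_on Ball2 (\<lambda>z. f z m)" "continuous_on Ball2 (\<lambda>z. vscale CD (G (li i)) z m)"
          using f h by (auto intro!: hol2_imp_continuous_on holo_forms_2(1))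
        fix b assume b: "b \<in> Ball2" "Pd b \<noteq> 0"
        have "D_denom \<phi> i b \<noteq> 0" using b(2) Pd_denom[of b i] by auto
        then show "f b m = vscale CD (G (li i)) b m" using f G1 b(1) by simp
      qed
    next
      case False
      then show ?thesis using holo_forms_2(3)[OF h] holo_forms_2(3) f by metis
    qed
  qed
qed

lemma D_MF: "D \<phi> i \<in> MF 2 5 0"
proof -
  have h: "vscale CD (G (li i)) \<in> holo_forms 2"
    unfolding holo_forms_def using holo_forms_2[OF G_holo[of "li i"]]
    by (auto simp: vscale_def fun_eq_iff intro!: hol2_intros)
  have "slash 2 5 (vscale CD (G (li i))) g = vscale CD (G (li i))" if g: "g \<in> \<Gamma>_cong" for g
    by (subst slash_2_eq_iff[OF Gamma_cong_Gamma[OF g] h h])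
      (auto simp: vscale_def sym2_linear MF_2_act[OF G_MF g] simp del: split_paired_All)
  then show ?thesis unfolding D_G using h by (simp add: MF_2_iff)
qed

end

section \<open>Coefficients of vector-valued forms\<close>

text \<open>The pairing of Sym^2 with two vectors induced by \<open>w2\<close>: on a square p^2 its
  value is w2 p x * w2 p w (\<open>pr_sym_vec\<close>).\<close>

definition pr :: "(nat \<Rightarrow> complex) \<Rightarrow> complex^2 \<Rightarrow> complex^2 \<Rightarrow> complex" where
  "pr y x w = y 0 * (x$2 * w$2) - y 1 * (x$2 * w$1 + x$1 * w$2) + y 2 * (x$1 * w$1)"

lemma pr_sym2: "pr (sym2 A y) (A *v x) (A *v w) = det A ^ 2 * pr y x w"
  by (simp add: pr_def sym2_def matrix_vector_mult_def sum_2 det_2 power2_eq_square algebra_simps)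

lemma pr_scale: "pr y (s *s x) (t *s w) = s * t * pr y x w" "pr (\<lambda>i. c * y i) x w = c * pr y x w"
  by (simp_all add: pr_def algebra_simps)

lemma pr_sym_vec: "pr (sym_vec 2 p) x w = w2 p x * w2 p w"
  by (simp add: pr_def w2_def sym_vec_2 algebra_simps)

lemma w2_self: "w2 x x = 0" "w2 x y = - w2 y x"
  by (simp_all add: w2_def)

text \<open>Expansion of \<open>y\<close> in the squares of b0, b1, b2: pairing with two of the
  vectors annihilates their squares and isolates the coefficient of the third. Denominators are
  cleared by the three determinants.\<close>

lemma pr_expand:
  assumes "m \<le> 2"
  shows "w2 b0 b1 * w2 b1 b2 * w2 b2 b0 * y m =
    - (sym_vec 2 b0 m * pr y b1 b2 * w2 b1 b2 + sym_vec 2 b1 m * pr y b2 b0 * w2 b2 b0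
       + sym_vec 2 b2 m * pr y b0 b1 * w2 b0 b1)"
proof -
  consider "m = 0" | "m = 1" | "m = 2" using assms by linarith
  then show ?thesis
    by cases (simp_all add: sym_vec_2 pr_def w2_def algebra_simps)
qed

text \<open>At u = 0 an eigenvalue different from 1 forces the value 0. Division by \<open>u\<close>
  divides the eigenvalue by \<rho>, that is, multiplies it by \<rho>^2.\<close>

lemma rot_div:
  assumes F: "F holomorphic2_on Ball2" "\<And>u v. (u, v) \<in> Ball2 \<Longrightarrow> F (\<rho> * u, v) = x0 * F (u, v)"
    and x0: "x0 \<noteq> 1"
  obtains F' where "F' holomorphic2_on Ball2" "\<And>b. b \<in> Ball2 \<Longrightarrow> F b = fst b * F' b"
    "\<And>u v. (u, v) \<in> Ball2 \<Longrightarrow> F' (\<rho> * u, v) = x0 * (\<rho> * \<rho>) * F' (u, v)"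
proof -
  have "F (0, v) = 0" if "Re v < 0" for v
    using F(2)[of 0 v] that x0 by (simp add: Ball2_axis)
  then obtain F' where F': "F' holomorphic2_on Ball2" "\<And>u v. (u, v) \<in> Ball2 \<Longrightarrow> F (u, v) = u * F' (u, v)"
    using hol2_div_u[OF F(1)] by metis
  have rG: "rotm \<in> \<Gamma>" by (rule Gamma_cong_Gamma[OF rotm_Gamma_cong])
  have r3: "\<rho> * \<rho> * \<rho> = 1" using rho_cube by (simp only: mult.assoc)
  have rot: "F' (act rotm b) = x0 * (\<rho> * \<rho>) * F' b" if b: "b \<in> Ball2" for b
  proof (rule hol2_eq_off_mirror[OF hol2_compose_act[OF rG F'(1)] _ _ b])
    show "(\<lambda>b. x0 * (\<rho> * \<rho>) * F' b) holomorphic2_on Ball2" by (intro hol2_intros F')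
    fix b :: "complex \<times> complex" assume b: "b \<in> Ball2" "fst b \<noteq> 0"
    obtain u v where uv: "b = (u, v)" by (cases b)
    have rb: "(\<rho> * u, v) \<in> Ball2" using Gamma_act(2)[OF rG b(1)] by (simp add: uv rotm_eqs)
    have "\<rho> * u * F' (\<rho> * u, v) = x0 * (u * F' (u, v))"
      using F(2)[of u v] F'(2)[OF rb] F'(2)[of u v] b(1) by (simp add: uv)
    then have "\<rho> * F' (\<rho> * u, v) = x0 * F' (u, v)" using b(2) by (simp add: uv)
    then have "(\<rho> * \<rho> * \<rho>) * F' (\<rho> * u, v) = x0 * (\<rho> * \<rho>) * F' (u, v)" by (metis mult.assoc mult.left_commute)
    then show "F' (act rotm b) = x0 * (\<rho> * \<rho>) * F' b" by (simp add: uv rotm_eqs r3)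
  qed
  show ?thesis
  proof (rule that[OF F'(1)])
    show "F b = fst b * F' b" if "b \<in> Ball2" for b using F'(2)[of "fst b" "snd b"] that by simp
    show "F' (\<rho> * u, v) = x0 * (\<rho> * \<rho>) * F' (u, v)" if "(u, v) \<in> Ball2" for u v
      using rot[OF that] by (simp add: rotm_eqs)
  qed
qed

lemma rho_sq_neq_1: "\<rho> * \<rho> \<noteq> 1" "\<rho> * \<rho> * (\<rho> * \<rho>) = \<rho>"
proof -
  have r3: "\<rho> * \<rho> * \<rho> = 1" using rho_cube by (simp only: mult.assoc)
  show "\<rho> * \<rho> \<noteq> 1" using r3 rho_neq_1 by auto
  show "\<rho> * \<rho> * (\<rho> * \<rho>) = \<rho>" using r3 by (metis mult.assoc mult_1_left)
qed

lemma rot_div2: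
  assumes F: "F holomorphic2_on Ball2" "\<And>u v. (u, v) \<in> Ball2 \<Longrightarrow> F (\<rho> * u, v) = \<rho> * \<rho> * F (u, v)"
  obtains F' where "F' holomorphic2_on Ball2" "\<And>b. b \<in> Ball2 \<Longrightarrow> F b = fst b ^ 2 * F' b"
proof -
  obtain F1 where F1: "F1 holomorphic2_on Ball2" "\<And>b. b \<in> Ball2 \<Longrightarrow> F b = fst b * F1 b"
    "\<And>u v. (u, v) \<in> Ball2 \<Longrightarrow> F1 (\<rho> * u, v) = \<rho> * \<rho> * (\<rho> * \<rho>) * F1 (u, v)"
    by (rule rot_div[OF F rho_sq_neq_1(1)], assumption, rule that)
  obtain F2 where F2: "F2 holomorphic2_on Ball2" "\<And>b. b \<in> Ball2 \<Longrightarrow> F1 b = fst b * F2 b"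
    by (rule rot_div[OF F1(1) F1(3)[unfolded rho_sq_neq_1(2)] rho_neq_1], assumption, rule that)
  show ?thesis using F1(2) F2(2) by (intro that[OF F2(1)]) (simp add: power2_eq_square)
qed

text \<open>Under \<open>rotm\<close> the components 0 and 1 have eigenvalues \<rho> and \<rho>^2,
  so they vanish on the axis to orders at least 1 and 2.\<close>

lemma MF_2_comps:
  assumes f: "f \<in> MF 2 k 0"
  obtains p q where "p holomorphic2_on Ball2" "\<And>b. b \<in> Ball2 \<Longrightarrow> f b 0 = fst b * p b"
    "q holomorphic2_on Ball2" "\<And>b. b \<in> Ball2 \<Longrightarrow> f b 1 = fst b ^ 2 * q b"
proof -
  have fh: "\<And>i. (\<lambda>b. f b i) holomorphic2_on Ball2" using holo_forms_2(1) f by (simp add: MF_2_iff)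
  obtain p where p: "p holomorphic2_on Ball2" "\<And>b. b \<in> Ball2 \<Longrightarrow> f b 0 = fst b * p b"
    by (rule rot_div[OF fh MF_2_rot(4)[OF f] rho_neq_1], assumption, rule that)
  obtain q where q: "q holomorphic2_on Ball2" "\<And>b. b \<in> Ball2 \<Longrightarrow> f b 1 = fst b ^ 2 * q b"
    by (rule rot_div2[OF fh MF_2_rot(3)[OF f]], assumption, rule that)
  show ?thesis by (rule that[OF p q])
qed

context generators
begin

text \<open>Since \<open>X i\<close> is invariant under u -> \<rho> u, its derivative in u has
  eigenvalue \<rho>^2.\<close>

lemma d_u_X:
  obtains F where "F holomorphic2_on Ball2" "\<And>b. b \<in> Ball2 \<Longrightarrow> d_u (X i) b = fst b ^ 2 * F b"
proof -
  have rG: "rotm \<in> \<Gamma>" by (rule Gamma_cong_Gamma[OF rotm_Gamma_cong])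
  have "d_u (X i) (\<rho> * u, v) = \<rho> * \<rho> * d_u (X i) (u, v)" if b: "(u, v) \<in> Ball2" for u v
  proof -
    have e: "X i (act rotm b) = X i b" if "b \<in> Ball2" for b
      using X_rot[of "fst b" "snd b" i] rotm_eqs(3)[of "fst b" "snd b"] that by simp
    have "nabla (\<lambda>b. X i (act rotm b)) (u, v) = nabla (X i) (u, v)"
      by (rule nabla_cong[OF open_Ball2 b e])
    then have "nabla (X i) (\<rho> * u, v) = j2 rotm (u, v) *v nabla (X i) (u, v)"
      using nabla_act[OF rG X_hol b, of i] by (simp add: rotm_eqs)
    from arg_cong[OF this, of "\<lambda>x. x $ 1"] show ?thesis
      by (simp add: nabla_nth matrix_vector_mult_def sum_2 j2_rotm)
  qed
  from rot_div2[OF hol2_d_u[OF X_hol open_Ball2] this] that show ?thesis by blast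
qed

lemma Wv_1:
  obtains p where "p holomorphic2_on Ball2" "\<And>z. z \<in> Ball2 \<Longrightarrow> Wv a b c z $ 1 = fst z ^ 2 * p z"
proof -
  have "\<forall>i. \<exists>F. F holomorphic2_on Ball2 \<and> (\<forall>b\<in>Ball2. d_u (X i) b = fst b ^ 2 * F b)" using d_u_X by metis
  then obtain F where F: "\<And>i. F i holomorphic2_on Ball2" "\<And>i b. b \<in> Ball2 \<Longrightarrow> d_u (X i) b = fst b ^ 2 * F i b" by metis
  define p where "p = (\<lambda>z. 1 / 3 * ((X a z - X b z) * (F a z - F c z) - (X a z - X c z) * (F a z - F b z)))"
  show ?thesis
  proof (rule that[of p])
    show "p holomorphic2_on Ball2" unfolding p_def by (intro hol2_intros X_hol F(1))
    show "Wv a b c z $ 1 = fst z ^ 2 * p z" if "z \<in> Ball2" for z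
      unfolding Wv_nth[OF that] nabla_nth F(2)[OF that] p_def by (simp add: algebra_simps)
  qed
qed

end

context mirror_root
begin

section \<open>Numerators of the coefficients and their division by zeta^4\<close>

lemma X34_dv:
  assumes "{i, j} = {3, 4 :: 4}"
  obtains t where "\<And>z. z \<in> Ball2 \<Longrightarrow> X i z - X j z = t * (fst z ^ 3 * h34 z)"
    "\<And>z. z \<in> Ball2 \<Longrightarrow> d_v (X i) z - d_v (X j) z = t * (fst z ^ 3 * d_v h34 z)"
proof -
  define t :: complex where "t = (if i = 3 then 1 else - 1)"
  have ij: "(i = 3 \<and> j = 4 \<and> t = 1) \<or> (i = 4 \<and> j = 3 \<and> t = - 1)"
    using assms four_neq by (auto simp: doubleton_eq_iff t_def)
  have d34: "d_v (X 3) z - d_v (X 4) z = fst z ^ 3 * d_v h34 z" if z: "z \<in> Ball2" for z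
  proof -
    have "nabla (dp (3, 4)) z = nabla (\<lambda>b. fst b ^ 3 * h34 b) z"
      by (rule nabla_cong[OF open_Ball2 z]) (simp add: dp_def h34)
    also have "\<dots> = fst z ^ (3 - 1) *s (fst z *s nabla h34 z + vector [of_nat 3 * h34 z, 0])"
      by (rule nabla_fst_power_mult[OF h34(1) z]) simp
    finally have "d_v (dp (3, 4)) z = fst z ^ (3 - 1) * (fst z * d_v h34 z)"
      by (metis (no_types) nabla_nth(2) vector_smult_component vector_add_component vector_2(2) add_0_right)
    then show ?thesis unfolding dp_d[OF z] by (simp add: power3_eq_cube power2_eq_square mult.assoc)
  qed
  show ?thesis
  proof (rule that[of t])
    fix z assume z: "z \<in> Ball2"
    show "X i z - X j z = t * (fst z ^ 3 * h34 z)"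
      using ij h34(2)[OF z] by (elim disjE conjE) (simp_all add: algebra_simps)
    show "d_v (X i) z - d_v (X j) z = t * (fst z ^ 3 * d_v h34 z)"
      using ij d34[OF z] by (elim disjE conjE) (simp_all add: algebra_simps)
  qed
qed

text \<open>When both 3 and 4 occur, every term of the second component contains, after
  rearrangement, X 3 - X 4 or its v-derivative, and both are divisible by u^3.\<close>

lemma Wv_2:
  assumes "{a, b} = {3, 4} \<or> {a, c} = {3, 4} \<or> {b, c} = {3, 4}"
  obtains q where "q holomorphic2_on Ball2" "\<And>z. z \<in> Ball2 \<Longrightarrow> Wv a b c z $ 2 = fst z ^ 3 * q z"
proof -
  have dh: "d_v h34 holomorphic2_on Ball2" "d_v (X l) holomorphic2_on Ball2" for l
    by (intro hol2_d_v open_Ball2 X_hol h34)+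
  note n = Wv_nth[of _ a b c 2, unfolded nabla_nth]
  consider "{a, b} = {3, 4}" | "{a, c} = {3, 4}" | "{b, c} = {3, 4}" using assms by blast
  then show ?thesis
  proof cases
    case 1
    obtain t where t: "\<And>z. z \<in> Ball2 \<Longrightarrow> X a z - X b z = t * (fst z ^ 3 * h34 z)"
      "\<And>z. z \<in> Ball2 \<Longrightarrow> d_v (X a) z - d_v (X b) z = t * (fst z ^ 3 * d_v h34 z)" using X34_dv[OF 1] by metis
    show ?thesis
    proof (rule that)
      show "(\<lambda>z. 1 / 3 * t * (h34 z * (d_v (X a) z - d_v (X c) z) - (X a z - X c z) * d_v h34 z)) holomorphic2_on Ball2"
        by (intro hol2_intros X_hol h34 dh)
      show "Wv a b c z $ 2 = fst z ^ 3 * (1 / 3 * t * (h34 z * (d_v (X a) z - d_v (X c) z) - (X a z - X c z) * d_v h34 z))"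
        if "z \<in> Ball2" for z unfolding n[OF that] t[OF that] by (simp add: algebra_simps)
    qed
  next
    case 2
    obtain t where t: "\<And>z. z \<in> Ball2 \<Longrightarrow> X a z - X c z = t * (fst z ^ 3 * h34 z)"
      "\<And>z. z \<in> Ball2 \<Longrightarrow> d_v (X a) z - d_v (X c) z = t * (fst z ^ 3 * d_v h34 z)" using X34_dv[OF 2] by metis
    show ?thesis
    proof (rule that)
      show "(\<lambda>z. 1 / 3 * t * ((X a z - X b z) * d_v h34 z - h34 z * (d_v (X a) z - d_v (X b) z))) holomorphic2_on Ball2"
        by (intro hol2_intros X_hol h34 dh)
      show "Wv a b c z $ 2 = fst z ^ 3 * (1 / 3 * t * ((X a z - X b z) * d_v h34 z - h34 z * (d_v (X a) z - d_v (X b) z)))"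
        if "z \<in> Ball2" for z unfolding n[OF that] t[OF that] by (simp add: algebra_simps)
    qed
  next
    case 3
    obtain t where t: "\<And>z. z \<in> Ball2 \<Longrightarrow> X b z - X c z = t * (fst z ^ 3 * h34 z)"
      "\<And>z. z \<in> Ball2 \<Longrightarrow> d_v (X b) z - d_v (X c) z = t * (fst z ^ 3 * d_v h34 z)" using X34_dv[OF 3] by metis
    show ?thesis
    proof (rule that)
      show "(\<lambda>z. 1 / 3 * t * ((X a z - X b z) * d_v h34 z - h34 z * (d_v (X a) z - d_v (X b) z))) holomorphic2_on Ball2"
        by (intro hol2_intros X_hol h34 dh)
      show "Wv a b c z $ 2 = fst z ^ 3 * (1 / 3 * t * ((X a z - X b z) * d_v h34 z - h34 z * (d_v (X a) z - d_v (X b) z)))"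
        if z: "z \<in> Ball2" for z
      proof -
        have e: "d_v (X a) z - d_v (X c) z = (d_v (X a) z - d_v (X b) z) + t * (fst z ^ 3 * d_v h34 z)"
          "X a z - X c z = (X a z - X b z) + t * (fst z ^ 3 * h34 z)" using t[OF z] by (simp_all add: algebra_simps)
        show ?thesis unfolding n[OF z] e by (simp add: algebra_simps)
      qed
    qed
  qed
qed

text \<open>Up to a constant, the numerator of a coefficient of \<open>f\<close>
  (\<open>NN_be\<close>). Five of the six pairs of indices lie within one of the two brackets; the
  factor X c - X d takes care of the pair which they separate.\<close>

definition NN :: "vector_fun \<Rightarrow> 4 \<Rightarrow> 4 \<Rightarrow> 4 \<Rightarrow> 4 \<Rightarrow> scalar_fun" where
  "NN f a b c d z = (X c z - X d z) * pr (f z) (Wv a b c z) (Wv a b d z)"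

text \<open>If {c, d} = {3, 4}, the difference contributes u^3, and each term of the pairing at
  least one further u. Otherwise a bracket contains 3 and 4, with components divisible by u^2 and
  u^3; the components of \<open>f\<close> have orders at least 1, 2, 0, and the first component of
  the other bracket has order at least 2, so every term reaches u^4.\<close>

lemma NN_order:
  assumes f: "f \<in> MF 2 k 0" and dist: "distinct [a, b, c, d]"
  obtains K where "K holomorphic2_on Ball2" "\<And>z. z \<in> Ball2 \<Longrightarrow> NN f a b c d z = fst z ^ 4 * K z"
proof -
  have fh: "\<And>i. (\<lambda>b. f b i) holomorphic2_on Ball2" using holo_forms_2(1) f by (simp add: MF_2_iff)
  obtain f0 f1 where f0: "f0 holomorphic2_on Ball2" "\<And>b. b \<in> Ball2 \<Longrightarrow> f b 0 = fst b * f0 b"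
    and f1: "f1 holomorphic2_on Ball2" "\<And>b. b \<in> Ball2 \<Longrightarrow> f b 1 = fst b ^ 2 * f1 b"
    using MF_2_comps[OF f] by metis
  obtain p where p: "p holomorphic2_on Ball2" "\<And>z. z \<in> Ball2 \<Longrightarrow> Wv a b c z $ 1 = fst z ^ 2 * p z" using Wv_1 by metis
  obtain p' where p': "p' holomorphic2_on Ball2" "\<And>z. z \<in> Ball2 \<Longrightarrow> Wv a b d z $ 1 = fst z ^ 2 * p' z" using Wv_1 by metis
  have "3 \<in> {a, b, c, d}" "4 \<in> {a, b, c, d}" using UNIV_4_eq[OF dist] by blast+
  then have "{c, d} = {3, 4} \<or> ({a, b} = {3, 4} \<or> {a, c} = {3, 4} \<or> {b, c} = {3, 4})
    \<or> ({a, b} = {3, 4} \<or> {a, d} = {3, 4} \<or> {b, d} = {3, 4})"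
    using four_neq by (auto simp: doubleton_eq_iff)
  then consider "{c, d} = {3, 4}" | "{a, b} = {3, 4} \<or> {a, c} = {3, 4} \<or> {b, c} = {3, 4}"
    | "{a, b} = {3, 4} \<or> {a, d} = {3, 4} \<or> {b, d} = {3, 4}" by argo
  then show ?thesis
  proof cases
    case 1
    obtain t where t: "\<And>z. z \<in> Ball2 \<Longrightarrow> X c z - X d z = t * (fst z ^ 3 * h34 z)" using X34_dv[OF 1] by metis
    show ?thesis
    proof (rule that)
      show "(\<lambda>z. t * h34 z * (f0 z * (Wv a b c z $ 2 * Wv a b d z $ 2)
        - fst z * f1 z * (Wv a b c z $ 2 * (fst z ^ 2 * p' z) + (fst z ^ 2 * p z) * Wv a b d z $ 2)
        + f z 2 * (fst z * p z * (fst z ^ 2 * p' z)))) holomorphic2_on Ball2"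
        by (intro hol2_intros h34 f0 f1 fh p p' hol2_Wv)
      show "NN f a b c d z = fst z ^ 4 * (t * h34 z * (f0 z * (Wv a b c z $ 2 * Wv a b d z $ 2)
        - fst z * f1 z * (Wv a b c z $ 2 * (fst z ^ 2 * p' z) + (fst z ^ 2 * p z) * Wv a b d z $ 2)
        + f z 2 * (fst z * p z * (fst z ^ 2 * p' z))))" if z: "z \<in> Ball2" for z
        unfolding NN_def pr_def t[OF z] f0(2)[OF z] f1(2)[OF z] p(2)[OF z] p'(2)[OF z]
        by (simp add: eval_nat_numeral algebra_simps)
    qed
  next
    case 2
    obtain q where q: "q holomorphic2_on Ball2" "\<And>z. z \<in> Ball2 \<Longrightarrow> Wv a b c z $ 2 = fst z ^ 3 * q z" using Wv_2[OF 2] by metis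
    show ?thesis
    proof (rule that)
      show "(\<lambda>z. (X c z - X d z) * (f0 z * (q z * Wv a b d z $ 2)
        - f1 z * (fst z ^ 3 * q z * p' z + p z * Wv a b d z $ 2) + f z 2 * (p z * p' z))) holomorphic2_on Ball2"
        by (intro hol2_intros X_hol q f0 f1 fh p p' hol2_Wv)
      show "NN f a b c d z = fst z ^ 4 * ((X c z - X d z) * (f0 z * (q z * Wv a b d z $ 2)
        - f1 z * (fst z ^ 3 * q z * p' z + p z * Wv a b d z $ 2) + f z 2 * (p z * p' z)))" if z: "z \<in> Ball2" for z
        unfolding NN_def pr_def q(2)[OF z] f0(2)[OF z] f1(2)[OF z] p(2)[OF z] p'(2)[OF z]
        by (simp add: eval_nat_numeral algebra_simps)
    qed
  next
    case 3
    obtain q where q: "q holomorphic2_on Ball2" "\<And>z. z \<in> Ball2 \<Longrightarrow> Wv a b d z $ 2 = fst z ^ 3 * q z" using Wv_2[OF 3] by metis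
    show ?thesis
    proof (rule that)
      show "(\<lambda>z. (X c z - X d z) * (f0 z * (Wv a b c z $ 2 * q z)
        - f1 z * (Wv a b c z $ 2 * p' z + p z * (fst z ^ 3 * q z)) + f z 2 * (p z * p' z))) holomorphic2_on Ball2"
        by (intro hol2_intros X_hol q f0 f1 fh p p' hol2_Wv)
      show "NN f a b c d z = fst z ^ 4 * ((X c z - X d z) * (f0 z * (Wv a b c z $ 2 * q z)
        - f1 z * (Wv a b c z $ 2 * p' z + p z * (fst z ^ 3 * q z)) + f z 2 * (p z * p' z)))" if z: "z \<in> Ball2" for z
        unfolding NN_def pr_def q(2)[OF z] f0(2)[OF z] f1(2)[OF z] p(2)[OF z] p'(2)[OF z]
        by (simp add: eval_nat_numeral algebra_simps)
    qed
  qed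
qed

text \<open>The exponent is k + 3 + 7 + 7 + 2; the last summand and the power of det h come from the
  square of det j2.\<close>

lemma NN_act:
  assumes T: "Tr h \<tau> s" and f: "f \<in> MF 2 k 0" and z: "z \<in> Ball2"
  shows "NN f a b c d (act h z) = s / det h ^ 2 * j1 h z powi (k + 19) * NN (slash 2 k f h) (\<tau> a) (\<tau> b) (\<tau> c) (\<tau> d) z"
proof -
  have h: "h \<in> \<Gamma>" and Xh: "\<And>k b. b \<in> Ball2 \<Longrightarrow> X k (act h b) = s * j1 h b ^ 3 * X (\<tau> k) b"
    using T unfolding Tr_def by blast+
  define f' where "f' = slash 2 k f h"
  define j where "j = j1 h z"
  have j: "j \<noteq> 0" unfolding j_def by (rule Gamma_act(1)[OF h z])
  have fh: "f \<in> holo_forms 2" using f by (simp add: MF_2_iff)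
  have f'h: "f' \<in> holo_forms 2" unfolding f'_def by (rule slash_holo_forms[OF h fh])
  have "\<forall>b\<in>Ball2. \<forall>i. f (act h b) i = j1 h b powi k * sym2 (j2 h b) (f' b) i"
    using slash_2_eq_iff[OF h fh f'h, of k] f'_def by blast
  then have "f (act h z) i = j powi k * sym2 (j2 h z) (f' z) i" for i using z unfolding j_def by blast
  then have ff: "f (act h z) = (\<lambda>i. j powi k * sym2 (j2 h z) (f' z) i)" by blast
  have "NN f a b c d (act h z) = s * j ^ 3 * (X (\<tau> c) z - X (\<tau> d) z) *
      (j powi k * (j ^ 7 * j ^ 7 * ((j / det h) ^ 2 * pr (f' z) (Wv (\<tau> a) (\<tau> b) (\<tau> c) z) (Wv (\<tau> a) (\<tau> b) (\<tau> d) z))))"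
    unfolding NN_def ff Wv_act[OF T z] pr_scale pr_sym2 det_j2[OF Gamma_det[OF h]] Xh[OF z] j_def[symmetric]
    by (simp add: algebra_simps)
  also have "\<dots> = s / det h ^ 2 * (j powi k * (j ^ 3 * (j ^ 7 * j ^ 7 * j ^ 2))) * NN f' (\<tau> a) (\<tau> b) (\<tau> c) (\<tau> d) z"
    unfolding NN_def by (simp add: power_divide mult_ac)
  also have "j ^ 3 * (j ^ 7 * j ^ 7 * j ^ 2) = j powi 19" by (simp flip: power_add)
  also have "j powi k * j powi 19 = j powi (k + 19)" using j by (simp add: power_int_add)
  finally show ?thesis by (simp add: j_def f'_def)
qed

lemma NN_cong:
  assumes f: "f \<in> MF 2 k 0" and g: "g \<in> \<Gamma>_cong" and z: "z \<in> Ball2"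
  shows "NN f a b c d (act g z) = j1 g z powi (k + 19) / det g ^ 2 * NN f a b c d z"
proof -
  have "slash 2 k f g = f" using f g by (simp add: MF_2_iff)
  then show ?thesis using NN_act[OF Tr_cong[OF g] f z, of a b c d] by simp
qed

text \<open>Order 4 of N against order 3 of the differences is just enough for
  \<open>div_all\<close>: 3 * 4 >= 3 * 4 allows N^3 to be divided by Pd^4 = cz^4 \<zeta>^12, so N /
  \<zeta>^4 is locally bounded. Its weight is (k + 19) - 24.\<close>

lemma A_exists:
  assumes f: "f \<in> MF 2 k 0" and dist: "distinct [a, b, c, d]"
  obtains A where "WM (k - 5) A" "\<And>z. z \<in> Ball2 \<Longrightarrow> \<zeta> z ^ 4 * A z = NN f a b c d z"
proof -
  define F where "F = NN f a b c d"
  have fh: "\<And>i. (\<lambda>b. f b i) holomorphic2_on Ball2" using holo_forms_2(1) f by (simp add: MF_2_iff)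
  have Fh: "F holomorphic2_on Ball2" unfolding F_def NN_def[abs_def] pr_def by (intro hol2_intros X_hol fh hol2_Wv)
  have F3: "WM (3 * (k + 19)) (\<lambda>b. F b ^ 3)"
  proof -
    have "F (act g z) ^ 3 = j1 g z powi (3 * (k + 19)) * F z ^ 3" if g: "g \<in> \<Gamma>_cong" and z: "z \<in> Ball2" for g z
    proof -
      define n where "n = k + 19"
      have "(det g ^ 2) ^ 3 = (det g ^ 3) ^ 2" by (simp flip: power_mult)
      also have "\<dots> = 1" using Gamma_cong_det[OF g] by simp
      finally have dt: "(det g ^ 2) ^ 3 = 1" .
      have "(j1 g z powi n) ^ 3 = j1 g z powi (3 * n)" using power_int_mult[of "j1 g z" n 3] by (simp add: mult.commute)
      then show ?thesis unfolding F_def NN_cong[OF f g z] n_def[symmetric] power_mult_distrib power_divide dt by simp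
    qed
    then show ?thesis unfolding WM_def using hol2_power[OF Fh] by blast
  qed
  obtain c' h v0 b1 where "c' \<noteq> 0" "\<And>b. b \<in> Ball2 \<Longrightarrow> J b ^ 3 = c' * Pd b ^ 2" "b1 \<in> Ball2" "J b1 \<noteq> 0"
    and h: "h holomorphic2_on Ball2" "\<And>b. b \<in> Ball2 \<Longrightarrow> X 3 b - X 4 b = fst b ^ 3 * h b"
    "Re v0 < 0" "h (0, v0) \<noteq> 0" using J_Pd by metis
  have "\<exists>R. WM (3 * (k + 19) - 18 * int 4) R \<and> (\<forall>b\<in>Ball2. F b ^ 3 = Pd b ^ 4 * R b)"
  proof (rule div_all[where n = 3 and e' = 4 and m = 4, OF h _ _ _ F3])
    fix g \<tau> s assume T: "Tr g \<tau> s"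
    have g: "g \<in> \<Gamma>" and inj: "inj \<tau>" using T unfolding Tr_def by blast+
    have d': "distinct [\<tau> a, \<tau> b, \<tau> c, \<tau> d]" using dist inj by (auto dest: injD)
    obtain K where K: "K holomorphic2_on Ball2"
      "\<And>z. z \<in> Ball2 \<Longrightarrow> NN (slash 2 k f g) (\<tau> a) (\<tau> b) (\<tau> c) (\<tau> d) z = fst z ^ 4 * K z"
      using NN_order[OF slash_MF[OF g f] d'] by metis
    show "\<exists>K. K holomorphic2_on Ball2 \<and> (\<forall>z\<in>Ball2. F (act g z) = fst z ^ 4 * K z)"
    proof (intro exI conjI ballI)
      show "(\<lambda>z. s / det g ^ 2 * j1 g z powi (k + 19) * K z) holomorphic2_on Ball2"
        by (intro hol2_intros hol2_powi hol2_j1 open_Ball2 Gamma_act(1)[OF g] K(1))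
      show "F (act g z) = fst z ^ 4 * (s / det g ^ 2 * j1 g z powi (k + 19) * K z)" if "z \<in> Ball2" for z
        unfolding F_def NN_act[OF T f that] K(2)[OF that] by (simp add: mult_ac)
    qed
  qed auto
  then obtain R where R: "WM (3 * (k + 19) - 18 * int 4) R" "\<And>b. b \<in> Ball2 \<Longrightarrow> F b ^ 3 = Pd b ^ 4 * R b" by blast
  have Fq: "(\<lambda>z. F z / \<zeta> z ^ 4) holomorphic2_on {z \<in> Ball2. \<zeta> z \<noteq> 0}"
    by (intro hol2_divide hol2_power hol2_subset[OF Fh] hol2_subset[OF zeta_hol] open_nonzero[OF zeta_hol open_Ball2]) auto
  have bd: "\<exists>W C. open W \<and> z \<in> W \<and> (\<forall>b\<in>W \<inter> Ball2. \<zeta> b \<noteq> 0 \<longrightarrow> cmod (F b / \<zeta> b ^ 4) \<le> C)"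
    if z: "z \<in> Ball2 - {}" for z
  proof -
    have Rh: "(\<lambda>b. cz ^ 4 * R b) holomorphic2_on Ball2" by (intro hol2_intros WM_hol[OF R(1)])
    obtain W C where W: "open W" "z \<in> W" "W \<subseteq> Ball2" and C: "\<And>b. b \<in> W \<Longrightarrow> cmod (cz ^ 4 * R b) \<le> C"
      using hol2_locally_bounded[OF hol2_imp_continuous_on[OF Rh] open_Ball2, of z] z by blast
    have "cmod (F b / \<zeta> b ^ 4) \<le> C + 1" if b: "b \<in> W" "\<zeta> b \<noteq> 0" for b
    proof (rule cube_le_imp)
      have bB: "b \<in> Ball2" using b W by blast
      have "(F b / \<zeta> b ^ 4) ^ 3 = (cz * \<zeta> b ^ 3) ^ 4 * R b / \<zeta> b ^ 12"
        unfolding power_divide R(2)[OF bB] zeta_Pd[OF bB] by (simp flip: power_mult)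
      also have "\<dots> = cz ^ 4 * R b" using b(2) by (simp add: power_mult_distrib flip: power_mult)
      finally have "cmod (F b / \<zeta> b ^ 4) ^ 3 = cmod (cz ^ 4 * R b)" by (metis norm_power)
      then show "cmod (F b / \<zeta> b ^ 4) ^ 3 \<le> C" using C[OF b(1)] by simp
    qed simp
    then show ?thesis using W by blast
  qed
  obtain A where A: "A holomorphic2_on Ball2" "\<And>z. z \<in> Ball2 \<Longrightarrow> \<zeta> z \<noteq> 0 \<Longrightarrow> A z = F z / \<zeta> z ^ 4"
    by (rule hol2_extend[OF zeta_hol bz countable_empty Fq bd], assumption, rule that)
  have AF: "\<zeta> z ^ 4 * A z = F z" if z: "z \<in> Ball2" for z
  proof (rule hol2_eq_of_dense[OF zeta_hol bz open_Ball2 order_refl _ _ _ z])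
    show "continuous_on Ball2 (\<lambda>z. \<zeta> z ^ 4 * A z)" "continuous_on Ball2 F"
      by (intro hol2_imp_continuous_on hol2_intros zeta_hol A(1) Fh)+
    show "\<zeta> z ^ 4 * A z = F z" if "z \<in> Ball2" "\<zeta> z \<noteq> 0" for z using A(2)[OF that] that(2) by simp
  qed
  have "A (act g z) = j1 g z powi (k - 5) * A z" if g: "g \<in> \<Gamma>_cong" and z: "z \<in> Ball2" for g z
  proof (rule hol2_eq_of_dense[OF zeta_hol bz open_Ball2 order_refl _ _ _ z])
    have gG: "g \<in> \<Gamma>" by (rule Gamma_cong_Gamma[OF g])
    show "continuous_on Ball2 (\<lambda>z. A (act g z))" "continuous_on Ball2 (\<lambda>z. j1 g z powi (k - 5) * A z)"
      by (intro hol2_imp_continuous_on hol2_compose_act gG A(1) hol2_mult hol2_powi hol2_j1 open_Ball2 Gamma_act(1)[OF gG])+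
    fix z assume z: "z \<in> Ball2" "\<zeta> z \<noteq> 0"
    define j where "j = j1 g z"
    define dt where "dt = det g"
    have j: "j \<noteq> 0" unfolding j_def by (rule Gamma_act(1)[OF gG z(1)])
    have dt: "dt \<noteq> 0" unfolding dt_def by (rule Gamma_det[OF gG])
    have gz: "act g z \<in> Ball2" by (rule Gamma_act(2)[OF gG z(1)])
    \<comment> \<open>The behaviour of \<zeta>^2 is known from J = cz \<zeta>^2; squaring it gives
      that of \<zeta>^4, with the same power of the determinant as in
      \<open>NN_cong\<close>.\<close>
    have "cz * \<zeta> (act g z) ^ 2 = j ^ 12 / dt * (cz * \<zeta> z ^ 2)"
      using J_cong[OF g z(1)] unfolding zeta_J[OF z(1)] zeta_J[OF gz] j_def dt_def .
    also have "\<dots> = cz * (j ^ 12 / dt * \<zeta> z ^ 2)" by (rule mult.left_commute)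
    finally have z2: "\<zeta> (act g z) ^ 2 = j ^ 12 / dt * \<zeta> z ^ 2" using cz unfolding mult_cancel_left by blast
    have "\<zeta> (act g z) ^ 4 = (\<zeta> (act g z) ^ 2) ^ 2" by (simp flip: power_mult)
    also have "\<dots> = j ^ 24 / dt ^ 2 * \<zeta> z ^ 4" unfolding z2 power_mult_distrib power_divide by (simp flip: power_mult)
    finally have z4: "\<zeta> (act g z) ^ 4 = j ^ 24 / dt ^ 2 * \<zeta> z ^ 4" .
    have "j ^ 24 / dt ^ 2 * \<zeta> z ^ 4 * A (act g z) = j powi (k + 19) / dt ^ 2 * (\<zeta> z ^ 4 * A z)"
      using AF[OF gz] NN_cong[OF f g z(1), of a b c d] unfolding z4 AF[OF z(1)] by (simp add: F_def j_def dt_def)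
    then have e: "j ^ 24 * A (act g z) = j powi (k + 19) * A z" using dt z(2) by (simp add: field_simps)
    have "j powi (k + 19) = j powi (24 + (k - 5))" by (simp add: algebra_simps)
    also have "\<dots> = j powi 24 * j powi (k - 5)" by (rule power_int_add) (use j in simp)
    also have "j powi 24 = j ^ 24" by simp
    finally have pj: "j powi (k + 19) = j ^ 24 * j powi (k - 5)" .
    have "j ^ 24 * A (act g z) = j ^ 24 * (j powi (k - 5) * A z)" using e unfolding pj mult.assoc .
    then show "A (act g z) = j1 g z powi (k - 5) * A z" using j by (simp add: j_def)
  qed
  then have "WM (k - 5) A" unfolding WM_def using A(1) by blast
  then show ?thesis using AF by (intro that) (simp_all add: F_def)
qed

text \<open>Jacobi's identity: the components of the \<open>be i\<close> are, up to the factor 1 /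
  3, cofactors of the Jacobian matrix, and a 2 x 2 minor of the cofactor matrix is an entry times
  the determinant.\<close>

lemma w2_be: "w2 (be (i + 1) z) (be (i + 2) z) = \<phi> i z * J z / 9"
proof -
  define t :: complex where "t = 1 / 3"
  have J9: "\<phi> i z * J z / 9 = t * t * (\<phi> i z * J z)" by (simp add: t_def)
  have b: "br f g z $ 1 = t * (f z * d_u g z - g z * d_u f z)" "br f g z $ 2 = t * (f z * d_v g z - g z * d_v f z)" for f g
    unfolding br_nth t_def by (rule refl)+
  have "w2 (be (i + 1) z) (be (i + 2) z) = t * t * (\<phi> i z * J z)"
  proof (rule three_cases[of _ i])
    show "w2 (be (0 + 1) z) (be (0 + 2) z) = t * t * (\<phi> 0 z * J z)"
      unfolding three_arith be_simps w2_def b J_def J3_def nabla_nth by (simp add: algebra_simps)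
    show "w2 (be (1 + 1) z) (be (1 + 2) z) = t * t * (\<phi> 1 z * J z)"
      unfolding three_arith be_simps w2_def b J_def J3_def nabla_nth by (simp add: algebra_simps)
    show "w2 (be (2 + 1) z) (be (2 + 2) z) = t * t * (\<phi> 2 z * J z)"
      unfolding three_arith be_simps w2_def b J_def J3_def nabla_nth by (simp add: algebra_simps)
  qed
  then show ?thesis unfolding J9 .
qed

text \<open>The constant is - 4 * 16 * 16: the difference X c - X d equals 4 times a difference of
  phi's, and each bracket is 16 times some \<open>be\<close> up to sign.\<close>

lemma NN_be:
  "\<exists>a b c d. distinct [a, b, c, d] \<and> (\<forall>f. \<forall>z\<in>Ball2. NN f a b c d z
     = - 1024 * ((\<phi> (i + 1) z - \<phi> (i + 2) z) * pr (f z) (be (i + 1) z) (be (i + 2) z)))"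
proof -
  have p: "dp (1, 2) = (\<lambda>z. 4 * \<phi> 0 z)" "dp (1, 3) = (\<lambda>z. 4 * \<phi> 1 z)" "dp (1, 4) = (\<lambda>z. 4 * \<phi> 2 z)"
    by (simp_all add: dp_phi fun_eq_iff)
  have sw: "(4 * 4) *s br f g z = (- 16) *s br g f z" for f g z by (simp add: vec_eq_iff forall_2 br_nth field_simps)
  have W: "Wv 1 2 4 z = (- 16) *s be 1 z" "Wv 1 2 3 z = 16 *s be 2 z" "Wv 1 3 2 z = (- 16) *s be 2 z"
    "Wv 1 3 4 z = 16 *s be 0 z" "Wv 1 4 3 z = (- 16) *s be 0 z" "Wv 1 4 2 z = 16 *s be 1 z" if "z \<in> Ball2" for z
  proof -
    note sc = br_scale[OF that phi_hol phi_hol]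
    show "Wv 1 2 4 z = (- 16) *s be 1 z" "Wv 1 3 2 z = (- 16) *s be 2 z" "Wv 1 4 3 z = (- 16) *s be 0 z"
      unfolding Wv_def p sc be_simps sw by (rule refl)+
    show "Wv 1 2 3 z = 16 *s be 2 z" "Wv 1 3 4 z = 16 *s be 0 z" "Wv 1 4 2 z = 16 *s be 1 z"
      unfolding Wv_def p sc be_simps by simp_all
  qed
  show ?thesis
  proof (rule three_cases[of _ i])
    show "\<exists>a b c d. distinct [a, b, c, d] \<and> (\<forall>f. \<forall>z\<in>Ball2. NN f a b c d z
       = - 1024 * ((\<phi> (0 + 1) z - \<phi> (0 + 2) z) * pr (f z) (be (0 + 1) z) (be (0 + 2) z)))"
      by (rule exI[of _ 1], rule exI[of _ 2], rule exI[of _ 4], rule exI[of _ 3], unfold three_arith,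
          intro conjI allI ballI, use four_neq in simp, simp only: NN_def W pr_scale)
        (simp add: X_eqs algebra_simps)
    show "\<exists>a b c d. distinct [a, b, c, d] \<and> (\<forall>f. \<forall>z\<in>Ball2. NN f a b c d z
       = - 1024 * ((\<phi> (1 + 1) z - \<phi> (1 + 2) z) * pr (f z) (be (1 + 1) z) (be (1 + 2) z)))"
      by (rule exI[of _ 1], rule exI[of _ 3], rule exI[of _ 2], rule exI[of _ 4], unfold three_arith,
          intro conjI allI ballI, use four_neq in simp, simp only: NN_def W pr_scale)
        (simp add: X_eqs algebra_simps)
    show "\<exists>a b c d. distinct [a, b, c, d] \<and> (\<forall>f. \<forall>z\<in>Ball2. NN f a b c d z
       = - 1024 * ((\<phi> (2 + 1) z - \<phi> (2 + 2) z) * pr (f z) (be (2 + 1) z) (be (2 + 2) z)))"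
      by (rule exI[of _ 1], rule exI[of _ 4], rule exI[of _ 3], rule exI[of _ 2], unfold three_arith,
          intro conjI allI ballI, use four_neq in simp, simp only: NN_def W pr_scale)
        (simp add: X_eqs algebra_simps)
  qed
qed

section \<open>Expansion in the \<open>D \<phi> i\<close> and independence\<close>

lemma D_eq:
  assumes "z \<in> Ball2" "Pd z \<noteq> 0"
  shows "D_denom \<phi> i z * D \<phi> i z m = 4 * CD * sym_vec 2 (be i z) m"
proof -
  have E: "El (li i) z \<noteq> 0" using assms(2) Pd_denom[of z i] by auto
  have "El (li i) z * (64 * D_denom \<phi> i z * G (li i) z m) = El (li i) z * (256 * sym_vec 2 (be i z) m)"
    using G_eq[OF assms(1), of "li i" m] unfolding be_Wl[OF assms(1)] Pd_denom[of z i] by (simp add: mult_ac)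
  then have "D_denom \<phi> i z * G (li i) z m = 4 * sym_vec 2 (be i z) m" using E by simp
  moreover have "D_denom \<phi> i z * D \<phi> i z m = CD * (D_denom \<phi> i z * G (li i) z m)" by (simp add: D_G vscale_def)
  ultimately show ?thesis by simp
qed

lemma Pd_nz:
  assumes "z \<in> Ball2" "Pd z \<noteq> 0"
  shows "\<phi> i z \<noteq> 0" "D_denom \<phi> i z \<noteq> 0" "\<zeta> z \<noteq> 0" "J z \<noteq> 0"
proof -
  show "D_denom \<phi> i z \<noteq> 0" for i using assms(2) Pd_denom[of z i] by auto
  from this[of "i + 1"] have "\<phi> (i + 1 + 2) z \<noteq> 0" by (auto simp: D_denom_def)
  moreover have "i + 1 + 2 = i" by (rule three_cases[of _ i]) (unfold three_arith, simp_all)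
  ultimately show "\<phi> i z \<noteq> 0" by simp
  show "\<zeta> z \<noteq> 0" using zeta_Pd[OF assms(1)] assms(2) by auto
  then show "J z \<noteq> 0" using zeta_J[OF assms(1)] cz by simp
qed

text \<open>\<open>pr_expand\<close> with the three vectors \<open>be\<close>, which are pairwise
  independent off the zeros of Pd. By \<open>w2_be\<close> and \<open>D_eq\<close> the pairings
  become the quotients of \<open>A_exists\<close>, forms of weight k - 5.\<close>

lemma MF_expand:
  assumes f: "f \<in> MF 2 k 0"
  obtains a where "\<And>i. a i \<in> scalar_MF (k - 5)" "f = (\<Sum>i\<in>UNIV. fmul (a i) (D \<phi> i))"
proof -
  have fh: "f \<in> holo_forms 2" using f by (simp add: MF_2_iff)
  have Dh: "D \<phi> i \<in> holo_forms 2" for i using D_MF by (simp add: MF_2_iff)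
  have "\<exists>A. WM (k - 5) A \<and> (\<forall>z\<in>Ball2. \<zeta> z ^ 4 * A z
     = - 1024 * ((\<phi> (i + 1) z - \<phi> (i + 2) z) * pr (f z) (be (i + 1) z) (be (i + 2) z)))" for i
  proof -
    obtain a b c d where d: "distinct [a, b, c, d]" and N: "\<forall>f. \<forall>z\<in>Ball2. NN f a b c d z
     = - 1024 * ((\<phi> (i + 1) z - \<phi> (i + 2) z) * pr (f z) (be (i + 1) z) (be (i + 2) z))" using NN_be[of i] by blast
    obtain A where "WM (k - 5) A" "\<And>z. z \<in> Ball2 \<Longrightarrow> \<zeta> z ^ 4 * A z = NN f a b c d z" using A_exists[OF f d] by metis
    then show ?thesis using N by metis
  qed
  then obtain A where A: "\<And>i. WM (k - 5) (A i)" "\<And>i z. z \<in> Ball2 \<Longrightarrow> \<zeta> z ^ 4 * A i z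
     = - 1024 * ((\<phi> (i + 1) z - \<phi> (i + 2) z) * pr (f z) (be (i + 1) z) (be (i + 2) z))" by metis
  \<comment> \<open>4096 = 4 * 1024 combines the constants of \<open>D_eq\<close> and
    \<open>NN_be\<close>, 81 is the square of the 9 in \<open>w2_be\<close>, and cz^2 comes from J^2
    = cz^2 \<zeta>^4.\<close>
  define C where "C = 81 / (4096 * CD * cz ^ 2)"
  define a where "a i = (\<lambda>b. if b \<in> Ball2 then C * A i b else 0)" for i
  have main: "f z m = C * (A 0 z * D \<phi> 0 z m + A 1 z * D \<phi> 1 z m + A 2 z * D \<phi> 2 z m)"
    if z: "z \<in> Ball2" "Pd z \<noteq> 0" and m: "m \<le> 2" for z m
  proof -
    define P3 where "P3 = \<phi> 0 z * \<phi> 1 z * \<phi> 2 z"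
    define S where "S i = sym_vec 2 (be i z) m" for i
    define p where "p i = pr (f z) (be (i + 1) z) (be (i + 2) z)" for i
    define Z where "Z = \<zeta> z ^ 4"
    have P3: "P3 \<noteq> 0" "Z \<noteq> 0" "J z \<noteq> 0" using Pd_nz[OF z] by (simp_all add: P3_def Z_def)
    have t: "4096 * CD * (S i * p i * \<phi> i z) = - (P3 * Z * (A i z * D \<phi> i z m))" for i
    proof -
      have P3i: "P3 = \<phi> i z * \<phi> (i + 1) z * \<phi> (i + 2) z"
        by (rule three_cases[of _ i]) (unfold three_arith P3_def, simp_all add: mult_ac)
      have "4096 * CD * (S i * p i * \<phi> i z) = 1024 * (4 * CD * S i) * p i * \<phi> i z" by simp
      also have "\<dots> = - P3 * (- 1024 * ((\<phi> (i + 1) z - \<phi> (i + 2) z) * p i)) * D \<phi> i z m"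
        unfolding S_def D_eq[OF z, symmetric] P3i D_denom_def by (simp only: mult_ac mult_minus_left mult_minus_right minus_minus)
      also have "\<dots> = - (P3 * Z * (A i z * D \<phi> i z m))"
        unfolding p_def A(2)[OF z(1), symmetric] Z_def by (simp only: mult_ac mult_minus_left mult_minus_right)
      finally show ?thesis .
    qed
    have w: "w2 (be 1 z) (be 2 z) = \<phi> 0 z * J z / 9" "w2 (be 2 z) (be 0 z) = \<phi> 1 z * J z / 9"
      "w2 (be 0 z) (be 1 z) = \<phi> 2 z * J z / 9"
      using w2_be[of 0 z] w2_be[of 1 z] w2_be[of 2 z] unfolding three_arith by blast+
    have pp: "p 0 = pr (f z) (be 1 z) (be 2 z)" "p 1 = pr (f z) (be 2 z) (be 0 z)" "p 2 = pr (f z) (be 0 z) (be 1 z)"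
      unfolding p_def three_arith by (rule refl)+
    have "\<phi> 2 z * J z / 9 * (\<phi> 0 z * J z / 9) * (\<phi> 1 z * J z / 9) * f z m
      = - (S 0 * p 0 * (\<phi> 0 z * J z / 9) + S 1 * p 1 * (\<phi> 1 z * J z / 9) + S 2 * p 2 * (\<phi> 2 z * J z / 9))"
      using pr_expand[OF m, of "be 0 z" "be 1 z" "be 2 z" "f z"] unfolding w S_def pp .
    then have "J z / 9 * (P3 * (J z) ^ 2 / 81 * f z m)
      = J z / 9 * (- (S 0 * p 0 * \<phi> 0 z + S 1 * p 1 * \<phi> 1 z + S 2 * p 2 * \<phi> 2 z))"
      by (simp add: P3_def power2_eq_square algebra_simps)
    then have e: "P3 * (J z) ^ 2 / 81 * f z m = - (S 0 * p 0 * \<phi> 0 z + S 1 * p 1 * \<phi> 1 z + S 2 * p 2 * \<phi> 2 z)"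
      using P3(3) by (simp only: mult_cancel_left divide_eq_0_iff) simp
    have "4096 * CD * (P3 * (J z) ^ 2 / 81 * f z m) = - (4096 * CD * (S 0 * p 0 * \<phi> 0 z)
      + 4096 * CD * (S 1 * p 1 * \<phi> 1 z) + 4096 * CD * (S 2 * p 2 * \<phi> 2 z))" unfolding e by (simp add: algebra_simps)
    also have "\<dots> = P3 * Z * (A 0 z * D \<phi> 0 z m + A 1 z * D \<phi> 1 z m + A 2 z * D \<phi> 2 z m)"
      unfolding t by (simp add: algebra_simps)
    finally have e2: "4096 * CD * (P3 * (J z) ^ 2 / 81 * f z m)
      = P3 * Z * (A 0 z * D \<phi> 0 z m + A 1 z * D \<phi> 1 z m + A 2 z * D \<phi> 2 z m)" .
    have J2: "(J z) ^ 2 = cz ^ 2 * Z" unfolding zeta_J[OF z(1)] Z_def by (simp add: power_mult_distrib flip: power_mult)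
    have "P3 * Z * (4096 * CD * cz ^ 2 / 81 * f z m)
      = P3 * Z * (A 0 z * D \<phi> 0 z m + A 1 z * D \<phi> 1 z m + A 2 z * D \<phi> 2 z m)"
      using e2 unfolding J2 by (simp add: mult_ac)
    then have E: "4096 * CD * cz ^ 2 / 81 * f z m = A 0 z * D \<phi> 0 z m + A 1 z * D \<phi> 1 z m + A 2 z * D \<phi> 2 z m"
    proof -
      assume e: "P3 * Z * (4096 * CD * cz ^ 2 / 81 * f z m)
        = P3 * Z * (A 0 z * D \<phi> 0 z m + A 1 z * D \<phi> 1 z m + A 2 z * D \<phi> 2 z m)"
      have "P3 * Z \<noteq> 0" using P3 by simp
      then show ?thesis using e unfolding mult_cancel_left by blast
    qed
    have "C * (4096 * CD * cz ^ 2 / 81 * f z m) = f z m" unfolding C_def using CD_nz cz by simp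
    then show ?thesis unfolding E by (rule sym)
  qed
  have "f z m = (\<Sum>i\<in>UNIV. fmul (a i) (D \<phi> i)) z m" for z m
  proof (cases "z \<in> Ball2")
    case True
    have R: "(\<Sum>i\<in>UNIV. fmul (a i) (D \<phi> i)) z m = C * (A 0 z * D \<phi> 0 z m + A 1 z * D \<phi> 1 z m + A 2 z * D \<phi> 2 z m)"
      using True by (simp add: sum_3' fmul_def a_def algebra_simps)
    show ?thesis
    proof (cases "m \<le> 2")
      case m: True
      show ?thesis unfolding R
      proof (rule hol2_eq_of_dense[OF hol2_Pd bz(1) Pd_bz open_Ball2 order_refl _ _ _ True])
        show "continuous_on Ball2 (\<lambda>z. f z m)"
          "continuous_on Ball2 (\<lambda>z. C * (A 0 z * D \<phi> 0 z m + A 1 z * D \<phi> 1 z m + A 2 z * D \<phi> 2 z m))"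
          by (intro hol2_imp_continuous_on hol2_intros holo_forms_2(1) fh Dh WM_hol[OF A(1)])+
      qed (rule main[OF _ _ m])
    next
      case False
      then show ?thesis unfolding R using holo_forms_2(2)[OF fh, of m z] holo_forms_2(2)[OF Dh, of m _ z] by simp
    qed
  next
    case False
    then show ?thesis using holo_forms_2(3)[OF fh False] by (simp add: sum_3' fmul_def a_def)
  qed
  then have "f = (\<Sum>i\<in>UNIV. fmul (a i) (D \<phi> i))" by (intro ext)
  moreover have "a i \<in> scalar_MF (k - 5)" for i
    unfolding a_def by (rule WM_scalar_MF[OF WM_cmult[OF A(1)]])
  ultimately show ?thesis by (intro that)
qed

text \<open>Pairing the relation with two of the vectors \<open>be\<close> leaves only the
  coefficient of the third, times nonzero determinants.\<close>

lemma D_indep: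
  assumes a: "\<And>i. a i holomorphic2_on Ball2" and s: "\<And>z m. z \<in> Ball2 \<Longrightarrow> (\<Sum>i\<in>UNIV. a i z * D \<phi> i z m) = 0"
    and z: "z \<in> Ball2"
  shows "a i z = 0"
proof (rule hol2_mult_eq_0[OF hol2_Pd a _ bz(1) Pd_bz z])
  fix z assume z: "z \<in> Ball2"
  show "Pd z * a i z = 0"
  proof (cases "Pd z = 0")
    case False
    note nz = Pd_nz[OF z False]
    define c where "c i = a i z * (4 * CD / D_denom \<phi> i z)" for i
    have D': "D \<phi> i z m = 4 * CD / D_denom \<phi> i z * sym_vec 2 (be i z) m" for i m
      using D_eq[OF z False, of i m] nz(2)[of i] by (simp add: field_simps)
    have c0: "c 0 * sym_vec 2 (be 0 z) m + c 1 * sym_vec 2 (be 1 z) m + c 2 * sym_vec 2 (be 2 z) m = 0" for m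
      using s[OF z, of m] unfolding D' sum_3' c_def by (simp add: mult.assoc)
    have H: "c 0 * (w2 (be 0 z) x * w2 (be 0 z) w) + c 1 * (w2 (be 1 z) x * w2 (be 1 z) w)
      + c 2 * (w2 (be 2 z) x * w2 (be 2 z) w) = 0" for x w
    proof -
      have "c 0 * pr (sym_vec 2 (be 0 z)) x w + c 1 * pr (sym_vec 2 (be 1 z)) x w + c 2 * pr (sym_vec 2 (be 2 z)) x w
        = pr (\<lambda>m. c 0 * sym_vec 2 (be 0 z) m + c 1 * sym_vec 2 (be 1 z) m + c 2 * sym_vec 2 (be 2 z) m) x w"
        by (simp add: pr_def algebra_simps)
      also have "\<dots> = 0" unfolding c0 by (simp add: pr_def)
      finally show ?thesis unfolding pr_sym_vec .
    qed
    have wn: "w2 (be 1 z) (be 2 z) \<noteq> 0" "w2 (be 2 z) (be 0 z) \<noteq> 0" "w2 (be 0 z) (be 1 z) \<noteq> 0"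
      unfolding w2_be[of 0 z, unfolded three_arith] w2_be[of 1 z, unfolded three_arith] w2_be[of 2 z, unfolded three_arith]
      using nz by simp_all
    then have wn': "w2 (be 2 z) (be 1 z) \<noteq> 0" "w2 (be 0 z) (be 2 z) \<noteq> 0" "w2 (be 1 z) (be 0 z) \<noteq> 0"
      using w2_self(2) by (metis neg_equal_0_iff_equal)+
    have "c i = 0"
    proof (rule three_cases[of _ i])
      show "c 0 = 0" using H[of "be 1 z" "be 2 z"] wn wn' by (simp add: w2_self(1))
      show "c 1 = 0" using H[of "be 0 z" "be 2 z"] wn wn' by (simp add: w2_self(1))
      show "c 2 = 0" using H[of "be 0 z" "be 1 z"] wn wn' by (simp add: w2_self(1))
    qed
    then show ?thesis using CD_nz nz(2)[of i] by (simp add: c_def)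
  qed simp
qed

end

section \<open>The module and its tensor decomposition\<close>

lemma vscale_apply: "vscale c f z m = c * f z m"
  by (simp add: vscale_def)

lemma fmul_apply: "fmul a f z m = a z * f z m"
  by (simp add: fmul_def)

lemma sum_apply2: "(\<Sum>i\<in>I. f i) z m = (\<Sum>i\<in>I. f i z m :: complex)"
  by (induction I rule: infinite_finite_induct) auto

lemma scalar_MF_add: "a \<in> scalar_MF k \<Longrightarrow> b \<in> scalar_MF k \<Longrightarrow> a + b \<in> scalar_MF k"
  unfolding scalar_MF_iff by (auto simp: algebra_simps plus_fun_def intro!: hol2_add)

lemma scalar_MF_cmult: "a \<in> scalar_MF k \<Longrightarrow> fscale c a \<in> scalar_MF k"
  unfolding scalar_MF_iff fscale_def by (auto intro!: hol2_intros)

lemma scalar_MF_zero: "0 \<in> scalar_MF k"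
  unfolding scalar_MF_iff zero_fun_def by (auto intro!: hol2_intros)

lemma MF_add:
  assumes "f \<in> MF 2 k 0" "g \<in> MF 2 k 0"
  shows "f + g \<in> MF 2 k 0"
proof -
  have fg: "f \<in> holo_forms 2" "g \<in> holo_forms 2" using assms by (auto simp: MF_2_iff)
  have h: "f + g \<in> holo_forms 2"
    unfolding holo_forms_def using holo_forms_2[OF fg(1)] holo_forms_2[OF fg(2)]
    by (auto intro!: hol2_add)
  have "slash 2 k (f + g) s = f + g" if s: "s \<in> \<Gamma>_cong" for s
  proof (subst slash_2_eq_iff[OF Gamma_cong_Gamma[OF s] h h], intro ballI allI)
    fix b i assume b: "b \<in> Ball2"
    have "sym2 (j2 s b) ((f + g) b) i = sym2 (j2 s b) (f b) i + sym2 (j2 s b) (g b) i"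
      unfolding plus_fun_def using sym2_linear(2)[of "j2 s b" "f b" "g b" i] by (simp add: plus_fun_def)
    then show "(f + g) (act s b) i = j1 s b powi k * sym2 (j2 s b) ((f + g) b) i"
      using MF_2_act[OF assms(1) s b, of i] MF_2_act[OF assms(2) s b, of i] by (simp add: algebra_simps)
  qed
  then show ?thesis using h by (simp add: MF_2_iff)
qed

lemma MF_zero: "0 \<in> MF 2 k 0"
proof -
  have h: "(0 :: vector_fun) \<in> holo_forms 2" unfolding holo_forms_def by (auto intro!: hol2_intros simp: zero_fun_def)
  have "slash 2 k 0 s = 0" if s: "s \<in> \<Gamma>_cong" for s
    by (subst slash_2_eq_iff[OF Gamma_cong_Gamma[OF s] h h]) (auto simp: sym2_def)
  then show ?thesis using h by (simp add: MF_2_iff)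
qed

lemma MF_sum: "(\<And>i. i \<in> I \<Longrightarrow> f i \<in> MF 2 k 0) \<Longrightarrow> sum f I \<in> MF 2 k 0"
  by (induction I rule: infinite_finite_induct) (auto intro: MF_add MF_zero)

section \<open>Congruence modulo the bilinearity relations\<close>

lemma free_space_closed:
  assumes "p \<in> free_space S" "q \<in> free_space S"
  shows "p + q \<in> free_space S" "p - q \<in> free_space S" "fscale c p \<in> free_space S"
proof -
  have *: "{x. (p + q) x \<noteq> 0} \<subseteq> {x. p x \<noteq> 0} \<union> {x. q x \<noteq> 0}" "{x. (p - q) x \<noteq> 0} \<subseteq> {x. p x \<noteq> 0} \<union> {x. q x \<noteq> 0}"
    "{x. fscale c p x \<noteq> 0} \<subseteq> {x. p x \<noteq> 0}" by (auto simp: fscale_def)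
  show "p + q \<in> free_space S" "p - q \<in> free_space S" "fscale c p \<in> free_space S"
    using *[THEN finite_subset] * assms unfolding free_space_def by (auto simp: fscale_def)
qed

lemma free_space_zero: "0 \<in> free_space S"
  by (simp add: free_space_def)

lemma free_space_delta: "x \<in> S \<Longrightarrow> delta x \<in> free_space S"
  using finite_support_delta[of x] by (auto simp: free_space_def delta_def)

lemma free_space_sum: "(\<And>i. i \<in> I \<Longrightarrow> f i \<in> free_space S) \<Longrightarrow> sum f I \<in> free_space S"
  by (induction I rule: infinite_finite_induct) (auto intro: free_space_closed free_space_zero)

lemma free_space_expand:
  assumes "p \<in> free_space S"
  shows "p = (\<Sum>x | p x \<noteq> 0. fscale (p x) (delta x))"
proof
  fix y
  have fin: "finite {x. p x \<noteq> 0}" using assms by (simp add: free_space_def)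
  have "(\<Sum>x | p x \<noteq> 0. fscale (p x) (delta x)) y = (\<Sum>x | p x \<noteq> 0. fscale (p x) (delta x) y)"
    using fin by induction auto
  also have "\<dots> = (\<Sum>x | p x \<noteq> 0. if x = y then p y else 0)"
    by (rule sum.cong) (auto simp: fscale_def delta_def)
  also have "\<dots> = p y" using fin by (simp add: sum.delta)
  finally show "p y = (\<Sum>x | p x \<noteq> 0. fscale (p x) (delta x)) y" ..
qed

text \<open>The congruence underlying \<open>tensor_eq\<close>, freed from the membership conditions
  so that sums can be treated termwise.\<close>

definition teq :: "scalar_fun set \<Rightarrow> vector_fun set \<Rightarrow> (scalar_fun \<times> vector_fun \<Rightarrow> complex) \<Rightarrow>
    (scalar_fun \<times> vector_fun \<Rightarrow> complex) \<Rightarrow> bool" where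
  "teq V W p q \<longleftrightarrow> p - q \<in> fsp.span (bilinearity_relations V W)"

lemma teq_trans: "teq V W p q \<Longrightarrow> teq V W q r \<Longrightarrow> teq V W p r"
  unfolding teq_def using fsp.span_add[of "p - q" _ "q - r"] by simp

lemma teq_add: "teq V W p q \<Longrightarrow> teq V W p' q' \<Longrightarrow> teq V W (p + p') (q + q')"
  unfolding teq_def using fsp.span_add[of "p - q" _ "p' - q'"] by (simp add: algebra_simps)

lemma teq_sym: "teq V W p q \<Longrightarrow> teq V W q p"
  unfolding teq_def using fsp.span_neg[of "p - q"] by simp

lemma teq_refl: "teq V W p p"
  unfolding teq_def by (simp add: fsp.span_zero)

lemma teq_scale: "teq V W p q \<Longrightarrow> teq V W (fscale c p) (fscale c q)"
  unfolding teq_def using fsp.span_scale[of "p - q" _ c] by (simp add: fsp.scale_right_diff_distrib)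

lemma teq_sum: "(\<And>i. i \<in> I \<Longrightarrow> teq V W (f i) (g i)) \<Longrightarrow> teq V W (sum f I) (sum g I)"
  by (induction I rule: infinite_finite_induct) (auto intro: teq_add teq_refl)

lemma teq_add_left: "v \<in> V \<Longrightarrow> v' \<in> V \<Longrightarrow> w \<in> W \<Longrightarrow> teq V W (delta (v + v', w)) (delta (v, w) + delta (v', w))"
  unfolding teq_def diff_diff_eq[symmetric] bilinearity_relations_def by (rule fsp.span_base) blast

lemma teq_add_right: "v \<in> V \<Longrightarrow> w \<in> W \<Longrightarrow> w' \<in> W \<Longrightarrow> teq V W (delta (v, w + w')) (delta (v, w) + delta (v, w'))"
  unfolding teq_def diff_diff_eq[symmetric] bilinearity_relations_def by (rule fsp.span_base) blast

lemma teq_scale_left: "v \<in> V \<Longrightarrow> w \<in> W \<Longrightarrow> teq V W (delta (fscale c v, w)) (fscale c (delta (v, w)))"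
  unfolding teq_def bilinearity_relations_def by (rule fsp.span_base) blast

lemma teq_scale_right: "v \<in> V \<Longrightarrow> w \<in> W \<Longrightarrow> teq V W (delta (v, vscale c w)) (fscale c (delta (v, w)))"
  unfolding teq_def bilinearity_relations_def by (rule fsp.span_base) blast

lemma free_mult_sum_delta:
  assumes "finite I"
  shows "free_mult (\<Sum>i\<in>I. delta (a i, g i)) = (\<Sum>i\<in>I. fmul (a i) (g i)) \<and> finite {x. (\<Sum>i\<in>I. delta (a i, g i)) x \<noteq> 0}"
  using assms
proof induction
  case empty
  show ?case by (simp add: free_mult_def)
next
  case (insert j I)
  have s: "fscale 1 f = f" for f :: "scalar_fun \<times> vector_fun \<Rightarrow> complex" by (simp add: fscale_def)
  have v: "vscale 1 f = f" for f :: vector_fun by (simp add: vscale_def)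
  note IH = conjunct1[OF insert.IH] conjunct2[OF insert.IH]
  show ?case
    unfolding sum.insert[OF insert.hyps(1,2)]
    using free_mult_combine[OF finite_support_delta IH(2), of "(a j, g j)" 1, unfolded s v free_mult_delta IH(1)]
      finite_support_combine[OF finite_support_delta IH(2), of "(a j, g j)" 1, unfolded s]
    by (rule conjI)
qed

context mirror_root
begin

definition W3 :: "vector_fun set" where "W3 = vsp.span (range (D \<phi>))"

lemma D_W3: "D \<phi> i \<in> W3"
  unfolding W3_def by (rule vsp.span_base) simp

lemma W3_iff: "w \<in> W3 \<longleftrightarrow> (\<exists>c. w = (\<Sum>i\<in>UNIV. vscale (c i) (D \<phi> i)))"
proof
  assume "w \<in> W3"
  then show "\<exists>c. w = (\<Sum>i\<in>UNIV. vscale (c i) (D \<phi> i))" unfolding W3_def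
  proof (induction rule: vsp.span_induct_alt)
    case base
    show ?case by (rule exI[of _ "\<lambda>_. 0"]) (simp add: fun_eq_iff vscale_def sum_apply2)
  next
    case (step d x y)
    then obtain j c where "x = D \<phi> j" "y = (\<Sum>i\<in>UNIV. vscale (c i) (D \<phi> i))" by blast
    then have "vscale d x + y = (\<Sum>i\<in>UNIV. vscale ((if i = j then d else 0) + c i) (D \<phi> i))"
      by (simp add: vsp.scale_left_distrib sum.distrib if_distrib[of "\<lambda>c. vscale c _"] cong: if_cong)
    then show ?case by (intro exI[of _ "\<lambda>i. (if i = j then d else 0) + c i"])
  qed
next
  assume "\<exists>c. w = (\<Sum>i\<in>UNIV. vscale (c i) (D \<phi> i))"
  then obtain c where c: "w = (\<Sum>i\<in>UNIV. vscale (c i) (D \<phi> i))" by blast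
  show "w \<in> W3" unfolding W3_def c by (intro vsp.span_sum vsp.span_scale vsp.span_base rangeI)
qed

lemma delta_sum_teq:
  assumes v: "v \<in> V" and fin: "finite I" and w: "\<And>i. i \<in> I \<Longrightarrow> g i \<in> W3"
  shows "teq V W3 (delta (v, \<Sum>i\<in>I. g i)) (\<Sum>i\<in>I. delta (v, g i))"
  using fin w
proof induction
  case empty
  \<comment> \<open>The empty sum is read as 0 times \<open>D \<phi> 0\<close>.\<close>
  have "teq V W3 (delta (v, vscale 0 (D \<phi> 0))) (fscale 0 (delta (v, D \<phi> 0)))" by (rule teq_scale_right[OF v D_W3])
  then show ?case by (simp add: vscale_def fscale_def zero_fun_def)
next
  case (insert j I)
  have "(\<Sum>i\<in>I. g i) \<in> W3" using insert.prems unfolding W3_def by (intro vsp.span_sum) simp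
  then have "teq V W3 (delta (v, g j + (\<Sum>i\<in>I. g i))) (delta (v, g j) + delta (v, \<Sum>i\<in>I. g i))"
    using insert.prems by (intro teq_add_right[OF v]) auto
  moreover have "teq V W3 (delta (v, g j) + delta (v, \<Sum>i\<in>I. g i)) (delta (v, g j) + (\<Sum>i\<in>I. delta (v, g i)))"
    using insert by (intro teq_add teq_refl) auto
  ultimately show ?case unfolding sum.insert[OF insert.hyps(1,2)] by (rule teq_trans)
qed

text \<open>Right-hand entries are expanded in the \<open>D \<phi> i\<close> and the scalars moved
  to the left, so every tensor is given by a triple of scalar forms.\<close>

lemma tensor_normal_form:
  assumes p: "p \<in> free_space (scalar_MF k \<times> W3)"
  shows "\<exists>a. (\<forall>i. a i \<in> scalar_MF k) \<and> teq (scalar_MF k) W3 p (\<Sum>i\<in>UNIV. delta (a i, D \<phi> i))"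
proof -
  let ?V = "scalar_MF k"
  define S where "S = {x. p x \<noteq> 0}"
  have S: "finite S" "S \<subseteq> ?V \<times> W3" using p by (auto simp: S_def free_space_def)
  have "\<exists>a. (\<forall>i. a i \<in> ?V) \<and> teq ?V W3 (\<Sum>x\<in>S. fscale (p x) (delta x)) (\<Sum>i\<in>UNIV. delta (a i, D \<phi> i))"
    using S
  proof induction
    case empty
    have z: "teq ?V W3 0 (delta (0, D \<phi> i))" for i
      using teq_sym[OF teq_scale_left[where c = 0, OF scalar_MF_zero[of k] D_W3[of i]]]
      by (simp only: fsp.scale_zero_left fsp.scale_zero_right)
    have "teq ?V W3 (\<Sum>i\<in>(UNIV :: 3 set). 0) (\<Sum>i\<in>UNIV. delta (0, D \<phi> i))" by (intro teq_sum z)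
    then show ?case
      by (intro exI[of _ "\<lambda>_. 0"] conjI allI scalar_MF_zero) (simp only: sum.neutral_const sum.empty)
  next
    case (insert x S)
    then obtain a where a: "\<forall>i. a i \<in> ?V" "teq ?V W3 (\<Sum>x\<in>S. fscale (p x) (delta x)) (\<Sum>i\<in>UNIV. delta (a i, D \<phi> i))" by auto
    obtain v w where x: "x = (v, w)" "v \<in> ?V" "w \<in> W3" using insert.prems by auto
    obtain c where c: "w = (\<Sum>i\<in>UNIV. vscale (c i) (D \<phi> i))" using x(3) W3_iff by blast
    define a' where "a' i = fscale (p x * c i) v" for i :: 3
    have a': "a' i \<in> ?V" for i unfolding a'_def by (rule scalar_MF_cmult[OF x(2)])
    have cD: "vscale (c i) (D \<phi> i) \<in> W3" for i unfolding W3_def by (intro vsp.span_scale vsp.span_base) simp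
    have 1: "teq ?V W3 (\<Sum>i\<in>UNIV. fscale (p x) (delta (v, vscale (c i) (D \<phi> i)))) (\<Sum>i\<in>UNIV. delta (a' i, D \<phi> i))"
    proof (rule teq_sum)
      fix i
      have "teq ?V W3 (fscale (p x) (delta (v, vscale (c i) (D \<phi> i)))) (fscale (p x) (fscale (c i) (delta (v, D \<phi> i))))"
        by (rule teq_scale[OF teq_scale_right[OF x(2) D_W3]])
      then have "teq ?V W3 (fscale (p x) (delta (v, vscale (c i) (D \<phi> i)))) (fscale (p x * c i) (delta (v, D \<phi> i)))"
        by (simp only: fsp.scale_scale)
      then show "teq ?V W3 (fscale (p x) (delta (v, vscale (c i) (D \<phi> i)))) (delta (a' i, D \<phi> i))"
        unfolding a'_def by (rule teq_trans[OF _ teq_sym[OF teq_scale_left[OF x(2) D_W3]]])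
    qed
    have "teq ?V W3 (fscale (p x) (delta (v, w))) (fscale (p x) (\<Sum>i\<in>UNIV. delta (v, vscale (c i) (D \<phi> i))))"
      unfolding c by (rule teq_scale[OF delta_sum_teq[OF x(2) finite cD]])
    then have "teq ?V W3 (fscale (p x) (delta (v, w))) (\<Sum>i\<in>UNIV. fscale (p x) (delta (v, vscale (c i) (D \<phi> i))))"
      by (simp only: fsp.scale_sum_right)
    from teq_trans[OF this 1] have "teq ?V W3 (fscale (p x) (delta x)) (\<Sum>i\<in>UNIV. delta (a' i, D \<phi> i))"
      unfolding x(1) .
    then have 2: "teq ?V W3 (\<Sum>x\<in>insert x S. fscale (p x) (delta x))
       ((\<Sum>i\<in>UNIV. delta (a' i, D \<phi> i)) + (\<Sum>i\<in>UNIV. delta (a i, D \<phi> i)))"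
      unfolding sum.insert[OF insert.hyps(1,2)] by (rule teq_add[OF _ a(2)])
    have "teq ?V W3 (\<Sum>i\<in>UNIV. delta (a' i + a i, D \<phi> i)) (\<Sum>i\<in>UNIV. delta (a' i, D \<phi> i) + delta (a i, D \<phi> i))"
      by (rule teq_sum) (rule teq_add_left[OF a' a(1)[rule_format] D_W3])
    from teq_sym[OF this]
    have 3: "teq ?V W3 ((\<Sum>i\<in>UNIV. delta (a' i, D \<phi> i)) + (\<Sum>i\<in>UNIV. delta (a i, D \<phi> i))) (\<Sum>i\<in>UNIV. delta (a' i + a i, D \<phi> i))"
      unfolding sum.distrib .
    show ?case
      by (intro exI[of _ "\<lambda>i. a' i + a i"] conjI allI scalar_MF_add a' a(1)[rule_format] teq_trans[OF 2 3])
  qed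
  then show ?thesis unfolding S_def free_space_expand[OF p, symmetric] .
qed

text \<open>On normal forms multiplication sends the triple \<open>a\<close> to the sum of the
  products a i * D i. Injectivity thus comes from \<open>D_indep\<close>, surjectivity from
  \<open>MF_expand\<close>.\<close>

lemma tensor_bij:
  "bij_betw tensor_mult (tensor (scalar_MF k) W3) (CF 2 (k + 5) 0)"
proof -
  let ?V = "scalar_MF k"
  let ?s = "\<lambda>a. \<Sum>i\<in>UNIV. delta (a i, D \<phi> i)"
  have sf: "?s a \<in> free_space (?V \<times> W3)" if "\<And>i. a i \<in> ?V" for a :: "3 \<Rightarrow> scalar_fun"
    using that D_W3 by (intro free_space_sum free_space_delta) simp
  have rep: "\<exists>a. (\<forall>i. a i \<in> ?V) \<and> C = tensor_eq ?V W3 `` {?s a} \<and> tensor_mult C = (\<Sum>i\<in>UNIV. fmul (a i) (D \<phi> i))"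
    if C: "C \<in> tensor ?V W3" for C
  proof -
    obtain p where p: "p \<in> free_space (?V \<times> W3)" "C = tensor_eq ?V W3 `` {p}"
      using C unfolding tensor_def by (rule quotientE)
    obtain a where a: "\<forall>i. a i \<in> ?V" "teq ?V W3 p (?s a)" using tensor_normal_form[OF p(1)] by blast
    have "(p, q) \<in> tensor_eq ?V W3 \<longleftrightarrow> (?s a, q) \<in> tensor_eq ?V W3" for q
      using p(1) sf[of a] a teq_trans teq_sym unfolding tensor_eq_def teq_def[symmetric] by blast
    then have C: "C = tensor_eq ?V W3 `` {?s a}" unfolding p(2) by blast
    then have "tensor_mult C = (\<Sum>i\<in>UNIV. fmul (a i) (D \<phi> i))"
      using tensor_mult_class[OF sf[of a]] a(1) free_mult_sum_delta[of UNIV a "D \<phi>"] by simp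
    then show ?thesis using a(1) C by blast
  qed
  show ?thesis unfolding bij_betw_def
  proof
    show "inj_on tensor_mult (tensor ?V W3)"
    proof (rule inj_onI)
      fix C C' assume C: "C \<in> tensor ?V W3" "C' \<in> tensor ?V W3" "tensor_mult C = tensor_mult C'"
      obtain a where a: "\<forall>i. a i \<in> ?V" "C = tensor_eq ?V W3 `` {?s a}" "tensor_mult C = (\<Sum>i\<in>UNIV. fmul (a i) (D \<phi> i))"
        using rep[OF C(1)] by blast
      obtain a' where a': "\<forall>i. a' i \<in> ?V" "C' = tensor_eq ?V W3 `` {?s a'}" "tensor_mult C' = (\<Sum>i\<in>UNIV. fmul (a' i) (D \<phi> i))"
        using rep[OF C(2)] by blast
      have ah: "\<And>i. a i holomorphic2_on Ball2" "\<And>i. a' i holomorphic2_on Ball2" using a(1) a'(1) by (auto simp: scalar_MF_iff)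
      have s0: "(\<Sum>i\<in>UNIV. (a i z - a' i z) * D \<phi> i z m) = 0" for z m
      proof -
        have "(\<Sum>i\<in>UNIV. fmul (a i) (D \<phi> i)) z m = (\<Sum>i\<in>UNIV. fmul (a' i) (D \<phi> i)) z m" using a(3) a'(3) C(3) by simp
        then show ?thesis by (simp add: sum_apply2 fmul_apply left_diff_distrib sum_subtractf)
      qed
      have "a i z = a' i z" for i z
      proof (cases "z \<in> Ball2")
        case True
        have "a i z - a' i z = 0"
          by (rule D_indep[of "\<lambda>i z. a i z - a' i z", OF hol2_diff[OF ah] s0 True])
        then show ?thesis by simp
      next
        case False
        then have "a i z = 0" "a' i z = 0" using a(1) a'(1) unfolding scalar_MF_iff by blast+
        then show ?thesis by simp
      qed
      then have "a = a'" by (simp add: fun_eq_iff)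
      then show "C = C'" using a(2) a'(2) by simp
    qed
    show "tensor_mult ` tensor ?V W3 = CF 2 (k + 5) 0"
    proof (intro equalityI subsetI)
      fix f assume "f \<in> tensor_mult ` tensor ?V W3"
      then obtain a where "\<forall>i. a i \<in> ?V" "f = (\<Sum>i\<in>UNIV. fmul (a i) (D \<phi> i))" using rep by blast
      then show "f \<in> CF 2 (k + 5) 0" unfolding CF_2_eq_MF_2 by (auto intro!: MF_sum MF_fmul D_MF)
    next
      fix f assume "f \<in> CF 2 (k + 5) 0"
      then have fm: "f \<in> MF 2 (k + 5) 0" by (simp only: CF_2_eq_MF_2)
      obtain a where a: "\<And>i. a i \<in> scalar_MF (k + 5 - 5)" "f = (\<Sum>i\<in>UNIV. fmul (a i) (D \<phi> i))"
        by (rule MF_expand[OF fm], rule that)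
      have a': "\<And>i. a i \<in> ?V" using a(1) by simp
      have "tensor_eq ?V W3 `` {?s a} \<in> tensor ?V W3" unfolding tensor_def by (rule quotientI) (rule sf[OF a'])
      moreover have "tensor_mult (tensor_eq ?V W3 `` {?s a}) = f"
        using tensor_mult_class[OF sf[OF a']] free_mult_sum_delta[of UNIV a "D \<phi>"] a(2) by simp
      ultimately show "f \<in> tensor_mult ` tensor ?V W3" by blast
    qed
  qed
qed

lemma gmul_homogeneous:
  assumes "finite {k. a k \<noteq> 0}"
  shows "gmul a (homogeneous d f) n = fmul (a (n - d)) f"
proof -
  have "gmul a (homogeneous d f) n = (\<Sum>k | a k \<noteq> 0. if k = n - d then fmul (a (n - d)) f else 0)"
    unfolding gmul_def by (rule sum.cong) (auto simp: homogeneous_def fmul_def zero_fun_def)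
  also have "\<dots> = fmul (a (n - d)) f" using assms by (auto simp: sum.delta fmul_def zero_fun_def)
  finally show ?thesis .
qed

lemma sum_fun_apply: "(\<Sum>i\<in>I. f i) n = (\<Sum>i\<in>I. f i n :: vector_fun)"
  by (induction I rule: infinite_finite_induct) auto

lemma Sigma20_generated: "Sigma20 = M_generated (\<lambda>i. homogeneous 5 (D \<phi> i))"
proof (intro equalityI subsetI)
  fix F assume "F \<in> Sigma20"
  then have F: "\<And>k. F k \<in> MF 2 k 0" "finite {k. F k \<noteq> 0}" unfolding Sigma20_def dsum_def CF_2_eq_MF_2 by auto
  have "\<exists>a. (\<forall>i. a i \<in> scalar_MF (k - 5)) \<and> F k = (\<Sum>i\<in>UNIV. fmul (a i) (D \<phi> i))" for k
    using MF_expand[OF F(1)[of k]] by metis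
  then obtain b where b: "\<And>k i. b k i \<in> scalar_MF (k - 5)" "\<And>k. F k = (\<Sum>i\<in>UNIV. fmul (b k i) (D \<phi> i))" by metis
  \<comment> \<open>Where a component of \<open>F\<close> vanishes the coefficients are set to 0,
    whatever \<open>b\<close> offers, so that the families have finite support. The shift by 5 is
    the weight of the generators.\<close>
  define a where "a i n = (if F (n + 5) = 0 then 0 else b (n + 5) i)" for i n
  have fin: "finite {k. a i k \<noteq> 0}" for i
  proof (rule finite_subset)
    show "{k. a i k \<noteq> 0} \<subseteq> (\<lambda>k. k - 5) ` {k. F k \<noteq> 0}"
    proof
      fix k assume "k \<in> {k. a i k \<noteq> 0}"
      then have "F (k + 5) \<noteq> 0" by (auto simp: a_def split: if_splits)
      then show "k \<in> (\<lambda>k. k - 5) ` {k. F k \<noteq> 0}" by (intro image_eqI[of _ _ "k + 5"]) auto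
    qed
  qed (use F(2) in simp)
  have aM: "a i \<in> M_ring" for i
    unfolding M_ring_def dsum_def using fin b(1)[of "k + 5" i for k] scalar_MF_zero by (auto simp: a_def)
  have "F n = (\<Sum>i\<in>UNIV. gmul (a i) (homogeneous 5 (D \<phi> i))) n" for n
  proof (cases "F n = 0")
    case True
    then show ?thesis
      by (simp add: sum_fun_apply gmul_homogeneous[OF fin] a_def fmul_def zero_fun_def sum_3')
  next
    case False
    then show ?thesis using b(2)[of n]
      by (simp add: sum_fun_apply gmul_homogeneous[OF fin] a_def)
  qed
  then have "F = (\<Sum>i\<in>UNIV. gmul (a i) (homogeneous 5 (D \<phi> i)))" by (rule ext)
  then show "F \<in> M_generated (\<lambda>i. homogeneous 5 (D \<phi> i))" unfolding M_generated_def using aM by blast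
next
  fix F assume "F \<in> M_generated (\<lambda>i. homogeneous 5 (D \<phi> i))"
  then obtain a where a: "\<forall>i. a i \<in> M_ring" "F = (\<Sum>i\<in>UNIV. gmul (a i) (homogeneous 5 (D \<phi> i)))"
    unfolding M_generated_def by blast
  have aM: "a i k \<in> scalar_MF k" "finite {k. a i k \<noteq> 0}" for i k using a(1) by (auto simp: M_ring_def dsum_def)
  have F: "F n = (\<Sum>i\<in>UNIV. fmul (a i (n - 5)) (D \<phi> i))" for n
    unfolding a(2) sum_fun_apply gmul_homogeneous[OF aM(2)] ..
  have "F k \<in> MF 2 k 0" for k
    unfolding F using MF_fmul[OF aM(1) D_MF, of _ "k - 5"] by (intro MF_sum) simp
  moreover have "finite {k. F k \<noteq> 0}"
  proof (rule finite_subset)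
    show "{k. F k \<noteq> 0} \<subseteq> (\<Union>i. (\<lambda>k. k + 5) ` {k. a i k \<noteq> 0})"
    proof
      fix k assume "k \<in> {k. F k \<noteq> 0}"
      then have "\<exists>i. fmul (a i (k - 5)) (D \<phi> i) \<noteq> 0" unfolding F by (auto intro: ccontr)
      then obtain i where "a i (k - 5) \<noteq> 0" by (auto simp: fmul_def zero_fun_def fun_eq_iff)
      then have "k \<in> (\<lambda>k. k + 5) ` {k. a i k \<noteq> 0}" by (intro image_eqI[of _ _ "k - 5"]) auto
      then show "k \<in> (\<Union>i. (\<lambda>k. k + 5) ` {k. a i k \<noteq> 0})" by blast
    qed
  qed (use aM(2) in simp)
  ultimately show "F \<in> Sigma20" unfolding Sigma20_def dsum_def CF_2_eq_MF_2 by blast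
qed

section \<open>The representation s[3,1]\<close>

text \<open>All four \<open>G l\<close> appear although they are dependent: S_4 permutes them, so
  the equivariance is visible from the formula.\<close>

definition TT :: "complex^4 \<Rightarrow> vector_fun" where
  "TT x = (\<Sum>l\<in>UNIV. vscale (x $ l) (G l))"

text \<open>By \<open>G_sum\<close> the first coordinate may be subtracted from all coordinates,
  which removes \<open>G 1\<close>; the other three are the \<open>D \<phi> i\<close> divided by
  \<open>CD\<close>.\<close>

lemma TT_D:
  assumes "x \<in> s31_space"
  shows "TT x = (\<Sum>i\<in>UNIV. vscale ((x $ li i - x $ 1) / CD) (D \<phi> i))"
proof (intro ext)
  fix z m
  have g1: "G 1 z m + G 2 z m + G 3 z m + G 4 z m = 0"
    using fun_cong[OF fun_cong[OF G_sum], of z m] by (simp only: plus_fun_apply zero_fun_apply)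
  have l: "li 0 = 2" "li 1 = 3" "li 2 = 4" by (simp_all add: li_def)
  have q: "(x $ li i - x $ 1) / CD * (CD * t) = (x $ li i - x $ 1) * t" for i t using CD_nz by simp
  show "TT x z m = (\<Sum>i\<in>UNIV. vscale ((x $ li i - x $ 1) / CD) (D \<phi> i)) z m"
    unfolding TT_def sum_apply2 sum_4 sum_3' vscale_apply D_G q unfolding l plus_fun_apply using g1 by algebra
qed

lemma TT_bij: "bij_betw TT s31_space W3"
  unfolding bij_betw_def
proof
  have s31: "x \<in> s31_space \<longleftrightarrow> x $ 1 + x $ 2 + x $ 3 + x $ 4 = 0" for x
    by (simp add: s31_space_def sum_4)
  have l: "li 0 = 2" "li 1 = 3" "li 2 = 4" by (simp_all add: li_def)
  show "inj_on TT s31_space"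
  proof (rule inj_onI)
    fix x y assume xy: "x \<in> s31_space" "y \<in> s31_space" "TT x = TT y"
    define a where "a i = (\<lambda>_ :: complex \<times> complex. (x $ li i - x $ 1) / CD - (y $ li i - y $ 1) / CD)" for i
    have s0: "(\<Sum>i\<in>UNIV. a i z * D \<phi> i z m) = 0" for z m
    proof -
      have "TT x z m = TT y z m" using xy(3) by simp
      then show ?thesis unfolding TT_D[OF xy(1)] TT_D[OF xy(2)] sum_apply2 vscale_apply a_def
        by (simp add: left_diff_distrib sum_subtractf)
    qed
    have "a i bz = 0" for i
      by (rule D_indep[OF _ s0 bz(1)]) (unfold a_def, rule hol2_const)
    then have e: "x $ li i - x $ 1 = y $ li i - y $ 1" for i using CD_nz by (simp add: a_def)
    have e: "x $ 2 = y $ 2 + (x $ 1 - y $ 1)" "x $ 3 = y $ 3 + (x $ 1 - y $ 1)" "x $ 4 = y $ 4 + (x $ 1 - y $ 1)"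
      using e[of 0] e[of 1] e[of 2] unfolding l by (simp_all add: algebra_simps)
    have "4 * (x $ 1 - y $ 1) = (x $ 1 + x $ 2 + x $ 3 + x $ 4) - (y $ 1 + y $ 2 + y $ 3 + y $ 4)"
      unfolding e by (simp add: algebra_simps)
    also have "\<dots> = 0" using xy(1,2) by (simp add: s31)
    finally have "x $ 1 = y $ 1" by simp
    then show "x = y" using e by (simp add: vec_eq_iff forall_4)
  qed
  show "TT ` s31_space = W3"
  proof (intro equalityI subsetI)
    fix w assume "w \<in> TT ` s31_space"
    then obtain x where x: "x \<in> s31_space" "w = TT x" by blast
    show "w \<in> W3" unfolding W3_iff x(2) TT_D[OF x(1)] by (rule exI) (rule refl)
  next
    fix w assume "w \<in> W3"
    then obtain c where c: "w = (\<Sum>i\<in>UNIV. vscale (c i) (D \<phi> i))" unfolding W3_iff by blast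
    \<comment> \<open>Determined by the condition that the four coordinates have sum 0.\<close>
    define t where "t = - (c 0 + c 1 + c 2) * CD / 4"
    define x :: "complex^4" where "x = (\<chi> l. if l = 1 then t else if l = 2 then c 0 * CD + t
      else if l = 3 then c 1 * CD + t else c 2 * CD + t)"
    have x: "x $ 1 = t" "x $ 2 = c 0 * CD + t" "x $ 3 = c 1 * CD + t" "x $ 4 = c 2 * CD + t"
      using four_neq by (simp_all add: x_def)
    have xs: "x \<in> s31_space" unfolding s31 x t_def by (simp add: field_simps)
    have "(x $ li i - x $ 1) / CD = c i" for i
      by (rule three_cases[of _ i]) (unfold l x, use CD_nz in simp_all)
    then have "TT x = w" unfolding TT_D[OF xs] c by simp
    then show "w \<in> TT ` s31_space" using xs by blast
  qed
qed

lemma TT_S4: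
  assumes \<sigma>: "\<sigma> permutes UNIV"
  shows "S4_acts e 2 5 \<sigma> (TT x) (TT (permute_coords \<sigma> x))"
  unfolding S4_acts_def
proof (intro ballI impI)
  fix g assume g: "g \<in> \<Gamma>1" "induces e g \<sigma>"
  define h where "h = matrix_inv g"
  have T: "Tr h \<sigma> (of_int (sign \<sigma>))" unfolding h_def by (rule S4_Tr[OF g])
  have h: "h \<in> \<Gamma>" using T by (simp add: Tr_def)
  have TTh: "TT x \<in> holo_forms 2" for x
  proof -
    have "(\<lambda>z. TT x z m) holomorphic2_on Ball2" for m
      unfolding TT_def sum_apply2 vscale_apply by (intro hol2_intros holo_forms_2(1) G_holo)
    moreover have "TT x z m = 0" if "z \<notin> Ball2 \<or> m > 2" for z m
    proof -
      have "G l z m = 0" for l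
        using that
      proof
        assume "z \<notin> Ball2"
        then have "G l z = 0" by (rule holo_forms_2(3)[OF G_holo])
        then show ?thesis by simp
      next
        assume "m > 2"
        then show ?thesis by (rule holo_forms_2(2)[OF G_holo])
      qed
      then show ?thesis by (simp add: TT_def sum_apply2 vscale_apply)
    qed
    ultimately show ?thesis unfolding holo_forms_def by (auto simp: fun_eq_iff)
  qed
  \<comment> \<open>The factor in \<open>slash_G\<close> is here the square of the sign of \<sigma>,
    hence 1.\<close>
  have sG: "slash 2 5 (G l) h = G (\<sigma> l)" for l
    using slash_G[OF T, of l] by (simp add: vscale_def sign_def)
  have Gact: "G l (act h b) i = j1 h b powi 5 * sym2 (j2 h b) (G (\<sigma> l) b) i" if "b \<in> Ball2" for l b i
    using slash_2_eq_iff[OF h G_holo G_holo, of 5 l "\<sigma> l"] sG[of l] that by blast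
  have "slash 2 5 (TT x) h = TT (permute_coords \<sigma> x)"
  proof (subst slash_2_eq_iff[OF h TTh TTh], intro ballI allI)
    fix b i assume b: "b \<in> Ball2"
    have lin: "sym2 A (TT y b) i = (\<Sum>l\<in>UNIV. y $ l * sym2 A (G l b) i)" for A y
      by (simp add: sym2_def TT_def sum_apply2 vscale_apply sum_4 algebra_simps)
    have "TT x (act h b) i = (\<Sum>l\<in>UNIV. x $ l * (j1 h b powi 5 * sym2 (j2 h b) (G (\<sigma> l) b) i))"
      unfolding TT_def sum_apply2 vscale_apply Gact[OF b] ..
    also have "\<dots> = (\<Sum>l\<in>UNIV. permute_coords \<sigma> x $ l * (j1 h b powi 5 * sym2 (j2 h b) (G l b) i))"
    proof -
      have "x $ l = permute_coords \<sigma> x $ \<sigma> l" for l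
        by (simp add: permute_coords_def permutes_inverses(2)[OF \<sigma>])
      then show ?thesis
        using sum.reindex_bij_betw[OF permutes_imp_bij[OF \<sigma>],
          of "\<lambda>l. permute_coords \<sigma> x $ l * (j1 h b powi 5 * sym2 (j2 h b) (G l b) i)"] by simp
    qed
    also have "\<dots> = j1 h b powi 5 * sym2 (j2 h b) (TT (permute_coords \<sigma> x) b) i"
      unfolding lin sum_distrib_left by (simp add: mult_ac)
    finally show "TT x (act h b) i = j1 h b powi 5 * sym2 (j2 h b) (TT (permute_coords \<sigma> x) b) i" .
  qed
  then show "slash 2 5 (TT x) (matrix_inv g) = TT (permute_coords \<sigma> x)" by (simp add: h_def)
qed

lemma S4_rep: "S4_rep_of_type_s31 e 2 5 W3"
  unfolding S4_rep_of_type_s31_def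
proof (intro exI conjI ballI allI impI)
  show "bij_betw TT s31_space W3" by (rule TT_bij)
  show "TT (x + y) = TT x + TT y" for x y
    by (simp add: TT_def vsp.scale_left_distrib sum.distrib)
  show "TT (c *s x) = vscale c (TT x)" for c x
    by (simp add: TT_def vsp.scale_sum_right)
qed (rule TT_S4)

end

theorem theorem14p3:
  fixes e :: complex and \<phi> :: "3 \<Rightarrow> scalar_fun"
  assumes "e = 1 \<or> e = - 1"
    and "standard_generators e \<phi>"
  shows "(\<forall>i. D \<phi> i \<in> CF 2 5 0)
    \<and> Sigma20 = M_generated (\<lambda>i. homogeneous 5 (D \<phi> i))
    \<and> S4_rep_of_type_s31 e 2 5 (vsp.span (range (D \<phi>)))
    \<and> (\<forall>k::nat. bij_betw tensor_mult
          (tensor (scalar_MF (3 * int k)) (vsp.span (range (D \<phi>))))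
          (CF 2 (3 * int k + 5) 0))"
proof -
  interpret generators e \<phi> by standard (rule assms)+
  obtain \<zeta> c h v0 b1 where "c \<noteq> 0" "\<zeta> holomorphic2_on Ball2" "\<And>b. b \<in> Ball2 \<Longrightarrow> Pd b = c * \<zeta> b ^ 3"
    "\<And>b. b \<in> Ball2 \<Longrightarrow> J b = c * \<zeta> b ^ 2" "b1 \<in> Ball2" "\<zeta> b1 \<noteq> 0"
    "h holomorphic2_on Ball2" "\<And>b. b \<in> Ball2 \<Longrightarrow> X 3 b - X 4 b = fst b ^ 3 * h b"
    using zeta_exists by metis
  then interpret mirror_root e \<phi> \<zeta> c h b1 by unfold_locales
  show ?thesis
    using D_MF Sigma20_generated S4_rep tensor_bij unfolding CF_2_eq_MF_2 W3_def by simp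
qed

end
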